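(* Let $k$ be an algebraically closed field, let $A$ be a finitely generated associative unital $k$-algebra, let $d_1,d_2\ge 1$, $d=d_1+d_2$ and $G={\rm GL}_{d_1}(k)\times{\rm GL}_{d_2}(k)$. If $C_1$ and $C_2$ are irreducible components of ${\rm mod}_A^{d_1}(k)$ and ${\rm mod}_A^{d_2}(k)$ respectively, and if ${\rm ext}_A^1(C_2,C_1) = 0$, then ${\mathcal E}(C_1\times C_2)$ contains an irreducible component of ${\rm mod}_A^{d}(k)$. It may be realized as the closure $\overline{{\mathcal E}(S)}$, where $S$ is the $G$-stable subset of $C_1\times C_2$ corresponding to the pairs of modules $(M_1,M_2)$ with $\dim {\rm Ext}_A^1(M_2,M_1) = 0$ and $\dim {\rm Ext}_A^1(M_1,M_2) = {\rm ext}_A^1(C_1,C_2)$.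
   Context: Modules are right $A$-modules. For $d\ge 1$, ${\rm mod}_A^d(k)$ is the set of $A$-module structures on $k^d$, equivalently the set of (unital) $k$-algebra homomorphisms $A \to {\rm M}_d(k)$ (the homomorphism $m$ gives the row space $k^d$ the right module structure $v\cdot a = v\,m(a)$). A homomorphism is determined by its values on a finite set of $N$ generators of $A$, and this embeds ${\rm mod}_A^d(k)$ as a Zariski closed subvariety of ${\rm M}_d(k)^N$; topological notions refer to the Zariski topology. The group ${\rm GL}_d(k)$ acts by conjugation, $(g\cdot m)(a) = g\,m(a)\,g^{-1}$, and orbits correspond to isomorphism classes of $d$-dimensional $A$-modules. If $C$ is a ${\rm GL}_d(k)$-stable subset, a $d$-dimensional module $M$ is said to be "in" $C$ if the corresponding orbit is contained in $C$. (Irreducible components are ${\rm GL}_d(k)$-stable.) For a $G$-stable subset $S$ of ${\rm mod}_A^{d_1}(k)\times {\rm mod}_A^{d_2}(k)$, a pair of modules $(M_1,M_2)$ with $\dim M_i=d_i$ is said to be "in" $S$ if the product of the corresponding orbits is a subset of $S$. The set ${\mathcal E}(S)$ is the ${\rm GL}_{d}(k)$-stable subset of ${\rm mod}_A^{d}(k)$ corresponding to all modules $M$ which belong to a short exact sequence $$0\longrightarrow M_2 \longrightarrow M\longrightarrow M_1\longrightarrow 0$$ with $(M_1,M_2)$ in $S$. For irreducible components $C\subseteq {\rm mod}_A^{c}(k)$ and $D\subseteq {\rm mod}_A^{e}(k)$, $${\rm ext}^1_A(C,D) = \min\{\dim_k {\rm Ext}^1_A(M,N)\},$$ where $M$ ranges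 over all modules in $C$ and $N$ over all modules in $D$. *)

theory Defs
  imports
    "HOL-Library.FuncSet"
    "HOL-Library.Function_Algebras"
    "HOL-Computational_Algebra.Polynomial"
    "HOL-Analysis.Abstract_Topology"
    "Jordan_Normal_Form.Matrix"
begin

section \<open>Algebras and varieties of module structures\<close>

locale assoc_algebra = vector_space scale
  for scale :: "'k::field \<Rightarrow> 'a::ring_1 \<Rightarrow> 'a" +
  assumes scale_mult_left: "scale c (x * y) = scale c x * y"
    and scale_mult_right: "scale c (x * y) = x * scale c y"

inductive_set generated_subalgebra :: "('k \<Rightarrow> 'a::ring_1 \<Rightarrow> 'a) \<Rightarrow> 'a set \<Rightarrow> 'a set"
  for scale :: "'k \<Rightarrow> 'a \<Rightarrow> 'a" and X :: "'a set" where
  gen: "x \<in> X \<Longrightarrow> x \<in> generated_subalgebra scale X"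
| one: "1 \<in> generated_subalgebra scale X"
| add: "x \<in> generated_subalgebra scale X \<Longrightarrow> y \<in> generated_subalgebra scale X
    \<Longrightarrow> x + y \<in> generated_subalgebra scale X"
| mult: "x \<in> generated_subalgebra scale X \<Longrightarrow> y \<in> generated_subalgebra scale X
    \<Longrightarrow> x * y \<in> generated_subalgebra scale X"
| scale: "x \<in> generated_subalgebra scale X \<Longrightarrow> scale c x \<in> generated_subalgebra scale X"

definition mod_var :: "('k::field \<Rightarrow> 'a::ring_1 \<Rightarrow> 'a) \<Rightarrow> nat \<Rightarrow> ('a \<Rightarrow> 'k mat) set" where
  "mod_var scale d = {m.
     (\<forall>a. m a \<in> carrier_mat d d) \<and>
     (\<forall>a b. m (a + b) = m a + m b) \<and>
     (\<forall>c a. m (scale c a) = c \<cdot>\<^sub>m m a) \<and>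
     (\<forall>a b. m (a * b) = m a * m b) \<and>
     m 1 = 1\<^sub>m d}"

definition gl_orbit :: "nat \<Rightarrow> ('a \<Rightarrow> 'k::field mat) \<Rightarrow> ('a \<Rightarrow> 'k mat) set" where
  "gl_orbit d m = {(\<lambda>a. g * m a * h) | g h.
     g \<in> carrier_mat d d \<and> h \<in> carrier_mat d d \<and> g * h = 1\<^sub>m d \<and> h * g = 1\<^sub>m d}"


section \<open>The Zariski topology\<close>

text \<open>Polynomial functions on affine space \<open>k\<^sup>I\<close>, realized as \<open>I \<rightarrow>\<^sub>E UNIV\<close>. The zero locus of a
  polynomial depends only on the function it induces, so formal polynomials are not needed.\<close>

inductive_set polyfun :: "'i set \<Rightarrow> (('i \<Rightarrow> 'k::field) \<Rightarrow> 'k) set" for I :: "'i set" where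
  const: "(\<lambda>x. c) \<in> polyfun I"
| coord: "i \<in> I \<Longrightarrow> (\<lambda>x. x i) \<in> polyfun I"
| add: "f \<in> polyfun I \<Longrightarrow> g \<in> polyfun I \<Longrightarrow> (\<lambda>x. f x + g x) \<in> polyfun I"
| mult: "f \<in> polyfun I \<Longrightarrow> g \<in> polyfun I \<Longrightarrow> (\<lambda>x. f x * g x) \<in> polyfun I"

definition zariski :: "'i set \<Rightarrow> ('i \<Rightarrow> 'k::field) topology" where
  "zariski I = topology (\<lambda>U. \<exists>F \<subseteq> polyfun I.
     U = (I \<rightarrow>\<^sub>E UNIV) - {x. \<forall>f\<in>F. f x = 0})"

lemma istopology_zariski:
  "istopology (\<lambda>U :: ('i \<Rightarrow> 'k::field) set. \<exists>F \<subseteq> polyfun I.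
     U = (I \<rightarrow>\<^sub>E UNIV) - {x. \<forall>f\<in>F. f x = 0})"
  (is "istopology ?P")
proof -
  have "?P (S \<inter> T)" if S: "?P S" and T: "?P T" for S T
  proof -
    obtain F where F: "F \<subseteq> polyfun I" "S = (I \<rightarrow>\<^sub>E UNIV) - {x. \<forall>f\<in>F. f x = 0}"
      using S by blast
    obtain G where G: "G \<subseteq> polyfun I" "T = (I \<rightarrow>\<^sub>E UNIV) - {x. \<forall>f\<in>G. f x = 0}"
      using T by blast
    let ?H = "{(\<lambda>x. f x * g x) | f g. f \<in> F \<and> g \<in> G}"
    have "?H \<subseteq> polyfun I"
      using F(1) G(1) by (auto intro: polyfun.mult)
    moreover have "S \<inter> T = (I \<rightarrow>\<^sub>E UNIV) - {x. \<forall>f\<in>?H. f x = 0}"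
    proof -
      have "(\<forall>h\<in>?H. h x = 0) \<longleftrightarrow> (\<forall>f\<in>F. f x = 0) \<or> (\<forall>g\<in>G. g x = 0)" for x
      proof
        assume H: "\<forall>h\<in>?H. h x = 0"
        show "(\<forall>f\<in>F. f x = 0) \<or> (\<forall>g\<in>G. g x = 0)"
        proof (rule ccontr)
          assume "\<not> ((\<forall>f\<in>F. f x = 0) \<or> (\<forall>g\<in>G. g x = 0))"
          then obtain f g where fg: "f \<in> F" "g \<in> G" "f x \<noteq> 0" "g x \<noteq> 0"
            by blast
          have "(\<lambda>x. f x * g x) \<in> ?H"
            using fg(1,2) by blast
          from bspec[OF H this] show False
            using fg(3,4) by simp
        qed
      next
        assume "(\<forall>f\<in>F. f x = 0) \<or> (\<forall>g\<in>G. g x = 0)"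
        then show "\<forall>h\<in>?H. h x = 0"
          by auto
      qed
      then have "{x. \<forall>h\<in>?H. h x = 0} = {x. \<forall>f\<in>F. f x = 0} \<union> {x. \<forall>g\<in>G. g x = 0}"
        by (simp only: set_eq_iff mem_Collect_eq Un_iff simp_thms)
      then show ?thesis
        unfolding F(2) G(2) by (simp only: Diff_Un)
    qed
    ultimately show ?thesis by (intro exI conjI)
  qed
  moreover have "?P (\<Union>\<K>)" if K: "\<forall>S\<in>\<K>. ?P S" for \<K>
  proof -
    let ?F = "{f \<in> polyfun I. (I \<rightarrow>\<^sub>E UNIV) \<inter> {x. f x \<noteq> 0} \<subseteq> \<Union>\<K>}"
    have "?F \<subseteq> polyfun I"
      by blast
    moreover have "\<Union>\<K> = (I \<rightarrow>\<^sub>E UNIV) - {x. \<forall>f\<in>?F. f x = 0}"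
    proof (intro equalityI subsetI)
      fix x assume "x \<in> \<Union>\<K>"
      then obtain S where S: "S \<in> \<K>" "x \<in> S"
        by (rule UnionE)
      from bspec[OF K S(1)] obtain F
        where F: "F \<subseteq> polyfun I" "S = (I \<rightarrow>\<^sub>E UNIV) - {x. \<forall>f\<in>F. f x = 0}"
        by (elim exE conjE)
      from S(2) obtain f where f: "x \<in> I \<rightarrow>\<^sub>E UNIV" "f \<in> F" "f x \<noteq> 0"
        unfolding F(2) by (simp del: PiE_UNIV_domain) metis
      have "(I \<rightarrow>\<^sub>E UNIV) \<inter> {x. f x \<noteq> 0} \<subseteq> S"
        unfolding F(2) using f(2) by blast
      then have "f \<in> ?F"
        using S(1) F(1) f(2) by blast
      then show "x \<in> (I \<rightarrow>\<^sub>E UNIV) - {x. \<forall>f\<in>?F. f x = 0}"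
        using f(1,3) by blast
    next
      fix x assume "x \<in> (I \<rightarrow>\<^sub>E UNIV) - {x. \<forall>f\<in>?F. f x = 0}"
      then show "x \<in> \<Union>\<K>"
        by blast
    qed
    ultimately show ?thesis by (intro exI conjI)
  qed
  ultimately show ?thesis
    unfolding istopology_def by (intro conjI allI impI)
qed

text \<open>The embedding of \<open>mod_var scale d\<close> into \<open>M\<^sub>d(k)\<^sup>X\<close>, where \<open>X\<close> is a finite set of generators,
  in terms of matrix entries; \<open>mod_var scale d\<close> carries the induced topology.\<close>

definition mod_coords :: "'a set \<Rightarrow> nat \<Rightarrow> ('a \<Rightarrow> 'k mat) \<Rightarrow> ('a \<times> nat \<times> nat \<Rightarrow> 'k)" where
  "mod_coords X d m = (\<lambda>(x, i, j) \<in> X \<times> {..<d} \<times> {..<d}. m x $$ (i, j))"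

definition mod_top ::
  "('k::field \<Rightarrow> 'a::ring_1 \<Rightarrow> 'a) \<Rightarrow> 'a set \<Rightarrow> nat \<Rightarrow> ('a \<Rightarrow> 'k mat) topology" where
  "mod_top scale X d =
     pullback_topology (mod_var scale d) (mod_coords X d) (zariski (X \<times> {..<d} \<times> {..<d}))"

definition irreducible_in :: "'x topology \<Rightarrow> 'x set \<Rightarrow> bool" where
  "irreducible_in T S \<longleftrightarrow> S \<subseteq> topspace T \<and> S \<noteq> {} \<and>
     (\<forall>Y Z. closedin T Y \<longrightarrow> closedin T Z \<longrightarrow> S \<subseteq> Y \<union> Z \<longrightarrow> S \<subseteq> Y \<or> S \<subseteq> Z)"

definition irreducible_component :: "'x topology \<Rightarrow> 'x set \<Rightarrow> bool" where
  "irreducible_component T C \<longleftrightarrow> irreducible_in T C \<and>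
     (\<forall>S. irreducible_in T S \<longrightarrow> C \<subseteq> S \<longrightarrow> S = C)"


section \<open>Right modules and short exact sequences\<close>

text \<open>A right module is given by a carrier and an action. Both \<open>k\<^sup>n\<close> and the free module \<open>A\<^sup>n\<close> are
  represented by functions on \<open>nat\<close> that vanish outside \<open>{..<n}\<close>. Module homomorphisms are
  normalized to vanish off their domain, so that \<open>right_hom\<close> is the actual Hom space under
  pointwise operations. Homomorphisms over a unital \<open>k\<close>-algebra are automatically \<open>k\<close>-linear.\<close>

definition tuples :: "nat \<Rightarrow> (nat \<Rightarrow> 'b::zero) set" where
  "tuples n = {v. \<forall>i\<ge>n. v i = 0}"

definition right_hom ::
  "'v::ab_group_add set \<Rightarrow> ('v \<Rightarrow> 'a \<Rightarrow> 'v) \<Rightarrow> 'w::ab_group_add set \<Rightarrow> ('w \<Rightarrow> 'a \<Rightarrow> 'w) \<Rightarrow> ('v \<Rightarrow> 'w) set"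
  where
  "right_hom V act W act' = {f.
     (\<forall>v\<in>V. f v \<in> W) \<and> (\<forall>v. v \<notin> V \<longrightarrow> f v = 0) \<and>
     (\<forall>u\<in>V. \<forall>v\<in>V. f (u + v) = f u + f v) \<and>
     (\<forall>v\<in>V. \<forall>a. f (act v a) = act' (f v) a)}"

text \<open>The row vector action \<open>v \<cdot> a = v m(a)\<close>.\<close>

definition row_act ::
  "nat \<Rightarrow> ('a \<Rightarrow> 'k::field mat) \<Rightarrow> (nat \<Rightarrow> 'k) \<Rightarrow> 'a \<Rightarrow> (nat \<Rightarrow> 'k)" where
  "row_act d m v a = (\<lambda>j. if j < d then \<Sum>i<d. v i * m a $$ (i, j) else 0)"

definition free_act :: "(nat \<Rightarrow> 'a::ring_1) \<Rightarrow> 'a \<Rightarrow> (nat \<Rightarrow> 'a)" where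
  "free_act w a = (\<lambda>i. w i * a)"

text \<open>There is a short exact sequence \<open>0 \<rightarrow> M\<^sub>2 \<rightarrow> M \<rightarrow> M\<^sub>1 \<rightarrow> 0\<close>, where the modules \<open>M\<^sub>2\<close>, \<open>M\<close>,
  \<open>M\<^sub>1\<close> are given by \<open>m2\<close>, \<open>m\<close>, \<open>m1\<close>.\<close>

definition is_extension ::
  "nat \<Rightarrow> ('a \<Rightarrow> 'k::field mat) \<Rightarrow> nat \<Rightarrow> ('a \<Rightarrow> 'k mat) \<Rightarrow> nat \<Rightarrow> ('a \<Rightarrow> 'k mat) \<Rightarrow> bool" where
  "is_extension d2 m2 d m d1 m1 \<longleftrightarrow> (\<exists>f p.
     f \<in> right_hom (tuples d2) (row_act d2 m2) (tuples d) (row_act d m) \<and>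
     p \<in> right_hom (tuples d) (row_act d m) (tuples d1) (row_act d1 m1) \<and>
     inj_on f (tuples d2) \<and>
     f ` tuples d2 = {v \<in> tuples d. p v = 0} \<and>
     p ` tuples d = tuples d1)"

definition extension_set ::
  "('k::field \<Rightarrow> 'a::ring_1 \<Rightarrow> 'a) \<Rightarrow> nat \<Rightarrow> nat \<Rightarrow> (('a \<Rightarrow> 'k mat) \<times> ('a \<Rightarrow> 'k mat)) set
     \<Rightarrow> ('a \<Rightarrow> 'k mat) set" where
  "extension_set scale d1 d2 S = {m \<in> mod_var scale (d1 + d2).
     \<exists>m1 \<in> mod_var scale d1. \<exists>m2 \<in> mod_var scale d2.
       gl_orbit d1 m1 \<times> gl_orbit d2 m2 \<subseteq> S \<and> is_extension d2 m2 (d1 + d2) m d1 m1}"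


section \<open>Ext\<close>

definition fun_scale :: "'k::field \<Rightarrow> ('x \<Rightarrow> nat \<Rightarrow> 'k) \<Rightarrow> ('x \<Rightarrow> nat \<Rightarrow> 'k)" where
  "fun_scale c f = (\<lambda>x i. c * f x i)"

lemma vector_space_fun_scale: "vector_space fun_scale"
  by unfold_locales (auto simp: fun_scale_def fun_eq_iff algebra_simps)

text \<open>The dimension of \<open>V / W\<close> for subspaces \<open>W \<subseteq> V\<close>: the set \<open>B\<close> below maps bijectively onto a
  basis of the quotient.\<close>

definition quotient_dim :: "('x \<Rightarrow> nat \<Rightarrow> 'k::field) set \<Rightarrow> ('x \<Rightarrow> nat \<Rightarrow> 'k) set \<Rightarrow> nat" where
  "quotient_dim V W = card (SOME B. B \<subseteq> V \<and> \<not> module.dependent fun_scale B \<and>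
     module.span fun_scale B \<inter> W = {0} \<and> V \<subseteq> module.span fun_scale (B \<union> W))"

text \<open>For \<open>M = k\<^sup>c\<close> with structure \<open>m\<close>, the free presentation \<open>0 \<rightarrow> \<Omega> \<rightarrow> A\<^sup>c \<rightarrow> M \<rightarrow> 0\<close> sends the
  \<open>i\<close>-th free generator to the \<open>i\<close>-th standard basis vector of \<open>k\<^sup>c\<close>, and
  \<open>Ext\<^sup>1(M, N)\<close> is the cokernel of the restriction map \<open>Hom(A\<^sup>c, N) \<rightarrow> Hom(\<Omega>, N)\<close>. This cokernel
  is finite-dimensional for a finitely generated algebra.\<close>

definition free_cover :: "nat \<Rightarrow> ('a \<Rightarrow> 'k::field mat) \<Rightarrow> (nat \<Rightarrow> 'a) \<Rightarrow> (nat \<Rightarrow> 'k)" where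
  "free_cover c m w = (\<Sum>i<c. row_act c m (\<lambda>j. if j = i then 1 else 0) (w i))"

definition syzygy :: "nat \<Rightarrow> ('a::ring_1 \<Rightarrow> 'k::field mat) \<Rightarrow> (nat \<Rightarrow> 'a) set" where
  "syzygy c m = {w \<in> tuples c. free_cover c m w = 0}"

definition ext1_dim ::
  "nat \<Rightarrow> ('a::ring_1 \<Rightarrow> 'k::field mat) \<Rightarrow> nat \<Rightarrow> ('a \<Rightarrow> 'k mat) \<Rightarrow> nat" where
  "ext1_dim c m e n = quotient_dim
     (right_hom (syzygy c m) free_act (tuples e) (row_act e n))
     ((\<lambda>f w. if w \<in> syzygy c m then f w else 0) `
        right_hom (tuples c) free_act (tuples e) (row_act e n))"

text \<open>A module is in a stable set if its orbit is contained in it.\<close>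

definition ext1_min ::
  "('k::field \<Rightarrow> 'a::ring_1 \<Rightarrow> 'a) \<Rightarrow> nat \<Rightarrow> ('a \<Rightarrow> 'k mat) set \<Rightarrow> nat \<Rightarrow> ('a \<Rightarrow> 'k mat) set \<Rightarrow> nat"
  where
  "ext1_min scale c C e D = (LEAST r. \<exists>m \<in> mod_var scale c. \<exists>n \<in> mod_var scale e.
     gl_orbit c m \<subseteq> C \<and> gl_orbit e n \<subseteq> D \<and> r = ext1_dim c m e n)"

end

theory Submission
  imports Defs "Jordan_Normal_Form.Determinant" "Jordan_Normal_Form.Gauss_Jordan_Elimination"
begin

section \<open>Hilbert's basis theorem for polynomial functions in finitely many coordinates\<close>

section \<open>Noetherian rings of polynomial functions\<close>

text \<open>An extension of M1 by M2 is, in a suitable basis, a block upper triangular module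
  structure with diagonal blocks \<open>m1\<close> and \<open>m2\<close> and a derivation in the
  corner, so E(P) is the set of all conjugates of such block structures with diagonal in P
  (\<open>extension_set_blocks\<close>). The theorem follows from three facts: E(S) is irreducible,
  E(C1 x C2) is closed, and every irreducible set that contains E(S) lies in the closure of E(S).

  Irreducibility. Through the free presentation of M, the space Ext^1(M, N) consists of derivations
  modulo inner derivations (\<open>ext1_dim_derivs\<close>). Derivations are the solutions of a
  linear system with regular coefficients, so near a point their dimension can only drop, while the
  rank of the map that produces the inner ones can only grow; hence dim Ext is upper semicontinuous
  (\<open>ext_chart\<close>). The pairs in S therefore form a nonempty open subset of the
  irreducible set C1 x C2. Since dim Ext(M1, M2) is constant on S, so is the dimension of the space
  of derivations, and the block triangular modules over S behave like a vector bundle over an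
  irreducible base (\<open>irred_blocks\<close>). Conjugation by GL_d preserves irreducibility,
  because any two invertible matrices lie on a line almost all of whose points are invertible
  (\<open>irred_gl_saturate\<close>).

  Closedness. The block triangular modules with diagonal in C1 x C2 form a closed set stable under
  the Borel subgroup of upper triangular matrices. The saturation of such a set under GL_d is
  closed, which is the completeness of the flag variety. Only projective lines enter: the saturation
  is reached by successive saturations under minimal parabolic subgroups, and each of these is
  closed by elimination of one variable (\<open>parabolic_saturate_closed\<close>,
  \<open>gl_saturate_closed\<close>). So the closure of E(S) stays inside E(C1 x C2).

  Maximality. Let T be irreducible and contain E(S), and let m0 be the direct sum of a pair that has
  a whole neighbourhood in S. The lower left block of a module m near m0 is a derivation for its
  diagonal blocks, and conjugation by a lower unitriangular matrix with block u changes it to first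
  order by the inner derivation of u. Since Ext(M2, M1) = 0, all derivations at m0 are inner, and
  Newton iteration solves formally for a u that makes the block zero, that is, makes m an extension.
  For polynomial functions this reads as follows (\<open>newton_vanishing\<close>): if f vanishes on
  E(S), then by the Nullstellensatz a power of f times a function nonzero at m0 is a combination of
  the equations for u; substituting the Newton iterates puts it into every power of the maximal
  ideal of m0 modulo the functions vanishing on T, and Krull's intersection theorem makes f vanish
  on T near m0. As T is irreducible, f vanishes on T (\<open>vanishing_extends\<close>).\<close>

definition is_subring :: "'r::comm_ring_1 set \<Rightarrow> bool" where
  "is_subring A \<longleftrightarrow> 0 \<in> A \<and> 1 \<in> A \<and> (\<forall>a\<in>A. \<forall>b\<in>A. a + b \<in> A \<and> a * b \<in> A) \<and> (\<forall>a\<in>A. - a \<in> A)"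

definition is_ideal :: "'r::comm_ring_1 set \<Rightarrow> 'r set \<Rightarrow> bool" where
  "is_ideal A J \<longleftrightarrow> J \<subseteq> A \<and> 0 \<in> J \<and> (\<forall>a\<in>J. \<forall>b\<in>J. a + b \<in> J) \<and> (\<forall>a\<in>A. \<forall>b\<in>J. a * b \<in> J)"

definition noetherian :: "'r::comm_ring_1 set \<Rightarrow> bool" where
  "noetherian A \<longleftrightarrow> (\<forall>J. (\<forall>n::nat. is_ideal A (J n)) \<longrightarrow> (\<forall>n. J n \<subseteq> J (Suc n)) \<longrightarrow>
     (\<exists>n. \<forall>m\<ge>n. J m = J n))"

text \<open>\<open>t\<close> may be algebraic over \<open>A\<close>, so elements of the extension
  are values of polynomials, and different polynomials may have the same value.\<close>

definition adjoin :: "'r::comm_ring_1 set \<Rightarrow> 'r \<Rightarrow> 'r set" where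
  "adjoin A t = {poly p t | p. \<forall>n. coeff p n \<in> A}"

lemma is_subringD:
  assumes "is_subring A"
  shows "0 \<in> A" "1 \<in> A" "a \<in> A \<Longrightarrow> b \<in> A \<Longrightarrow> a + b \<in> A" "a \<in> A \<Longrightarrow> b \<in> A \<Longrightarrow> a * b \<in> A"
    "a \<in> A \<Longrightarrow> - a \<in> A" "a \<in> A \<Longrightarrow> b \<in> A \<Longrightarrow> a - b \<in> A"
  using assms unfolding is_subring_def by (auto simp: diff_conv_add_uminus simp del: add_uminus_conv_diff)

lemma is_idealD:
  assumes "is_ideal A J"
  shows "J \<subseteq> A" "0 \<in> J" "a \<in> J \<Longrightarrow> b \<in> J \<Longrightarrow> a + b \<in> J" "a \<in> A \<Longrightarrow> b \<in> J \<Longrightarrow> a * b \<in> J"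
    "b \<in> J \<Longrightarrow> a \<in> A \<Longrightarrow> b * a \<in> J"
  using assms unfolding is_ideal_def by (auto simp: mult.commute)

lemma is_ideal_diff:
  assumes "is_subring A" "is_ideal A J" "a \<in> J" "b \<in> J"
  shows "a - b \<in> J"
proof -
  have "(- 1) * b \<in> J"
    using assms is_idealD(4) is_subringD(2,5) by blast
  from is_idealD(3)[OF assms(2,3) this] show ?thesis by simp
qed

lemma is_subring_sum:
  "is_subring A \<Longrightarrow> (\<And>i. i \<in> S \<Longrightarrow> f i \<in> A) \<Longrightarrow> sum f S \<in> A"
  by (induction S rule: infinite_finite_induct) (auto simp: is_subringD)

lemma is_subring_power: "is_subring A \<Longrightarrow> a \<in> A \<Longrightarrow> a ^ n \<in> A"
  by (induction n) (auto simp: is_subringD)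

lemma coeff_mult_mem:
  assumes "is_subring A" "\<forall>n. coeff p n \<in> A" "\<forall>n. coeff q n \<in> A"
  shows "coeff (p * q) n \<in> A"
  unfolding coeff_mult using assms by (intro is_subring_sum is_subringD(4)) auto

lemma is_subring_adjoin:
  assumes "is_subring A"
  shows "is_subring (adjoin A t)"
proof -
  note d = is_subringD[OF assms]
  have "0 \<in> adjoin A t" "1 \<in> adjoin A t"
    unfolding adjoin_def mem_Collect_eq
    by (intro exI[of _ 0] exI[of _ 1]; simp add: d coeff_1)+
  moreover have "a + b \<in> adjoin A t \<and> a * b \<in> adjoin A t" if ab: "a \<in> adjoin A t" "b \<in> adjoin A t" for a b
  proof -
    obtain p q where "a = poly p t" "b = poly q t" "\<forall>n. coeff p n \<in> A" "\<forall>n. coeff q n \<in> A"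
      using ab unfolding adjoin_def by blast
    then have "a + b = poly (p + q) t" "a * b = poly (p * q) t" "\<forall>n. coeff (p + q) n \<in> A"
      "\<forall>n. coeff (p * q) n \<in> A"
      using coeff_mult_mem[OF assms] d by auto
    then show ?thesis unfolding adjoin_def by blast
  qed
  moreover have "- a \<in> adjoin A t" if ab: "a \<in> adjoin A t" for a
  proof -
    obtain p where "a = poly p t" "\<forall>n. coeff p n \<in> A"
      using ab unfolding adjoin_def by blast
    then have "- a = poly (- p) t" "\<forall>n. coeff (- p) n \<in> A"
      using d by auto
    then show ?thesis unfolding adjoin_def by blast
  qed
  ultimately show ?thesis unfolding is_subring_def by blast
qed

text \<open>Without a maximal member, a choice of a strictly larger member could be iterated to an
  ascending chain that never becomes constant.\<close>

lemma noetherian_max: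
  assumes "noetherian A" "\<J> \<noteq> {}" "\<And>J. J \<in> \<J> \<Longrightarrow> is_ideal A J"
  shows "\<exists>J\<in>\<J>. \<forall>J'\<in>\<J>. J \<subseteq> J' \<longrightarrow> J' = J"
proof (rule ccontr)
  assume "\<not> ?thesis"
  then have step: "\<forall>J\<in>\<J>. \<exists>J'\<in>\<J>. J \<subset> J'" by blast
  then obtain g where g: "\<And>J. J \<in> \<J> \<Longrightarrow> g J \<in> \<J> \<and> J \<subset> g J" by metis
  obtain J0 where "J0 \<in> \<J>" using assms(2) by blast
  define c where "c n = (g ^^ n) J0" for n
  have c: "c n \<in> \<J>" for n by (induction n) (auto simp: c_def \<open>J0 \<in> \<J>\<close> g)
  have lt: "c n \<subset> c (Suc n)" for n using g[OF c[of n]] by (simp add: c_def)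
  then obtain n where "\<forall>m\<ge>n. c m = c n"
    using assms(1)[unfolded noetherian_def, rule_format, of c] assms(3) c by blast
  with lt[of n] show False by (metis le_Suc_eq psubset_eq order_refl)
qed

text \<open>An ideal \<open>J\<close> of \<open>A[t]\<close> is determined by the ideals of its leading coefficients.\<close>

theorem noetherian_adjoin:
  assumes A: "is_subring A" and "noetherian A"
  shows "noetherian (adjoin A t)"
  unfolding noetherian_def
proof (intro allI impI)
  fix J assume J: "\<forall>n::nat. is_ideal (adjoin A t) (J n)" and inc: "\<forall>n. J n \<subseteq> J (Suc n)"
  note d = is_subringD[OF A]
  note dJ = is_idealD[OF J[rule_format]]
  define P where "P = {p. \<forall>n. coeff p n \<in> A}"
  have mono: "J m \<subseteq> J n" if "m \<le> n" for m n
    using lift_Suc_mono_le[of J] inc that by blast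
  define L where "L n K = {coeff p n | p. p \<in> P \<and> degree p \<le> n \<and> poly p t \<in> K}" for n K
  have const: "a \<in> adjoin A t" if "a \<in> A" for a
    unfolding adjoin_def mem_Collect_eq using that d
    by (intro exI[of _ "[:a:]"]) (auto simp: coeff_pCons split: nat.split)
  have t: "t \<in> adjoin A t"
    unfolding adjoin_def mem_Collect_eq using d
    by (intro exI[of _ "[:0,1:]"]) (auto simp: coeff_pCons split: nat.split)
  have L_ideal: "is_ideal A (L n (J k))" for n k
    unfolding is_ideal_def
  proof (intro conjI ballI)
    show "L n (J k) \<subseteq> A" by (auto simp: L_def P_def)
    show "0 \<in> L n (J k)"
      unfolding L_def mem_Collect_eq using d dJ(2) by (intro exI[of _ 0]) (auto simp: P_def)
  next
    fix a b assume "a \<in> L n (J k)" "b \<in> L n (J k)"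
    then obtain p q where "a = coeff p n" "p \<in> P" "degree p \<le> n" "poly p t \<in> J k"
      "b = coeff q n" "q \<in> P" "degree q \<le> n" "poly q t \<in> J k"
      unfolding L_def by blast
    then show "a + b \<in> L n (J k)"
      unfolding L_def mem_Collect_eq
      by (intro exI[of _ "p + q"]) (auto simp: P_def d degree_add_le dJ(3))
  next
    fix a b assume a: "a \<in> A" and "b \<in> L n (J k)"
    then obtain q where "b = coeff q n" "q \<in> P" "degree q \<le> n" "poly q t \<in> J k"
      unfolding L_def by blast
    then show "a * b \<in> L n (J k)"
      unfolding L_def mem_Collect_eq using a
      by (intro exI[of _ "Polynomial.smult a q"])
        (auto simp: P_def d intro!: dJ(4) const order.trans[OF degree_smult_le])
  qed
  have L_Suc: "L n (J k) \<subseteq> L (Suc n) (J k)" for n k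
  proof
    fix a assume "a \<in> L n (J k)"
    then obtain p where "a = coeff p n" "p \<in> P" "degree p \<le> n" "poly p t \<in> J k"
      unfolding L_def by blast
    then show "a \<in> L (Suc n) (J k)"
      unfolding L_def mem_Collect_eq
      by (intro exI[of _ "pCons 0 p"])
        (auto simp: P_def d coeff_pCons split: nat.split intro!: dJ(4) t intro: order.trans[OF degree_pCons_le])
  qed
  have L_mono: "L m (J k) \<subseteq> L n (J l)" if "m \<le> n" "k \<le> l" for m n k l
  proof -
    have "L m (J k) \<subseteq> L n (J k)"
      using lift_Suc_mono_le[of "\<lambda>n. L n (J k)"] L_Suc that(1) by blast
    also have "\<dots> \<subseteq> L n (J l)" using mono[OF that(2)] unfolding L_def by blast
    finally show ?thesis .
  qed
  \<comment> \<open>The chain condition along a monotone path through the double family; it is used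
    for the diagonal and for each fixed degree.\<close>
  have stab: "\<exists>n. \<forall>m\<ge>n. L (f m) (J m) = L (f n) (J n)" if "mono f" for f
    using \<open>noetherian A\<close>[unfolded noetherian_def, rule_format, of "\<lambda>m. L (f m) (J m)"] L_ideal
      L_mono that by (simp add: mono_def)
  obtain N where N: "\<And>m. m \<ge> N \<Longrightarrow> L m (J m) = L N (J N)"
    using stab[of "\<lambda>m. m"] by (auto simp: mono_def)
  have "\<exists>n. \<forall>m\<ge>n. L i (J m) = L i (J n)" for i
    using stab[of "\<lambda>m. i"] by (auto simp: mono_def)
  then obtain h where h: "\<And>i m. m \<ge> h i \<Longrightarrow> L i (J m) = L i (J (h i))" by metis
  \<comment> \<open>The diagonal controls all degrees above \<open>N\<close>, so only finitely many
    of the individual bounds \<open>h i\<close> have to be respected.\<close>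
  define M where "M = Max (insert N (h ` {..N}))"
  have MN: "M \<ge> N" and Mh: "\<And>i. i \<le> N \<Longrightarrow> M \<ge> h i"
    unfolding M_def by (rule Max_ge; force)+
  have Leq: "L i (J m) = L i (J M)" if "m \<ge> M" for i m
  proof (cases "i \<le> N")
    case True
    then show ?thesis using h[of i m] h[of i M] Mh[OF True] that by simp
  next
    case False
    have "L i (J m) \<subseteq> L (max i m) (J (max i m))" by (rule L_mono) auto
    also have "\<dots> = L N (J N)" using False by (intro N) auto
    also have "\<dots> \<subseteq> L i (J M)" using False MN by (intro L_mono) auto
    finally show ?thesis using L_mono[of i i M m] that by auto
  qed
  have "J m = J M" if m: "m \<ge> M" for m
  proof
    show "J M \<subseteq> J m" by (rule mono[OF m])
    \<comment> \<open>Induction on the degree: a polynomial with value in \<open>J M\<close> and the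
      same top coefficient is subtracted, and the value of the difference still lies in
      \<open>J m\<close>.\<close>
    have "poly p t \<in> J M" if "p \<in> P" "degree p \<le> n" "poly p t \<in> J m" for p n
      using that
    proof (induction n arbitrary: p)
      case 0
      then have "coeff p 0 \<in> L 0 (J M)"
        using Leq[OF m, of 0] unfolding L_def by blast
      then obtain q where q: "coeff p 0 = coeff q 0" "degree q = 0" "poly q t \<in> J M"
        unfolding L_def by auto
      have "p = q" using 0 q by (metis degree_eq_zeroE coeff_pCons_0 le_zero_eq)
      with q show ?case by simp
    next
      case (Suc n)
      then have "coeff p (Suc n) \<in> L (Suc n) (J M)"
        using Leq[OF m, of "Suc n"] unfolding L_def by blast
      then obtain q where q: "coeff p (Suc n) = coeff q (Suc n)" "degree q \<le> Suc n" "poly q t \<in> J M"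
        "q \<in> P"
        unfolding L_def by auto
      have "degree (p - q) \<le> n"
      proof (rule degree_le, intro allI impI)
        fix i assume "n < i"
        then show "coeff (p - q) i = 0"
          using q Suc.prems(2) by (cases "i = Suc n") (auto simp: coeff_eq_0)
      qed
      moreover have "p - q \<in> P" using Suc.prems(1) q(4) d by (auto simp: P_def)
      moreover have "poly (p - q) t \<in> J m"
        using Suc.prems(3) q(3) mono[OF m] is_ideal_diff[OF is_subring_adjoin[OF A] J[rule_format]] by auto
      ultimately have "poly (p - q) t \<in> J M" using Suc.IH by blast
      from dJ(3)[OF this q(3)] show ?case by simp
    qed
    then show "J m \<subseteq> J M"
      using dJ(1)[of m] unfolding adjoin_def P_def by blast
  qed
  then show "\<exists>n. \<forall>m\<ge>n. J m = J n" by blast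
qed

lemma polyfun_eqI:
  assumes "f \<in> polyfun I" "\<And>i. i \<in> I \<Longrightarrow> x i = y i"
  shows "f x = f y"
  using assms by (induction rule: polyfun.induct) auto

lemma is_subring_polyfun: "is_subring (polyfun I :: (('i \<Rightarrow> 'k::field) \<Rightarrow> 'k) set)"
proof -
  have "(\<lambda>x. - f x) \<in> polyfun I" if "f \<in> polyfun I" for f :: "('i \<Rightarrow> 'k) \<Rightarrow> 'k"
    using polyfun.mult[OF polyfun.const[of "-1"] that] by simp
  then show ?thesis
    unfolding is_subring_def plus_fun_def times_fun_def zero_fun_def one_fun_def fun_Compl_def
    by (auto intro: polyfun.intros)
qed

lemma polyfun_mono: "f \<in> polyfun I \<Longrightarrow> I \<subseteq> I' \<Longrightarrow> f \<in> polyfun I'"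
  by (induction rule: polyfun.induct) (auto intro: polyfun.intros)

lemma polyfun_empty: "polyfun {} = range (\<lambda>(c :: 'k::field) (x :: 'i \<Rightarrow> 'k). c)" (is "?L = ?R")
proof
  show "?L \<subseteq> ?R"
  proof
    fix f :: "('i \<Rightarrow> 'k) \<Rightarrow> 'k" assume "f \<in> polyfun {}" then show "f \<in> ?R"
      by induction auto
  qed
qed (auto intro: polyfun.const)

lemma polyfun_insert:
  "polyfun (insert i I) = adjoin (polyfun I :: (('i \<Rightarrow> 'k::field) \<Rightarrow> 'k) set) (\<lambda>x. x i)" (is "?L = ?R")
proof
  note s = is_subring_polyfun[of I, where 'k='k]
  note sr = is_subringD[OF is_subring_adjoin[OF s, of "\<lambda>x. x i"]]
  have A: "f \<in> ?R" if "f \<in> polyfun I" for f :: "('i \<Rightarrow> 'k) \<Rightarrow> 'k"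
    unfolding adjoin_def mem_Collect_eq using that is_subringD[OF s]
    by (intro exI[of _ "[:f:]"]) (auto simp: coeff_pCons split: nat.split)
  have t: "(\<lambda>x. x i) \<in> ?R"
    unfolding adjoin_def mem_Collect_eq using is_subringD[OF s]
    by (intro exI[of _ "[:0,1:]"]) (auto simp: coeff_pCons split: nat.split)
  show "?L \<subseteq> ?R"
  proof
    fix f assume "f \<in> ?L" then show "f \<in> ?R"
    proof induction
      case (const c) show ?case by (rule A[OF polyfun.const])
    next
      case (coord j) then show ?case using t A[OF polyfun.coord] by auto
    next
      case (add f g) then show ?case using sr(3) by (simp add: plus_fun_def)
    next
      case (mult f g) then show ?case using sr(4) by (simp add: times_fun_def)
    qed
  qed
  note sl = is_subringD[OF is_subring_polyfun[of "insert i I", where 'k='k]]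
  show "?R \<subseteq> ?L"
  proof
    fix f assume "f \<in> ?R"
    then obtain p where p: "f = poly p (\<lambda>x. x i)" "\<forall>n. coeff p n \<in> polyfun I"
      unfolding adjoin_def by blast
    have "coeff p n \<in> ?L" for n using p(2) polyfun_mono[of _ I "insert i I"] by blast
    then show "f \<in> ?L"
      unfolding p(1) poly_altdef
      by (intro is_subring_sum is_subring_polyfun sl(4) is_subring_power polyfun.coord) auto
  qed
qed

text \<open>The coordinates are adjoined one at a time to the field of constants, whose only ideals
  are zero and the whole field.\<close>

lemma noetherian_polyfun: "finite I \<Longrightarrow> noetherian (polyfun I :: (('i \<Rightarrow> 'k::field) \<Rightarrow> 'k) set)"
proof (induction I rule: finite_induct)
  case empty
  define A where "A = (polyfun {} :: (('i \<Rightarrow> 'k) \<Rightarrow> 'k) set)"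
  have triv: "J = {0} \<or> J = A" if "is_ideal A J" for J
  proof (rule ccontr)
    note d = is_idealD[OF that]
    assume n: "\<not> (J = {0} \<or> J = A)"
    have "\<exists>f\<in>J. f \<noteq> 0"
    proof (rule ccontr)
      assume "\<not> (\<exists>f\<in>J. f \<noteq> 0)"
      then have "J = {0}" using d(2) by auto
      with n show False by simp
    qed
    then obtain f where f: "f \<in> J" "f \<noteq> 0" by blast
    with d(1) have "f \<in> A" by blast
    then obtain c where c: "f = (\<lambda>x. c)" unfolding A_def polyfun_empty by (rule rangeE)
    with f have "c \<noteq> 0" by (auto simp: zero_fun_def)
    have AJ: "g \<in> J" if g: "g \<in> A" for g
    proof -
      obtain b where b: "g = (\<lambda>x. b)" using g unfolding A_def polyfun_empty by (rule rangeE)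
      have "(\<lambda>x. b / c) * f \<in> J"
        by (rule d(4)[OF _ f(1)]) (simp add: A_def polyfun.const)
      moreover have "(\<lambda>x. b / c) * f = g" using \<open>c \<noteq> 0\<close> by (auto simp: b c times_fun_def)
      ultimately show ?thesis by simp
    qed
    have "J = A" using d(1) AJ by (intro subset_antisym) auto
    with n show False by simp
  qed
  show ?case
    unfolding noetherian_def A_def[symmetric]
  proof (intro allI impI)
    fix J :: "nat \<Rightarrow> _" assume J: "\<forall>n. is_ideal A (J n)" and inc: "\<forall>n. J n \<subseteq> J (Suc n)"
    have mono: "J m \<subseteq> J n" if "m \<le> n" for m n
      using lift_Suc_mono_le[of J] inc that by blast
    show "\<exists>n. \<forall>m\<ge>n. J m = J n"
    proof (cases "\<exists>n. J n = A")
      case True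
      then obtain n where "J n = A" by blast
      then show ?thesis using mono is_idealD(1)[OF J[rule_format]] by blast
    next
      case False
      then show ?thesis using triv J by blast
    qed
  qed
next
  case (insert i I)
  then show ?case
    unfolding polyfun_insert using noetherian_adjoin is_subring_polyfun by blast
qed

section \<open>The Nullstellensatz, by induction on the number of coordinates\<close>

section \<open>Hilbert's Nullstellensatz\<close>

text \<open>Over a finite field, one plus the product of all \<open>X - a\<close> is a nonconstant
  polynomial without a root.\<close>

lemma infinite_UNIV_alg_closed: "infinite (UNIV :: 'k::alg_closed_field set)"
proof
  assume fin: "finite (UNIV :: 'k set)"
  define p :: "'k poly" where "p = (\<Prod>a\<in>UNIV. [:- a, 1:]) + 1"
  have deg: "degree (\<Prod>a\<in>(UNIV :: 'k set). [:- a, 1:]) = card (UNIV :: 'k set)"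
    by (subst degree_prod_eq_sum_degree) simp_all
  have "card (UNIV :: 'k set) > 0" using fin by (simp add: card_gt_0_iff)
  then have "degree p > 0" unfolding p_def using deg
    by (subst degree_add_eq_left) simp_all
  then obtain x where "poly p x = 0" using alg_closed_imp_poly_has_root by blast
  moreover have "(\<Prod>a\<in>(UNIV :: 'k set). poly [:- a, 1:] x) = 0"
    by (rule prod_zero[OF fin]) auto
  then have "poly p x = 1" by (simp only: p_def poly_add poly_prod poly_1 add_0_left)
  ultimately show False by simp
qed

lemma exists_nonroot:
  assumes "(p :: 'k::field poly) \<noteq> 0" "infinite (UNIV :: 'k set)"
  shows "\<exists>c. poly p c \<noteq> 0"
  using assms poly_roots_finite[OF assms(1)] by (metis (mono_tags, lifting) Collect_cong UNIV_def)

text \<open>The coefficients are functions of a point. Fixing the point gives an ordinary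
  polynomial, and evaluation commutes with this specialization.\<close>

lemma poly_fun_apply: "poly p t x = poly (map_poly (\<lambda>f. f x) p) (t x)"
  for p :: "('x \<Rightarrow> 'k::field) poly"
  by (induction p) (auto simp: map_poly_pCons plus_fun_def times_fun_def zero_fun_def)

definition is_prime_ideal :: "'r::comm_ring_1 set \<Rightarrow> 'r set \<Rightarrow> bool" where
  "is_prime_ideal A P \<longleftrightarrow> is_ideal A P \<and> 1 \<notin> P \<and> (\<forall>a\<in>A. \<forall>b\<in>A. a * b \<in> P \<longrightarrow> a \<in> P \<or> b \<in> P)"

lemma is_prime_idealD:
  assumes "is_prime_ideal A P"
  shows "is_ideal A P" "1 \<notin> P" "a \<in> A \<Longrightarrow> b \<in> A \<Longrightarrow> a * b \<in> P \<Longrightarrow> a \<in> P \<or> b \<in> P"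
  using assms unfolding is_prime_ideal_def by auto

lemma prime_ideal_power:
  assumes "is_subring A" "is_prime_ideal A P" "a \<in> A" "a ^ n \<in> P"
  shows "a \<in> P"
  using assms(4)
proof (induction n)
  case (Suc n)
  then show ?case
    using is_prime_idealD(3)[OF assms(2,3) is_subring_power[OF assms(1,3)], of n] by auto
qed (use is_prime_idealD(2)[OF assms(2)] in simp)

text \<open>Long division without inverting anything: before each cancellation of a top term the
  dividend is multiplied by the leading coefficient of \<open>g\<close>, so all coefficients stay in
  \<open>A\<close>.\<close>

lemma pseudo_divmod_coeffs:
  assumes A: "is_subring A" and f: "\<forall>n. coeff f n \<in> A" and g: "\<forall>n. coeff g n \<in> A" and "g \<noteq> 0"
  obtains e q r where "Polynomial.smult (lead_coeff g ^ e) f = g * q + r" "r = 0 \<or> degree r < degree g"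
    "\<forall>n. coeff q n \<in> A" "\<forall>n. coeff r n \<in> A"
proof -
  note d = is_subringD[OF A]
  have "\<exists>e q r. Polynomial.smult (lead_coeff g ^ e) f = g * q + r \<and> (r = 0 \<or> degree r < degree g) \<and>
    (\<forall>n. coeff q n \<in> A) \<and> (\<forall>n. coeff r n \<in> A)"
    using f
  proof (induction "degree f" arbitrary: f rule: less_induct)
    case (less f)
    show ?case
    proof (cases "f = 0 \<or> degree f < degree g")
      case True
      then show ?thesis using less.prems d(1) by (intro exI[of _ 0] exI[of _ f]) auto
    next
      case False
      define h where "h = Polynomial.smult (lead_coeff g) f - g * monom (lead_coeff f) (degree f - degree g)"
      have mon: "\<forall>n. coeff (monom (lead_coeff f) (degree f - degree g)) n \<in> A"
        using less.prems d(1) by simp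
      have hA: "\<forall>n. coeff h n \<in> A"
        unfolding h_def coeff_diff coeff_smult
        by (intro allI d(6) d(4) coeff_mult_mem[OF A g mon] less.prems[rule_format] g[rule_format])
      have "degree (g * monom (lead_coeff f) (degree f - degree g)) \<le> degree f"
        using False degree_mult_le[of g "monom (lead_coeff f) (degree f - degree g)"]
          degree_monom_le[of "lead_coeff f" "degree f - degree g"] by linarith
      then have le: "degree h \<le> degree f"
        unfolding h_def by (intro degree_diff_le degree_smult_le)
      have c0: "coeff h (degree f) = 0"
        using False coeff_mult_degree_sum[of g "monom (lead_coeff f) (degree f - degree g)"]
        by (simp add: h_def coeff_monom_mult mult.commute[of g])
      show ?thesis
      proof (cases "h = 0 \<or> degree h < degree f")
        case True
        have "\<exists>e q r. Polynomial.smult (lead_coeff g ^ e) h = g * q + r \<and> (r = 0 \<or> degree r < degree g) \<and>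
          (\<forall>n. coeff q n \<in> A) \<and> (\<forall>n. coeff r n \<in> A)"
        proof (cases "h = 0")
          case True
          then show ?thesis using d(1) by (intro exI[of _ 0]) auto
        next
          case False
          with \<open>h = 0 \<or> degree h < degree f\<close> show ?thesis using less.hyps[OF _ hA] by simp
        qed
        then obtain e q r where *: "Polynomial.smult (lead_coeff g ^ e) h = g * q + r" "r = 0 \<or> degree r < degree g"
          "\<forall>n. coeff q n \<in> A" "\<forall>n. coeff r n \<in> A" by blast
        define q' where "q' = q + Polynomial.smult (lead_coeff g ^ e) (monom (lead_coeff f) (degree f - degree g))"
        have "Polynomial.smult (lead_coeff g ^ Suc e) f = g * q' + r"
          using *(1) unfolding h_def q'_def
          by (simp add: smult_diff_right algebra_simps)
        moreover have "\<forall>n. coeff q' n \<in> A"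
          unfolding q'_def coeff_add coeff_smult
          by (intro allI d(3,4) is_subring_power[OF A] *(3)[rule_format] mon[rule_format] g[rule_format])
        ultimately show ?thesis using *(2,4) by (intro exI[of _ "Suc e"] exI[of _ q'] exI[of _ r] conjI)
      next
        case False
        then have "degree h = degree f" "h \<noteq> 0" using le by auto
        with c0 show ?thesis by (metis leading_coeff_0_iff)
      qed
    qed
  qed
  then show ?thesis using that by blast
qed

lemma poly_const_mem_adjoin:
  assumes "is_subring A" "a \<in> A"
  shows "a \<in> adjoin A t"
  unfolding adjoin_def mem_Collect_eq using assms(2) is_subringD(1)[OF assms(1)]
  by (intro exI[of _ "[:a:]"]) (auto simp: coeff_pCons split: nat.split)

text \<open>Removing the top terms with coefficients in \<open>P\<close>.\<close>

lemma trim_poly: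
  assumes A: "is_subring A" and P: "is_ideal (adjoin A t) P" and g: "\<forall>n. coeff g n \<in> A"
  obtains g' where "\<forall>n. coeff g' n \<in> A" "\<forall>n. coeff (g - g') n \<in> P" "degree g' \<le> degree g"
    "g' = 0 \<or> lead_coeff g' \<notin> P"
proof -
  note d = is_subringD[OF A] and dP = is_idealD[OF P]
  have "\<exists>g'. (\<forall>n. coeff g' n \<in> A) \<and> (\<forall>n. coeff (g - g') n \<in> P) \<and> degree g' \<le> degree g \<and>
    (g' = 0 \<or> lead_coeff g' \<notin> P)"
    using g
  proof (induction "degree g" arbitrary: g rule: less_induct)
    case (less g)
    show ?case
    proof (cases "g = 0 \<or> lead_coeff g \<notin> P")
      case True
      then show ?thesis using less.prems dP(2) by (intro exI[of _ g]) auto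
    next
      case False
      define h where "h = g - monom (lead_coeff g) (degree g)"
      have hA: "\<forall>n. coeff h n \<in> A" unfolding h_def using less.prems d(1,6) by auto
      have gh: "\<forall>n. coeff (g - h) n \<in> P" unfolding h_def using False dP(2) by auto
      have le: "degree h \<le> degree g"
        unfolding h_def by (intro degree_diff_le degree_monom_le order.refl)
      have "\<exists>g'. (\<forall>n. coeff g' n \<in> A) \<and> (\<forall>n. coeff (h - g') n \<in> P) \<and> degree g' \<le> degree h \<and>
        (g' = 0 \<or> lead_coeff g' \<notin> P)"
      proof (cases "h = 0")
        case True
        then show ?thesis using d(1) dP(2) by (intro exI[of _ 0]) auto
      next
        case hne: False
        have "coeff h (degree g) = 0" by (simp add: h_def)
        then have "degree h < degree g" using le hne by (metis le_neq_implies_less leading_coeff_0_iff)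
        from less.hyps[OF this hA] show ?thesis .
      qed
      then obtain g' where g': "\<forall>n. coeff g' n \<in> A" "\<forall>n. coeff (h - g') n \<in> P" "degree g' \<le> degree h"
        "g' = 0 \<or> lead_coeff g' \<notin> P" by blast
      have "coeff (g - g') n \<in> P" for n
        using dP(3)[OF gh[rule_format, of n] g'(2)[rule_format, of n]] by simp
      then show ?thesis using g' le by (intro exI[of _ g']) auto
    qed
  qed
  then show ?thesis using that by blast
qed

lemma poly_mem_ideal:
  assumes A: "is_subring A" and P: "is_ideal (adjoin A t) P" and "\<forall>n. coeff g n \<in> P"
  shows "poly g t \<in> P"
proof -
  note B = is_subring_adjoin[OF A, of t] and dP = is_idealD[OF P]
  have "t \<in> adjoin A t"
    unfolding adjoin_def mem_Collect_eq using is_subringD[OF A]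
    by (intro exI[of _ "[:0,1:]"]) (auto simp: coeff_pCons split: nat.split)
  then have *: "coeff g i * t ^ i \<in> P" for i
    using assms(3) by (intro dP(5) is_subring_power[OF B]) auto
  have "(\<Sum>i\<in>S. coeff g i * t ^ i) \<in> P" for S
    by (induction S rule: infinite_finite_induct) (auto simp: dP(2) intro!: dP(3) *)
  then show ?thesis by (simp add: poly_altdef)
qed

lemma poly_eval_ideal_coeffs:
  fixes h :: "('x \<Rightarrow> 'k::field) poly"
  assumes "\<forall>n. coeff h n \<in> P" "\<forall>f\<in>P. f x = 0"
  shows "poly h (\<lambda>_. \<tau>) x = 0"
proof -
  have "map_poly (\<lambda>f. f x) h = 0"
    by (rule poly_eqI) (use assms in \<open>simp add: coeff_map_poly\<close>)
  then show ?thesis by (simp add: poly_fun_apply)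
qed

text \<open>The case where \<open>t\<close> is algebraic over \<open>A / (A \<inter> P)\<close>.\<close>

lemma prime_ideal_poly_root:
  fixes p q :: "('x \<Rightarrow> 'k::alg_closed_field) poly"
  assumes A: "is_subring A" and P: "is_prime_ideal (adjoin A t) P"
    and p: "\<forall>n. coeff p n \<in> A" "poly p t \<in> P" "\<exists>n. coeff p n \<notin> P"
    and q: "\<forall>n. coeff q n \<in> A" "poly q t \<notin> P"
  obtains c where "c \<in> A" "c \<notin> P"
    "\<And>x. \<forall>f\<in>A \<inter> P. f x = 0 \<Longrightarrow> c x \<noteq> 0 \<Longrightarrow> \<exists>\<tau>. poly q (\<lambda>_. \<tau>) x \<noteq> 0 \<and>
       (\<forall>h. (\<forall>n. coeff h n \<in> A) \<longrightarrow> poly h t \<in> P \<longrightarrow> poly h (\<lambda>_. \<tau>) x = 0)"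
proof -
  define B where "B = adjoin A t"
  note d = is_subringD[OF A]
  have B: "is_subring B" unfolding B_def by (rule is_subring_adjoin[OF A])
  note dB = is_subringD[OF B]
  note PI = is_prime_idealD(1)[OF P]
  note dP = is_idealD[OF PI, folded B_def]
  note prime = is_prime_idealD(3)[OF P, folded B_def]
  have AB: "a \<in> B" if "a \<in> A" for a unfolding B_def by (rule poly_const_mem_adjoin[OF A that])
  have polyB: "poly g t \<in> B" if "\<forall>n. coeff g n \<in> A" for g using that unfolding B_def adjoin_def by blast
  have diffP: "a - b \<in> P" if "a \<in> P" "b \<in> P" for a b
    using is_ideal_diff[OF B _ that] PI unfolding B_def by blast
  have powP: "a \<in> P" if "a \<in> A" "a ^ n \<in> P" for a n
    using prime_ideal_power[OF B _ AB[OF that(1)] that(2)] P unfolding B_def by blast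
  have trim: "\<exists>g'. (\<forall>n. coeff g' n \<in> A) \<and> (\<forall>n. coeff (g - g') n \<in> P) \<and> degree g' \<le> degree g \<and>
    (g' = 0 \<or> lead_coeff g' \<notin> P) \<and> (poly g' t \<in> P \<longleftrightarrow> poly g t \<in> P) \<and> poly g t - poly g' t \<in> P"
    if "\<forall>n. coeff g n \<in> A" for g
  proof -
    obtain g' where g': "\<forall>n. coeff g' n \<in> A" "\<forall>n. coeff (g - g') n \<in> P" "degree g' \<le> degree g"
      "g' = 0 \<or> lead_coeff g' \<notin> P" by (rule trim_poly[OF A PI \<open>\<forall>n. coeff g n \<in> A\<close>])
    have *: "poly g t - poly g' t \<in> P" using poly_mem_ideal[OF A PI g'(2)] by simp
    have "poly g' t \<in> P \<longleftrightarrow> poly g t \<in> P"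
      using dP(3)[OF *, of "poly g' t"] diffP[OF _ *, of "poly g t"] by auto
    with * g' show ?thesis by blast
  qed
  \<comment> \<open>Relations of \<open>t\<close> modulo \<open>P\<close> that have a leading
    coefficient outside \<open>P\<close>. A member of least degree plays the part of the minimal
    polynomial of \<open>t\<close> over the fraction field of
    \<open>A / (A \<inter> P)\<close>.\<close>
  define S where "S = {g. (\<forall>n. coeff g n \<in> A) \<and> poly g t \<in> P \<and> lead_coeff g \<notin> P}"
  have "\<exists>g. g \<in> S"
  proof -
    obtain g' where g': "\<forall>n. coeff g' n \<in> A" "\<forall>n. coeff (p - g') n \<in> P" "g' = 0 \<or> lead_coeff g' \<notin> P"
      "poly g' t \<in> P" using trim[OF p(1)] p(2) by blast
    have "g' \<noteq> 0" using g'(2) p(3) by auto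
    with g' show ?thesis unfolding S_def by blast
  qed
  then obtain p0 where p0: "p0 \<in> S" and min0: "\<And>g. g \<in> S \<Longrightarrow> degree p0 \<le> degree g"
    using ex_has_least_nat[of "\<lambda>g. g \<in> S" _ degree] by blast
  define a where "a = lead_coeff p0"
  have p0': "\<forall>n. coeff p0 n \<in> A" "poly p0 t \<in> P" "a \<notin> P" "a \<in> A" using p0 by (auto simp: S_def a_def)
  have n1: "degree p0 > 0"
  proof (rule ccontr)
    assume "\<not> degree p0 > 0"
    then obtain b where "p0 = [:b:]" by (metis degree_eq_zeroE gr0I)
    with p0' show False by (simp add: a_def)
  qed
  have p0ne: "p0 \<noteq> 0" using n1 by auto
  \<comment> \<open>A relation of degree below that of the minimal one is trivial modulo
    \<open>P\<close>.\<close>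
  have small: "\<forall>n. coeff r n \<in> P" if r: "\<forall>n. coeff r n \<in> A" "poly r t \<in> P" "r = 0 \<or> degree r < degree p0" for r
  proof -
    obtain r' where r': "\<forall>n. coeff r' n \<in> A" "\<forall>n. coeff (r - r') n \<in> P" "r' = 0 \<or> lead_coeff r' \<notin> P"
      "poly r' t \<in> P" "degree r' \<le> degree r" using trim[OF r(1)] r(2) by blast
    have "r' = 0"
    proof (rule ccontr)
      assume "r' \<noteq> 0"
      then have "r' \<in> S" using r' by (auto simp: S_def)
      from min0[OF this] r'(5) r(3) n1 show False by auto
    qed
    then show ?thesis using r'(2) by simp
  qed
  \<comment> \<open>The polynomials whose value at \<open>t\<close> is, modulo \<open>P\<close>, a
    multiple of the value of \<open>q\<close>. A constant outside \<open>P\<close> among them makes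
    \<open>q\<close> invertible wherever that constant is nonzero.\<close>
  define I2 where "I2 = {g. (\<forall>n. coeff g n \<in> A) \<and> (\<exists>s. (\<forall>n. coeff s n \<in> A) \<and> poly g t - poly s t * poly q t \<in> P)}"
  define S2 where "S2 = {g\<in>I2. poly g t \<notin> P \<and> lead_coeff g \<notin> P}"
  have trim2: "\<exists>r'\<in>S2. degree r' \<le> degree r" if r: "r \<in> I2" "poly r t \<notin> P" for r
  proof -
    obtain r' where r': "\<forall>n. coeff r' n \<in> A" "\<forall>n. coeff (r - r') n \<in> P" "r' = 0 \<or> lead_coeff r' \<notin> P"
      "poly r' t \<notin> P" "degree r' \<le> degree r" "poly r t - poly r' t \<in> P"
      using trim[of r] r unfolding I2_def by blast
    obtain s where s: "\<forall>n. coeff s n \<in> A" "poly r t - poly s t * poly q t \<in> P"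
      using r unfolding I2_def by blast
    have "r' \<noteq> 0" using r'(4) dP(2) by auto
    moreover have "poly r' t - poly s t * poly q t \<in> P" using diffP[OF s(2) r'(6)] by simp
    ultimately have "r' \<in> S2" using r' s(1) unfolding S2_def I2_def by blast
    then show ?thesis using r'(5) by blast
  qed
  have "q \<in> I2" unfolding I2_def mem_Collect_eq
    using q(1) d(1,2) dP(2) by (intro conjI exI[of _ 1]) (auto simp: coeff_1)
  then have "\<exists>g. g \<in> S2" using trim2 q(2) by blast
  then obtain r0 where r0: "r0 \<in> S2" and min2: "\<And>g. g \<in> S2 \<Longrightarrow> degree r0 \<le> degree g"
    using ex_has_least_nat[of "\<lambda>g. g \<in> S2" _ degree] by blast
  define b where "b = lead_coeff r0"
  have r0': "\<forall>n. coeff r0 n \<in> A" "poly r0 t \<notin> P" "b \<notin> P" "b \<in> A" "r0 \<in> I2"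
    using r0 by (auto simp: S2_def I2_def b_def)
  obtain s0 where s0: "\<forall>n. coeff s0 n \<in> A" "poly r0 t - poly s0 t * poly q t \<in> P"
    using r0'(5) unfolding I2_def by blast
  have r0ne: "r0 \<noteq> 0" using r0'(2) dP(2) by auto
  \<comment> \<open>If \<open>r0\<close> had positive degree, pseudo-division by \<open>p0\<close>
    shows that its degree is below that of \<open>p0\<close>. Pseudo-division of \<open>p0\<close>
    by \<open>r0\<close> then factors \<open>p0\<close> modulo \<open>P\<close>, and the cofactor is
    again a relation of \<open>t\<close>; by minimality of \<open>p0\<close> its degree is too large
    for a factor.\<close>
  have deg0: "degree r0 = 0"
  proof (rule ccontr)
    assume pos: "degree r0 \<noteq> 0"
    have small2: "poly r t \<in> P" if "r \<in> I2" "r = 0 \<or> degree r < degree r0" for r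
    proof (rule ccontr)
      assume *: "poly r t \<notin> P"
      then have "r \<noteq> 0" using dP(2) by auto
      with trim2[OF that(1) *] min2 that(2) show False by fastforce
    qed
    have lt: "degree r0 < degree p0"
    proof (rule ccontr)
      assume ge: "\<not> degree r0 < degree p0"
      obtain e s r where *: "Polynomial.smult (lead_coeff p0 ^ e) r0 = p0 * s + r" "r = 0 \<or> degree r < degree p0"
        "\<forall>n. coeff s n \<in> A" "\<forall>n. coeff r n \<in> A"
        by (rule pseudo_divmod_coeffs[OF A r0'(1) p0'(1) p0ne])
      have ae: "a ^ e \<in> A" using is_subring_power[OF A p0'(4)] .
      from arg_cong[OF *(1), of "\<lambda>g. poly g t"] have eq: "a ^ e * poly r0 t = poly p0 t * poly s t + poly r t"
        by (simp add: a_def)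
      have psP: "poly p0 t * poly s t \<in> P" using dP(5)[OF p0'(2) polyB[OF *(3)]] .
      have "r \<in> I2" unfolding I2_def mem_Collect_eq
      proof (intro conjI exI)
        show "\<forall>n. coeff (Polynomial.smult (a ^ e) s0) n \<in> A" using s0(1) d(4) ae by simp
        have "a ^ e * (poly r0 t - poly s0 t * poly q t) - poly p0 t * poly s t \<in> P"
          by (intro diffP psP dP(4) AB ae s0(2))
        then show "poly r t - poly (Polynomial.smult (a ^ e) s0) t * poly q t \<in> P"
          using eq by (simp add: algebra_simps)
      qed (use * in auto)
      moreover have "degree r < degree r0 \<or> r = 0" using *(2) ge by auto
      ultimately have "poly r t \<in> P" using small2 by blast
      with psP have "a ^ e * poly r0 t \<in> P" unfolding eq by (intro dP(3))
      then have "a ^ e \<in> P" using prime[OF AB[OF ae] polyB[OF r0'(1)]] r0'(2) by blast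
      then show False using powP p0' by blast
    qed
    obtain e s r where *: "Polynomial.smult (lead_coeff r0 ^ e) p0 = r0 * s + r" "r = 0 \<or> degree r < degree r0"
      "\<forall>n. coeff s n \<in> A" "\<forall>n. coeff r n \<in> A"
      by (rule pseudo_divmod_coeffs[OF A p0'(1) r0'(1) r0ne])
    have be: "b ^ e \<in> A" using is_subring_power[OF A r0'(4)] .
    from arg_cong[OF *(1), of "\<lambda>g. poly g t"] have eq: "b ^ e * poly p0 t = poly r0 t * poly s t + poly r t"
      by (simp add: b_def)
    have bpP: "b ^ e * poly p0 t \<in> P" by (intro dP(4) AB be p0'(2))
    have "r \<in> I2" unfolding I2_def mem_Collect_eq
    proof (intro conjI exI)
      show "\<forall>n. coeff (- (s0 * s)) n \<in> A" using coeff_mult_mem[OF A s0(1) *(3)] d(5) by simp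
      have "b ^ e * poly p0 t - poly s t * (poly r0 t - poly s0 t * poly q t) \<in> P"
        by (intro diffP bpP dP(4) polyB *(3) s0(2))
      then show "poly r t - poly (- (s0 * s)) t * poly q t \<in> P"
        unfolding eq by (simp add: algebra_simps)
    qed (use * in auto)
    then have rP: "poly r t \<in> P" using small2 *(2) by blast
    have "poly r0 t * poly s t \<in> P" using diffP[OF bpP rP] eq by simp
    then have sP: "poly s t \<in> P" using prime[OF polyB[OF r0'(1)] polyB[OF *(3)]] r0'(2) by blast
    obtain s' where s': "\<forall>n. coeff s' n \<in> A" "\<forall>n. coeff (s - s') n \<in> P" "s' = 0 \<or> lead_coeff s' \<notin> P"
      "poly s' t \<in> P" using trim[OF *(3)] sP by blast
    have rc: "coeff r n \<in> P" for n using small[OF *(4) rP] *(2) lt by auto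
    have sc: "coeff (r0 * (s - s')) n \<in> P" for n
    proof -
      have "coeff r0 i * coeff (s - s') (n - i) \<in> P" for i
        using s'(2) r0'(1) AB by (intro dP(4)) auto
      then have "(\<Sum>i\<in>F. coeff r0 i * coeff (s - s') (n - i)) \<in> P" for F
        by (induction F rule: infinite_finite_induct) (auto simp: dP(2) intro!: dP(3))
      then show ?thesis by (simp add: coeff_mult)
    qed
    have id: "r0 * s' = Polynomial.smult (b ^ e) p0 - (r0 * (s - s') + r)"
      using *(1) by (simp add: b_def algebra_simps)
    show False
    proof (cases "s' = 0")
      case True
      have "coeff (Polynomial.smult (b ^ e) p0) (degree p0) = coeff (r0 * (s - s') + r) (degree p0)"
        using id True by simp
      also have "\<dots> \<in> P" unfolding coeff_add by (intro dP(3) sc rc)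
      finally have "b ^ e * a \<in> P" by (simp add: a_def)
      then have "b ^ e \<in> P" using prime[OF AB[OF be] AB[OF p0'(4)]] p0'(3) by blast
      then show False using powP r0' by blast
    next
      case False
      then have "s' \<in> S" using s' by (auto simp: S_def)
      then have ge: "degree p0 \<le> degree s'" by (rule min0)
      define N where "N = degree r0 + degree s'"
      have "coeff (r0 * s') N = b * lead_coeff s'"
        unfolding N_def b_def by (rule coeff_mult_degree_sum)
      moreover have "coeff (r0 * s') N \<in> P"
      proof -
        have "coeff p0 N = 0" using ge pos by (intro coeff_eq_0) (simp add: N_def)
        then have "coeff (r0 * s') N = 0 - coeff (r0 * (s - s') + r) N" unfolding id by simp
        also have "\<dots> \<in> P" unfolding coeff_add by (intro diffP dP(2,3) sc rc)
        finally show ?thesis .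
      qed
      ultimately have "b * lead_coeff s' \<in> P" by simp
      then show False using prime[OF AB[OF r0'(4)] AB, of "lead_coeff s'"] s' False r0'(3) by blast
    qed
  qed
  have r0b: "r0 = [:b:]" using deg0 by (metis b_def degree_eq_zeroE lead_coeff_pCons(2) lead_coeff_pCons(1))
  \<comment> \<open>The product of the two leading coefficients works: where \<open>a\<close> is
    nonzero, \<open>p0\<close> keeps its positive degree and has a root; where \<open>b\<close> is
    nonzero, the relation between \<open>b\<close>, \<open>s0\<close> and \<open>q\<close> at that
    root forces \<open>q\<close> to be nonzero.\<close>
  show ?thesis
  proof (rule that)
    show "a * b \<in> A" using d(4) p0'(4) r0'(4) by blast
    show "a * b \<notin> P" using prime[OF AB[OF p0'(4)] AB[OF r0'(4)]] p0'(3) r0'(3) by blast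
    fix x assume x: "\<forall>f\<in>A \<inter> P. f x = 0" and "(a * b) x \<noteq> 0"
    then have ab: "a x \<noteq> 0" "b x \<noteq> 0" by (auto simp: times_fun_def)
    have "coeff (map_poly (\<lambda>f. f x) p0) (degree p0) \<noteq> 0"
      using ab(1) by (simp add: coeff_map_poly a_def zero_fun_def)
    then have "degree (map_poly (\<lambda>f. f x) p0) > 0" using n1 le_degree by fastforce
    then obtain \<tau> where "poly (map_poly (\<lambda>f. f x) p0) \<tau> = 0" using alg_closed_imp_poly_has_root by blast
    then have \<tau>: "poly p0 (\<lambda>_. \<tau>) x = 0" by (simp add: poly_fun_apply)
    \<comment> \<open>Pseudo-division of the relation \<open>h\<close> by \<open>p0\<close> leaves a
      remainder with all coefficients in \<open>A \<inter> P\<close>, and these vanish at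
      \<open>x\<close>.\<close>
    have van: "poly h (\<lambda>_. \<tau>) x = 0" if h: "\<forall>n. coeff h n \<in> A" "poly h t \<in> P" for h
    proof -
      obtain e s r where *: "Polynomial.smult (lead_coeff p0 ^ e) h = p0 * s + r" "r = 0 \<or> degree r < degree p0"
        "\<forall>n. coeff s n \<in> A" "\<forall>n. coeff r n \<in> A"
        by (rule pseudo_divmod_coeffs[OF A h(1) p0'(1) p0ne])
      have ae: "a ^ e \<in> A" using is_subring_power[OF A p0'(4)] .
      from arg_cong[OF *(1), of "\<lambda>g. poly g t"] have "poly r t = a ^ e * poly h t - poly p0 t * poly s t"
        by (simp add: a_def)
      also have "\<dots> \<in> P"
        by (rule diffP[OF dP(4)[OF AB[OF ae] h(2)] dP(5)[OF p0'(2) polyB[OF *(3)]]])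
      finally have "\<forall>n. coeff r n \<in> A \<inter> P" using small[OF *(4) _ *(2)] *(4) by blast
      from poly_eval_ideal_coeffs[OF this x] have "poly r (\<lambda>_. \<tau>) x = 0" .
      moreover from arg_cong[OF *(1), of "\<lambda>g. poly g (\<lambda>_. \<tau>) x"]
      have "(a ^ e) x * poly h (\<lambda>_. \<tau>) x = poly p0 (\<lambda>_. \<tau>) x * poly s (\<lambda>_. \<tau>) x + poly r (\<lambda>_. \<tau>) x"
        by (simp add: a_def times_fun_def plus_fun_def)
      moreover have "(a ^ e) x = a x ^ e" by (induction e) (auto simp: times_fun_def one_fun_def)
      ultimately show ?thesis using \<tau> ab(1) by simp
    qed
    have "poly (r0 - s0 * q) (\<lambda>_. \<tau>) x = 0"
    proof (rule van)
      show "\<forall>n. coeff (r0 - s0 * q) n \<in> A" using coeff_mult_mem[OF A s0(1) q(1)] r0'(1) d(6) by simp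
      show "poly (r0 - s0 * q) t \<in> P" using s0(2) by simp
    qed
    then have "b x = poly s0 (\<lambda>_. \<tau>) x * poly q (\<lambda>_. \<tau>) x"
      by (simp add: r0b times_fun_def fun_diff_def)
    then have "poly q (\<lambda>_. \<tau>) x \<noteq> 0" using ab(2) by auto
    with van show "\<exists>\<tau>. poly q (\<lambda>_. \<tau>) x \<noteq> 0 \<and>
       (\<forall>h. (\<forall>n. coeff h n \<in> A) \<longrightarrow> poly h t \<in> P \<longrightarrow> poly h (\<lambda>_. \<tau>) x = 0)" by blast
  qed
qed

text \<open>Points are built one coordinate at a time. The induction hypothesis applies to the
  contraction of \<open>P\<close> to the other coordinates and to a suitable \<open>c\<close>
  outside \<open>P\<close>; every zero of the contraction at which \<open>c\<close> is nonzero
  extends to a zero of \<open>P\<close> at which \<open>q\<close> is nonzero.\<close>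

theorem prime_ideal_zero:
  fixes P :: "(('i \<Rightarrow> 'k::alg_closed_field) \<Rightarrow> 'k) set"
  assumes "finite I" "is_prime_ideal (polyfun I) P" "q \<in> polyfun I" "q \<notin> P"
  shows "\<exists>x. (\<forall>f\<in>P. f x = 0) \<and> q x \<noteq> 0"
  using assms
proof (induction I arbitrary: P q rule: finite_induct)
  case empty
  have zero: "f = (\<lambda>x. 0)" if "f \<in> P" for f
  proof -
    note PI = is_prime_idealD(1)[OF empty(1)]
    have "f \<in> polyfun {}" using is_idealD(1)[OF PI] that by blast
    then obtain c where c: "f = (\<lambda>x. c)" unfolding polyfun_empty by (rule rangeE)
    have "c = 0"
    proof (rule ccontr)
      assume "c \<noteq> 0"
      have "(\<lambda>x. 1 / c) * f \<in> P" by (rule is_idealD(4)[OF PI polyfun.const that])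
      moreover have "(\<lambda>x. 1 / c) * f = 1" using \<open>c \<noteq> 0\<close> by (simp add: c times_fun_def one_fun_def)
      ultimately show False using is_prime_idealD(2)[OF empty(1)] by simp
    qed
    then show ?thesis using c by simp
  qed
  have "q \<noteq> 0" using empty(3) is_idealD(2)[OF is_prime_idealD(1)[OF empty(1)]] by auto
  then obtain x where "q x \<noteq> 0" by (auto simp: zero_fun_def fun_eq_iff)
  with zero show ?case by auto
next
  case (insert i I)
  define A where "A = (polyfun I :: (('i \<Rightarrow> 'k) \<Rightarrow> 'k) set)"
  define t where "t = (\<lambda>x :: 'i \<Rightarrow> 'k. x i)"
  have A: "is_subring A" unfolding A_def by (rule is_subring_polyfun)
  have P: "is_prime_ideal (adjoin A t) P" using insert.prems(1) by (simp add: polyfun_insert A_def t_def)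
  note PI = is_prime_idealD(1)[OF P] and dP = is_idealD[OF is_prime_idealD(1)[OF P]]
  have AB: "a \<in> adjoin A t" if "a \<in> A" for a by (rule poly_const_mem_adjoin[OF A that])
  obtain p where p: "q = poly p t" "\<forall>n. coeff p n \<in> A"
    using insert.prems(2) unfolding polyfun_insert A_def[symmetric] t_def[symmetric] adjoin_def by blast
  have q: "poly p t \<notin> P" using insert.prems(3) p(1) by simp
  have "\<exists>c\<in>A. c \<notin> P \<and> (\<forall>x. (\<forall>f\<in>A \<inter> P. f x = 0) \<longrightarrow> c x \<noteq> 0 \<longrightarrow> (\<exists>\<tau>. poly p (\<lambda>_. \<tau>) x \<noteq> 0 \<and>
       (\<forall>h. (\<forall>n. coeff h n \<in> A) \<longrightarrow> poly h t \<in> P \<longrightarrow> poly h (\<lambda>_. \<tau>) x = 0)))"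
  proof (cases "\<exists>g. (\<forall>n. coeff g n \<in> A) \<and> poly g t \<in> P \<and> (\<exists>n. coeff g n \<notin> P)")
    case True
    then obtain g where g: "\<forall>n. coeff g n \<in> A" "poly g t \<in> P" "\<exists>n. coeff g n \<notin> P" by blast
    show ?thesis by (rule prime_ideal_poly_root[OF A P g p(2) q]) blast
  next
    \<comment> \<open>Here \<open>t\<close> is transcendental modulo \<open>P\<close>: the
      coefficients of every relation lie in \<open>P\<close>, so any \<open>\<tau>\<close> that is
      not a root of \<open>p\<close> at \<open>x\<close> works. A coefficient of \<open>p\<close>
      outside \<open>P\<close> serves as \<open>c\<close>.\<close>
    case False
    obtain n where n: "coeff p n \<notin> P" using poly_mem_ideal[OF A PI] q by blast
    have "\<exists>\<tau>. poly p (\<lambda>_. \<tau>) x \<noteq> 0 \<and>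
       (\<forall>h. (\<forall>n. coeff h n \<in> A) \<longrightarrow> poly h t \<in> P \<longrightarrow> poly h (\<lambda>_. \<tau>) x = 0)"
      if x: "\<forall>f\<in>A \<inter> P. f x = 0" "coeff p n x \<noteq> 0" for x
    proof -
      have "coeff (map_poly (\<lambda>f. f x) p) n \<noteq> 0" using x(2) by (simp add: coeff_map_poly zero_fun_def)
      then have "map_poly (\<lambda>f. f x) p \<noteq> 0" by auto
      from exists_nonroot[OF this infinite_UNIV_alg_closed] obtain \<tau>
        where "poly p (\<lambda>_. \<tau>) x \<noteq> 0" by (auto simp: poly_fun_apply)
      moreover have "poly h (\<lambda>_. \<tau>) x = 0" if "\<forall>n. coeff h n \<in> A" "poly h t \<in> P" for h
        using poly_eval_ideal_coeffs[OF _ x(1)] False that by blast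
      ultimately show ?thesis by blast
    qed
    then show ?thesis using n p(2) by blast
  qed
  then obtain c where c: "c \<in> A" "c \<notin> P"
    "\<And>x. (\<forall>f\<in>A \<inter> P. f x = 0) \<Longrightarrow> c x \<noteq> 0 \<Longrightarrow> (\<exists>\<tau>. poly p (\<lambda>_. \<tau>) x \<noteq> 0 \<and>
       (\<forall>h. (\<forall>n. coeff h n \<in> A) \<longrightarrow> poly h t \<in> P \<longrightarrow> poly h (\<lambda>_. \<tau>) x = 0))" by blast
  have "is_prime_ideal A (A \<inter> P)"
    unfolding is_prime_ideal_def is_ideal_def
  proof (intro conjI ballI impI)
    show "A \<inter> P \<subseteq> A" "0 \<in> A \<inter> P" "1 \<notin> A \<inter> P"
      using is_subringD(1)[OF A] dP(2) is_prime_idealD(2)[OF P] by auto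
  next
    fix a b assume "a \<in> A \<inter> P" "b \<in> A \<inter> P"
    then show "a + b \<in> A \<inter> P" using is_subringD(3)[OF A] dP(3) by blast
  next
    fix a b assume "a \<in> A" "b \<in> A \<inter> P"
    then show "a * b \<in> A \<inter> P" using is_subringD(4)[OF A] dP(4)[OF AB] by blast
  next
    fix a b assume "a \<in> A" "b \<in> A" "a * b \<in> A \<inter> P"
    then show "a \<in> A \<inter> P \<or> b \<in> A \<inter> P" using is_prime_idealD(3)[OF P AB AB, of a b] by blast
  qed
  from insert.IH[OF this[unfolded A_def] c(1)[unfolded A_def]] c(2)
  obtain x where x: "\<forall>f\<in>A \<inter> P. f x = 0" "c x \<noteq> 0" unfolding A_def by blast
  obtain \<tau> where \<tau>: "poly p (\<lambda>_. \<tau>) x \<noteq> 0"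
    "\<And>h. (\<forall>n. coeff h n \<in> A) \<Longrightarrow> poly h t \<in> P \<Longrightarrow> poly h (\<lambda>_. \<tau>) x = 0"
    using c(3)[OF x] by blast
  have eval: "poly h t (x(i := \<tau>)) = poly h (\<lambda>_. \<tau>) x" if "\<forall>n. coeff h n \<in> A" for h
  proof -
    have "coeff h n (x(i := \<tau>)) = coeff h n x" for n
      by (rule polyfun_eqI[of _ I]) (use that insert.hyps(2) in \<open>auto simp: A_def\<close>)
    then have "map_poly (\<lambda>f. f (x(i := \<tau>))) h = map_poly (\<lambda>f. f x) h"
      by (intro poly_eqI) (simp add: coeff_map_poly zero_fun_def)
    then show ?thesis by (simp add: poly_fun_apply t_def)
  qed
  show ?case
  proof (intro exI conjI ballI)
    show "q (x(i := \<tau>)) \<noteq> 0" using \<tau>(1) eval[OF p(2)] p(1) by simp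
    fix f assume f: "f \<in> P"
    then obtain h where h: "f = poly h t" "\<forall>n. coeff h n \<in> A" using dP(1) unfolding adjoin_def by blast
    then show "f (x(i := \<tau>)) = 0" using \<tau>(2)[OF h(2)] f eval[OF h(2)] by simp
  qed
qed

text \<open>An ideal that is maximal, by Zorn's lemma, among those containing \<open>J\<close> and
  no power of \<open>q\<close> is prime: adjoining either of two elements outside it produces a
  power of \<open>q\<close>, and multiplying these two powers shows that the product of the elements
  is outside as well.\<close>

lemma exists_prime_ideal_avoiding_powers:
  assumes A: "is_subring A" and J: "is_ideal A J" and q: "q \<in> A" "\<And>n. q ^ n \<notin> J"
  obtains P where "is_prime_ideal A P" "J \<subseteq> P" "q \<notin> P"
proof -
  note d = is_subringD[OF A]
  define \<K> where "\<K> = {K. is_ideal A K \<and> J \<subseteq> K \<and> (\<forall>n. q ^ n \<notin> K)}"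
  have "J \<in> \<K>" using J q unfolding \<K>_def by blast
  moreover have "\<Union>\<C> \<in> \<K>" if C: "\<C> \<noteq> {}" "subset.chain \<K> \<C>" for \<C>
  proof -
    have CK: "K \<in> \<K>" if "K \<in> \<C>" for K using C(2) that unfolding subset.chain_def by blast
    have ch: "K \<subseteq> L \<or> L \<subseteq> K" if "K \<in> \<C>" "L \<in> \<C>" for K L
      using C(2) that unfolding subset_chain_def by blast
    have "is_ideal A (\<Union>\<C>)"
      unfolding is_ideal_def
    proof (intro conjI ballI)
      show "\<Union>\<C> \<subseteq> A" using CK is_idealD(1) unfolding \<K>_def by blast
      show "0 \<in> \<Union>\<C>" using C(1) CK is_idealD(2) unfolding \<K>_def by blast
    next
      fix a b assume "a \<in> \<Union>\<C>" "b \<in> \<Union>\<C>"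
      then obtain K L where "K \<in> \<C>" "a \<in> K" "L \<in> \<C>" "b \<in> L" by blast
      then obtain M where M: "M \<in> \<C>" "a \<in> M" "b \<in> M" using ch[of K L] by blast
      then have "is_ideal A M" using CK unfolding \<K>_def by blast
      from is_idealD(3)[OF this M(2,3)] M(1) show "a + b \<in> \<Union>\<C>" by blast
    next
      fix a b assume "a \<in> A" "b \<in> \<Union>\<C>"
      then obtain M where M: "M \<in> \<C>" "b \<in> M" by blast
      then have "is_ideal A M" using CK unfolding \<K>_def by blast
      from is_idealD(4)[OF this \<open>a \<in> A\<close> M(2)] M(1) show "a * b \<in> \<Union>\<C>" by blast
    qed
    then show ?thesis using C(1) CK unfolding \<K>_def by blast
  qed
  ultimately obtain P where P: "P \<in> \<K>" and max: "\<And>K. K \<in> \<K> \<Longrightarrow> P \<subseteq> K \<Longrightarrow> K = P"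
    using subset_Zorn_nonempty[of \<K>] by blast
  have PI: "is_ideal A P" and PJ: "J \<subseteq> P" and Pq: "\<And>n. q ^ n \<notin> P" using P unfolding \<K>_def by auto
  note dP = is_idealD[OF PI]
  have ext: "\<exists>n s. s \<in> A \<and> q ^ n - s * a \<in> P" if a: "a \<in> A" "a \<notin> P" for a
  proof -
    define K where "K = {x\<in>A. \<exists>s\<in>A. x - s * a \<in> P}"
    have "is_ideal A K"
      unfolding is_ideal_def
    proof (intro conjI ballI)
      show "K \<subseteq> A" unfolding K_def by blast
      show "0 \<in> K" unfolding K_def using d(1) dP(2) by (auto intro!: bexI[of _ 0])
    next
      fix x y assume "x \<in> K" "y \<in> K"
      then obtain s s' where "x \<in> A" "y \<in> A" "s \<in> A" "x - s * a \<in> P" "s' \<in> A" "y - s' * a \<in> P"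
        unfolding K_def by blast
      then show "x + y \<in> K" unfolding K_def
        using dP(3)[of "x - s * a" "y - s' * a"] d(3)
        by (auto intro!: bexI[of _ "s + s'"] simp: algebra_simps)
    next
      fix x y assume "x \<in> A" "y \<in> K"
      then obtain s where "y \<in> A" "s \<in> A" "y - s * a \<in> P" unfolding K_def by blast
      then show "x * y \<in> K" unfolding K_def
        using dP(4)[OF \<open>x \<in> A\<close>, of "y - s * a"] d(4) \<open>x \<in> A\<close>
        by (auto intro!: bexI[of _ "x * s"] simp: algebra_simps)
    qed
    moreover have "P \<subseteq> K"
      unfolding K_def using dP(1) d(1) by (auto intro!: bexI[of _ 0])
    moreover have "a \<in> K" unfolding K_def using a d(2) dP(2) by (auto intro!: bexI[of _ 1])
    ultimately have "K \<notin> \<K>" using max[of K] a(2) by blast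
    then obtain n where "q ^ n \<in> K" using \<open>is_ideal A K\<close> \<open>P \<subseteq> K\<close> PJ unfolding \<K>_def by blast
    then show ?thesis unfolding K_def by blast
  qed
  have "is_prime_ideal A P"
    unfolding is_prime_ideal_def
  proof (intro conjI ballI impI PI)
    show "1 \<notin> P" using Pq[of 0] by simp
    fix a b assume ab: "a \<in> A" "b \<in> A" "a * b \<in> P"
    show "a \<in> P \<or> b \<in> P"
    proof (rule ccontr)
      assume "\<not> (a \<in> P \<or> b \<in> P)"
      then obtain n s m r where s: "s \<in> A" "q ^ n - s * a \<in> P" and r: "r \<in> A" "q ^ m - r * b \<in> P"
        using ext ab by meson
      have "q ^ m * (q ^ n - s * a) \<in> P" "(s * a) * (q ^ m - r * b) \<in> P" "(s * r) * (a * b) \<in> P"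
        using s r ab by (auto intro!: dP(4) is_subring_power[OF A] q d(4))
      from dP(3)[OF dP(3)[OF this(1,2)] this(3)] have "q ^ (m + n) \<in> P"
        by (simp add: algebra_simps power_add)
      with Pq show False by blast
    qed
  qed
  then show ?thesis using that PJ Pq[of 1] by simp
qed

text \<open>Otherwise some prime ideal contains \<open>J\<close> and misses \<open>q\<close>, and
  \<open>prime_ideal_zero\<close> gives a zero of it at which \<open>q\<close> does not
  vanish.\<close>

theorem nullstellensatz:
  fixes J :: "(('i \<Rightarrow> 'k::alg_closed_field) \<Rightarrow> 'k) set"
  assumes "finite I" "is_ideal (polyfun I) J" "q \<in> polyfun I" "\<And>x. \<forall>f\<in>J. f x = 0 \<Longrightarrow> q x = 0"
  shows "\<exists>n. q ^ n \<in> J"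
proof (rule ccontr)
  assume "\<nexists>n. q ^ n \<in> J"
  then obtain P where P: "is_prime_ideal (polyfun I) P" "J \<subseteq> P" "q \<notin> P"
    using exists_prime_ideal_avoiding_powers[OF is_subring_polyfun assms(2,3)] by blast
  from prime_ideal_zero[OF assms(1) P(1) assms(3) P(3)] obtain x where "\<forall>f\<in>P. f x = 0" "q x \<noteq> 0" by blast
  with assms(4)[of x] P(2) show False by blast
qed

section \<open>Powers of the maximal ideal of a point and their intersection\<close>

section \<open>Krull's intersection theorem\<close>

text \<open>For a subring \<open>A\<close> that contains \<open>Y\<close> this is membership of
  \<open>f\<close> in the \<open>n\<close>-th power of the ideal of \<open>A\<close> generated by
  \<open>Y\<close>; the zeroth power is \<open>A\<close> itself.\<close>

inductive ideal_power :: "'r::comm_ring_1 set \<Rightarrow> 'r set \<Rightarrow> nat \<Rightarrow> 'r \<Rightarrow> bool" for A Y where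
  zero: "ideal_power A Y n 0"
| base: "f \<in> A \<Longrightarrow> ideal_power A Y 0 f"
| add: "ideal_power A Y n f \<Longrightarrow> ideal_power A Y n g \<Longrightarrow> ideal_power A Y n (f + g)"
| mult: "y \<in> Y \<Longrightarrow> ideal_power A Y n f \<Longrightarrow> ideal_power A Y (Suc n) (y * f)"

lemma ideal_power_smult:
  assumes "is_subring A" "a \<in> A" "ideal_power A Y n f"
  shows "ideal_power A Y n (a * f)"
  using assms(3)
proof induction
  case (base f)
  then show ?case using is_subringD(4)[OF assms(1,2)] by (intro ideal_power.base)
next
  case (mult y n f)
  from ideal_power.mult[OF mult(1,3)] show ?case by (simp add: mult.left_commute)
qed (auto intro: ideal_power.intros simp: distrib_left)

lemma ideal_power_mem:
  assumes "is_subring A" "Y \<subseteq> A" "ideal_power A Y n f"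
  shows "f \<in> A"
  using assms(3) by induction (use assms is_subringD[OF assms(1)] in auto)

lemma ideal_power_mult:
  assumes "is_subring A" "Y \<subseteq> A" "ideal_power A Y m f" "ideal_power A Y n g"
  shows "ideal_power A Y (m + n) (f * g)"
  using assms(3)
proof induction
  case (base f)
  then show ?case using ideal_power_smult[OF assms(1)] assms(4) by simp
next
  case (mult y m f)
  from ideal_power.mult[OF mult(1,3)] show ?case by (simp add: mult.assoc)
qed (auto intro: ideal_power.intros simp: distrib_right)

lemma ideal_power_Suc_imp:
  assumes "is_subring A" "Y \<subseteq> A" "ideal_power A Y n f"
  shows "ideal_power A Y (n - 1) f"
  using assms(3)
proof induction
  case (mult y n f)
  then show ?case using ideal_power_smult[OF assms(1), of y] assms(2) by auto
qed (auto intro: ideal_power.intros)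

lemma ideal_power_diff:
  assumes "is_subring A" "ideal_power A Y n f" "ideal_power A Y n g"
  shows "ideal_power A Y n (f - g)"
proof -
  have "ideal_power A Y n (f + (- 1) * g)"
    using assms is_subringD(2,5)[OF assms(1)] by (intro ideal_power.add ideal_power_smult) auto
  then show ?thesis by simp
qed

lemma ideal_power_sum:
  "(\<And>i. i \<in> S \<Longrightarrow> ideal_power A Y n (f i)) \<Longrightarrow> ideal_power A Y n (sum f S)"
  by (induction S rule: infinite_finite_induct) (auto intro: ideal_power.intros)

lemma ideal_power_subset:
  assumes "ideal_power A Y (Suc n) g" "is_ideal A J" "\<And>y h. y \<in> Y \<Longrightarrow> ideal_power A Y n h \<Longrightarrow> y * h \<in> J"
  shows "g \<in> J"
proof -
  have "ideal_power A Y m g \<Longrightarrow> m = Suc n \<Longrightarrow> g \<in> J" for m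
    by (induction rule: ideal_power.induct) (use assms(3) is_idealD[OF assms(2)] in auto)
  then show ?thesis using assms(1) by blast
qed

text \<open>Pigeonhole: a product of more than \<open>sum e Y\<close> factors from \<open>Y\<close>
  contains some \<open>y\<close> more than \<open>e y\<close> times. In the induction one factor
  \<open>y\<close> is split off, which replaces \<open>J\<close> by its quotient ideal by
  \<open>y\<close> and lowers \<open>e y\<close> by one.\<close>

lemma ideal_power_mem_ideal:
  assumes A: "is_subring A" and Y: "finite Y" "Y \<subseteq> A"
    and "is_ideal A J" "\<And>y. y \<in> Y \<Longrightarrow> y ^ e y \<in> J" "ideal_power A Y (Suc (sum e Y)) g"
  shows "g \<in> J"
  using assms(4-6)
proof (induction "sum e Y" arbitrary: e J g rule: less_induct)
  case less
  note dJ = is_idealD[OF less.prems(1)]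
  show ?case
  proof (rule ideal_power_subset[OF less.prems(3,1)])
    fix y h assume y: "y \<in> Y" and h: "ideal_power A Y (sum e Y) h"
    show "y * h \<in> J"
    proof (cases "e y")
      case 0
      then have "1 \<in> J" using less.prems(2)[OF y] by simp
      have "y * h \<in> A" using is_subringD(4)[OF A] Y(2) y ideal_power_mem[OF A Y(2) h] by blast
      from dJ(4)[OF this \<open>1 \<in> J\<close>] show ?thesis by simp
    next
      case (Suc k)
      define e' where "e' = e(y := k)"
      have sum: "sum e Y = Suc (sum e' Y)"
        using sum.remove[OF Y(1) y, of e] sum.remove[OF Y(1) y, of e'] Suc
        by (simp add: e'_def)
      define K where "K = {f\<in>A. y * f \<in> J}"
      have "is_ideal A K"
        unfolding is_ideal_def K_def
        using is_subringD[OF A] dJ(2,3,4) by (auto simp: distrib_left mult.left_commute)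
      moreover have "z ^ e' z \<in> K" if "z \<in> Y" for z
      proof -
        have "z ^ e' z \<in> A" using that Y(2) is_subring_power[OF A] by blast
        moreover have "y * z ^ e' z \<in> J"
        proof (cases "z = y")
          case True
          then show ?thesis using less.prems(2)[OF y] Suc by (simp add: e'_def)
        next
          case False
          then show ?thesis using dJ(4)[OF _ less.prems(2)[OF that], of y] y Y(2) by (auto simp: e'_def)
        qed
        ultimately show ?thesis unfolding K_def by blast
      qed
      ultimately have "h \<in> K" using less.hyps[of e' K h] h sum by simp
      then show ?thesis unfolding K_def by blast
    qed
  qed
qed

text \<open>The maximal ideal of \<open>x0\<close> is generated by the differences
  \<open>x i - x0 i\<close>; for a product use
  \<open>f g - f0 g0 = g (f - f0) + f0 (g - g0)\<close>.\<close>

lemma vanishing_imp_ideal_power: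
  fixes x0 :: "'i \<Rightarrow> 'k::field"
  assumes "f \<in> polyfun I" "f x0 = 0"
  shows "ideal_power (polyfun I) ((\<lambda>i x. x i - x0 i) ` I) 1 f"
proof -
  note A = is_subring_polyfun[of I, where 'k='k]
  have "ideal_power (polyfun I) ((\<lambda>i x. x i - x0 i) ` I) 1 (f - (\<lambda>x. f x0))"
    using assms(1)
  proof induction
    case (const c)
    have "(\<lambda>x. c) - (\<lambda>x. c) = (0 :: ('i \<Rightarrow> 'k) \<Rightarrow> 'k)" by auto
    then show ?case by (simp only: ideal_power.zero)
  next
    case (coord i)
    have "ideal_power (polyfun I) ((\<lambda>i x. x i - x0 i) ` I) (Suc 0) ((\<lambda>x. x i - x0 i) * 1)"
      using coord is_subringD(2)[OF A] by (intro ideal_power.mult ideal_power.base) auto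
    moreover have "(\<lambda>x. x i - x0 i) * 1 = (\<lambda>x. x i) - (\<lambda>x. x0 i)" by (auto simp: fun_eq_iff)
    ultimately show ?case by (simp only: One_nat_def)
  next
    case (add f g)
    have eq: "(\<lambda>x. f x + g x) - (\<lambda>x. f x0 + g x0) = (f - (\<lambda>x. f x0)) + (g - (\<lambda>x. g x0))"
      by (auto simp: fun_eq_iff)
    show ?case unfolding eq by (rule ideal_power.add[OF add(3,4)])
  next
    case (mult f g)
    have eq: "(\<lambda>x. f x * g x) - (\<lambda>x. f x0 * g x0) = g * (f - (\<lambda>x. f x0)) + (\<lambda>x. f x0) * (g - (\<lambda>x. g x0))"
      by (auto simp: fun_eq_iff algebra_simps)
    show ?case
      unfolding eq by (intro ideal_power.add ideal_power_smult[OF A] mult polyfun.const)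
  qed
  moreover have "f - (\<lambda>x. f x0) = f" using assms(2) by (auto simp: fun_eq_iff)
  ultimately show ?thesis by simp
qed

text \<open>In the local ring at \<open>x0\<close> of the quotient by \<open>K\<close>, an element
  in all powers of the maximal ideal is zero; the multipliers \<open>s\<close> express this without
  localizing. The proof produces an ideal \<open>J\<close> that contains a power of the maximal
  ideal but meets the ideal generated by \<open>f\<close> and \<open>K\<close> only in multiples of
  \<open>f\<close> by functions vanishing at \<open>x0\<close>, modulo \<open>K\<close>. So some
  multiple \<open>s f\<close> equals such a multiple, and the two are subtracted.\<close>

theorem krull_intersection:
  fixes x0 :: "'i \<Rightarrow> 'k::field"
  defines "Y \<equiv> \<lambda>I :: 'i set. (\<lambda>i (x :: 'i \<Rightarrow> 'k). x i - x0 i) ` I"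
  assumes I: "finite I" and K: "is_ideal (polyfun I) K" and f: "f \<in> polyfun I"
    and N: "\<And>N. \<exists>s\<in>polyfun I. s x0 \<noteq> 0 \<and> (\<exists>g. ideal_power (polyfun I) (Y I) N g \<and> s * f - g \<in> K)"
  shows "\<exists>s\<in>polyfun I. s x0 \<noteq> 0 \<and> s * f \<in> K"
proof -
  define A where "A = (polyfun I :: (('i \<Rightarrow> 'k) \<Rightarrow> 'k) set)"
  note A = is_subring_polyfun[of I, where 'k='k, folded A_def]
  note d = is_subringD[OF A]
  note K = K[folded A_def] and f = f[folded A_def] and N = N[folded A_def]
  note dK = is_idealD[OF K]
  define M where "M = {g\<in>A. g x0 = 0}"
  have YM: "Y I \<subseteq> M"
    using polyfun.add[OF polyfun.coord polyfun.const, of _ I "- x0 _"] by (auto simp: Y_def M_def A_def)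
  then have YA: "Y I \<subseteq> A" unfolding M_def by blast
  define Mf where "Mf = {h\<in>A. \<exists>g\<in>M. h - g * f \<in> K}"
  define Cf where "Cf = {h\<in>A. \<exists>g\<in>A. h - g * f \<in> K}"
  have Mf: "is_ideal A Mf"
    unfolding is_ideal_def
  proof (intro conjI ballI)
    show "Mf \<subseteq> A" unfolding Mf_def by blast
    show "0 \<in> Mf" unfolding Mf_def M_def using d(1) dK(2) by (auto intro!: bexI[of _ 0])
  next
    fix x y assume "x \<in> Mf" "y \<in> Mf"
    then obtain s s' where "x \<in> A" "y \<in> A" "s \<in> M" "x - s * f \<in> K" "s' \<in> M" "y - s' * f \<in> K"
      unfolding Mf_def by blast
    then show "x + y \<in> Mf" unfolding Mf_def M_def
      using dK(3)[of "x - s * f" "y - s' * f"] d(3)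
      by (auto intro!: exI[of _ "s + s'"] simp: algebra_simps)
  next
    fix x y assume "x \<in> A" "y \<in> Mf"
    then obtain s where "y \<in> A" "s \<in> M" "y - s * f \<in> K" unfolding Mf_def by blast
    then show "x * y \<in> Mf" unfolding Mf_def M_def
      using dK(4)[OF \<open>x \<in> A\<close>, of "y - s * f"] d(4) \<open>x \<in> A\<close>
      by (auto intro!: exI[of _ "x * s"] simp: algebra_simps)
  qed
  have KMf: "K \<subseteq> Mf" unfolding Mf_def M_def using dK(1) d(1) by (auto intro!: bexI[of _ 0])
  \<comment> \<open>Ideals that cut \<open>Cf\<close> back to \<open>Mf\<close>. A maximal one
    exists as the ring is noetherian, and it contains a power of every function vanishing at
    \<open>x0\<close>.\<close>
  define \<J> where "\<J> = {J. is_ideal A J \<and> Mf \<subseteq> J \<and> J \<inter> Cf \<subseteq> Mf}"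
  have "noetherian A" unfolding A_def by (rule noetherian_polyfun[OF I])
  moreover have "\<J> \<noteq> {}" using Mf unfolding \<J>_def by blast
  moreover have "is_ideal A J" if "J \<in> \<J>" for J using that unfolding \<J>_def by blast
  ultimately have "\<exists>J\<in>\<J>. \<forall>J'\<in>\<J>. J \<subseteq> J' \<longrightarrow> J' = J"
    by (rule noetherian_max)
  then obtain J where J: "J \<in> \<J>" and max: "\<And>J'. J' \<in> \<J> \<Longrightarrow> J \<subseteq> J' \<Longrightarrow> J' = J"
    by blast
  have JI: "is_ideal A J" and MJ: "Mf \<subseteq> J" and JC: "J \<inter> Cf \<subseteq> Mf" using J unfolding \<J>_def by auto
  note dJ = is_idealD[OF JI]
  have pow: "\<exists>n. y ^ n \<in> J" if y: "y \<in> M" for y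
  proof -
    have yA: "y \<in> A" using y unfolding M_def by blast
    have ynA: "y ^ n \<in> A" for n by (rule is_subring_power[OF A yA])
    \<comment> \<open>The quotients of \<open>J\<close> by the powers of \<open>y\<close> become
      stationary at some \<open>n\<close>. Enlarging \<open>J\<close> by \<open>y ^ n\<close> then
      gives another member of \<open>\<J>\<close>, so by maximality \<open>y ^ n\<close> already
      lies in \<open>J\<close>.\<close>
    define Q where "Q n = {h\<in>A. y ^ n * h \<in> J}" for n
    have "is_ideal A (Q n)" for n
      unfolding is_ideal_def Q_def
      using d(1,3,4) dJ(2,3,4) by (auto simp: distrib_left mult.left_commute)
    moreover have "Q n \<subseteq> Q (Suc n)" for n
      unfolding Q_def using dJ(4)[OF yA] by (auto simp: mult.assoc)
    ultimately obtain n where n: "\<forall>m\<ge>n. Q m = Q n"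
      using \<open>noetherian A\<close>[unfolded noetherian_def, rule_format, of Q] by blast
    define J' where "J' = {h\<in>A. \<exists>a\<in>A. h - a * y ^ n \<in> J}"
    have "is_ideal A J'"
      unfolding is_ideal_def
    proof (intro conjI ballI)
      show "J' \<subseteq> A" unfolding J'_def by blast
      show "0 \<in> J'" unfolding J'_def using d(1) dJ(2) by (auto intro!: bexI[of _ 0])
    next
      fix x z assume "x \<in> J'" "z \<in> J'"
      then obtain s s' where "x \<in> A" "z \<in> A" "s \<in> A" "x - s * y ^ n \<in> J" "s' \<in> A" "z - s' * y ^ n \<in> J"
        unfolding J'_def by blast
      then show "x + z \<in> J'" unfolding J'_def
        using dJ(3)[of "x - s * y ^ n" "z - s' * y ^ n"] d(3)
        by (auto intro!: bexI[of _ "s + s'"] simp: algebra_simps)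
    next
      fix x z assume "x \<in> A" "z \<in> J'"
      then obtain s where "z \<in> A" "s \<in> A" "z - s * y ^ n \<in> J" unfolding J'_def by blast
      then show "x * z \<in> J'" unfolding J'_def
        using dJ(4)[OF \<open>x \<in> A\<close>, of "z - s * y ^ n"] d(4) \<open>x \<in> A\<close>
        by (auto intro!: bexI[of _ "x * s"] simp: algebra_simps)
    qed
    moreover have JJ': "J \<subseteq> J'" unfolding J'_def using dJ(1) d(1) by (auto intro!: bexI[of _ 0])
    moreover have "J' \<inter> Cf \<subseteq> Mf"
    proof
      fix z assume z: "z \<in> J' \<inter> Cf"
      then obtain a c where a: "z \<in> A" "a \<in> A" "z - a * y ^ n \<in> J" and c: "c \<in> A" "z - c * f \<in> K"
        unfolding J'_def Cf_def by blast
      \<comment> \<open>Since \<open>y\<close> vanishes at \<open>x0\<close>, multiplication by it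
        takes \<open>Cf\<close> into \<open>Mf\<close>, hence into \<open>J\<close>. This puts
        \<open>a\<close> into the quotient by the power \<open>n + 1\<close>, which equals that by
        the power \<open>n\<close>.\<close>
      have "y * z - y * c * f \<in> K" using dK(4)[OF yA c(2)] by (simp add: algebra_simps)
      moreover have "y * c \<in> M" using y c(1) d(4) unfolding M_def by auto
      ultimately have "y * z \<in> Mf" unfolding Mf_def using d(4)[OF yA a(1)] by blast
      then have "y * z \<in> J" using MJ by blast
      moreover have "y * (z - a * y ^ n) \<in> J" by (rule dJ(4)[OF yA a(3)])
      ultimately have "y * z - y * (z - a * y ^ n) \<in> J" by (rule is_ideal_diff[OF A JI])
      then have "a \<in> Q (Suc n)" unfolding Q_def using a(2) by (simp add: algebra_simps)
      then have "a \<in> Q n" using n by (metis le_Suc_eq order_refl)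
      then have "y ^ n * a \<in> J" unfolding Q_def by blast
      from dJ(3)[OF a(3) this] have "z \<in> J" by (simp add: mult.commute)
      then show "z \<in> Mf" using JC z by blast
    qed
    ultimately have "J' = J" using MJ by (intro max) (auto simp: \<J>_def)
    moreover have "y ^ n \<in> J'" unfolding J'_def using ynA d(2) dJ(2) by (auto intro!: bexI[of _ 1])
    ultimately show ?thesis by blast
  qed
  then obtain e where e: "\<And>y. y \<in> Y I \<Longrightarrow> y ^ e y \<in> J" using YM by (metis subsetD)
  obtain s g where s: "s \<in> A" "s x0 \<noteq> 0" "ideal_power A (Y I) (Suc (sum e (Y I))) g" "s * f - g \<in> K"
    using N[of "Suc (sum e (Y I))"] by blast
  have "finite (Y I)" unfolding Y_def using I by blast
  from ideal_power_mem_ideal[OF A this YA JI e s(3)] have "g \<in> J" .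
  moreover have "s * f - g \<in> J" using s(4) KMf MJ by blast
  ultimately have "s * f \<in> J" using dJ(3)[of g "s * f - g"] by simp
  moreover have "s * f \<in> Cf" unfolding Cf_def using s(1) f d(4) dK(2) by (auto intro!: bexI[of _ s])
  ultimately have "s * f \<in> Mf" using JC by blast
  \<comment> \<open>Modulo \<open>K\<close>, \<open>s f\<close> is \<open>g' f\<close> with
    \<open>g'\<close> zero at \<open>x0\<close>, so \<open>s - g'\<close> is the multiplier
    sought.\<close>
  then obtain g' where g': "g' \<in> M" "s * f - g' * f \<in> K" unfolding Mf_def by blast
  show ?thesis
  proof (intro bexI conjI)
    show "(s - g') x0 \<noteq> 0" using g'(1) s(2) by (simp add: M_def)
    show "(s - g') * f \<in> K" using g'(2) by (simp add: algebra_simps)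
    show "s - g' \<in> polyfun I" using d(6)[OF s(1)] g'(1) unfolding M_def A_def by blast
  qed
qed

section \<open>Gaussian elimination for linear systems whose coefficients are functions\<close>

section \<open>Linear systems with polynomial coefficients\<close>

text \<open>Elimination is applied to regular functions on a variety, on pairs of modules and to
  polynomial functions of auxiliary points, so only closure under the ring operations is
  assumed.\<close>

locale fun_algebra =
  fixes R :: "('x \<Rightarrow> 'k::field) set"
  assumes const: "(\<lambda>x. c) \<in> R"
    and add: "f \<in> R \<Longrightarrow> g \<in> R \<Longrightarrow> (\<lambda>x. f x + g x) \<in> R"
    and mult: "f \<in> R \<Longrightarrow> g \<in> R \<Longrightarrow> (\<lambda>x. f x * g x) \<in> R"
begin

lemma uminus: "f \<in> R \<Longrightarrow> (\<lambda>x. - f x) \<in> R"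
  using mult[OF const[of "- 1"]] by simp

lemma diff: "f \<in> R \<Longrightarrow> g \<in> R \<Longrightarrow> (\<lambda>x. f x - g x) \<in> R"
  using add[OF _ uminus] by simp

lemma sum: "(\<And>i. i \<in> S \<Longrightarrow> f i \<in> R) \<Longrightarrow> (\<lambda>x. \<Sum>i\<in>S. f i x) \<in> R"
  by (induction S rule: infinite_finite_induct) (auto intro: const add)

lemma prod: "(\<And>i. i \<in> S \<Longrightarrow> f i \<in> R) \<Longrightarrow> (\<lambda>x. \<Prod>i\<in>S. f i x) \<in> R"
  by (induction S rule: infinite_finite_induct) (auto intro: const mult)

lemma power: "f \<in> R \<Longrightarrow> (\<lambda>x. f x ^ n) \<in> R"
  by (induction n) (auto intro: const mult)

lemmas intros = const add mult uminus diff sum prod power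

lemma polyfun_compose:
  assumes "F \<in> polyfun I" "\<And>i. i \<in> I \<Longrightarrow> (\<lambda>x. \<zeta> x i) \<in> R"
  shows "(\<lambda>x. F (\<zeta> x)) \<in> R"
  using assms(1) by induction (auto intro: intros assms(2))

end

text \<open>\<open>\<Lambda>\<close> is a possibly infinite set of linear forms with coefficients
  depending on \<open>x\<close>. Solutions vanish off \<open>J\<close>, so that they are determined
  by their coordinates.\<close>

definition lin_kernel :: "('j \<Rightarrow> 'x \<Rightarrow> 'k::field) set \<Rightarrow> 'j set \<Rightarrow> 'x \<Rightarrow> ('j \<Rightarrow> 'k) set" where
  "lin_kernel \<Lambda> J x = {v. (\<forall>j. j \<notin> J \<longrightarrow> v j = 0) \<and> (\<forall>\<kappa>\<in>\<Lambda>. (\<Sum>j\<in>J. \<kappa> j x * v j) = 0)}"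

context fun_algebra
begin

text \<open>Gaussian elimination near \<open>x0\<close>: near \<open>x0\<close> the kernel at \<open>x\<close> is contained in the graph of a
  linear map of the coordinates in \<open>B\<close>, and it is equal to this graph at \<open>x0\<close>.\<close>

theorem lin_kernel_chart:
  fixes \<Lambda> :: "('j \<Rightarrow> 'x \<Rightarrow> 'k) set"
  assumes "finite J" "\<And>\<kappa> j. \<kappa> \<in> \<Lambda> \<Longrightarrow> j \<in> J \<Longrightarrow> \<kappa> j \<in> R"
  obtains B s c where "B \<subseteq> J" "s \<in> R" "s x0 \<noteq> 0" "\<forall>j\<in>J. \<forall>b\<in>B. c j b \<in> R"
    "\<forall>x v. s x \<noteq> 0 \<longrightarrow> v \<in> lin_kernel \<Lambda> J x \<longrightarrow> (\<forall>j\<in>J. s x * v j = (\<Sum>b\<in>B. c j b x * v b))"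
    "\<forall>w. \<exists>v\<in>lin_kernel \<Lambda> J x0. \<forall>b\<in>B. v b = w b"
proof -
  have "\<exists>B s c. B \<subseteq> J \<and> s \<in> R \<and> s x0 \<noteq> 0 \<and> (\<forall>j\<in>J. \<forall>b\<in>B. c j b \<in> R) \<and>
    (\<forall>x v. s x \<noteq> 0 \<longrightarrow> v \<in> lin_kernel \<Lambda> J x \<longrightarrow> (\<forall>j\<in>J. s x * v j = (\<Sum>b\<in>B. c j b x * v b))) \<and>
    (\<forall>w. \<exists>v\<in>lin_kernel \<Lambda> J x0. \<forall>b\<in>B. v b = w b)"
    using assms
  proof (induction "card J" arbitrary: J \<Lambda> rule: less_induct)
    case less
    show ?case
    proof (cases "\<exists>\<mu>\<in>\<Lambda>. \<exists>k\<in>J. \<mu> k x0 \<noteq> 0")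
      \<comment> \<open>All forms vanish at \<open>x0\<close>, so every coordinate is free there.
        They may still restrict the kernel at nearby points, and this is why the chart only contains
        the kernel away from \<open>x0\<close>.\<close>
      case False
      show ?thesis
      proof (rule exI[of _ J], rule exI[of _ "\<lambda>x. 1"], rule exI[of _ "\<lambda>j b x. if j = b then 1 else 0"],
          intro conjI allI ballI impI)
        fix x and v :: "'j \<Rightarrow> 'k" and j assume "j \<in> J"
        show "1 * v j = (\<Sum>b\<in>J. (if j = b then 1 else 0) * v b)"
        proof -
          have "(\<Sum>b\<in>J. (if j = b then 1 else 0) * v b) = (\<Sum>b\<in>J. if j = b then v b else 0)"
            by (intro sum.cong) auto
          also have "\<dots> = 1 * v j" using less.prems(1) \<open>j \<in> J\<close> by (subst sum.delta') auto
          finally show ?thesis by simp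
        qed
      next
        fix w :: "'j \<Rightarrow> 'k"
        show "\<exists>v\<in>lin_kernel \<Lambda> J x0. \<forall>b\<in>J. v b = w b"
          using False by (intro bexI[of _ "\<lambda>j. if j \<in> J then w j else 0"]) (auto simp: lin_kernel_def)
      next
        show "J \<subseteq> J" "(\<lambda>x. 1) \<in> R" "(1 :: 'k) \<noteq> 0" by (simp_all add: const)
        fix j b :: 'j show "(\<lambda>x. if j = b then 1 else 0) \<in> R" by (rule const)
      qed
    next
      case True
      then obtain \<mu> k where \<mu>: "\<mu> \<in> \<Lambda>" "k \<in> J" "\<mu> k x0 \<noteq> 0" by blast
      define J' where "J' = J - {k}"
      \<comment> \<open>The combination of \<open>\<kappa>\<close> with the pivot form
        \<open>\<mu>\<close> in which coordinate \<open>k\<close> cancels; cross-multiplication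
        keeps the coefficients in \<open>R\<close>.\<close>
      define el where "el \<kappa> = (\<lambda>j x. \<mu> k x * \<kappa> j x - \<kappa> k x * \<mu> j x)" for \<kappa>
      have J: "J = insert k J'" "k \<notin> J'" "finite J'" using \<mu>(2) less.prems(1) by (auto simp: J'_def)
      have RJ: "\<kappa> j \<in> R" if "\<kappa> \<in> \<Lambda>" "j \<in> insert k J'" for \<kappa> j using less.prems(2)[OF that(1)] that(2) J(1) by simp
      have "card J' < card J" using J by simp
      moreover have "\<kappa> j \<in> R" if "\<kappa> \<in> el ` \<Lambda>" "j \<in> J'" for \<kappa> j
        using that less.prems(2) \<mu>(1) J(1) by (auto simp: el_def intro!: diff mult)
      ultimately have "\<exists>B s c. B \<subseteq> J' \<and> s \<in> R \<and> s x0 \<noteq> 0 \<and> (\<forall>j\<in>J'. \<forall>b\<in>B. c j b \<in> R) \<and>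
        (\<forall>x v. s x \<noteq> 0 \<longrightarrow> v \<in> lin_kernel (el ` \<Lambda>) J' x \<longrightarrow> (\<forall>j\<in>J'. s x * v j = (\<Sum>b\<in>B. c j b x * v b))) \<and>
        (\<forall>w. \<exists>v\<in>lin_kernel (el ` \<Lambda>) J' x0. \<forall>b\<in>B. v b = w b)"
        by (intro less.hyps J(3))
      then obtain B s c where IH: "B \<subseteq> J'" "s \<in> R" "s x0 \<noteq> 0" "\<forall>j\<in>J'. \<forall>b\<in>B. c j b \<in> R"
        "\<forall>x v. s x \<noteq> 0 \<longrightarrow> v \<in> lin_kernel (el ` \<Lambda>) J' x \<longrightarrow> (\<forall>j\<in>J'. s x * v j = (\<Sum>b\<in>B. c j b x * v b))"
        "\<forall>w. \<exists>v\<in>lin_kernel (el ` \<Lambda>) J' x0. \<forall>b\<in>B. v b = w b"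
        by (elim exE conjE)
      note IH = IH(1-3) IH(4)[rule_format] IH(5)[rule_format] IH(6)[rule_format]
      have elim: "(\<Sum>j\<in>J'. el \<kappa> j x * v j) = \<mu> k x * (\<Sum>j\<in>J. \<kappa> j x * v j) - \<kappa> k x * (\<Sum>j\<in>J. \<mu> j x * v j)" for \<kappa> x v
        using J(2,3) unfolding J(1) el_def
        by (simp add: left_diff_distrib sum_subtractf sum_distrib_left ring_distribs mult_ac)
      have kB: "k \<notin> B" using IH(1) J(2) by blast
      \<comment> \<open>The pivot equation determines coordinate \<open>k\<close> once the others
        are inserted, at the cost of the factor \<open>\<mu> k\<close> in the common
        denominator.\<close>
      define c' where "c' j b = (if j = k then (\<lambda>x. - (\<Sum>i\<in>J'. \<mu> i x * c i b x)) else (\<lambda>x. \<mu> k x * c j b x))" for j b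
      show ?thesis
      proof (rule exI[of _ B], rule exI[of _ "\<lambda>x. \<mu> k x * s x"], rule exI[of _ c'], intro conjI allI ballI impI)
        show "B \<subseteq> J" using IH(1) J(1) by blast
        show "(\<lambda>x. \<mu> k x * s x) \<in> R" by (intro mult IH RJ \<mu>) simp
        show "\<mu> k x0 * s x0 \<noteq> 0" using IH(3) \<mu>(3) by simp
      next
        fix j b assume "j \<in> J" "b \<in> B"
        show "c' j b \<in> R"
        proof (cases "j = k")
          case True
          have "(\<lambda>x. - (\<Sum>i\<in>J'. \<mu> i x * c i b x)) \<in> R"
            by (intro uminus sum mult IH(4) RJ[OF \<mu>(1)] insertI2 \<open>b \<in> B\<close>)
          then show ?thesis using True by (simp add: c'_def)
        next
          case False
          with \<open>j \<in> J\<close> have "j \<in> J'" using J(1) by simp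
          have "(\<lambda>x. \<mu> k x * c j b x) \<in> R"
            by (intro mult IH(4) RJ[OF \<mu>(1)] insertI1 \<open>b \<in> B\<close> \<open>j \<in> J'\<close>)
          then show ?thesis using False by (simp add: c'_def)
        qed
      next
        fix x v j assume x: "\<mu> k x * s x \<noteq> 0" and v: "v \<in> lin_kernel \<Lambda> J x" and j: "j \<in> J"
        have sum0: "(\<Sum>j\<in>J. \<kappa> j x * v j) = 0" if "\<kappa> \<in> \<Lambda>" for \<kappa> using v that by (simp add: lin_kernel_def)
        have v0: "v(k := 0) \<in> lin_kernel (el ` \<Lambda>) J' x"
        proof -
          have "(\<Sum>j\<in>J'. el \<kappa> j x * (v(k := 0)) j) = 0" if "\<kappa> \<in> \<Lambda>" for \<kappa>
          proof -
            have "(\<Sum>j\<in>J'. el \<kappa> j x * (v(k := 0)) j) = (\<Sum>j\<in>J'. el \<kappa> j x * v j)"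
              using J(2) by (intro sum.cong) auto
            then show ?thesis using elim[of \<kappa> x v] sum0[OF that] sum0[OF \<mu>(1)] by simp
          qed
          moreover have "(v(k := 0)) j = 0" if "j \<notin> J'" for j
            using v that unfolding lin_kernel_def J'_def by auto
          ultimately show ?thesis unfolding lin_kernel_def by blast
        qed
        have sx: "s x \<noteq> 0" using x by simp
        have *: "s x * v i = (\<Sum>b\<in>B. c i b x * v b)" if "i \<in> J'" for i
        proof -
          have "(\<Sum>b\<in>B. c i b x * (v(k := 0)) b) = (\<Sum>b\<in>B. c i b x * v b)" using kB by (intro sum.cong) auto
          moreover have "(v(k := 0)) i = v i" using that J(2) by auto
          ultimately show ?thesis using IH(5)[OF sx v0 that] by simp
        qed
        show "\<mu> k x * s x * v j = (\<Sum>b\<in>B. c' j b x * v b)"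
        proof (cases "j = k")
          case True
          have "\<mu> k x * v k = - (\<Sum>i\<in>J'. \<mu> i x * v i)"
            using sum0[OF \<mu>(1)] J(2,3) unfolding J(1) by (simp add: eq_neg_iff_add_eq_0)
          then have "s x * (\<mu> k x * v k) = s x * (- (\<Sum>i\<in>J'. \<mu> i x * v i))" by simp
          then have "\<mu> k x * s x * v k = - (\<Sum>i\<in>J'. \<mu> i x * (s x * v i))"
            by (simp add: sum_distrib_left mult_ac)
          also have "\<dots> = - (\<Sum>i\<in>J'. \<mu> i x * (\<Sum>b\<in>B. c i b x * v b))" using * by simp
          also have "\<dots> = (\<Sum>b\<in>B. c' k b x * v b)"
            unfolding c'_def sum_distrib_left by (subst sum.swap) (simp add: sum_distrib_right sum_negf mult.assoc)
          finally show ?thesis using True by simp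
        next
          case False
          then have "j \<in> J'" using j J(1) by simp
          then show ?thesis using *[of j] False by (simp add: c'_def sum_distrib_left mult.assoc)
        qed
      next
        fix w :: "'j \<Rightarrow> 'k"
        obtain v where v: "v \<in> lin_kernel (el ` \<Lambda>) J' x0" "\<forall>b\<in>B. v b = w b" using IH(6) by blast
        define v' where "v' = v(k := - (\<Sum>j\<in>J'. \<mu> j x0 * v j) / \<mu> k x0)"
        have eq: "(\<Sum>j\<in>J'. h j * v' j) = (\<Sum>j\<in>J'. h j * v j)" for h
          using J(2) unfolding v'_def by (intro sum.cong) auto
        have \<mu>0: "(\<Sum>j\<in>J. \<mu> j x0 * v' j) = 0"
        proof -
          have "(\<Sum>j\<in>J. \<mu> j x0 * v' j) = \<mu> k x0 * v' k + (\<Sum>j\<in>J'. \<mu> j x0 * v' j)"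
            using J(2,3) unfolding J(1) by simp
          then show ?thesis unfolding eq using \<mu>(3) by (simp add: v'_def)
        qed
        have "(\<Sum>j\<in>J. \<kappa> j x0 * v' j) = 0" if "\<kappa> \<in> \<Lambda>" for \<kappa>
        proof -
          have "(\<Sum>j\<in>J'. el \<kappa> j x0 * v' j) = 0" unfolding eq using v(1) that by (simp add: lin_kernel_def)
          then show ?thesis using elim[of \<kappa> x0 v'] \<mu>0 \<mu>(3) by simp
        qed
        then have "v' \<in> lin_kernel \<Lambda> J x0"
          using v(1) J(1) by (auto simp: lin_kernel_def v'_def)
        moreover have "\<forall>b\<in>B. v' b = w b" using v(2) kB by (auto simp: v'_def)
        ultimately show "\<exists>v\<in>lin_kernel \<Lambda> J x0. \<forall>b\<in>B. v b = w b" by blast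
      qed
    qed
  qed
  then obtain B s c where *: "B \<subseteq> J" "s \<in> R" "s x0 \<noteq> 0" "\<forall>j\<in>J. \<forall>b\<in>B. c j b \<in> R"
    "\<forall>x v. s x \<noteq> 0 \<longrightarrow> v \<in> lin_kernel \<Lambda> J x \<longrightarrow> (\<forall>j\<in>J. s x * v j = (\<Sum>b\<in>B. c j b x * v b))"
    "\<forall>w. \<exists>v\<in>lin_kernel \<Lambda> J x0. \<forall>b\<in>B. v b = w b"
    by (elim exE conjE)
  show ?thesis
    by (rule that[OF *])
qed

end

section \<open>Irreducibility expressed by functions; decomposition into irreducible pieces\<close>

section \<open>Irreducible sets and regular functions\<close>

text \<open>Irreducibility for the topology whose closed sets are common zero sets of members of
  \<open>R\<close>: the functions vanishing on \<open>T\<close> form a prime ideal.\<close>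

definition irred :: "('x \<Rightarrow> 'k::field) set \<Rightarrow> 'x set \<Rightarrow> bool" where
  "irred R T \<longleftrightarrow> T \<noteq> {} \<and> (\<forall>f\<in>R. \<forall>g\<in>R. (\<exists>t\<in>T. f t \<noteq> 0) \<longrightarrow> (\<exists>t\<in>T. g t \<noteq> 0) \<longrightarrow>
     (\<exists>t\<in>T. f t \<noteq> 0 \<and> g t \<noteq> 0))"

lemma irred_nonempty: "irred R T \<Longrightarrow> T \<noteq> {}"
  unfolding irred_def by simp

lemma irredD:
  assumes "irred R T" "f \<in> R" "g \<in> R" "t \<in> T" "f t \<noteq> 0" "t' \<in> T" "g t' \<noteq> 0"
  shows "\<exists>t\<in>T. f t \<noteq> 0 \<and> g t \<noteq> 0"
  using assms unfolding irred_def by blast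

text \<open>Values off \<open>M\<close> are left free, so that any formula which is polynomial on
  \<open>M\<close> counts as regular.\<close>

definition regular_on :: "'x set \<Rightarrow> ('x \<Rightarrow> 'i \<Rightarrow> 'k::field) \<Rightarrow> 'i set \<Rightarrow> ('x \<Rightarrow> 'k) set" where
  "regular_on M crd I = {\<phi>. \<exists>F\<in>polyfun I. \<forall>m\<in>M. \<phi> m = F (crd m)}"

lemma fun_algebra_regular_on: "fun_algebra (regular_on M crd I)"
proof
  show "(\<lambda>x. c) \<in> regular_on M crd I" for c
    unfolding regular_on_def by (auto intro: polyfun.const)
  fix f g assume "f \<in> regular_on M crd I" "g \<in> regular_on M crd I"
  then obtain F G where "F \<in> polyfun I" "G \<in> polyfun I" "\<forall>m\<in>M. f m = F (crd m)" "\<forall>m\<in>M. g m = G (crd m)"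
    unfolding regular_on_def by blast
  then show "(\<lambda>x. f x + g x) \<in> regular_on M crd I" "(\<lambda>x. f x * g x) \<in> regular_on M crd I"
    unfolding regular_on_def mem_Collect_eq
    by (intro bexI[OF _ polyfun.add] bexI[OF _ polyfun.mult]; simp)+
qed

lemma regular_on_coord: "i \<in> I \<Longrightarrow> (\<lambda>m. crd m i) \<in> regular_on M crd I"
  unfolding regular_on_def using polyfun.coord[of i I] by auto

lemma regular_on_cong:
  assumes "\<phi> \<in> regular_on M crd I" "\<And>m. m \<in> M \<Longrightarrow> \<psi> m = \<phi> m"
  shows "\<psi> \<in> regular_on M crd I"
  using assms unfolding regular_on_def by auto

text \<open>The coordinate vectors \<open>\<zeta> x\<close> need not belong to points of
  \<open>M\<close> for every \<open>x\<close>; the resulting function has the value of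
  \<open>\<phi>\<close> at those parameters where they do.\<close>

lemma (in fun_algebra) regular_on_compose:
  assumes "\<phi> \<in> regular_on M crd I" "\<And>i. i \<in> I \<Longrightarrow> (\<lambda>x. \<zeta> x i) \<in> R"
  obtains f where "f \<in> R" "\<And>x m. m \<in> M \<Longrightarrow> (\<And>i. i \<in> I \<Longrightarrow> crd m i = \<zeta> x i) \<Longrightarrow> f x = \<phi> m"
proof -
  obtain F where F: "F \<in> polyfun I" "\<forall>m\<in>M. \<phi> m = F (crd m)"
    using assms(1) unfolding regular_on_def by blast
  have "(\<lambda>x. F (\<zeta> x)) \<in> R" by (rule polyfun_compose[OF F(1) assms(2)])
  then show ?thesis
  proof (rule that)
    fix x m assume "m \<in> M" and eq: "\<And>i. i \<in> I \<Longrightarrow> crd m i = \<zeta> x i"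
    have "F (\<zeta> x) = F (crd m)" by (rule polyfun_eqI[OF F(1)]) (simp add: eq)
    then show "F (\<zeta> x) = \<phi> m" using F(2) \<open>m \<in> M\<close> by simp
  qed
qed

lemma (in fun_algebra) irred_finite_product:
  assumes "irred R T" "finite H" "\<And>h. h \<in> H \<Longrightarrow> h \<in> R \<and> (\<exists>t\<in>T. h t \<noteq> 0)"
  shows "\<exists>t\<in>T. \<forall>h\<in>H. h t \<noteq> 0"
  using assms(2,3)
proof (induction H rule: finite_induct)
  case empty
  then show ?case using assms(1) unfolding irred_def by blast
next
  case (insert h H)
  then obtain t where t: "t \<in> T" "\<forall>h\<in>H. h t \<noteq> 0" by blast
  obtain t' where t': "t' \<in> T" "h t' \<noteq> 0" "h \<in> R" using insert.prems by blast
  have "(\<lambda>x. \<Prod>h\<in>H. h x) \<in> R" using insert.prems by (intro prod) auto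
  moreover have "(\<Prod>h\<in>H. h t) \<noteq> 0" using t(2) insert.hyps(1) by simp
  ultimately obtain u where "u \<in> T" "h u \<noteq> 0" "(\<Prod>h\<in>H. h u) \<noteq> 0"
    using irredD[OF assms(1) t'(3) _ t'(1,2) t(1)] by blast
  then show ?case using insert.hyps(1) by (auto intro!: bexI[of _ u])
qed

text \<open>Noetherian induction: a counterexample with maximal vanishing ideal is reducible, hence
  the union of its parts where \<open>f\<close> or where \<open>g\<close> vanishes, and these have
  strictly larger ideals.\<close>

lemma finite_irred_decomposition:
  assumes I: "finite I" and "Y \<subseteq> M"
  shows "\<exists>\<Z>. finite \<Z> \<and> \<Union>\<Z> = Y \<and> (\<forall>Z\<in>\<Z>. irred (regular_on M crd I) Z)"
proof (rule ccontr)
  define vi where "vi Y = {F\<in>polyfun I. \<forall>m\<in>Y. F (crd m) = 0}" for Y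
  have vi: "is_ideal (polyfun I) (vi Y)" for Y
    unfolding is_ideal_def vi_def using is_subringD[OF is_subring_polyfun[of I]]
    by (auto simp: times_fun_def plus_fun_def zero_fun_def)
  define good where "good Y \<longleftrightarrow> (\<exists>\<Z>. finite \<Z> \<and> \<Union>\<Z> = Y \<and> (\<forall>Z\<in>\<Z>. irred (regular_on M crd I) Z))" for Y
  assume "\<not> ?thesis"
  then have bad: "\<not> good Y" unfolding good_def by simp
  have "\<exists>J\<in>vi ` {Y. Y \<subseteq> M \<and> \<not> good Y}. \<forall>J'\<in>vi ` {Y. Y \<subseteq> M \<and> \<not> good Y}. J \<subseteq> J' \<longrightarrow> J' = J"
    by (rule noetherian_max[OF noetherian_polyfun[OF I]]) (use bad \<open>Y \<subseteq> M\<close> vi in auto)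
  then obtain J where J: "J \<in> vi ` {Y. Y \<subseteq> M \<and> \<not> good Y}"
    "\<forall>J'\<in>vi ` {Y. Y \<subseteq> M \<and> \<not> good Y}. J \<subseteq> J' \<longrightarrow> J' = J" by (rule bexE)
  from J(1) obtain Z where Z: "Z \<subseteq> M" "\<not> good Z" "J = vi Z" by (elim imageE CollectE conjE)
  have max: "vi Z' = vi Z" if "Z' \<subseteq> M" "\<not> good Z'" "vi Z \<subseteq> vi Z'" for Z'
    using J(2)[unfolded Z(3), rule_format, OF imageI, of Z'] that by simp
  have "Z \<noteq> {}" using Z(2) unfolding good_def by (metis Union_empty ball_empty finite.emptyI)
  moreover have "\<not> irred (regular_on M crd I) Z"
  proof
    assume "irred (regular_on M crd I) Z"
    then have "good Z" unfolding good_def by (intro exI[of _ "{Z}"]) simp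
    with Z(2) show False by blast
  qed
  ultimately obtain f g where fg: "f \<in> regular_on M crd I" "g \<in> regular_on M crd I"
    "\<exists>t\<in>Z. f t \<noteq> 0" "\<exists>t\<in>Z. g t \<noteq> 0" "\<forall>t\<in>Z. f t = 0 \<or> g t = 0"
    unfolding irred_def by blast
  have sub: "good {z\<in>Z. h z = 0}" if h: "h \<in> regular_on M crd I" "\<exists>t\<in>Z. h t \<noteq> 0" for h
  proof (rule ccontr)
    assume b: "\<not> good {z\<in>Z. h z = 0}"
    obtain F where F: "F \<in> polyfun I" "\<forall>m\<in>M. h m = F (crd m)" using h(1) unfolding regular_on_def by blast
    have "vi {z\<in>Z. h z = 0} = vi Z" by (rule max) (use Z(1) b in \<open>auto simp: vi_def\<close>)
    moreover have "F \<in> vi {z\<in>Z. h z = 0}" using F Z(1) unfolding vi_def by (auto simp: subset_iff)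
    moreover have "F \<notin> vi Z" using F h(2) Z(1) unfolding vi_def by (auto simp: subset_iff)
    ultimately show False by simp
  qed
  obtain Z1 Z2 where "finite Z1" "finite Z2" "\<Union>Z1 = {z\<in>Z. f z = 0}" "\<Union>Z2 = {z\<in>Z. g z = 0}"
    "\<forall>Y\<in>Z1. irred (regular_on M crd I) Y" "\<forall>Y\<in>Z2. irred (regular_on M crd I) Y"
    using sub[OF fg(1,3)] sub[OF fg(2,4)] unfolding good_def by (elim exE conjE) (rule that)
  then have "finite (Z1 \<union> Z2)" "\<Union>(Z1 \<union> Z2) = Z" "\<forall>Y\<in>Z1 \<union> Z2. irred (regular_on M crd I) Y"
    using fg(5) by auto
  then have "good Z" unfolding good_def by (intro exI[of _ "Z1 \<union> Z2"] conjI)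
  with Z(2) show False by blast
qed

section \<open>Conjugation, topology and components of the variety of module structures\<close>

section \<open>The variety of module structures\<close>

lemma mat_mult_entry:
  assumes "A \<in> carrier_mat n m" "B \<in> carrier_mat m p" "i < n" "j < p"
  shows "(A * B) $$ (i, j) = (\<Sum>l<m. A $$ (i, l) * B $$ (l, j))"
  using assms by (simp add: scalar_prod_def atLeast0LessThan)

text \<open>Group elements are carried together with their inverses, so that conjugation is a
  polynomial expression in both.\<close>

definition mat_inverse_pair :: "nat \<Rightarrow> 'k::field mat \<Rightarrow> 'k mat \<Rightarrow> bool" where
  "mat_inverse_pair d g h \<longleftrightarrow> g \<in> carrier_mat d d \<and> h \<in> carrier_mat d d \<and> g * h = 1\<^sub>m d \<and> h * g = 1\<^sub>m d"

lemma mat_inverse_pairD: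
  assumes "mat_inverse_pair d g h"
  shows "g \<in> carrier_mat d d" "h \<in> carrier_mat d d" "g * h = 1\<^sub>m d" "h * g = 1\<^sub>m d"
  using assms unfolding mat_inverse_pair_def by auto

lemma mat_inverse_pair_sym: "mat_inverse_pair d g h \<Longrightarrow> mat_inverse_pair d h g"
  unfolding mat_inverse_pair_def by blast

lemma mat_inverse_pair_one: "mat_inverse_pair d (1\<^sub>m d) (1\<^sub>m d)"
  unfolding mat_inverse_pair_def by simp

lemma mat_inverse_pair_cancel:
  assumes "mat_inverse_pair d g h" "x \<in> carrier_mat d n"
  shows "g * (h * x) = x" "h * (g * x) = x"
  using mat_inverse_pairD[OF assms(1)] assms(2)
  by (simp_all add: assoc_mult_mat[of _ d d _ d _ n, symmetric])

lemma mat_inverse_pair_mult: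
  assumes "mat_inverse_pair d g h" "mat_inverse_pair d g' h'"
  shows "mat_inverse_pair d (g * g') (h' * h)"
proof -
  note d = mat_inverse_pairD[OF assms(1)] mat_inverse_pairD[OF assms(2)]
  have "g * g' * (h' * h) = 1\<^sub>m d" "h' * h * (g * g') = 1\<^sub>m d"
    using d mat_inverse_pair_cancel[OF assms(1), of _ d] mat_inverse_pair_cancel[OF assms(2), of _ d]
    by (simp_all add: assoc_mult_mat[of _ d d _ d _ d])
  then show ?thesis using d unfolding mat_inverse_pair_def by simp
qed

definition conj_mod :: "'k::field mat \<Rightarrow> 'k mat \<Rightarrow> ('a \<Rightarrow> 'k mat) \<Rightarrow> ('a \<Rightarrow> 'k mat)" where
  "conj_mod g h m = (\<lambda>a. g * m a * h)"

lemma gl_orbit_alt: "gl_orbit d m = {conj_mod g h m | g h. mat_inverse_pair d g h}"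
  unfolding gl_orbit_def conj_mod_def mat_inverse_pair_def by blast

lemma mod_varD:
  assumes "m \<in> mod_var scale d"
  shows "m a \<in> carrier_mat d d" "m (a + b) = m a + m b" "m (scale c a) = c \<cdot>\<^sub>m m a"
    "m (a * b) = m a * m b" "m 1 = 1\<^sub>m d"
  using assms unfolding mod_var_def by auto

lemma mod_var_dim: "m \<in> mod_var scale d \<Longrightarrow> dim_row (m a) = d" "m \<in> mod_var scale d \<Longrightarrow> dim_col (m a) = d"
  using mod_varD(1)[of m scale d a] by auto

lemma mod_var_entry:
  assumes "m \<in> mod_var scale d" "i < d" "j < d"
  shows "m (a + b) $$ (i, j) = m a $$ (i, j) + m b $$ (i, j)"
    "m (scale c a) $$ (i, j) = c * m a $$ (i, j)"
    "m (a * b) $$ (i, j) = (\<Sum>l<d. m a $$ (i, l) * m b $$ (l, j))"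
    "m 1 $$ (i, j) = (if i = j then 1 else 0)"
  using assms mod_varD[OF assms(1)] mat_mult_entry[OF mod_varD(1)[OF assms(1)] mod_varD(1)[OF assms(1)]]
  by (simp_all add: mod_var_dim[OF assms(1)])

lemma conj_conj:
  assumes "mat_inverse_pair d g h" "mat_inverse_pair d g' h'" "m \<in> mod_var scale d"
  shows "conj_mod g' h' (conj_mod g h m) = conj_mod (g' * g) (h * h') m"
proof
  fix a
  note d = mat_inverse_pairD[OF assms(1)] mat_inverse_pairD[OF assms(2)] mod_varD(1)[OF assms(3), of a]
  have "g * m a \<in> carrier_mat d d" "g * m a * h \<in> carrier_mat d d" "g' * g \<in> carrier_mat d d"
    using d by auto
  then show "conj_mod g' h' (conj_mod g h m) a = conj_mod (g' * g) (h * h') m a"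
    unfolding conj_mod_def using d by (simp add: assoc_mult_mat[of _ d d _ d _ d])
qed

lemma conj_one: "m \<in> mod_var scale d \<Longrightarrow> conj_mod (1\<^sub>m d) (1\<^sub>m d) m = m"
  unfolding conj_mod_def
  by (rule ext) (use mod_varD(1)[of m scale d] in \<open>simp add: left_mult_one_mat[of _ d d] right_mult_one_mat[of _ d d]\<close>)

lemma conj_inverse:
  assumes "mat_inverse_pair d g h" "m \<in> mod_var scale d"
  shows "conj_mod h g (conj_mod g h m) = m"
  using conj_conj[OF assms(1) mat_inverse_pair_sym[OF assms(1)] assms(2)] conj_one[OF assms(2)]
    mat_inverse_pairD(4)[OF assms(1)] by simp

lemma conj_mod_var:
  assumes "mat_inverse_pair d g h" "m \<in> mod_var scale d"
  shows "conj_mod g h m \<in> mod_var scale d"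
proof -
  note d = mat_inverse_pairD[OF assms(1)] and m = mod_varD[OF assms(2)]
  have c: "g * m a \<in> carrier_mat d d" "m a * h \<in> carrier_mat d d" "m a * m b \<in> carrier_mat d d" for a b
    using d(1,2) m(1)[of a] m(1)[of b] by auto
  have "g * (m a * m b) * h = g * m a * h * (g * m b * h)" for a b
    using d m(1) c mat_inverse_pair_cancel[OF assms(1), of _ d]
    by (simp add: assoc_mult_mat[of _ d d _ d _ d])
  moreover have "g * (m a + m b) * h = g * m a * h + g * m b * h" for a b
    using d m(1) c by (simp add: mult_add_distrib_mat[of _ d d _ d] add_mult_distrib_mat[of _ d d _ _ d])
  moreover have "g * (c \<cdot>\<^sub>m m a) * h = c \<cdot>\<^sub>m (g * m a * h)" for a c
    using d m(1) c by (simp add: mult_smult_distrib[of _ d d _ d] mult_smult_assoc_mat[of _ d d _ d])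
  ultimately show ?thesis
    unfolding mod_var_def conj_mod_def using d m by auto
qed

locale fg_algebra = assoc_algebra scale
  for scale :: "'k::field \<Rightarrow> 'a::ring_1 \<Rightarrow> 'a" +
  fixes X :: "'a set"
  assumes finite_X: "finite X" and generated: "generated_subalgebra scale X = UNIV"
begin

abbreviation "MV d \<equiv> mod_var scale d"
abbreviation "Idx d \<equiv> X \<times> {..<d} \<times> {..<d::nat}"
abbreviation "RF d \<equiv> regular_on (MV d) (mod_coords X d) (Idx d)"

lemma finite_Idx: "finite (Idx d)"
  using finite_X by simp

lemma mod_coords_eq: "x \<in> X \<Longrightarrow> i < d \<Longrightarrow> j < d \<Longrightarrow> mod_coords X d m (x, i, j) = m x $$ (i, j)"
  unfolding mod_coords_def by simp

text \<open>This holds for every algebra element, not only for generators: writing \<open>a\<close>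
  in terms of the generators writes its matrix entries as polynomials in theirs.\<close>

lemma entry_regular:
  assumes "i < d" "j < d"
  shows "(\<lambda>m. m a $$ (i, j)) \<in> RF d"
proof -
  interpret fun_algebra "RF d" by (rule fun_algebra_regular_on)
  have "a \<in> generated_subalgebra scale X" using generated by simp
  then show ?thesis using assms
  proof (induction arbitrary: i j)
    case (gen x)
    then show ?case
      using regular_on_coord[of "(x, i, j)" "Idx d" "mod_coords X d" "MV d"]
      by (auto simp: mod_coords_eq)
  next
    case one
    show ?case
      by (rule regular_on_cong[OF const[of "if i = j then 1 else 0"]]) (rule mod_var_entry(4)[OF _ one])
  next
    case (add a b)
    show ?case
      by (rule regular_on_cong[OF fun_algebra.add[OF fun_algebra_axioms add.IH(1)[OF add.prems] add.IH(2)[OF add.prems]]])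
        (rule mod_var_entry(1)[OF _ add.prems])
  next
    case (mult a b)
    have "(\<lambda>m. \<Sum>l<d. m a $$ (i, l) * m b $$ (l, j)) \<in> RF d"
      using mult by (intro sum fun_algebra.mult[OF fun_algebra_axioms]) auto
    then show ?case
      by (rule regular_on_cong) (rule mod_var_entry(3)[OF _ mult.prems])
  next
    case (scale a c)
    have "(\<lambda>m. c * m a $$ (i, j)) \<in> RF d"
      using scale by (intro fun_algebra.mult[OF fun_algebra_axioms] const) auto
    then show ?case
      by (rule regular_on_cong) (rule mod_var_entry(2)[OF _ scale.prems])
  qed
qed

lemma topspace_mod_top: "topspace (mod_top scale X d) = MV d"
  and closedin_mod_top: "closedin (mod_top scale X d) Y \<longleftrightarrow>
    (\<exists>\<F>\<subseteq>RF d. Y = {m\<in>MV d. \<forall>\<phi>\<in>\<F>. \<phi> m = 0})"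
proof -
  have op: "openin (zariski I) U \<longleftrightarrow> (\<exists>F \<subseteq> polyfun I. U = (I \<rightarrow>\<^sub>E UNIV) - {x. \<forall>f\<in>F. f x = 0})"
    for I :: "('a \<times> nat \<times> nat) set" and U :: "(_ \<Rightarrow> 'k) set"
    unfolding zariski_def by (subst topology_inverse'[OF istopology_zariski]) (rule refl)
  have crd: "mod_coords X d m \<in> Idx d \<rightarrow>\<^sub>E UNIV" for m :: "'a \<Rightarrow> 'k mat"
    unfolding mod_coords_def by (rule restrict_PiE_iff[THEN iffD2]) auto
  have op2: "openin (mod_top scale X d) V \<longleftrightarrow>
    (\<exists>F \<subseteq> polyfun (Idx d). V = MV d - {m. \<forall>f\<in>F. f (mod_coords X d m) = 0})" for V
  proof
    assume "openin (mod_top scale X d) V"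
    then obtain F where F: "F \<subseteq> polyfun (Idx d)"
      "V = mod_coords X d -` ((Idx d \<rightarrow>\<^sub>E UNIV) - {x. \<forall>f\<in>F. f x = 0}) \<inter> MV d"
      unfolding mod_top_def openin_pullback_topology op by blast
    have "V = MV d - {m. \<forall>f\<in>F. f (mod_coords X d m) = 0}"
      unfolding F(2) using crd by auto
    with F(1) show "\<exists>F \<subseteq> polyfun (Idx d). V = MV d - {m. \<forall>f\<in>F. f (mod_coords X d m) = 0}" by blast
  next
    assume "\<exists>F \<subseteq> polyfun (Idx d). V = MV d - {m. \<forall>f\<in>F. f (mod_coords X d m) = 0}"
    then obtain F where F: "F \<subseteq> polyfun (Idx d)" "V = MV d - {m. \<forall>f\<in>F. f (mod_coords X d m) = 0}" by blast
    have "V = mod_coords X d -` ((Idx d \<rightarrow>\<^sub>E UNIV) - {x. \<forall>f\<in>F. f x = 0}) \<inter> MV d"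
      unfolding F(2) using crd by auto
    with F(1) show "openin (mod_top scale X d) V"
      unfolding mod_top_def openin_pullback_topology op by blast
  qed
  have "openin (mod_top scale X d) (MV d)"
    unfolding op2 by (rule exI[of _ "{\<lambda>x. 1}"]) (auto intro: polyfun.const)
  moreover have "V \<subseteq> MV d" if "openin (mod_top scale X d) V" for V using that unfolding op2 by blast
  ultimately show top: "topspace (mod_top scale X d) = MV d"
    unfolding topspace_def by blast
  show "closedin (mod_top scale X d) Y \<longleftrightarrow> (\<exists>\<F>\<subseteq>RF d. Y = {m\<in>MV d. \<forall>\<phi>\<in>\<F>. \<phi> m = 0})"
  proof
    assume "closedin (mod_top scale X d) Y"
    then obtain F where F: "Y \<subseteq> MV d" "F \<subseteq> polyfun (Idx d)"
      "MV d - Y = MV d - {m. \<forall>f\<in>F. f (mod_coords X d m) = 0}"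
      unfolding closedin_def top op2 by blast
    have "(\<lambda>f m. f (mod_coords X d m)) ` F \<subseteq> RF d" using F(2) unfolding regular_on_def by blast
    moreover have "Y = {m\<in>MV d. \<forall>\<phi>\<in>(\<lambda>f m. f (mod_coords X d m)) ` F. \<phi> m = 0}"
      using F(1,3) by auto
    ultimately show "\<exists>\<F>\<subseteq>RF d. Y = {m\<in>MV d. \<forall>\<phi>\<in>\<F>. \<phi> m = 0}" by blast
  next
    assume "\<exists>\<F>\<subseteq>RF d. Y = {m\<in>MV d. \<forall>\<phi>\<in>\<F>. \<phi> m = 0}"
    then obtain \<F> where F: "\<F> \<subseteq> RF d" "Y = {m\<in>MV d. \<forall>\<phi>\<in>\<F>. \<phi> m = 0}" by blast
    define F where "F = {f\<in>polyfun (Idx d). \<exists>\<phi>\<in>\<F>. \<forall>m\<in>MV d. \<phi> m = f (mod_coords X d m)}"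
    have "MV d - Y = MV d - {m. \<forall>f\<in>F. f (mod_coords X d m) = 0}"
    proof (intro equalityI subsetI)
      fix m assume m: "m \<in> MV d - Y"
      then obtain \<phi> where \<phi>: "\<phi> \<in> \<F>" "\<phi> m \<noteq> 0" unfolding F(2) by blast
      then obtain f where "f \<in> polyfun (Idx d)" "\<forall>m\<in>MV d. \<phi> m = f (mod_coords X d m)"
        using F(1) unfolding regular_on_def by blast
      then show "m \<in> MV d - {m. \<forall>f\<in>F. f (mod_coords X d m) = 0}" using \<phi> m unfolding F_def by auto
    next
      fix m assume "m \<in> MV d - {m. \<forall>f\<in>F. f (mod_coords X d m) = 0}"
      then obtain f \<phi> where "m \<in> MV d" "f (mod_coords X d m) \<noteq> 0" "\<phi> \<in> \<F>" "\<forall>m\<in>MV d. \<phi> m = f (mod_coords X d m)"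
        unfolding F_def by blast
      then show "m \<in> MV d - Y" unfolding F(2) by force
    qed
    then show "closedin (mod_top scale X d) Y" unfolding closedin_def top op2 using F(2)
      by (intro conjI exI[of _ F]) (auto simp: F_def)
  qed
qed

definition zariski_closure :: "nat \<Rightarrow> ('a \<Rightarrow> 'k mat) set \<Rightarrow> ('a \<Rightarrow> 'k mat) set" where
  "zariski_closure d S = {m\<in>MV d. \<forall>\<phi>\<in>RF d. (\<forall>s\<in>S. \<phi> s = 0) \<longrightarrow> \<phi> m = 0}"

lemma closedin_zariski_closure: "closedin (mod_top scale X d) (zariski_closure d S)"
  unfolding closedin_mod_top zariski_closure_def by (rule exI[of _ "{\<phi>\<in>RF d. \<forall>s\<in>S. \<phi> s = 0}"]) blast

lemma zariski_closure_subset: "S \<subseteq> MV d \<Longrightarrow> S \<subseteq> zariski_closure d S"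
  unfolding zariski_closure_def by blast

lemma zariski_closure_minimal:
  assumes "closedin (mod_top scale X d) Y" "S \<subseteq> Y"
  shows "zariski_closure d S \<subseteq> Y"
proof -
  obtain \<F> where F: "\<F>\<subseteq>RF d" "Y = {m\<in>MV d. \<forall>\<phi>\<in>\<F>. \<phi> m = 0}" using assms(1) unfolding closedin_mod_top by blast
  show ?thesis using assms(2) F unfolding zariski_closure_def by blast
qed

lemma closure_of_mod_top: "S \<subseteq> MV d \<Longrightarrow> Abstract_Topology.closure_of (mod_top scale X d) S = zariski_closure d S"
  by (intro subset_antisym closure_of_minimal zariski_closure_subset closedin_zariski_closure
      zariski_closure_minimal closedin_closure_of closure_of_subset) (auto simp: topspace_mod_top)

lemma irreducible_in_iff: "irreducible_in (mod_top scale X d) S \<longleftrightarrow> S \<subseteq> MV d \<and> irred (RF d) S"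
proof (cases "S \<subseteq> MV d \<and> S \<noteq> {}")
  case True
  have "irred (RF d) S" if irr: "irreducible_in (mod_top scale X d) S"
    unfolding irred_def
  proof (intro conjI ballI impI)
    show "S \<noteq> {}" using True by blast
    fix f g assume fg: "f \<in> RF d" "g \<in> RF d" "\<exists>t\<in>S. f t \<noteq> 0" "\<exists>t\<in>S. g t \<noteq> 0"
    have cl: "closedin (mod_top scale X d) {m\<in>MV d. h m = 0}" if "h \<in> RF d" for h
      unfolding closedin_mod_top by (rule exI[of _ "{h}"]) (use that in auto)
    have "\<not> S \<subseteq> {m\<in>MV d. f m = 0} \<union> {m\<in>MV d. g m = 0}"
      using irr cl[OF fg(1)] cl[OF fg(2)] fg(3,4) unfolding irreducible_in_def by blast
    then show "\<exists>t\<in>S. f t \<noteq> 0 \<and> g t \<noteq> 0" using True by blast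
  qed
  moreover have "irreducible_in (mod_top scale X d) S" if irr: "irred (RF d) S"
    unfolding irreducible_in_def topspace_mod_top
  proof (intro conjI allI impI)
    show "S \<subseteq> MV d" "S \<noteq> {}" using True by auto
    fix Y Z assume YZ: "closedin (mod_top scale X d) Y" "closedin (mod_top scale X d) Z" "S \<subseteq> Y \<union> Z"
    show "S \<subseteq> Y \<or> S \<subseteq> Z"
    proof (rule ccontr)
      assume "\<not> (S \<subseteq> Y \<or> S \<subseteq> Z)"
      then obtain s t where st: "s \<in> S" "s \<notin> Y" "t \<in> S" "t \<notin> Z" by blast
      obtain \<F> where F: "\<F>\<subseteq>RF d" "Y = {m\<in>MV d. \<forall>\<phi>\<in>\<F>. \<phi> m = 0}" using YZ(1) unfolding closedin_mod_top by blast
      obtain \<G> where G: "\<G>\<subseteq>RF d" "Z = {m\<in>MV d. \<forall>\<phi>\<in>\<G>. \<phi> m = 0}" using YZ(2) unfolding closedin_mod_top by blast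
      obtain \<phi> \<psi> where "\<phi> \<in> \<F>" "\<phi> s \<noteq> 0" "\<psi> \<in> \<G>" "\<psi> t \<noteq> 0" using F(2) G(2) st True by blast
      then obtain u where "u \<in> S" "\<phi> u \<noteq> 0" "\<psi> u \<noteq> 0" using irredD[OF irr _ _ st(1) _ st(3)] F(1) G(1) by blast
      then show False using YZ(3) F(2) G(2) \<open>\<phi> \<in> \<F>\<close> \<open>\<psi> \<in> \<G>\<close> by blast
    qed
  qed
  ultimately show ?thesis using True by blast
next
  case False
  then show ?thesis unfolding irreducible_in_def irred_def topspace_mod_top by blast
qed

lemma irred_zariski_closure:
  assumes "S \<subseteq> MV d" "irred (RF d) S"
  shows "irred (RF d) (zariski_closure d S)"
  unfolding irred_def
proof (intro conjI ballI impI)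
  show "zariski_closure d S \<noteq> {}" using assms zariski_closure_subset unfolding irred_def by blast
  fix f g assume fg: "f \<in> RF d" "g \<in> RF d" "\<exists>t\<in>zariski_closure d S. f t \<noteq> 0" "\<exists>t\<in>zariski_closure d S. g t \<noteq> 0"
  then have "\<exists>t\<in>S. f t \<noteq> 0" "\<exists>t\<in>S. g t \<noteq> 0" unfolding zariski_closure_def by blast+
  then obtain u where "u \<in> S" "f u \<noteq> 0" "g u \<noteq> 0" using irredD[OF assms(2) fg(1,2)] by blast
  then show "\<exists>t\<in>zariski_closure d S. f t \<noteq> 0 \<and> g t \<noteq> 0" using zariski_closure_subset[OF assms(1)] by blast
qed

abbreviation "component d C \<equiv> irreducible_component (mod_top scale X d) C"

lemma componentD:
  assumes "component d C"
  shows "C \<subseteq> MV d" "irred (RF d) C" "S \<subseteq> MV d \<Longrightarrow> irred (RF d) S \<Longrightarrow> C \<subseteq> S \<Longrightarrow> S = C"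
  using assms unfolding irreducible_component_def irreducible_in_iff by blast+

lemma component_closed:
  assumes "component d C"
  shows "zariski_closure d C = C" "closedin (mod_top scale X d) C"
proof -
  note C = componentD[OF assms]
  have "zariski_closure d C \<subseteq> MV d" unfolding zariski_closure_def by blast
  from C(3)[OF this irred_zariski_closure[OF C(1,2)] zariski_closure_subset[OF C(1)]]
  show "zariski_closure d C = C" .
  then show "closedin (mod_top scale X d) C" using closedin_zariski_closure[of d C] by simp
qed

text \<open>Every irreducible piece \<open>Z\<close> of the variety that is not inside
  \<open>C\<close> has a function that vanishes on \<open>Z\<close> but not on all of
  \<open>C\<close>: otherwise \<open>C\<close> would lie in the closure of \<open>Z\<close> and
  equal it by maximality. The product of these finitely many functions is \<open>h\<close>.\<close>

lemma component_open_part: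
  assumes "component d C"
  obtains h c where "h \<in> RF d" "c \<in> C" "h c \<noteq> 0" "\<And>m. m \<in> MV d \<Longrightarrow> h m \<noteq> 0 \<Longrightarrow> m \<in> C"
proof -
  interpret fun_algebra "RF d" by (rule fun_algebra_regular_on)
  note C = componentD[OF assms]
  from finite_irred_decomposition[OF finite_Idx[of d] order.refl[of "MV d"], of "mod_coords X d"]
  obtain \<Z> where Z: "finite \<Z>" "\<Union>\<Z> = MV d" "\<forall>Z\<in>\<Z>. irred (RF d) Z"
    by (elim exE conjE)
  note Z = Z(1,2) Z(3)[rule_format]
  have "\<exists>h\<in>RF d. (\<forall>z\<in>Z. h z = 0) \<and> (\<exists>c\<in>C. h c \<noteq> 0)" if "Z \<in> \<Z>" "\<not> Z \<subseteq> C" for Z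
  proof (rule ccontr)
    assume "\<not> ?thesis"
    then have "C \<subseteq> zariski_closure d Z" using C(1) unfolding zariski_closure_def by blast
    moreover have "Z \<subseteq> MV d" using that(1) Z(2) by blast
    moreover have "zariski_closure d Z \<subseteq> MV d" unfolding zariski_closure_def by blast
    ultimately have "zariski_closure d Z = C" using C(3) irred_zariski_closure Z(3)[OF that(1)] by blast
    then show False using zariski_closure_subset[OF \<open>Z \<subseteq> MV d\<close>] that(2) by blast
  qed
  then obtain h where h: "\<And>Z. Z \<in> \<Z> \<Longrightarrow> \<not> Z \<subseteq> C \<Longrightarrow> h Z \<in> RF d \<and> (\<forall>z\<in>Z. h Z z = 0) \<and> (\<exists>c\<in>C. h Z c \<noteq> 0)"
    by metis
  define H where "H = h ` {Z\<in>\<Z>. \<not> Z \<subseteq> C}"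
  have fin: "finite H" unfolding H_def using Z(1) by simp
  have H: "f \<in> RF d \<and> (\<exists>c\<in>C. f c \<noteq> 0)" if "f \<in> H" for f using that h unfolding H_def by blast
  obtain c where c: "c \<in> C" "\<forall>f\<in>H. f c \<noteq> 0" using irred_finite_product[OF C(2) fin H] by blast
  show ?thesis
  proof (rule that)
    show "(\<lambda>m. \<Prod>f\<in>H. f m) \<in> RF d" using H by (intro prod) blast
    show "c \<in> C" "(\<Prod>f\<in>H. f c) \<noteq> 0" using c fin by auto
    fix m assume m: "m \<in> MV d" "(\<Prod>f\<in>H. f m) \<noteq> 0"
    then obtain Z where z: "Z \<in> \<Z>" "m \<in> Z" using Z(2) by blast
    show "m \<in> C"
    proof (rule ccontr)
      assume "m \<notin> C"
      then have n: "\<not> Z \<subseteq> C" using z(2) by blast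
      then have "h Z \<in> H" unfolding H_def using z(1) by blast
      moreover have "h Z m = 0" using h[OF z(1) n] z(2) by blast
      ultimately show False using m(2) fin by auto
    qed
  qed
qed

end

lemma triple_mult_entry:
  assumes "g \<in> carrier_mat d d" "A \<in> carrier_mat d d" "h \<in> carrier_mat d d" "i < d" "j < d"
  shows "(g * A * h) $$ (i, j) = (\<Sum>k<d. \<Sum>l<d. g $$ (i, l) * A $$ (l, k) * h $$ (k, j))"
  using assms mat_mult_entry[of "g * A" d d h d i j] mat_mult_entry[OF assms(1,2,4)]
  by (simp add: sum_distrib_right)

definition gl_saturate :: "nat \<Rightarrow> ('a \<Rightarrow> 'k::field mat) set \<Rightarrow> ('a \<Rightarrow> 'k mat) set" where
  "gl_saturate d Y = {conj_mod g h y | g h y. mat_inverse_pair d g h \<and> y \<in> Y}"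

lemma finite_union_nonroot:
  assumes "finite Q" "\<And>q. q \<in> Q \<Longrightarrow> (q :: 'k::field poly) \<noteq> 0" "infinite (UNIV :: 'k set)"
  shows "\<exists>t. \<forall>q\<in>Q. poly q t \<noteq> 0"
proof -
  have "(\<Prod>q\<in>Q. q) \<noteq> 0" using assms(1,2) by simp
  from exists_nonroot[OF this assms(3)] show ?thesis using assms(1) by (auto simp: poly_prod)
qed

text \<open>Off the zeros of \<open>\<delta>\<close> these functions agree with elements of the
  polynomial ring localized at \<open>\<delta>\<close>; at the zeros their values are
  arbitrary.\<close>

lemma fun_algebra_rational:
  "fun_algebra {\<phi> :: 'k::field \<Rightarrow> 'k. \<exists>p e. \<forall>t. poly \<delta> t \<noteq> 0 \<longrightarrow> \<phi> t * poly \<delta> t ^ e = poly p t}"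
    (is "fun_algebra ?R")
proof
  show "(\<lambda>x. c) \<in> ?R" for c
    by (rule CollectI, rule exI[of _ "[:c:]"], rule exI[of _ 0]) simp
  fix f g assume "f \<in> ?R" "g \<in> ?R"
  then obtain p e q e' where *: "\<forall>t. poly \<delta> t \<noteq> 0 \<longrightarrow> f t * poly \<delta> t ^ e = poly p t"
    "\<forall>t. poly \<delta> t \<noteq> 0 \<longrightarrow> g t * poly \<delta> t ^ e' = poly q t" by blast
  have "(f t + g t) * poly \<delta> t ^ (e + e') = poly (p * \<delta> ^ e' + q * \<delta> ^ e) t" if "poly \<delta> t \<noteq> 0" for t
    using *[rule_format, OF that] by (simp add: power_add algebra_simps flip: *[rule_format, OF that])
  then show "(\<lambda>x. f x + g x) \<in> ?R" by blast
  have "(f t * g t) * poly \<delta> t ^ (e + e') = poly (p * q) t" if "poly \<delta> t \<noteq> 0" for t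
    by (simp add: power_add algebra_simps flip: *[rule_format, OF that])
  then show "(\<lambda>x. f x * g x) \<in> ?R" by blast
qed

lemma mat_inverse_pair_det:
  assumes "mat_inverse_pair d g h"
  shows "det g \<noteq> 0"
proof -
  note d = mat_inverse_pairD[OF assms]
  have "det g * det h = 1" using det_mult[OF d(1,2)] d(3) by simp
  then show ?thesis by auto
qed

text \<open>Two elements of \<open>GL\<^sub>d\<close> are joined by a line, on which the inverse is rational.\<close>

lemma gl_line:
  fixes g1 g2 :: "'k::field mat"
  assumes "mat_inverse_pair d g1 h1" "mat_inverse_pair d g2 h2"
  obtains \<delta> :: "'k poly" and G H :: "'k \<Rightarrow> 'k mat" where "poly \<delta> 0 \<noteq> 0" "poly \<delta> 1 \<noteq> 0" "G 0 = g1" "H 0 = h1" "G 1 = g2" "H 1 = h2"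
    "\<forall>t. poly \<delta> t \<noteq> 0 \<longrightarrow> mat_inverse_pair d (G t) (H t)"
    "\<forall>i<d. \<forall>j<d. \<exists>p e. \<forall>t. poly \<delta> t \<noteq> 0 \<longrightarrow> G t $$ (i, j) * poly \<delta> t ^ e = poly p t"
    "\<forall>i<d. \<forall>j<d. \<exists>p e. \<forall>t. poly \<delta> t \<noteq> 0 \<longrightarrow> H t $$ (i, j) * poly \<delta> t ^ e = poly p t"
proof -
  note d1 = mat_inverse_pairD[OF assms(1)] and d2 = mat_inverse_pairD[OF assms(2)]
  define P where "P = mat d d (\<lambda>ij. [:g1 $$ ij, g2 $$ ij - g1 $$ ij:])"
  define \<delta> where "\<delta> = det P"
  define ev where "ev t = map_mat (\<lambda>p. poly p t)" for t :: 'k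
  have P: "P \<in> carrier_mat d d" unfolding P_def by simp
  have hom: "comm_ring_hom (\<lambda>p. poly p t)" for t :: 'k
    by unfold_locales auto
  have Pt: "ev t P \<in> carrier_mat d d" "ev t (adj_mat P) \<in> carrier_mat d d" for t
    using P adj_mat(1)[OF P] unfolding ev_def by auto
  have det: "det (ev t P) = poly \<delta> t" for t
    unfolding ev_def \<delta>_def by (rule comm_ring_hom.hom_det[OF hom])
  have evm: "ev t (A * B) = ev t A * ev t B" if "A \<in> carrier_mat d d" "B \<in> carrier_mat d d" for t A B
    unfolding ev_def by (rule semiring_hom.mat_hom_mult[OF _ that]) (unfold_locales, auto)
  have sm: "ev t (\<delta> \<cdot>\<^sub>m 1\<^sub>m d) = poly \<delta> t \<cdot>\<^sub>m 1\<^sub>m d" for t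
    unfolding ev_def by (rule eq_matI) auto
  have adj: "ev t P * ev t (adj_mat P) = poly \<delta> t \<cdot>\<^sub>m 1\<^sub>m d" "ev t (adj_mat P) * ev t P = poly \<delta> t \<cdot>\<^sub>m 1\<^sub>m d" for t
    using adj_mat(2,3)[OF P] evm[OF P adj_mat(1)[OF P], of t] evm[OF adj_mat(1)[OF P] P, of t] sm
    unfolding \<delta>_def by auto
  define G where "G t = ev t P" for t
  \<comment> \<open>The inverse is the adjugate divided by the determinant, so
    \<open>\<delta>\<close> is the only denominator.\<close>
  define H where "H t = inverse (poly \<delta> t) \<cdot>\<^sub>m ev t (adj_mat P)" for t
  have inv: "mat_inverse_pair d (G t) (H t)" if "poly \<delta> t \<noteq> 0" for t
  proof -
    have "inverse (poly \<delta> t) \<cdot>\<^sub>m (poly \<delta> t \<cdot>\<^sub>m 1\<^sub>m d) = 1\<^sub>m d"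
      using that by (intro eq_matI) auto
    then show ?thesis
      unfolding mat_inverse_pair_def G_def H_def using Pt adj
      by (simp add: mult_smult_distrib[of _ d d _ d] mult_smult_assoc_mat[of _ d d _ d])
  qed
  have G01: "G 0 = g1" "G 1 = g2" unfolding G_def ev_def P_def using d1 d2 by auto
  have \<delta>01: "poly \<delta> 0 \<noteq> 0" "poly \<delta> 1 \<noteq> 0"
    using det[of 0] det[of 1] G01 mat_inverse_pair_det[OF assms(1)] mat_inverse_pair_det[OF assms(2)]
    unfolding G_def by auto
  have uniq: "h = h'" if "mat_inverse_pair d g h" "mat_inverse_pair d g h'" for g h h' :: "'k mat"
  proof -
    have "h * (g * h') = h * 1\<^sub>m d" using mat_inverse_pairD(3)[OF that(2)] by simp
    then show ?thesis
      using mat_inverse_pair_cancel(2)[OF that(1) mat_inverse_pairD(2)[OF that(2)]]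
        mat_inverse_pairD(2)[OF that(1)] by simp
  qed
  have H01: "H 0 = h1" "H 1 = h2"
    using uniq[OF _ assms(1)] uniq[OF _ assms(2)] inv[OF \<delta>01(1)] inv[OF \<delta>01(2)] G01 by auto
  show ?thesis
  proof (rule that[OF \<delta>01 G01(1) H01(1) G01(2) H01(2)], safe)
    show "mat_inverse_pair d (G t) (H t)" if "poly \<delta> t \<noteq> 0" for t by (rule inv[OF that])
    fix i j assume ij: "i < d" "j < d"
    show "\<exists>p e. \<forall>t. poly \<delta> t \<noteq> 0 \<longrightarrow> G t $$ (i, j) * poly \<delta> t ^ e = poly p t"
      by (rule exI[of _ "P $$ (i, j)"], rule exI[of _ 0]) (use ij P in \<open>auto simp: G_def ev_def\<close>)
    show "\<exists>p e. \<forall>t. poly \<delta> t \<noteq> 0 \<longrightarrow> H t $$ (i, j) * poly \<delta> t ^ e = poly p t"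
      by (rule exI[of _ "adj_mat P $$ (i, j)"], rule exI[of _ 1])
        (use ij adj_mat(1)[OF P] in \<open>auto simp: H_def ev_def\<close>)
  qed
qed

lemma regular_pullback:
  assumes "\<phi> \<in> regular_on M crd I" "\<And>x. x \<in> N \<Longrightarrow> \<psi> x \<in> M"
    "\<And>i. i \<in> I \<Longrightarrow> (\<lambda>x. crd (\<psi> x) i) \<in> regular_on N crd' I'"
  shows "(\<lambda>x. \<phi> (\<psi> x)) \<in> regular_on N crd' I'"
proof -
  obtain F where F: "F \<in> polyfun I" "\<forall>m\<in>M. \<phi> m = F (crd m)"
    using assms(1) unfolding regular_on_def by blast
  have "(\<lambda>x. F (crd (\<psi> x))) \<in> regular_on N crd' I'"
    by (rule fun_algebra.polyfun_compose[OF fun_algebra_regular_on F(1) assms(3)])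
  then show ?thesis by (rule regular_on_cong) (use F(2) assms(2) in auto)
qed

context fg_algebra
begin

lemma conj_regular:
  assumes "f \<in> RF d" "mat_inverse_pair d g h"
  shows "(\<lambda>m. f (conj_mod g h m)) \<in> RF d"
proof -
  interpret fun_algebra "RF d" by (rule fun_algebra_regular_on)
  note gh = mat_inverse_pairD[OF assms(2)]
  show ?thesis
  proof (rule regular_pullback[OF assms(1) conj_mod_var[OF assms(2)]])
    fix i assume "i \<in> Idx d"
    then obtain x a b where i: "i = (x, a, b)" "x \<in> X" "a < d" "b < d" by auto
    have "(\<lambda>m. \<Sum>k<d. \<Sum>l<d. g $$ (a, l) * m x $$ (l, k) * h $$ (k, b)) \<in> RF d"
      by (intro sum mult const entry_regular) auto
    then show "(\<lambda>m. mod_coords X d (conj_mod g h m) i) \<in> RF d"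
      by (rule regular_on_cong)
        (use i triple_mult_entry[OF gh(1) mod_varD(1) gh(2)] in \<open>simp add: mod_coords_eq conj_mod_def\<close>)
  qed
qed

text \<open>If \<open>f1\<close> is nonzero at a conjugate by \<open>g1\<close> and
  \<open>f2\<close> at a conjugate by \<open>g2\<close>, irreducibility of \<open>Y\<close> provides
  one \<open>y\<close> for both group elements, and the line joining \<open>g1\<close> to
  \<open>g2\<close> provides one group element for both functions, since finitely many nonzero
  polynomials have a common nonroot.\<close>

lemma irred_gl_saturate:
  assumes inf: "infinite (UNIV :: 'k set)" and Y: "Y \<subseteq> MV d" "irred (RF d) Y"
  shows "irred (RF d) (gl_saturate d Y)"
  unfolding irred_def
proof (intro conjI ballI impI)
  obtain y where "y \<in> Y" using irred_nonempty[OF Y(2)] by blast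
  then show "gl_saturate d Y \<noteq> {}" unfolding gl_saturate_def using mat_inverse_pair_one by blast
  fix f1 f2 assume f: "f1 \<in> RF d" "f2 \<in> RF d"
    and "\<exists>t\<in>gl_saturate d Y. f1 t \<noteq> 0" "\<exists>t\<in>gl_saturate d Y. f2 t \<noteq> 0"
  then obtain g1 h1 y1 g2 h2 y2 where 1: "mat_inverse_pair d g1 h1" "y1 \<in> Y" "f1 (conj_mod g1 h1 y1) \<noteq> 0"
    and 2: "mat_inverse_pair d g2 h2" "y2 \<in> Y" "f2 (conj_mod g2 h2 y2) \<noteq> 0"
    unfolding gl_saturate_def by blast
  obtain y where y: "y \<in> Y" "f1 (conj_mod g1 h1 y) \<noteq> 0" "f2 (conj_mod g2 h2 y) \<noteq> 0"
    using irredD[OF Y(2) conj_regular[OF f(1) 1(1)] conj_regular[OF f(2) 2(1)], of y1 y2] 1(2,3) 2(2,3) by blast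
  obtain \<delta> :: "'k poly" and G H where GH: "poly \<delta> 0 \<noteq> 0" "poly \<delta> 1 \<noteq> 0" "G 0 = g1" "H 0 = h1" "G 1 = g2" "H 1 = h2"
    "\<forall>t. poly \<delta> t \<noteq> 0 \<longrightarrow> mat_inverse_pair d (G t) (H t)"
    "\<forall>i<d. \<forall>j<d. \<exists>p e. \<forall>t. poly \<delta> t \<noteq> 0 \<longrightarrow> G t $$ (i, j) * poly \<delta> t ^ e = poly p t"
    "\<forall>i<d. \<forall>j<d. \<exists>p e. \<forall>t. poly \<delta> t \<noteq> 0 \<longrightarrow> H t $$ (i, j) * poly \<delta> t ^ e = poly p t"
    by (rule gl_line[OF 1(1) 2(1)])
  note GH = GH(1-6) GH(7)[rule_format] GH(8)[rule_format] GH(9)[rule_format]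
  define R where "R = {\<phi> :: 'k \<Rightarrow> 'k. \<exists>p e. \<forall>t. poly \<delta> t \<noteq> 0 \<longrightarrow> \<phi> t * poly \<delta> t ^ e = poly p t}"
  interpret fun_algebra R unfolding R_def by (rule fun_algebra_rational)
  have yM: "y \<in> MV d" using y(1) Y(1) by blast
  define \<zeta> :: "'k \<Rightarrow> 'a \<times> nat \<times> nat \<Rightarrow> 'k"
    where "\<zeta> t = (\<lambda>(x, i, j). \<Sum>k<d. \<Sum>l<d. G t $$ (i, l) * y x $$ (l, k) * H t $$ (k, j))" for t
  have \<zeta>R: "(\<lambda>t. \<zeta> t i) \<in> R" if i: "i \<in> Idx d" for i
  proof -
    obtain x a b where i: "i = (x, a, b)" "x \<in> X" "a < d" "b < d" using i by auto
    have "(\<lambda>t. G t $$ (k, l)) \<in> R" "(\<lambda>t. H t $$ (k, l)) \<in> R" if "k < d" "l < d" for k l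
      unfolding R_def mem_Collect_eq using GH(8,9)[OF that] by blast+
    then show ?thesis unfolding \<zeta>_def i(1) using i(3,4) by (auto intro!: sum mult const)
  qed
  note comp = regular_on_compose[of _ "MV d" "mod_coords X d" "Idx d" \<zeta>, OF _ \<zeta>R]
  have val: "mod_coords X d (conj_mod (G t) (H t) y) i = \<zeta> t i" if t: "poly \<delta> t \<noteq> 0" "i \<in> Idx d" for t i
  proof -
    note gh = mat_inverse_pairD[OF GH(7)[OF t(1)]]
    obtain x a b where "i = (x, a, b)" "x \<in> X" "a < d" "b < d" using t(2) by auto
    then show ?thesis
      using triple_mult_entry[OF gh(1) mod_varD(1)[OF yM] gh(2)]
      by (simp add: mod_coords_eq conj_mod_def \<zeta>_def)
  qed
  have rat: "\<exists>p e. \<forall>t. poly \<delta> t \<noteq> 0 \<longrightarrow> f (conj_mod (G t) (H t) y) * poly \<delta> t ^ e = poly p t" if f: "f \<in> RF d" for f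
  proof -
    obtain f' where f': "f' \<in> R"
      "\<And>x m. m \<in> MV d \<Longrightarrow> (\<And>i. i \<in> Idx d \<Longrightarrow> mod_coords X d m i = \<zeta> x i) \<Longrightarrow> f' x = f m"
      using comp[OF f] by metis
    have "f' t = f (conj_mod (G t) (H t) y)" if "poly \<delta> t \<noteq> 0" for t
      by (rule f'(2)[OF conj_mod_var[OF GH(7)[OF that] yM]]) (rule val[OF that])
    then show ?thesis using f'(1) unfolding R_def by simp
  qed
  obtain p e where p: "\<And>t. poly \<delta> t \<noteq> 0 \<Longrightarrow> f1 (conj_mod (G t) (H t) y) * poly \<delta> t ^ e = poly p t"
    using rat[OF f(1)] by blast
  obtain q e' where q: "\<And>t. poly \<delta> t \<noteq> 0 \<Longrightarrow> f2 (conj_mod (G t) (H t) y) * poly \<delta> t ^ e' = poly q t"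
    using rat[OF f(2)] by blast
  have "poly p 0 \<noteq> 0" using p[OF GH(1)] GH(1,3,4) y(2) by (metis mult_eq_0_iff power_not_zero)
  moreover have "poly q 1 \<noteq> 0" using q[OF GH(2)] GH(2,5,6) y(3) by (metis mult_eq_0_iff power_not_zero)
  ultimately have "\<exists>t. \<forall>r\<in>{\<delta>, p, q}. poly r t \<noteq> 0"
    using GH(1) by (intro finite_union_nonroot inf) auto
  then obtain t where t: "poly \<delta> t \<noteq> 0" "poly p t \<noteq> 0" "poly q t \<noteq> 0" by auto
  have "f1 (conj_mod (G t) (H t) y) \<noteq> 0" "f2 (conj_mod (G t) (H t) y) \<noteq> 0"
    using p[OF t(1)] q[OF t(1)] t(2,3) by auto
  moreover have "conj_mod (G t) (H t) y \<in> gl_saturate d Y"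
    unfolding gl_saturate_def using GH(7)[OF t(1)] y(1) by blast
  ultimately show "\<exists>t\<in>gl_saturate d Y. f1 t \<noteq> 0 \<and> f2 t \<noteq> 0" by blast
qed

lemma gl_saturate_subset:
  assumes "Y \<subseteq> MV d"
  shows "gl_saturate d Y \<subseteq> MV d" "Y \<subseteq> gl_saturate d Y"
proof -
  show "gl_saturate d Y \<subseteq> MV d"
    unfolding gl_saturate_def using conj_mod_var[of d _ _ _ scale] assms by blast
  show "Y \<subseteq> gl_saturate d Y"
  proof
    fix y assume y: "y \<in> Y"
    then have "y = conj_mod (1\<^sub>m d) (1\<^sub>m d) y" using conj_one[of y scale d] assms by auto
    then show "y \<in> gl_saturate d Y"
      unfolding gl_saturate_def using y mat_inverse_pair_one[of d] by blast
  qed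
qed

text \<open>The saturation of a component is irreducible and contains it, hence equals it by
  maximality.\<close>

lemma component_conj:
  assumes "infinite (UNIV :: 'k set)" "component d C" "m \<in> C" "mat_inverse_pair d g h"
  shows "conj_mod g h m \<in> C"
proof -
  note C = componentD[OF assms(2)]
  have "gl_saturate d C = C"
    using C(3)[OF gl_saturate_subset(1)[OF C(1)] irred_gl_saturate[OF assms(1) C(1,2)] gl_saturate_subset(2)[OF C(1)]] .
  then show ?thesis using assms(3,4) unfolding gl_saturate_def by blast
qed

definition pair_coords :: "nat \<Rightarrow> nat \<Rightarrow> ('a \<Rightarrow> 'k mat) \<times> ('a \<Rightarrow> 'k mat) \<Rightarrow>
    ('a \<times> nat \<times> nat) + ('a \<times> nat \<times> nat) \<Rightarrow> 'k" where
  "pair_coords d1 d2 p = case_sum (mod_coords X d1 (fst p)) (mod_coords X d2 (snd p))"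

abbreviation "RP d1 d2 \<equiv> regular_on (MV d1 \<times> MV d2) (pair_coords d1 d2) (Idx d1 <+> Idx d2)"

lemma pair_regular:
  shows "f \<in> RF d1 \<Longrightarrow> (\<lambda>p. f (fst p)) \<in> RP d1 d2"
    and "g \<in> RF d2 \<Longrightarrow> (\<lambda>p. g (snd p)) \<in> RP d1 d2"
proof -
  note crd = regular_on_coord[of _ "Idx d1 <+> Idx d2" "pair_coords d1 d2" "MV d1 \<times> MV d2"]
  show "(\<lambda>p. f (fst p)) \<in> RP d1 d2" if "f \<in> RF d1"
    by (rule regular_pullback[OF that]) (use crd[OF InlI] in \<open>auto simp: pair_coords_def\<close>)
  show "(\<lambda>p. g (snd p)) \<in> RP d1 d2" if "g \<in> RF d2"
    by (rule regular_pullback[OF that]) (use crd[OF InrI] in \<open>auto simp: pair_coords_def\<close>)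
qed

lemma pair_slices:
  assumes "f \<in> RP d1 d2"
  shows "m2 \<in> MV d2 \<Longrightarrow> (\<lambda>m1. f (m1, m2)) \<in> RF d1" "m1 \<in> MV d1 \<Longrightarrow> (\<lambda>m2. f (m1, m2)) \<in> RF d2"
proof -
  show "(\<lambda>m1. f (m1, m2)) \<in> RF d1" if "m2 \<in> MV d2"
  proof (rule regular_pullback[OF assms])
    show "(\<lambda>m1. pair_coords d1 d2 (m1, m2) i) \<in> RF d1" if i: "i \<in> Idx d1 <+> Idx d2" for i
      using i fun_algebra.const[OF fun_algebra_regular_on]
      by (cases i) (auto simp: pair_coords_def intro!: regular_on_coord)
  qed (use that in auto)
  show "(\<lambda>m2. f (m1, m2)) \<in> RF d2" if "m1 \<in> MV d1"
  proof (rule regular_pullback[OF assms])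
    show "(\<lambda>m2. pair_coords d1 d2 (m1, m2) i) \<in> RF d2" if i: "i \<in> Idx d1 <+> Idx d2" for i
      using i fun_algebra.const[OF fun_algebra_regular_on]
      by (cases i) (auto simp: pair_coords_def intro!: regular_on_coord)
  qed (use that in auto)
qed

text \<open>Irreducibility of the second factor gives a common second entry for two different
  slices; with this entry fixed, irreducibility of the first factor gives a common first
  entry.\<close>

lemma irred_product:
  assumes C1: "C1 \<subseteq> MV d1" "irred (RF d1) C1" and C2: "C2 \<subseteq> MV d2" "irred (RF d2) C2"
  shows "irred (RP d1 d2) (C1 \<times> C2)"
  unfolding irred_def
proof (intro conjI ballI impI)
  show "C1 \<times> C2 \<noteq> {}" using irred_nonempty[OF C1(2)] irred_nonempty[OF C2(2)] by simp
  fix f g assume f: "f \<in> RP d1 d2" and g: "g \<in> RP d1 d2"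
    and "\<exists>t\<in>C1 \<times> C2. f t \<noteq> 0" "\<exists>t\<in>C1 \<times> C2. g t \<noteq> 0"
  then obtain a1 a2 b1 b2 where a: "a1 \<in> C1" "a2 \<in> C2" "f (a1, a2) \<noteq> 0"
    and b: "b1 \<in> C1" "b2 \<in> C2" "g (b1, b2) \<noteq> 0" by blast
  obtain c2 where c2: "c2 \<in> C2" "f (a1, c2) \<noteq> 0" "g (b1, c2) \<noteq> 0"
    using irredD[OF C2(2) pair_slices(2)[OF f, of a1] pair_slices(2)[OF g, of b1], of a2 b2] a b C1(1) by blast
  obtain c1 where "c1 \<in> C1" "f (c1, c2) \<noteq> 0" "g (c1, c2) \<noteq> 0"
    using irredD[OF C1(2) pair_slices(1)[OF f, of c2] pair_slices(1)[OF g, of c2], of a1 b1] a b c2 C2(1) by blast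
  then show "\<exists>t\<in>C1 \<times> C2. f t \<noteq> 0 \<and> g t \<noteq> 0" using c2(1) by blast
qed

end

section \<open>Families of polynomials without a common root, and persistence of this
  property\<close>

section \<open>Elimination on the projective line\<close>

lemma poly_lift_const: "poly (map_poly (\<lambda>a _. a) u) (\<lambda>_. c) x = poly u (c :: 'k::field)"
  for x :: 'x
  by (induction u) (auto simp: map_poly_pCons zero_fun_def plus_fun_def times_fun_def)

lemma poly_sum_atMost:
  fixes c :: "'k::comm_ring_1"
  assumes "degree p \<le> M"
  shows "poly p c = (\<Sum>j\<le>M. coeff p j * c ^ j)"
  unfolding poly_altdef using assms
  by (intro sum.mono_neutral_left) (auto simp: coeff_eq_0)

text \<open>\<open>D\<close> is a proper nonzero ideal of a principal ideal domain: a member of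
  least degree divides all others and is not constant, so its roots are common roots.\<close>

lemma exists_common_root:
  fixes D :: "'k::alg_closed_field poly set"
  assumes D: "\<And>a b. a \<in> D \<Longrightarrow> b \<in> D \<Longrightarrow> a + b \<in> D" "\<And>u a. a \<in> D \<Longrightarrow> u * a \<in> D"
    and q: "q \<in> D" "q \<noteq> 0" and 1: "1 \<notin> D"
  shows "\<exists>c. \<forall>p\<in>D. poly p c = 0"
proof -
  obtain d where d: "d \<in> D" "d \<noteq> 0" and min: "\<And>p. p \<in> D \<Longrightarrow> p \<noteq> 0 \<Longrightarrow> degree d \<le> degree p"
    using ex_has_least_nat[of "\<lambda>p. p \<in> D \<and> p \<noteq> 0" q degree] q by blast
  have "degree d > 0"
  proof (rule ccontr)
    assume "\<not> degree d > 0"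
    then obtain a where a: "d = [:a:]" by (metis degree_eq_zeroE gr0I)
    with d(2) have "[:inverse a:] * d = 1" by (simp add: one_pCons)
    with D(2)[OF d(1)] 1 show False by metis
  qed
  then obtain c where c: "poly d c = 0" using alg_closed_imp_poly_has_root by blast
  have "poly p c = 0" if p: "p \<in> D" for p
  proof -
    have eq: "p mod d = p + (- (p div d)) * d" by (simp add: minus_div_mult_eq_mod [symmetric])
    have "p mod d \<in> D" unfolding eq by (rule D(1)[OF p D(2)[OF d(1)]])
    then have "p mod d = 0" using min[of "p mod d"] degree_mod_less[OF d(2), of p] by (meson leD)
    then have "d dvd p" by (simp add: mod_eq_0_iff_dvd)
    then show ?thesis using c by auto
  qed
  then show ?thesis by blast
qed

context fun_algebra
begin

lemma is_subring: "is_subring R"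
  unfolding is_subring_def zero_fun_def one_fun_def plus_fun_def times_fun_def fun_Compl_def
  by (auto intro: const add mult uminus)

end


locale fun_algebra_closed = fun_algebra R for R :: "('x \<Rightarrow> 'k::alg_closed_field) set"
begin

text \<open>If the polynomials \<open>P \<in> \<P>\<close> have no common root at \<open>x1\<close> and one of them is monic there, then the
  products of the members of the ideal of \<open>\<P>\<close> with powers of the variable span all polynomials of degree
  at most \<open>M\<close>; this persists near \<open>x1\<close>.\<close>

theorem common_root_closed:
  assumes \<P>: "\<And>P n. P \<in> \<P> \<Longrightarrow> coeff P n \<in> R"
    and P0: "P0 \<in> \<P>" "coeff P0 e x1 \<noteq> 0" "degree P0 \<le> e"
    and root: "\<And>c. \<exists>P\<in>\<P>. poly P (\<lambda>_. c) x1 \<noteq> 0"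
  shows "\<exists>s\<in>R. s x1 \<noteq> 0 \<and> (\<forall>x. s x \<noteq> 0 \<longrightarrow> (\<forall>c. \<exists>P\<in>\<P>. poly P (\<lambda>_. c) x \<noteq> 0))"
proof -
  define ev where "ev P = map_poly (\<lambda>f. f x1) P" for P :: "('x \<Rightarrow> 'k) poly"
  have ev: "poly P (\<lambda>_. c) x1 = poly (ev P) c" for P c
    unfolding ev_def by (rule poly_fun_apply)
  \<comment> \<open>A substitute for membership in the ideal generated by \<open>\<P>\<close>:
    vanishing at all common roots of \<open>\<P>\<close> is the consequence of membership that is
    used.\<close>
  define van where "van P \<longleftrightarrow> (\<forall>n. coeff P n \<in> R) \<and>
    (\<forall>x c. (\<forall>P\<in>\<P>. poly P (\<lambda>_. c) x = 0) \<longrightarrow> poly P (\<lambda>_. c) x = 0)" for P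
  define D where "D = ev ` Collect van"
  have eq_if: "p = q" if "\<And>c. poly p c = poly q c" for p q :: "'k poly"
    using exists_nonroot[OF _ infinite_UNIV_alg_closed, of "p - q"] that by auto
  have ev_hom: "ev (P + Q) = ev P + ev Q" "ev (P * Q) = ev P * ev Q" for P Q
  proof -
    have "poly (ev (P + Q)) c = poly (ev P + ev Q) c" "poly (ev (P * Q)) c = poly (ev P * ev Q) c" for c
      by (simp_all add: ev[symmetric] plus_fun_def times_fun_def)
    then show "ev (P + Q) = ev P + ev Q" "ev (P * Q) = ev P * ev Q"
      using eq_if by blast+
  qed
  have van_mult: "van (Q * P)" if "\<forall>n. coeff Q n \<in> R" "van P" for P Q
    using that coeff_mult_mem[OF is_subring that(1)] unfolding van_def by (auto simp: times_fun_def)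
  have D_add: "a + b \<in> D" if ab: "a \<in> D" "b \<in> D" for a b
  proof -
    obtain P Q where "van P" "van Q" "a = ev P" "b = ev Q" using ab unfolding D_def by blast
    moreover from this have "van (P + Q)" unfolding van_def
      using is_subringD(3)[OF is_subring] by (auto simp: plus_fun_def[of "poly _ _"])
    ultimately show ?thesis unfolding D_def using ev_hom(1)[of P Q] by (metis imageI mem_Collect_eq)
  qed
  have D_mult: "u * a \<in> D" if a: "a \<in> D" for u a
  proof -
    obtain P where P: "van P" "a = ev P" using a unfolding D_def by blast
    define U where "U = map_poly (\<lambda>a (_ :: 'x). a) u"
    have "\<forall>n. coeff U n \<in> R" unfolding U_def by (simp add: coeff_map_poly const zero_fun_def)
    then have "van (U * P)" using van_mult P(1) by blast
    moreover have "ev U = u"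
      unfolding ev_def U_def by (rule poly_eqI) (simp add: coeff_map_poly zero_fun_def)
    ultimately show ?thesis unfolding D_def P(2) using ev_hom(2)[of U P] by (metis imageI mem_Collect_eq)
  qed
  have PD: "van P" if "P \<in> \<P>" for P unfolding van_def using that \<P> by blast
  have "ev P0 \<in> D" unfolding D_def using PD[OF P0(1)] by blast
  moreover have "coeff (ev P0) e \<noteq> 0" using P0(2) unfolding ev_def by (simp add: coeff_map_poly zero_fun_def)
  then have "ev P0 \<noteq> 0" by auto
  moreover have "\<nexists>c. \<forall>p\<in>D. poly p c = 0"
  proof
    assume "\<exists>c. \<forall>p\<in>D. poly p c = 0"
    then obtain c where c: "\<forall>p\<in>D. poly p c = 0" by blast
    obtain P where "P \<in> \<P>" "poly P (\<lambda>_. c) x1 \<noteq> 0" using root[of c] by blast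
    then show False using c PD unfolding D_def ev by blast
  qed
  \<comment> \<open>Without a common root at \<open>x1\<close> the specializations at
    \<open>x1\<close> form the unit ideal, so some \<open>Q\<close> specializes to the constant
    one.\<close>
  ultimately have "1 \<in> D" using exists_common_root[of D "ev P0"] D_add D_mult by blast
  then obtain Q where Q: "van Q" "ev Q = 1" unfolding D_def by force
  have cQ: "coeff Q n x1 = (if n = 0 then 1 else 0)" for n
  proof -
    have "coeff (ev Q) n = coeff Q n x1" unfolding ev_def by (simp add: coeff_map_poly zero_fun_def)
    then show ?thesis using Q(2) by (cases n) auto
  qed
  define M where "M = e + degree Q"
  \<comment> \<open>At \<open>x1\<close> the multiples of \<open>Q\<close> specialize to the
    monomials of degree below \<open>e\<close>, and the multiples of \<open>P0\<close> have their
    top terms in the degrees from \<open>e\<close> to \<open>M\<close>. The system is therefore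
    triangular there and has only the zero solution.\<close>
  define \<Lambda> where "\<Lambda> = {monom 1 i * P0 | i. i + e \<le> M} \<union> {monom 1 i * Q | i. i < e}"
  have \<Lambda>van: "van P" if "P \<in> \<Lambda>" for P
    using that PD[OF P0(1)] Q(1) unfolding \<Lambda>_def
    by (auto intro!: van_mult simp: one_fun_def zero_fun_def const)
  have \<Lambda>deg: "degree P \<le> M" if "P \<in> \<Lambda>" for P
  proof -
    have "degree (monom 1 i * P :: ('x \<Rightarrow> 'k) poly) \<le> i + degree P" for i P
      using degree_mult_le[of "monom 1 i" P] degree_monom_le[of 1 i] by (meson add_mono le_trans order_refl)
    then show ?thesis using that P0(3) unfolding \<Lambda>_def M_def by (fastforce intro: order.trans)
  qed
  define \<L> where "\<L> = (\<lambda>P n. coeff P n) ` \<Lambda>"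
  have "\<kappa> j \<in> R" if "\<kappa> \<in> \<L>" "j \<in> {..M}" for \<kappa> j
    using that \<Lambda>van unfolding \<L>_def van_def by blast
  then obtain B s c where Bs: "B \<subseteq> {..M}" "s \<in> R" "s x1 \<noteq> 0" "\<forall>j\<in>{..M}. \<forall>b\<in>B. c j b \<in> R"
    "\<forall>x v. s x \<noteq> 0 \<longrightarrow> v \<in> lin_kernel \<L> {..M} x \<longrightarrow> (\<forall>j\<in>{..M}. s x * v j = (\<Sum>b\<in>B. c j b x * v b))"
    "\<forall>w. \<exists>v\<in>lin_kernel \<L> {..M} x1. \<forall>b\<in>B. v b = w b"
    by (rule lin_kernel_chart[OF finite_atMost])
  have triv: "v n = 0" if v: "v \<in> lin_kernel \<L> {..M} x1" "n \<le> M" for v n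
    using v(2)
  proof (induction n rule: less_induct)
    case (less n)
    have form: "(\<Sum>j\<le>M. coeff P j x1 * v j) = 0" if "P \<in> \<Lambda>" for P
      using v(1) that unfolding lin_kernel_def \<L>_def by blast
    show ?case
    proof (cases "n < e")
      case True
      have "monom 1 n * Q \<in> \<Lambda>" using True unfolding \<Lambda>_def by blast
      from form[OF this] have "(\<Sum>j\<le>M. coeff (monom 1 n * Q) j x1 * v j) = 0" .
      also have "(\<Sum>j\<le>M. coeff (monom 1 n * Q) j x1 * v j) = (\<Sum>j\<le>M. if j = n then v n else 0)"
        by (intro sum.cong) (auto simp: coeff_monom_mult cQ zero_fun_def)
      finally have "(\<Sum>j\<le>M. if j = n then v n else 0) = 0" .
      then show ?thesis using less.prems by simp
    next
      case False
      define i where "i = n - e"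
      have "monom 1 i * P0 \<in> \<Lambda>" using False less.prems unfolding \<Lambda>_def i_def by auto
      from form[OF this] have "(\<Sum>j\<le>M. coeff (monom 1 i * P0) j x1 * v j) = 0" .
      also have "(\<Sum>j\<le>M. coeff (monom 1 i * P0) j x1 * v j) = (\<Sum>j\<le>M. if j = n then coeff P0 e x1 * v n else 0)"
      proof (rule sum.cong)
        fix j assume "j \<in> {..M}"
        show "coeff (monom 1 i * P0) j x1 * v j = (if j = n then coeff P0 e x1 * v n else 0)"
        proof (cases j n rule: linorder_cases)
          case less
          then show ?thesis using \<open>\<And>y. y < n \<Longrightarrow> y \<le> M \<Longrightarrow> v y = 0\<close>[of j] \<open>j \<in> {..M}\<close> by simp
        next
          case equal
          then show ?thesis using False by (simp add: coeff_monom_mult i_def)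
        next
          case greater
          then have "coeff P0 (j - i) = 0" using P0(3) False by (intro coeff_eq_0) (simp add: i_def)
          then show ?thesis using greater by (simp add: coeff_monom_mult zero_fun_def)
        qed
      qed simp
      finally show ?thesis using P0(2) less.prems by simp
    qed
  qed
  have "B = {}"
  proof (rule ccontr)
    assume "B \<noteq> {}"
    then obtain b where "b \<in> B" by blast
    moreover obtain v where "v \<in> lin_kernel \<L> {..M} x1" "\<forall>b\<in>B. v b = 1" using Bs(6)[rule_format, of "\<lambda>_. 1"] by blast
    ultimately show False using triv[of v b] Bs(1) by auto
  qed
  have "\<exists>P\<in>\<P>. poly P (\<lambda>_. c) x \<noteq> 0" if x: "s x \<noteq> 0" for x c
  proof (rule ccontr)
    assume n: "\<not> ?thesis"
    \<comment> \<open>For a common root \<open>c\<close> the vector of its powers solves the system,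
      but with \<open>B\<close> empty the chart allows only the zero vector, and entry 0 of
      \<open>v\<close> is one.\<close>
    define v where "v j = (if j \<le> M then c ^ j else 0)" for j
    have "v \<in> lin_kernel \<L> {..M} x"
      unfolding lin_kernel_def \<L>_def mem_Collect_eq
    proof (intro conjI allI impI ballI)
      fix \<kappa> assume "\<kappa> \<in> (\<lambda>P n. coeff P n) ` \<Lambda>"
      then obtain P where P: "P \<in> \<Lambda>" "\<kappa> = coeff P" by blast
      have "0 = poly P (\<lambda>_. c) x" using \<Lambda>van[OF P(1)] n unfolding van_def by metis
      also have "\<dots> = poly (map_poly (\<lambda>f. f x) P) c" by (rule poly_fun_apply)
      also have "\<dots> = (\<Sum>j\<le>M. coeff (map_poly (\<lambda>f. f x) P) j * c ^ j)"
      proof (rule poly_sum_atMost)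
        show "degree (map_poly (\<lambda>f. f x) P) \<le> M"
          using \<Lambda>deg[OF P(1)] by (intro degree_le allI impI) (simp add: coeff_map_poly zero_fun_def coeff_eq_0)
      qed
      also have "\<dots> = (\<Sum>j\<le>M. \<kappa> j x * v j)"
        by (intro sum.cong) (auto simp: P(2) v_def coeff_map_poly zero_fun_def)
      finally show "(\<Sum>j\<le>M. \<kappa> j x * v j) = 0" by simp
    qed (simp add: v_def)
    from Bs(5)[rule_format, OF x this, of 0] show False using \<open>B = {}\<close> x by (simp add: v_def)
  qed
  then show ?thesis using Bs(2,3) by blast
qed

end

section \<open>Completeness of the flag variety by way of minimal parabolic subgroups\<close>

section \<open>Saturation of Borel-stable closed sets\<close>

text \<open>The diagonal of \<open>g\<close> has no zeros because its product is the determinant;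
  the entries of \<open>h\<close> below the diagonal then vanish column by column, from
  \<open>h * g = 1\<close>.\<close>

lemma inverse_upper_triangular:
  fixes g h :: "'k::field mat"
  assumes gh: "mat_inverse_pair d g h" and g: "upper_triangular g"
  shows "upper_triangular h"
proof -
  note D = mat_inverse_pairD[OF gh]
  have diag: "g $$ (j, j) \<noteq> 0" if "j < d" for j
  proof
    assume "g $$ (j, j) = 0"
    then have "0 \<in> set (diag_mat g)" using that D(1) unfolding diag_mat_def by force
    then have "det g = 0" using det_upper_triangular[OF g D(1)] by (simp add: prod_list_zero_iff)
    then show False using mat_inverse_pair_det[OF gh] by simp
  qed
  have "h $$ (i, j) = 0" if "j < i" "i < d" for i j
    using that
  proof (induction j arbitrary: i rule: less_induct)
    case (less j)
    have "0 = (h * g) $$ (i, j)" using D less.prems by simp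
    also have "\<dots> = (\<Sum>l<d. h $$ (i, l) * g $$ (l, j))"
      using less.prems by (intro mat_mult_entry[OF D(2,1)]) auto
    also have "\<dots> = (\<Sum>l<d. if l = j then h $$ (i, j) * g $$ (j, j) else 0)"
    proof (rule sum.cong)
      fix l assume "l \<in> {..<d}"
      then show "h $$ (i, l) * g $$ (l, j) = (if l = j then h $$ (i, j) * g $$ (j, j) else 0)"
        using less.IH[of l i] less.prems g D(1) unfolding upper_triangular_def
        by (cases l j rule: linorder_cases) auto
    qed simp
    also have "\<dots> = h $$ (i, j) * g $$ (j, j)" using less.prems by simp
    finally show ?case using diag[of j] less.prems by simp
  qed
  then show ?thesis using D(2) unfolding upper_triangular_def by auto
qed

lemma swaprows_pair:
  "k < d \<Longrightarrow> l < d \<Longrightarrow> mat_inverse_pair d (swaprows_mat d k l) (swaprows_mat d k l)"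
  unfolding mat_inverse_pair_def by (simp add: swaprows_mat_inv)

lemma addrow_pair:
  fixes c :: "'k::field"
  assumes "k < d" "l < d" "k \<noteq> l"
  shows "mat_inverse_pair d (addrow_mat d c k l) (addrow_mat d (- c) k l)"
  unfolding mat_inverse_pair_def using addrow_mat_inv[OF assms, of c] addrow_mat_inv[OF assms, of "- c"] by simp

locale fg_algebra_closed = fg_algebra scale X
  for scale :: "'k::alg_closed_field \<Rightarrow> 'a::ring_1 \<Rightarrow> 'a" and X
begin

definition borel_stable :: "nat \<Rightarrow> ('a \<Rightarrow> 'k mat) set \<Rightarrow> bool" where
  "borel_stable d Y \<longleftrightarrow> (\<forall>b c y. mat_inverse_pair d b c \<longrightarrow> upper_triangular b \<longrightarrow> y \<in> Y \<longrightarrow> conj_mod b c y \<in> Y)"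

text \<open>The saturation of \<open>Y\<close> under the minimal parabolic subgroup \<open>P\<^sub>r \<supseteq> B\<close>, where \<open>B \<setminus> P\<^sub>r\<close> is a projective
  line: the swap of the rows \<open>r\<close> and \<open>r + 1\<close> represents the point at infinity.\<close>

definition parabolic_saturate :: "nat \<Rightarrow> nat \<Rightarrow> ('a \<Rightarrow> 'k mat) set \<Rightarrow> ('a \<Rightarrow> 'k mat) set" where
  "parabolic_saturate d r Y = {m\<in>MV d.
     conj_mod (swaprows_mat d r (Suc r)) (swaprows_mat d r (Suc r)) m \<in> Y \<or>
     (\<exists>c. conj_mod (addrow_mat d c (Suc r) r) (addrow_mat d (- c) (Suc r) r) m \<in> Y)}"

text \<open>A matrix \<open>h\<close> with at most one nonzero entry below the diagonal, at
  \<open>(r + 1, r)\<close>, becomes upper triangular by a single row operation: the swap if its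
  entry at \<open>(r, r)\<close> is zero, a row addition otherwise. So the chosen representatives
  reach every coset of the Borel subgroup in the parabolic subgroup.\<close>

lemma parabolic_saturate_mem:
  assumes r: "Suc r < d" and Y: "borel_stable d Y" and gh: "mat_inverse_pair d g h" and m: "m \<in> MV d"
    and shape: "\<And>i j. j < i \<Longrightarrow> i < d \<Longrightarrow> (i, j) \<noteq> (Suc r, r) \<Longrightarrow> h $$ (i, j) = 0"
    and mY: "conj_mod g h m \<in> Y"
  shows "m \<in> parabolic_saturate d r Y"
proof -
  note D = mat_inverse_pairD[OF gh]
  have key: "conj_mod p q m \<in> Y" if pq: "mat_inverse_pair d p q" and ut: "upper_triangular (p * h)" for p q
  proof -
    have ph: "mat_inverse_pair d (p * h) (g * q)"
      by (rule mat_inverse_pair_mult[OF pq mat_inverse_pair_sym[OF gh]])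
    have "conj_mod (p * h) (g * q) (conj_mod g h m) = conj_mod p q (conj_mod h g (conj_mod g h m))"
      using conj_conj[OF mat_inverse_pair_sym[OF gh] pq conj_mod_var[OF gh m]] by simp
    also have "\<dots> = conj_mod p q m" using conj_inverse[OF gh m] by simp
    finally show ?thesis using Y mY ph ut unfolding borel_stable_def by metis
  qed
  show ?thesis
  proof (cases "h $$ (r, r) = 0")
    case True
    have "upper_triangular (swaprows_mat d r (Suc r) * h)"
      unfolding upper_triangular_def using r D(2) shape True
      by (auto simp: swaprows_mat[symmetric, OF D(2)] mat_swaprows_def less_Suc_eq)
    then show ?thesis
      using key[OF swaprows_pair] r m unfolding parabolic_saturate_def by auto
  next
    case False
    define c where "c = - h $$ (Suc r, r) / h $$ (r, r)"
    have "upper_triangular (addrow_mat d c (Suc r) r * h)"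
      unfolding upper_triangular_def using r D(2) shape False
      by (auto simp: addrow_mat[symmetric, OF D(2)] mat_addrow_def c_def less_Suc_eq)
    then show ?thesis
      using key[OF addrow_pair, of "Suc r" r c] r m unfolding parabolic_saturate_def by auto
  qed
qed

text \<open>Multiplication by an upper triangular matrix from the left preserves the zero pattern of
  the parabolic subgroup, so \<open>parabolic_saturate_mem\<close> applies again.\<close>

lemma parabolic_saturate_borel_stable:
  assumes r: "Suc r < d" and Y: "borel_stable d Y"
  shows "borel_stable d (parabolic_saturate d r Y)"
  unfolding borel_stable_def
proof (intro allI impI)
  fix b c :: "'k mat" and y assume bc: "mat_inverse_pair d b c" and b: "upper_triangular b"
    and y: "y \<in> parabolic_saturate d r Y"
  note D = mat_inverse_pairD[OF bc]
  have yM: "y \<in> MV d" using y unfolding parabolic_saturate_def by blast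
  have key: "conj_mod b c y \<in> parabolic_saturate d r Y"
    if pq: "mat_inverse_pair d p q" and pY: "conj_mod p q y \<in> Y"
      and shape: "\<And>i j. j < i \<Longrightarrow> i < d \<Longrightarrow> (i, j) \<noteq> (Suc r, r) \<Longrightarrow> q $$ (i, j) = 0" for p q
  proof (rule parabolic_saturate_mem[OF r Y])
    show pc: "mat_inverse_pair d (p * c) (b * q)"
      by (rule mat_inverse_pair_mult[OF pq mat_inverse_pair_sym[OF bc]])
    show "conj_mod b c y \<in> MV d" by (rule conj_mod_var[OF bc yM])
    have "conj_mod (p * c) (b * q) (conj_mod b c y) = conj_mod p q (conj_mod c b (conj_mod b c y))"
      using conj_conj[OF mat_inverse_pair_sym[OF bc] pq conj_mod_var[OF bc yM]] by simp
    then show "conj_mod (p * c) (b * q) (conj_mod b c y) \<in> Y"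
      using conj_inverse[OF bc yM] pY by simp
    fix i j assume ij: "j < i" "i < d" "(i, j) \<noteq> (Suc r, r)"
    have "(b * q) $$ (i, j) = (\<Sum>l<d. b $$ (i, l) * q $$ (l, j))"
      using ij by (intro mat_mult_entry[OF D(1) mat_inverse_pairD(2)[OF pq]]) auto
    also have "\<dots> = 0"
    proof (rule sum.neutral, intro ballI)
      fix l assume l: "l \<in> {..<d}"
      show "b $$ (i, l) * q $$ (l, j) = 0"
      proof (cases "l < i")
        case True
        then show ?thesis using b D(1) ij unfolding upper_triangular_def by auto
      next
        case False
        then have "(l, j) \<noteq> (Suc r, r)" using ij by auto
        then show ?thesis using shape[of j l] False ij l by auto
      qed
    qed
    finally show "(b * q) $$ (i, j) = 0" .
  qed
  from y consider "conj_mod (swaprows_mat d r (Suc r)) (swaprows_mat d r (Suc r)) y \<in> Y"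
    | c' where "conj_mod (addrow_mat d c' (Suc r) r) (addrow_mat d (- c') (Suc r) r) y \<in> Y"
    unfolding parabolic_saturate_def by blast
  then show "conj_mod b c y \<in> parabolic_saturate d r Y"
  proof cases
    case 1
    show ?thesis by (rule key[OF swaprows_pair 1]) (use r in auto)
  next
    case 2
    show ?thesis by (rule key[OF addrow_pair 2]) (use r in auto)
  qed
qed

lemma parabolic_saturate_subset:
  assumes "Suc r < d" "Y \<subseteq> MV d"
  shows "parabolic_saturate d r Y \<subseteq> gl_saturate d Y"
proof
  fix m assume m: "m \<in> parabolic_saturate d r Y"
  have key: "m \<in> gl_saturate d Y" if "mat_inverse_pair d p q" "conj_mod p q m \<in> Y" for p q
  proof -
    have "m = conj_mod q p (conj_mod p q m)"
      using conj_inverse[OF that(1), of m scale] m unfolding parabolic_saturate_def by simp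
    then show ?thesis unfolding gl_saturate_def using that mat_inverse_pair_sym by blast
  qed
  from m consider "conj_mod (swaprows_mat d r (Suc r)) (swaprows_mat d r (Suc r)) m \<in> Y"
    | c' where "conj_mod (addrow_mat d c' (Suc r) r) (addrow_mat d (- c') (Suc r) r) m \<in> Y"
    unfolding parabolic_saturate_def by blast
  then show "m \<in> gl_saturate d Y"
  proof cases
    case 1
    show ?thesis by (rule key[OF swaprows_pair 1]) (use assms(1) in auto)
  next
    case 2
    show ?thesis by (rule key[OF addrow_pair 2]) (use assms(1) in auto)
  qed
qed

lemma closedin_mod_topI:
  assumes "S \<subseteq> MV d" "\<And>m. m \<in> MV d \<Longrightarrow> m \<notin> S \<Longrightarrow> \<exists>\<phi>\<in>RF d. (\<forall>s\<in>S. \<phi> s = 0) \<and> \<phi> m \<noteq> 0"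
  shows "closedin (mod_top scale X d) S"
proof -
  have "zariski_closure d S = S"
    using zariski_closure_subset[OF assms(1)] assms(2) unfolding zariski_closure_def by blast
  then show ?thesis using closedin_zariski_closure[of d S] by simp
qed

lemma closedin_mod_topD:
  assumes "closedin (mod_top scale X d) Y"
  shows "Y \<subseteq> MV d" "m \<in> MV d \<Longrightarrow> m \<notin> Y \<Longrightarrow> \<exists>\<phi>\<in>RF d. (\<forall>y\<in>Y. \<phi> y = 0) \<and> \<phi> m \<noteq> 0"
proof -
  obtain \<F> where F: "\<F>\<subseteq>RF d" "Y = {m\<in>MV d. \<forall>\<phi>\<in>\<F>. \<phi> m = 0}" using assms unfolding closedin_mod_top by blast
  show "Y \<subseteq> MV d" unfolding F(2) by blast
  assume "m \<in> MV d" "m \<notin> Y"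
  then obtain \<phi> where "\<phi> \<in> \<F>" "\<phi> m \<noteq> 0" unfolding F(2) by blast
  then show "\<exists>\<phi>\<in>RF d. (\<forall>y\<in>Y. \<phi> y = 0) \<and> \<phi> m \<noteq> 0" using F by blast
qed

text \<open>A row addition and its inverse depend polynomially on \<open>c\<close>. Functions of a
  module and a parameter of this kind form an algebra \<open>\<Psi>\<close> containing the
  coordinates of the conjugate.\<close>

lemma conj_addrow_polynomial:
  assumes "h \<in> RF d" "k < d" "l < d" "k \<noteq> l"
  shows "\<exists>P. (\<forall>n. coeff P n \<in> RF d) \<and>
    (\<forall>m\<in>MV d. \<forall>c. h (conj_mod (addrow_mat d c k l) (addrow_mat d (- c) k l) m) = poly P (\<lambda>_. c) m)"
proof -
  interpret RF: fun_algebra "RF d" by (rule fun_algebra_regular_on)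
  note sub = is_subringD[OF RF.is_subring]
  define \<Psi> where "\<Psi> = {\<psi> :: ('a \<Rightarrow> 'k mat) \<times> 'k \<Rightarrow> 'k. \<exists>P. (\<forall>n. coeff P n \<in> RF d) \<and>
    (\<forall>m\<in>MV d. \<forall>c. \<psi> (m, c) = poly P (\<lambda>_. c) m)}"
  interpret fun_algebra \<Psi>
  proof
    show "(\<lambda>x. c) \<in> \<Psi>" for c
      unfolding \<Psi>_def mem_Collect_eq using RF.const sub(1)
      by (intro exI[of _ "[:\<lambda>_. c:]"]) (auto simp: coeff_pCons plus_fun_def times_fun_def zero_fun_def split: nat.split)
    fix f g assume "f \<in> \<Psi>" "g \<in> \<Psi>"
    then obtain P Q where PQ: "\<forall>n. coeff P n \<in> RF d" "\<forall>m\<in>MV d. \<forall>c. f (m, c) = poly P (\<lambda>_. c) m"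
      "\<forall>n. coeff Q n \<in> RF d" "\<forall>m\<in>MV d. \<forall>c. g (m, c) = poly Q (\<lambda>_. c) m" unfolding \<Psi>_def by blast
    show "(\<lambda>x. f x + g x) \<in> \<Psi>"
      unfolding \<Psi>_def mem_Collect_eq using PQ sub(3)
      by (intro exI[of _ "P + Q"]) (auto simp: plus_fun_def[of "poly _ _"])
    show "(\<lambda>x. f x * g x) \<in> \<Psi>"
      unfolding \<Psi>_def mem_Collect_eq using PQ coeff_mult_mem[OF RF.is_subring PQ(1,3)]
      by (intro exI[of _ "P * Q"]) (auto simp: times_fun_def[of "poly _ _"])
  qed
  have par: "(\<lambda>p. snd p) \<in> \<Psi>"
    unfolding \<Psi>_def mem_Collect_eq using sub(1,2)
    by (intro exI[of _ "[:0, 1:]"]) (auto simp: coeff_pCons plus_fun_def times_fun_def zero_fun_def one_fun_def split: nat.split)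
  have reg: "(\<lambda>p. f (fst p)) \<in> \<Psi>" if "f \<in> RF d" for f
    unfolding \<Psi>_def mem_Collect_eq using that sub(1)
    by (intro exI[of _ "[:f:]"]) (auto simp: coeff_pCons plus_fun_def times_fun_def zero_fun_def split: nat.split)
  have ent: "(\<lambda>p. addrow_mat d (snd p) k l $$ (i, j)) \<in> \<Psi>" "(\<lambda>p. addrow_mat d (- snd p) k l $$ (i, j)) \<in> \<Psi>"
    if "i < d" "j < d" for i j
  proof -
    have eq: "addrow_mat d a k l $$ (i, j) = (if i = j then 1 else 0) + (if k = i \<and> l = j then 1 else 0) * a" for a :: 'k
      using that by (auto simp: add.commute)
    show "(\<lambda>p. addrow_mat d (snd p) k l $$ (i, j)) \<in> \<Psi>" "(\<lambda>p. addrow_mat d (- snd p) k l $$ (i, j)) \<in> \<Psi>"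
      unfolding eq by (intro add mult uminus const par)+
  qed
  obtain F where F: "F \<in> polyfun (Idx d)" "\<forall>m\<in>MV d. h m = F (mod_coords X d m)"
    using assms(1) unfolding regular_on_def by blast
  define \<zeta> :: "('a \<Rightarrow> 'k mat) \<times> 'k \<Rightarrow> 'a \<times> nat \<times> nat \<Rightarrow> 'k"
    where "\<zeta> p = (\<lambda>(x, i, j). \<Sum>b<d. \<Sum>a<d. addrow_mat d (snd p) k l $$ (i, a) * fst p x $$ (a, b) *
      addrow_mat d (- snd p) k l $$ (b, j))" for p
  have "(\<lambda>p. F (\<zeta> p)) \<in> \<Psi>"
  proof (rule polyfun_compose[OF F(1)])
    fix i assume "i \<in> Idx d"
    then obtain x a b where i: "i = (x, a, b)" "a < d" "b < d" by auto
    show "(\<lambda>p. \<zeta> p i) \<in> \<Psi>"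
      unfolding \<zeta>_def i(1) prod.case using i(2,3) by (intro sum mult ent reg entry_regular) auto
  qed
  then obtain P where P: "\<forall>n. coeff P n \<in> RF d" "\<forall>m\<in>MV d. \<forall>c. F (\<zeta> (m, c)) = poly P (\<lambda>_. c) m"
    unfolding \<Psi>_def by blast
  have "h (conj_mod (addrow_mat d c k l) (addrow_mat d (- c) k l) m) = F (\<zeta> (m, c))" if m: "m \<in> MV d" for m c
  proof -
    note pr = addrow_pair[OF assms(2-4), of c]
    have "h (conj_mod (addrow_mat d c k l) (addrow_mat d (- c) k l) m) =
        F (mod_coords X d (conj_mod (addrow_mat d c k l) (addrow_mat d (- c) k l) m))"
      using F(2) conj_mod_var[OF pr m] by blast
    also have "\<dots> = F (\<zeta> (m, c))"
    proof (rule polyfun_eqI[OF F(1)])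
      fix i assume "i \<in> Idx d"
      then obtain x a b where i: "i = (x, a, b)" "x \<in> X" "a < d" "b < d" by auto
      show "mod_coords X d (conj_mod (addrow_mat d c k l) (addrow_mat d (- c) k l) m) i = \<zeta> (m, c) i"
        using i triple_mult_entry[OF mat_inverse_pairD(1)[OF pr] mod_varD(1)[OF m] mat_inverse_pairD(2)[OF pr]]
        by (simp add: mod_coords_eq conj_mod_def \<zeta>_def del: index_mat_addrow_mat)
    qed
    finally show ?thesis .
  qed
  with P show ?thesis by auto
qed

lemma poly_fun_sum:
  fixes P :: "('y \<Rightarrow> 'k) poly" and c :: 'k
  assumes "degree P \<le> M"
  shows "poly P (\<lambda>_. c) m = (\<Sum>i\<le>M. coeff P i m * c ^ i)"
proof -
  have "degree (map_poly (\<lambda>f. f m) P) \<le> M"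
    using assms by (intro degree_le allI impI) (simp add: coeff_map_poly zero_fun_def coeff_eq_0)
  then show ?thesis
    by (simp add: poly_fun_apply poly_sum_atMost coeff_map_poly zero_fun_def)
qed

lemma poly_reflect_fun:
  fixes P :: "('y \<Rightarrow> 'k) poly"
  assumes "c \<noteq> (0 :: 'k)"
  shows "poly (reflect_poly P) (\<lambda>_. c) m = c ^ degree P * poly P (\<lambda>_. 1 / c) m"
proof -
  define n where "n = degree P"
  have "poly (reflect_poly P) (\<lambda>_. c) m = (\<Sum>i\<le>n. coeff (reflect_poly P) i m * c ^ i)"
    by (rule poly_fun_sum) (simp add: n_def degree_reflect_poly_le)
  also have "\<dots> = (\<Sum>i\<le>n. coeff P (n - i) m * c ^ i)"
    by (intro sum.cong) (auto simp: coeff_reflect_poly n_def)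
  also have "\<dots> = (\<Sum>i\<le>n. coeff P i m * c ^ (n - i))"
    by (rule sum.reindex_bij_witness[of _ "\<lambda>i. n - i" "\<lambda>i. n - i"]) auto
  also have "\<dots> = (\<Sum>i\<le>n. c ^ n * (coeff P i m * (1 / c) ^ i))"
    by (intro sum.cong) (use assms in \<open>auto simp: power_diff power_one_over field_simps\<close>)
  also have "\<dots> = c ^ n * poly P (\<lambda>_. 1 / c) m"
    by (simp add: poly_fun_sum[of P n] n_def sum_distrib_left)
  finally show ?thesis unfolding n_def .
qed

text \<open>Whether conjugation by a group element leads into \<open>Y\<close> depends only on its
  coset modulo the Borel subgroup; the hypothesis on \<open>g * q\<close> says that the cosets
  agree.\<close>

lemma borel_stable_change:
  assumes "borel_stable d Y" "mat_inverse_pair d g h" "mat_inverse_pair d p q" "m \<in> MV d"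
    and "upper_triangular (g * q)" "conj_mod g h m \<in> Y"
  shows "conj_mod p q m \<in> Y"
proof -
  have pr: "mat_inverse_pair d (p * h) (g * q)"
    by (rule mat_inverse_pair_mult[OF assms(3) mat_inverse_pair_sym[OF assms(2)]])
  have "upper_triangular (p * h)"
    by (rule inverse_upper_triangular[OF mat_inverse_pair_sym[OF pr] assms(5)])
  moreover have "conj_mod (p * h) (g * q) (conj_mod g h m) = conj_mod p q (conj_mod h g (conj_mod g h m))"
    using conj_conj[OF mat_inverse_pair_sym[OF assms(2)] assms(3) conj_mod_var[OF assms(2,4)]] by simp
  ultimately show ?thesis
    using assms(1,6) pr conj_inverse[OF assms(2,4)] unfolding borel_stable_def by metis
qed

text \<open>At a point \<open>m1\<close> outside the saturation, no point of a projective line of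
  cosets leads into \<open>Y\<close>. For the point at infinity this is an open condition. For the
  finite points \<open>c\<close> it says that polynomials in \<open>c\<close> have no common root,
  which persists by \<open>common_root_closed\<close>; the polynomial with invertible top
  coefficient required there comes from the chart at infinity.\<close>

theorem parabolic_saturate_closed:
  assumes r: "Suc r < d" and cl: "closedin (mod_top scale X d) Y" and Y: "borel_stable d Y"
  shows "closedin (mod_top scale X d) (parabolic_saturate d r Y)"
proof (rule closedin_mod_topI)
  show "parabolic_saturate d r Y \<subseteq> MV d" unfolding parabolic_saturate_def by blast
  fix m1 assume m1: "m1 \<in> MV d" "m1 \<notin> parabolic_saturate d r Y"
  interpret RF: fun_algebra_closed "RF d"
    by (intro fun_algebra_closed.intro fun_algebra_regular_on)
  define W :: "'k mat" where "W = swaprows_mat d r (Suc r)"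
  define E :: "'k \<Rightarrow> 'k mat" where "E c = addrow_mat d c (Suc r) r" for c
  \<comment> \<open>The chart around infinity: for nonzero \<open>c\<close>, the matrices
    \<open>E c\<close> and \<open>W * U (1 / c)\<close> lie in the same coset of the Borel
    subgroup.\<close>
  define U :: "'k \<Rightarrow> 'k mat" where "U c = addrow_mat d c r (Suc r)" for c
  have W: "mat_inverse_pair d W W" unfolding W_def using r by (intro swaprows_pair) auto
  have E: "mat_inverse_pair d (E c) (E (- c))" for c unfolding E_def using r by (intro addrow_pair) auto
  have U: "mat_inverse_pair d (U c) (U (- c))" for c unfolding U_def using r by (intro addrow_pair) auto
  have sat: "m \<in> parabolic_saturate d r Y \<longleftrightarrow> m \<in> MV d \<and> (conj_mod W W m \<in> Y \<or> (\<exists>c. conj_mod (E c) (E (- c)) m \<in> Y))" for m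
    unfolding parabolic_saturate_def W_def E_def by blast
  obtain h0 where h0: "h0 \<in> RF d" "\<forall>y\<in>Y. h0 y = 0" "h0 (conj_mod W W m1) \<noteq> 0"
    using closedin_mod_topD(2)[OF cl conj_mod_var[OF W m1(1)]] m1 sat by blast
  define h1 where "h1 m = h0 (conj_mod W W m)" for m
  have h1: "h1 \<in> RF d" unfolding h1_def by (rule conj_regular[OF h0(1) W])
  obtain P1 where P1: "\<forall>n. coeff P1 n \<in> RF d" "\<forall>m\<in>MV d. \<forall>c. h1 (conj_mod (U c) (U (- c)) m) = poly P1 (\<lambda>_. c) m"
    using conj_addrow_polynomial[OF h1, of r "Suc r"] r unfolding U_def by auto
  define \<P> where "\<P> = {P. (\<forall>n. coeff P n \<in> RF d) \<and>
    (\<forall>m\<in>MV d. \<forall>c. conj_mod (E c) (E (- c)) m \<in> Y \<longrightarrow> poly P (\<lambda>_. c) m = 0)}"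
  \<comment> \<open>Reversing the coefficients replaces \<open>1 / c\<close> by \<open>c\<close>.
    The extra factor of the variable forces vanishing at \<open>c = 0\<close>, where the change of
    chart is undefined. The constant coefficient of \<open>P1\<close>, whose value at
    \<open>m1\<close> is \<open>h1 m1\<close>, becomes the top coefficient.\<close>
  define P0 where "P0 = pCons 0 (reflect_poly P1)"
  have swap: "conj_mod W W (conj_mod (U (1 / c)) (U (- (1 / c))) m) \<in> Y"
    if c: "c \<noteq> 0" and m: "m \<in> MV d" and mY: "conj_mod (E c) (E (- c)) m \<in> Y" for c m
  proof -
    have pr: "mat_inverse_pair d (W * U (1 / c)) (U (- (1 / c)) * W)"
      by (rule mat_inverse_pair_mult[OF W U])
    have Wc: "W \<in> carrier_mat d d" using W mat_inverse_pairD by blast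
    have a: "addrow (- (1 / c)) r (Suc r) W \<in> carrier_mat d d" using Wc by simp
    have "E c * (U (- (1 / c)) * W) = addrow c (Suc r) r (addrow (- (1 / c)) r (Suc r) W)"
      using r addrow_mat[OF Wc, of "Suc r" "- (1 / c)" r] addrow_mat[OF a, of r c "Suc r"]
      unfolding E_def U_def by simp
    moreover have "upper_triangular (addrow c (Suc r) r (addrow (- (1 / c)) r (Suc r) W))"
      unfolding upper_triangular_def using r c
      by (auto simp: mat_addrow_def W_def less_Suc_eq)
    ultimately have "conj_mod (W * U (1 / c)) (U (- (1 / c)) * W) m \<in> Y"
      using borel_stable_change[OF Y E pr m _ mY] by simp
    then show ?thesis using conj_conj[OF U W m, of "1 / c"] by simp
  qed
  have "P0 \<in> \<P>"
    unfolding \<P>_def mem_Collect_eq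
  proof (intro conjI allI ballI impI)
    show "coeff P0 n \<in> RF d" for n
      unfolding P0_def coeff_pCons coeff_reflect_poly using P1(1) is_subringD(1)[OF RF.is_subring]
      by (auto split: nat.split)
    fix m c assume m: "m \<in> MV d" and mY: "conj_mod (E c) (E (- c)) m \<in> Y"
    show "poly P0 (\<lambda>_. c) m = 0"
    proof (cases "c = 0")
      case True
      then show ?thesis unfolding P0_def by (simp add: plus_fun_def times_fun_def zero_fun_def)
    next
      case False
      have "poly P1 (\<lambda>_. 1 / c) m = h1 (conj_mod (U (1 / c)) (U (- (1 / c))) m)" using P1(2) m by simp
      also have "\<dots> = 0" unfolding h1_def using h0(2) swap[OF False m mY] by blast
      finally have "poly (reflect_poly P1) (\<lambda>_. c) m = 0" unfolding poly_reflect_fun[OF False] by simp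
      then show ?thesis unfolding P0_def by (simp add: plus_fun_def times_fun_def zero_fun_def)
    qed
  qed
  moreover have "coeff P0 (Suc (degree P1)) m1 \<noteq> 0"
  proof -
    have "U 0 = 1\<^sub>m d" unfolding U_def by (rule eq_matI) auto
    then have "h1 m1 = poly P1 (\<lambda>_. 0) m1"
      using P1(2)[rule_format, OF m1(1), of 0] conj_one[OF m1(1)] by simp
    also have "\<dots> = coeff P1 0 m1" by (simp add: poly_fun_sum[OF order.refl] power_0_left if_distrib cong: if_cong)
    finally show ?thesis using h0(3) unfolding P0_def h1_def by (simp add: coeff_reflect_poly)
  qed
  moreover have "degree P0 \<le> Suc (degree P1)"
    unfolding P0_def using degree_pCons_le[of 0 "reflect_poly P1"] degree_reflect_poly_le[of P1] by linarith
  moreover have "\<exists>P\<in>\<P>. poly P (\<lambda>_. c) m1 \<noteq> 0" for c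
  proof -
    have "conj_mod (E c) (E (- c)) m1 \<notin> Y" using m1 sat by blast
    then obtain h where h: "h \<in> RF d" "\<forall>y\<in>Y. h y = 0" "h (conj_mod (E c) (E (- c)) m1) \<noteq> 0"
      using closedin_mod_topD(2)[OF cl conj_mod_var[OF E m1(1)]] by blast
    obtain P where P: "\<forall>n. coeff P n \<in> RF d" "\<forall>m\<in>MV d. \<forall>c. h (conj_mod (E c) (E (- c)) m) = poly P (\<lambda>_. c) m"
      using conj_addrow_polynomial[OF h(1), of "Suc r" r] r unfolding E_def by auto
    have "P \<in> \<P>" unfolding \<P>_def mem_Collect_eq
    proof (intro conjI ballI allI impI)
      fix m c assume "m \<in> MV d" "conj_mod (E c) (E (- c)) m \<in> Y"
      then show "poly P (\<lambda>_. c) m = 0" using P(2) h(2) by (metis (no_types))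
    qed (use P(1) in blast)
    moreover have "poly P (\<lambda>_. c) m1 \<noteq> 0" using P(2) m1(1) h(3) by simp
    ultimately show ?thesis by blast
  qed
  ultimately have "\<exists>s\<in>RF d. s m1 \<noteq> 0 \<and> (\<forall>x. s x \<noteq> 0 \<longrightarrow> (\<forall>c. \<exists>P\<in>\<P>. poly P (\<lambda>_. c) x \<noteq> 0))"
    by (intro RF.common_root_closed) (auto simp: \<P>_def)
  then obtain s where s: "s \<in> RF d" "s m1 \<noteq> 0" "\<forall>x. s x \<noteq> 0 \<longrightarrow> (\<forall>c. \<exists>P\<in>\<P>. poly P (\<lambda>_. c) x \<noteq> 0)"
    by (elim bexE conjE)
  show "\<exists>\<phi>\<in>RF d. (\<forall>s\<in>parabolic_saturate d r Y. \<phi> s = 0) \<and> \<phi> m1 \<noteq> 0"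
  proof (intro bexI conjI ballI)
    \<comment> \<open>On the saturation either the point at infinity leads into \<open>Y\<close> and
      \<open>h1\<close> vanishes, or some finite \<open>c\<close> does and \<open>s\<close>
      vanishes.\<close>
    show "(\<lambda>m. s m * h1 m) \<in> RF d" by (intro RF.mult s(1) h1)
    show "s m1 * h1 m1 \<noteq> 0" using s(2) h0(3) unfolding h1_def by simp
    fix m assume m: "m \<in> parabolic_saturate d r Y"
    show "s m * h1 m = 0"
    proof (rule ccontr)
      assume "s m * h1 m \<noteq> 0"
      then have *: "s m \<noteq> 0" "h1 m \<noteq> 0" by auto
      have "conj_mod W W m \<notin> Y" using *(2) h0(2) unfolding h1_def by blast
      then obtain c where c: "m \<in> MV d" "conj_mod (E c) (E (- c)) m \<in> Y" using m sat by blast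
      obtain P where P: "P \<in> \<P>" "poly P (\<lambda>_. c) m \<noteq> 0" using s(3) *(1) by blast
      then show False using c unfolding \<P>_def by blast
    qed
  qed
qed

lemma gl_saturate_gl_saturate:
  assumes "Z \<subseteq> gl_saturate d Y" "Y \<subseteq> MV d"
  shows "gl_saturate d Z \<subseteq> gl_saturate d Y"
proof
  fix m assume "m \<in> gl_saturate d Z"
  then obtain g h z where 1: "m = conj_mod g h z" "mat_inverse_pair d g h" "z \<in> Z" unfolding gl_saturate_def by blast
  then obtain g' h' y where 2: "z = conj_mod g' h' y" "mat_inverse_pair d g' h'" "y \<in> Y"
    using assms(1) unfolding gl_saturate_def by blast
  have "m = conj_mod (g * g') (h' * h) y"
    using conj_conj[OF 2(2) 1(2), of y scale] 2(3) assms(2) 1(1) 2(1) by auto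
  then show "m \<in> gl_saturate d Y"
    unfolding gl_saturate_def using mat_inverse_pair_mult[OF 1(2) 2(2)] 2(3) by blast
qed

text \<open>Every invertible matrix is reduced to an upper triangular one by row operations with adjacent rows, in
  an order that does not depend on the matrix.\<close>

theorem gl_saturate_closed:
  assumes cl: "closedin (mod_top scale X d) Y" and Y: "borel_stable d Y"
  shows "closedin (mod_top scale X d) (gl_saturate d Y)"
proof -
  define good where "good Y \<longleftrightarrow> closedin (mod_top scale X d) Y \<and> borel_stable d Y" for Y
  define low where "low k g \<longleftrightarrow> (\<forall>j<k. \<forall>i. j < i \<longrightarrow> i < d \<longrightarrow> g $$ (i, j) = (0 :: 'k))" for k and g :: "'k mat"
  \<comment> \<open>\<open>Y'\<close> is closed and Borel-stable, catches everything that a matrix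
    of shape \<open>G\<close> carries into \<open>Y\<close>, and does not leave the full saturation.
    When \<open>G\<close> imposes no condition, \<open>Y'\<close> is the saturation.\<close>
  define covers where "covers G Y Y' \<longleftrightarrow> good Y' \<and> Y' \<subseteq> gl_saturate d Y \<and>
    (\<forall>g h m. mat_inverse_pair d g h \<longrightarrow> m \<in> MV d \<longrightarrow> G g \<longrightarrow> conj_mod g h m \<in> Y \<longrightarrow> m \<in> Y')" for G Y Y'
  have sub: "Y \<subseteq> MV d" if "good Y" for Y using that closedin_mod_topD(1) unfolding good_def by blast
  have outer: "\<exists>Y'. covers (low k) Y Y'" if "good Y" "k \<le> d" for k Y
    using that(2,1)
  proof (induction k arbitrary: Y rule: inc_induct)
    case base
    have "m \<in> Y" if gh: "mat_inverse_pair d g h" and m: "m \<in> MV d" and "low d g" "conj_mod g h m \<in> Y" for g h m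
    proof -
      have "upper_triangular g"
        using \<open>low d g\<close> mat_inverse_pairD(1)[OF gh] unfolding low_def upper_triangular_def by auto
      then have "upper_triangular h" by (rule inverse_upper_triangular[OF gh])
      then have "conj_mod h g (conj_mod g h m) \<in> Y"
        using base mat_inverse_pair_sym[OF gh] \<open>conj_mod g h m \<in> Y\<close> unfolding good_def borel_stable_def by blast
      then show ?thesis using conj_inverse[OF gh m] by simp
    qed
    then show ?case
      unfolding covers_def using base gl_saturate_subset(2)[OF sub[OF base]] by (intro exI[of _ Y]) blast
  next
    case (step k)
    \<comment> \<open>Column \<open>k\<close> is cleared from the bottom upwards. The operation on
      rows \<open>r\<close> and \<open>r + 1\<close> that clears the entry \<open>(r + 1, k)\<close>
      leaves the earlier columns alone, as both rows are zero there.\<close>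
    define col where "col r g \<longleftrightarrow> low k g \<and> (\<forall>i. r < i \<longrightarrow> i < d \<longrightarrow> g $$ (i, k) = 0)" for r g
    have inner: "\<exists>Y'. covers (col r) Z Y'" if "k \<le> r" "r < d" "good Z" for r Z
      using that
    proof (induction r arbitrary: Z rule: dec_induct)
      case base
      have "low (Suc k) g" if "col k g" for g
        using that unfolding col_def low_def by (auto simp: less_Suc_eq)
      moreover obtain Y' where "covers (low (Suc k)) Z Y'" using step.IH[OF base(2)] by blast
      ultimately show ?case unfolding covers_def by blast
    next
      case (step r)
      have r: "Suc r < d" using step.prems(1) .
      \<comment> \<open>The row operation depends on the matrix, but for all matrices it is absorbed
        by replacing the target \<open>Z\<close> by the same parabolic saturation.\<close>
      define Z1 where "Z1 = parabolic_saturate d r Z"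
      have Z1: "good Z1"
        using step.prems(2) parabolic_saturate_closed[OF r] parabolic_saturate_borel_stable[OF r]
        unfolding good_def Z1_def by blast
      obtain Y' where Y': "covers (col r) Z1 Y'" using step.IH[OF _ Z1] r by auto
      have "Y' \<subseteq> gl_saturate d Z1" using Y' unfolding covers_def by blast
      also have "\<dots> \<subseteq> gl_saturate d Z"
        unfolding Z1_def using sub[OF step.prems(2)]
        by (intro gl_saturate_gl_saturate parabolic_saturate_subset r)
      finally have Y'sub: "Y' \<subseteq> gl_saturate d Z" .
      have "m \<in> Y'" if gh: "mat_inverse_pair d g h" and m: "m \<in> MV d" and g: "col (Suc r) g"
        and mZ: "conj_mod g h m \<in> Z" for g h m
      proof -
        note D = mat_inverse_pairD[OF gh]
        have red: "m \<in> Y'" if pq: "mat_inverse_pair d p q" and c: "col r (p * g)"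
          and s: "\<And>x. x \<in> MV d \<Longrightarrow> conj_mod q p x \<in> Z \<Longrightarrow> x \<in> Z1" for p q
        proof -
          have pr: "mat_inverse_pair d (p * g) (h * q)" by (rule mat_inverse_pair_mult[OF pq gh])
          have eq: "conj_mod (p * g) (h * q) m = conj_mod p q (conj_mod g h m)"
            using conj_conj[OF gh pq m] by simp
          have "conj_mod q p (conj_mod (p * g) (h * q) m) \<in> Z"
            unfolding eq using conj_inverse[OF pq conj_mod_var[OF gh m]] mZ by simp
          then have "conj_mod (p * g) (h * q) m \<in> Z1" by (rule s[OF conj_mod_var[OF pr m]])
          then show ?thesis using Y' pr m c unfolding covers_def by blast
        qed
        have zero: "g $$ (i, j) = 0" if "j < k" "j < i" "i < d" for i j
          using g that unfolding col_def low_def by blast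
        have zero': "g $$ (i, k) = 0" if "Suc r < i" "i < d" for i
          using g that unfolding col_def by blast
        show ?thesis
        proof (cases "g $$ (r, k) = 0")
          case True
          show ?thesis
          proof (rule red[OF swaprows_pair])
            show "col r (swaprows_mat d r (Suc r) * g)"
              unfolding col_def low_def using D(1) r zero zero' True step.hyps
              by (auto simp: swaprows_mat[symmetric, OF D(1)] mat_swaprows_def)
          qed (use r in \<open>auto simp: Z1_def parabolic_saturate_def\<close>)
        next
          case False
          define c where "c = g $$ (Suc r, k) / g $$ (r, k)"
          have pr: "mat_inverse_pair d (addrow_mat d (- c) (Suc r) r) (addrow_mat d c (Suc r) r)"
            using addrow_pair[of "Suc r" d r "- c"] r by simp
          show ?thesis
          proof (rule red[OF pr])
            show "col r (addrow_mat d (- c) (Suc r) r * g)"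
              unfolding col_def low_def using D(1) r zero zero' False step.hyps
              by (auto simp: addrow_mat[symmetric, OF D(1)] mat_addrow_def c_def)
          qed (use r in \<open>auto simp: Z1_def parabolic_saturate_def\<close>)
        qed
      qed
      then show ?case
        using Y'sub Y' unfolding covers_def by (intro exI[of _ Y']) blast
    qed
    have "col (d - 1) g" if "low k g" for g
      using that unfolding col_def by auto
    moreover obtain Y' where "covers (col (d - 1)) Y Y'"
      using inner[of "d - 1" Y] step.hyps step.prems by fastforce
    ultimately show ?case unfolding covers_def by blast
  qed
  have good: "good Y" using assms unfolding good_def by blast
  obtain Y' where Y': "covers (low 0) Y Y'" using outer[OF good, of 0] by blast
  have "gl_saturate d Y \<subseteq> Y'"
  proof
    fix m assume "m \<in> gl_saturate d Y"
    then obtain g h y where m: "m = conj_mod g h y" "mat_inverse_pair d g h" "y \<in> Y" unfolding gl_saturate_def by blast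
    have y: "y \<in> MV d" using m(3) sub[OF good] by blast
    have "conj_mod h g m \<in> Y" using conj_inverse[OF m(2) y] m(1,3) by simp
    moreover have "m \<in> MV d" using conj_mod_var[OF m(2) y] m(1) by simp
    moreover have "low 0 h" unfolding low_def by simp
    ultimately show "m \<in> Y'" using Y' mat_inverse_pair_sym[OF m(2)] unfolding covers_def by blast
  qed
  then have "gl_saturate d Y = Y'" using Y' unfolding covers_def by blast
  then show ?thesis using Y' unfolding covers_def good_def by blast
qed

end

section \<open>Translation between short exact sequences and block triangular matrices\<close>

section \<open>Extensions and block triangular modules\<close>

lemma sum_lessThan_add: "(\<Sum>l<m + n. f l) = (\<Sum>l<m. f l) + (\<Sum>l<n. f (m + l :: nat))"
  for f :: "nat \<Rightarrow> 'b::comm_monoid_add"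
  by (induction n) (auto simp: add.assoc)

lemma less_add_cases:
  fixes i :: nat
  assumes "i < m + n"
  obtains "i < m" | k where "k < n" "i = m + k"
  using assms by (metis add_less_cancel_left le_Suc_ex not_less)

lemma mod_varI_entries:
  assumes "\<And>a. m a \<in> carrier_mat d d"
    and "\<And>a b i j. i < d \<Longrightarrow> j < d \<Longrightarrow> m (a + b) $$ (i, j) = m a $$ (i, j) + m b $$ (i, j)"
    and "\<And>c a i j. i < d \<Longrightarrow> j < d \<Longrightarrow> m (scale c a) $$ (i, j) = c * m a $$ (i, j)"
    and "\<And>a b i j. i < d \<Longrightarrow> j < d \<Longrightarrow> m (a * b) $$ (i, j) = (\<Sum>l<d. m a $$ (i, l) * m b $$ (l, j))"
    and "\<And>i j. i < d \<Longrightarrow> j < d \<Longrightarrow> m 1 $$ (i, j) = (if i = j then 1 else 0)"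
  shows "m \<in> mod_var scale d"
proof -
  have dim: "dim_row (m a) = d" "dim_col (m a) = d" for a using assms(1)[of a] by auto
  have "m (a * b) = m a * m b" for a b
    by (rule eq_matI) (use assms(4) mat_mult_entry[OF assms(1) assms(1)] in \<open>auto simp: dim\<close>)
  moreover have "m (a + b) = m a + m b" "m (scale c a) = c \<cdot>\<^sub>m m a" "m 1 = 1\<^sub>m d" for a b c
    by (rule eq_matI; use assms(2,3,5) in \<open>auto simp: dim\<close>)+
  ultimately show ?thesis unfolding mod_var_def using assms(1) by auto
qed

text \<open>The derivations \<open>A \<rightarrow> Hom\<^sub>k(k\<^sup>c, k\<^sup>e)\<close> with respect to \<open>t\<close> and \<open>p\<close>, given by their matrix entries.\<close>

definition derivs :: "('k::field \<Rightarrow> 'a::ring_1 \<Rightarrow> 'a) \<Rightarrow> nat \<Rightarrow> ('a \<Rightarrow> 'k mat) \<Rightarrow> nat \<Rightarrow> ('a \<Rightarrow> 'k mat) \<Rightarrow>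
    ('a \<times> nat \<times> nat \<Rightarrow> 'k) set" where
  "derivs scale c t e p = {D.
     (\<forall>a i j. \<not> (i < c \<and> j < e) \<longrightarrow> D (a, i, j) = 0) \<and>
     (\<forall>a b i j. i < c \<longrightarrow> j < e \<longrightarrow> D (a + b, i, j) = D (a, i, j) + D (b, i, j)) \<and>
     (\<forall>s a i j. i < c \<longrightarrow> j < e \<longrightarrow> D (scale s a, i, j) = s * D (a, i, j)) \<and>
     (\<forall>a b i j. i < c \<longrightarrow> j < e \<longrightarrow> D (a * b, i, j) =
        (\<Sum>l<c. t a $$ (i, l) * D (b, l, j)) + (\<Sum>l<e. D (a, i, l) * p b $$ (l, j))) \<and>
     (\<forall>i j. i < c \<longrightarrow> j < e \<longrightarrow> D (1, i, j) = 0)}"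

lemma derivsI:
  assumes "\<And>a i j. \<not> (i < c \<and> j < e) \<Longrightarrow> D (a, i, j) = 0"
    and "\<And>a b i j. i < c \<Longrightarrow> j < e \<Longrightarrow> D (a + b, i, j) = D (a, i, j) + D (b, i, j)"
    and "\<And>s a i j. i < c \<Longrightarrow> j < e \<Longrightarrow> D (scale s a, i, j) = s * D (a, i, j)"
    and "\<And>a b i j. i < c \<Longrightarrow> j < e \<Longrightarrow> D (a * b, i, j) =
        (\<Sum>l<c. t a $$ (i, l) * D (b, l, j)) + (\<Sum>l<e. D (a, i, l) * p b $$ (l, j))"
    and "\<And>i j. i < c \<Longrightarrow> j < e \<Longrightarrow> D (1, i, j) = 0"
  shows "D \<in> derivs scale c t e p"
  using assms unfolding derivs_def by blast

lemma derivsD: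
  assumes "D \<in> derivs scale c t e p"
  shows "\<not> (i < c \<and> j < e) \<Longrightarrow> D (a, i, j) = 0"
    "i < c \<Longrightarrow> j < e \<Longrightarrow> D (a + b, i, j) = D (a, i, j) + D (b, i, j)"
    "i < c \<Longrightarrow> j < e \<Longrightarrow> D (scale s a, i, j) = s * D (a, i, j)"
    "i < c \<Longrightarrow> j < e \<Longrightarrow> D (a * b, i, j) =
        (\<Sum>l<c. t a $$ (i, l) * D (b, l, j)) + (\<Sum>l<e. D (a, i, l) * p b $$ (l, j))"
    "i < c \<Longrightarrow> j < e \<Longrightarrow> D (1, i, j) = 0"
  using assms unfolding derivs_def by blast+

text \<open>Modules are row spaces, so the zero lower left block makes the last \<open>d2\<close>
  coordinates a submodule isomorphic to \<open>m2\<close>, with quotient \<open>m1\<close>.\<close>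

definition block_mod :: "nat \<Rightarrow> nat \<Rightarrow> ('a \<Rightarrow> 'k::field mat) \<Rightarrow> ('a \<times> nat \<times> nat \<Rightarrow> 'k) \<Rightarrow> ('a \<Rightarrow> 'k mat) \<Rightarrow>
    ('a \<Rightarrow> 'k mat)" where
  "block_mod d1 d2 m1 D m2 = (\<lambda>a. mat (d1 + d2) (d1 + d2) (\<lambda>(i, j).
     if i < d1 then if j < d1 then m1 a $$ (i, j) else D (a, i, j - d1)
     else if j < d1 then 0 else m2 a $$ (i - d1, j - d1)))"

lemma block_mod_entry:
  "i < d1 \<Longrightarrow> j < d1 \<Longrightarrow> block_mod d1 d2 m1 D m2 a $$ (i, j) = m1 a $$ (i, j)"
  "i < d1 \<Longrightarrow> j < d2 \<Longrightarrow> block_mod d1 d2 m1 D m2 a $$ (i, d1 + j) = D (a, i, j)"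
  "i < d2 \<Longrightarrow> j < d1 \<Longrightarrow> block_mod d1 d2 m1 D m2 a $$ (d1 + i, j) = 0"
  "i < d2 \<Longrightarrow> j < d2 \<Longrightarrow> block_mod d1 d2 m1 D m2 a $$ (d1 + i, d1 + j) = m2 a $$ (i, j)"
  unfolding block_mod_def by auto

lemma block_mod_carrier: "block_mod d1 d2 m1 D m2 a \<in> carrier_mat (d1 + d2) (d1 + d2)"
  unfolding block_mod_def by simp

definition upper_left :: "nat \<Rightarrow> ('a \<Rightarrow> 'k mat) \<Rightarrow> ('a \<Rightarrow> 'k mat)" where
  "upper_left d1 m = (\<lambda>a. mat d1 d1 (\<lambda>(i, j). m a $$ (i, j)))"

definition lower_right :: "nat \<Rightarrow> nat \<Rightarrow> ('a \<Rightarrow> 'k mat) \<Rightarrow> ('a \<Rightarrow> 'k mat)" where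
  "lower_right d1 d2 m = (\<lambda>a. mat d2 d2 (\<lambda>(i, j). m a $$ (d1 + i, d1 + j)))"

definition upper_right :: "nat \<Rightarrow> nat \<Rightarrow> ('a \<Rightarrow> 'k::zero mat) \<Rightarrow> ('a \<times> nat \<times> nat \<Rightarrow> 'k)" where
  "upper_right d1 d2 m = (\<lambda>(a, i, j). if i < d1 \<and> j < d2 then m a $$ (i, d1 + j) else 0)"

definition lower_left :: "nat \<Rightarrow> nat \<Rightarrow> ('a \<Rightarrow> 'k::zero mat) \<Rightarrow> ('a \<times> nat \<times> nat \<Rightarrow> 'k)" where
  "lower_left d1 d2 m = (\<lambda>(a, i, j). if i < d2 \<and> j < d1 then m a $$ (d1 + i, j) else 0)"

lemma block_mod_mem:
  assumes m1: "m1 \<in> mod_var scale d1" and m2: "m2 \<in> mod_var scale d2" and D: "D \<in> derivs scale d1 m1 d2 m2"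
  shows "block_mod d1 d2 m1 D m2 \<in> mod_var scale (d1 + d2)"
proof (rule mod_varI_entries)
  note e1 = mod_var_entry[OF m1] and e2 = mod_var_entry[OF m2] and eD = derivsD[OF D]
  fix i j assume ij: "i < d1 + d2" "j < d1 + d2"
  show "block_mod d1 d2 m1 D m2 (a + b) $$ (i, j) = block_mod d1 d2 m1 D m2 a $$ (i, j) + block_mod d1 d2 m1 D m2 b $$ (i, j)" for a b
    using ij(1) by (rule less_add_cases; use ij(2) in \<open>rule less_add_cases\<close>)
      (simp_all add: block_mod_entry e1 e2 eD)
  show "block_mod d1 d2 m1 D m2 (scale c a) $$ (i, j) = c * block_mod d1 d2 m1 D m2 a $$ (i, j)" for a c
    using ij(1) by (rule less_add_cases; use ij(2) in \<open>rule less_add_cases\<close>)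
      (simp_all add: block_mod_entry e1 e2 eD)
  show "block_mod d1 d2 m1 D m2 1 $$ (i, j) = (if i = j then 1 else 0)"
    using ij(1) by (rule less_add_cases; use ij(2) in \<open>rule less_add_cases\<close>)
      (simp_all add: block_mod_entry e1 e2 eD)
  show "block_mod d1 d2 m1 D m2 (a * b) $$ (i, j) =
    (\<Sum>l<d1 + d2. block_mod d1 d2 m1 D m2 a $$ (i, l) * block_mod d1 d2 m1 D m2 b $$ (l, j))" for a b
    unfolding sum_lessThan_add
    using ij(1) by (rule less_add_cases; use ij(2) in \<open>rule less_add_cases\<close>)
      (simp_all add: block_mod_entry e1 e2 eD)
qed (rule block_mod_carrier)

text \<open>The lower left block of \<open>m (a * b) = m a * m b\<close> is the product rule,
  whatever stands in the upper right. The diagonal blocks need not be modules here, which is why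
  \<open>derivs\<close> admits arbitrary matrix-valued functions.\<close>

lemma quasi_block:
  assumes m: "m \<in> mod_var scale (d1 + d2)"
  shows "lower_left d1 d2 m \<in> derivs scale d2 (lower_right d1 d2 m) d1 (upper_left d1 m)"
proof (rule derivsI)
  note e = mod_var_entry[OF m]
  fix i j assume ij: "i < d2" "j < d1"
  show "lower_left d1 d2 m (a + b, i, j) = lower_left d1 d2 m (a, i, j) + lower_left d1 d2 m (b, i, j)" for a b
    using ij by (simp add: lower_left_def e)
  show "lower_left d1 d2 m (scale s a, i, j) = s * lower_left d1 d2 m (a, i, j)" for a s
    using ij by (simp add: lower_left_def e)
  show "lower_left d1 d2 m (1, i, j) = 0"
    using ij by (simp add: lower_left_def e)
  show "lower_left d1 d2 m (a * b, i, j) = (\<Sum>l<d2. lower_right d1 d2 m a $$ (i, l) * lower_left d1 d2 m (b, l, j)) +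
    (\<Sum>l<d1. lower_left d1 d2 m (a, i, l) * upper_left d1 m b $$ (l, j))" for a b
    using ij by (simp add: lower_left_def lower_right_def upper_left_def e sum_lessThan_add add.commute)
qed (auto simp: lower_left_def)

lemma block_decomposition:
  assumes m: "m \<in> mod_var scale (d1 + d2)" and ll: "\<And>a i j. i < d2 \<Longrightarrow> j < d1 \<Longrightarrow> m a $$ (d1 + i, j) = 0"
  shows "upper_left d1 m \<in> mod_var scale d1" "lower_right d1 d2 m \<in> mod_var scale d2"
    "upper_right d1 d2 m \<in> derivs scale d1 (upper_left d1 m) d2 (lower_right d1 d2 m)"
    "block_mod d1 d2 (upper_left d1 m) (upper_right d1 d2 m) (lower_right d1 d2 m) = m"
proof -
  note e = mod_var_entry[OF m]
  show "upper_left d1 m \<in> mod_var scale d1"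
    by (rule mod_varI_entries) (auto simp: upper_left_def e sum_lessThan_add ll)
  show "lower_right d1 d2 m \<in> mod_var scale d2"
    by (rule mod_varI_entries) (auto simp: lower_right_def e sum_lessThan_add ll)
  show "upper_right d1 d2 m \<in> derivs scale d1 (upper_left d1 m) d2 (lower_right d1 d2 m)"
    by (rule derivsI) (auto simp: upper_right_def upper_left_def lower_right_def e sum_lessThan_add)
  show "block_mod d1 d2 (upper_left d1 m) (upper_right d1 d2 m) (lower_right d1 d2 m) = m"
  proof (rule ext, rule eq_matI)
    fix a i j assume "i < dim_row (m a)" "j < dim_col (m a)"
    then have ij: "i < d1 + d2" "j < d1 + d2" using mod_varD(1)[OF m, of a] by auto
    show "block_mod d1 d2 (upper_left d1 m) (upper_right d1 d2 m) (lower_right d1 d2 m) a $$ (i, j) = m a $$ (i, j)"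
      using ij(1) by (rule less_add_cases; use ij(2) in \<open>rule less_add_cases\<close>)
        (simp_all add: block_mod_entry upper_left_def upper_right_def lower_right_def ll)
  qed (simp_all add: block_mod_def mod_var_dim[OF m])
qed

lemma derivs_of_block:
  assumes "block_mod d1 d2 m1 D m2 \<in> mod_var scale (d1 + d2)" "\<And>a i j. \<not> (i < d1 \<and> j < d2) \<Longrightarrow> D (a, i, j) = 0"
  shows "D \<in> derivs scale d1 m1 d2 m2"
proof (rule derivsI)
  note e = mod_var_entry[OF assms(1)]
  fix i j assume ij: "i < d1" "j < d2"
  show "D (a + b, i, j) = D (a, i, j) + D (b, i, j)" for a b
    using e(1)[of i "d1 + j" a b] ij by (simp add: block_mod_entry)
  show "D (scale s a, i, j) = s * D (a, i, j)" for a s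
    using e(2)[of i "d1 + j" s a] ij by (simp add: block_mod_entry)
  show "D (1, i, j) = 0"
    using e(4)[of i "d1 + j"] ij by (simp add: block_mod_entry)
  show "D (a * b, i, j) = (\<Sum>l<d1. m1 a $$ (i, l) * D (b, l, j)) + (\<Sum>l<d2. D (a, i, l) * m2 b $$ (l, j))" for a b
    using e(3)[of i "d1 + j" a b] ij by (simp add: block_mod_entry sum_lessThan_add)
qed (rule assms(2))

definition row_mat :: "nat \<Rightarrow> (nat \<Rightarrow> 'k) \<Rightarrow> 'k mat" where
  "row_mat n v = mat 1 n (\<lambda>(i, j). v j)"

definition mat_tuple :: "nat \<Rightarrow> 'k::zero mat \<Rightarrow> (nat \<Rightarrow> 'k)" where
  "mat_tuple n A = (\<lambda>j. if j < n then A $$ (0, j) else 0)"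

lemma row_mat_carrier [simp]: "row_mat n v \<in> carrier_mat 1 n"
  unfolding row_mat_def by simp

lemma mat_tuple_mem [simp]: "mat_tuple n A \<in> tuples n"
  unfolding mat_tuple_def tuples_def by simp

lemma mat_tuple_row_mat: "v \<in> tuples n \<Longrightarrow> mat_tuple n (row_mat n v) = v"
  unfolding mat_tuple_def row_mat_def tuples_def by (auto simp: fun_eq_iff)

lemma row_mat_mat_tuple: "A \<in> carrier_mat 1 n \<Longrightarrow> row_mat n (mat_tuple n A) = A"
  unfolding mat_tuple_def row_mat_def by (rule eq_matI) auto

lemma row_mat_mult: "G \<in> carrier_mat n k \<Longrightarrow> row_mat k (mat_tuple k (row_mat n v * G)) = row_mat n v * G"
  by (rule row_mat_mat_tuple[OF mult_carrier_mat[OF row_mat_carrier]])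

lemma row_mat_inj: "u \<in> tuples n \<Longrightarrow> v \<in> tuples n \<Longrightarrow> row_mat n u = row_mat n v \<Longrightarrow> u = v"
  using mat_tuple_row_mat by metis

lemma row_mat_add: "row_mat n (u + v) = row_mat n u + row_mat n v" for u v :: "nat \<Rightarrow> 'k::field"
  unfolding row_mat_def by (rule eq_matI) auto

lemma row_mat_zero: "row_mat n (0 :: nat \<Rightarrow> 'k::field) = 0\<^sub>m 1 n"
  unfolding row_mat_def by (rule eq_matI) auto

lemma tuples_add: "u \<in> tuples n \<Longrightarrow> v \<in> tuples n \<Longrightarrow> u + v \<in> tuples n" for u v :: "nat \<Rightarrow> 'k::field"
  unfolding tuples_def by simp

lemma row_act_mem: "row_act n m v a \<in> tuples n"
  unfolding row_act_def tuples_def by simp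

lemma row_mat_row_act:
  assumes "m a \<in> carrier_mat n n"
  shows "row_mat n (row_act n m v a) = row_mat n v * m a"
proof (rule eq_matI)
  fix i j assume "i < dim_row (row_mat n v * m a)" "j < dim_col (row_mat n v * m a)"
  then have "i = 0" "j < n" using assms by (auto simp: row_mat_def)
  then show "row_mat n (row_act n m v a) $$ (i, j) = (row_mat n v * m a) $$ (i, j)"
    using mat_mult_entry[OF row_mat_carrier[of n v] assms, of 0 j] by (simp add: row_mat_def row_act_def)
qed (use assms in \<open>auto simp: row_mat_def\<close>)

lemma intertwiner_hom:
  fixes G :: "'k::field mat"
  assumes G: "G \<in> carrier_mat n k" and m: "\<And>a. m a \<in> carrier_mat n n" "\<And>a. m' a \<in> carrier_mat k k"
    and int: "\<And>a. m a * G = G * m' a"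
  shows "(\<lambda>v. if v \<in> tuples n then mat_tuple k (row_mat n v * G) else 0) \<in>
    right_hom (tuples n) (row_act n m) (tuples k) (row_act k m')"
proof -
  define f where "f = (\<lambda>v. if v \<in> tuples n then mat_tuple k (row_mat n v * G) else 0)"
  have rf: "row_mat k (f v) = row_mat n v * G" if "v \<in> tuples n" for v
    using that G by (simp add: f_def row_mat_mult)
  have ft: "f v \<in> tuples k" for v by (simp add: f_def tuples_def mat_tuple_def)
  have "f (u + v) = f u + f v" if "u \<in> tuples n" "v \<in> tuples n" for u v
  proof (rule row_mat_inj[OF ft tuples_add[OF ft ft]])
    show "row_mat k (f (u + v)) = row_mat k (f u + f v)"
      unfolding rf[OF tuples_add[OF that]] row_mat_add rf[OF that(1)] rf[OF that(2)]
      by (rule add_mult_distrib_mat[OF row_mat_carrier row_mat_carrier G])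
  qed
  moreover have "f (row_act n m v a) = row_act k m' (f v) a" if "v \<in> tuples n" for v a
  proof (rule row_mat_inj[OF ft row_act_mem])
    show "row_mat k (f (row_act n m v a)) = row_mat k (row_act k m' (f v) a)"
      unfolding rf[OF row_act_mem] row_mat_row_act[of m a n, OF m(1)] row_mat_row_act[of m' a k, OF m(2)] rf[OF that]
      using int[of a] assoc_mult_mat[OF row_mat_carrier m(1) G, of v a] assoc_mult_mat[OF row_mat_carrier G m(2), of v a]
      by simp
  qed
  moreover have "f v = 0" if "v \<notin> tuples n" for v using that by (simp add: f_def)
  ultimately show ?thesis unfolding right_hom_def f_def[symmetric] using ft by blast
qed

text \<open>The splitting \<open>k\<^sup>d = k\<^sup>d\<^sup>1 \<oplus> k\<^sup>d\<^sup>2\<close> given by an invertible matrix: the submodule is spanned by the last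
  \<open>d2\<close> rows of \<open>g\<close>, and the quotient map is given by the first \<open>d1\<close> columns of its inverse.\<close>

lemma is_extension_of_block:
  fixes m :: "'a::ring_1 \<Rightarrow> 'k::field mat"
  assumes m: "m \<in> mod_var scale (d1 + d2)" and m1: "m1 \<in> mod_var scale d1" and m2: "m2 \<in> mod_var scale d2"
    and gh: "mat_inverse_pair (d1 + d2) g h" and eq: "conj_mod g h m = block_mod d1 d2 m1 D m2"
  shows "is_extension d2 m2 (d1 + d2) m d1 m1"
proof -
  define d where "d = d1 + d2"
  note gh = gh[folded d_def] and m = m[folded d_def]
  note C = mat_inverse_pairD[OF gh]
  define G1 where "G1 = mat d1 d (\<lambda>(i, j). g $$ (i, j))"
  define G2 where "G2 = mat d2 d (\<lambda>(i, j). g $$ (d1 + i, j))"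
  define H1 where "H1 = mat d d1 (\<lambda>(i, j). h $$ (i, j))"
  define H2 where "H2 = mat d d2 (\<lambda>(i, j). h $$ (i, d1 + j))"
  have car: "G1 \<in> carrier_mat d1 d" "G2 \<in> carrier_mat d2 d" "H1 \<in> carrier_mat d d1" "H2 \<in> carrier_mat d d2"
    unfolding G1_def G2_def H1_def H2_def by auto
  have gh1: "(\<Sum>l<d. g $$ (i, l) * h $$ (l, j)) = (if i = j then 1 else 0)" if "i < d" "j < d" for i j
    using mat_mult_entry[OF C(1,2) that] C(3) that by simp
  have hg1: "(\<Sum>l<d. h $$ (i, l) * g $$ (l, j)) = (if i = j then 1 else 0)" if "i < d" "j < d" for i j
    using mat_mult_entry[OF C(2,1) that] C(4) that by simp
  have G1H1: "G1 * H1 = 1\<^sub>m d1"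
    by (rule eq_matI) (use mat_mult_entry[OF car(1,3)] gh1 car in \<open>auto simp: G1_def H1_def d_def\<close>)
  have G2H1: "G2 * H1 = 0\<^sub>m d2 d1"
    by (rule eq_matI) (use mat_mult_entry[OF car(2,3)] gh1 car in \<open>auto simp: G2_def H1_def d_def\<close>)
  have G2H2: "G2 * H2 = 1\<^sub>m d2"
    by (rule eq_matI) (use mat_mult_entry[OF car(2,4)] gh1 car in \<open>auto simp: G2_def H2_def d_def\<close>)
  have HG: "H1 * G1 + H2 * G2 = 1\<^sub>m d"
  proof (rule eq_matI)
    fix i j assume "i < dim_row (1\<^sub>m d :: 'k mat)" "j < dim_col (1\<^sub>m d :: 'k mat)"
    then have ij: "i < d" "j < d" by auto
    have "(H1 * G1 + H2 * G2) $$ (i, j) = (H1 * G1) $$ (i, j) + (H2 * G2) $$ (i, j)"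
      using ij car by simp
    also have "\<dots> = (\<Sum>l<d1. h $$ (i, l) * g $$ (l, j)) + (\<Sum>l<d2. h $$ (i, d1 + l) * g $$ (d1 + l, j))"
      unfolding mat_mult_entry[OF car(3,1) ij] mat_mult_entry[OF car(4,2) ij]
      using ij by (simp add: H1_def H2_def G1_def G2_def)
    also have "\<dots> = (\<Sum>l<d. h $$ (i, l) * g $$ (l, j))" unfolding d_def sum_lessThan_add by simp
    finally show "(H1 * G1 + H2 * G2) $$ (i, j) = 1\<^sub>m d $$ (i, j)" using hg1[OF ij] ij by simp
  qed (use car in auto)
  have gm: "g * m a = block_mod d1 d2 m1 D m2 a * g" for a
  proof -
    have ma: "m a \<in> carrier_mat d d" by (rule mod_varD(1)[OF m])
    have "block_mod d1 d2 m1 D m2 a * g = g * m a * h * g" using eq unfolding conj_mod_def by metis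
    also have "\<dots> = g * m a" using C ma by (simp add: assoc_mult_mat[of _ d d _ d _ d])
    finally show ?thesis by simp
  qed
  have mh: "m a * h = h * block_mod d1 d2 m1 D m2 a" for a
  proof -
    have ma: "m a \<in> carrier_mat d d" by (rule mod_varD(1)[OF m])
    have "h * block_mod d1 d2 m1 D m2 a = h * (g * m a * h)" using eq unfolding conj_mod_def by metis
    also have "\<dots> = m a * h"
      using C ma mat_inverse_pair_cancel(2)[OF gh, of "m a * h" d] by (simp add: assoc_mult_mat[of _ d d _ d _ d])
    finally show ?thesis by simp
  qed
  have bc: "block_mod d1 d2 m1 D m2 a \<in> carrier_mat d d" for a unfolding d_def by (rule block_mod_carrier)
  have ma: "m a \<in> carrier_mat d d" "m1 a \<in> carrier_mat d1 d1" "m2 a \<in> carrier_mat d2 d2" for a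
    using mod_varD(1) m m1 m2 by blast+
  have int2: "m2 a * G2 = G2 * m a" for a
  proof (rule eq_matI)
    fix i j assume "i < dim_row (G2 * m a)" "j < dim_col (G2 * m a)"
    then have ij: "i < d2" "j < d" using car ma(1)[of a] by auto
    then have i': "d1 + i < d" by (simp add: d_def)
    have "(G2 * m a) $$ (i, j) = (g * m a) $$ (d1 + i, j)"
      unfolding mat_mult_entry[OF car(2) ma(1) ij] mat_mult_entry[OF C(1) ma(1) i' ij(2)] using ij by (simp add: G2_def)
    also have "\<dots> = (\<Sum>l<d. block_mod d1 d2 m1 D m2 a $$ (d1 + i, l) * g $$ (l, j))"
      unfolding gm by (rule mat_mult_entry[OF bc C(1) i' ij(2)])
    also have "\<dots> = (m2 a * G2) $$ (i, j)"
      unfolding d_def sum_lessThan_add mat_mult_entry[OF ma(3) car(2) ij] using ij by (simp add: block_mod_entry G2_def d_def)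
    finally show "(m2 a * G2) $$ (i, j) = (G2 * m a) $$ (i, j)" by simp
  qed (use car ma(1,3)[of a] in auto)
  have int1: "m a * H1 = H1 * m1 a" for a
  proof (rule eq_matI)
    fix i j assume "i < dim_row (H1 * m1 a)" "j < dim_col (H1 * m1 a)"
    then have ij: "i < d" "j < d1" using car ma(2)[of a] by auto
    then have j': "j < d" by (simp add: d_def)
    have "(m a * H1) $$ (i, j) = (m a * h) $$ (i, j)"
      unfolding mat_mult_entry[OF ma(1) car(3) ij] mat_mult_entry[OF ma(1) C(2) ij(1) j'] using ij by (simp add: H1_def)
    also have "\<dots> = (\<Sum>l<d. h $$ (i, l) * block_mod d1 d2 m1 D m2 a $$ (l, j))"
      unfolding mh by (rule mat_mult_entry[OF C(2) bc ij(1) j'])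
    also have "\<dots> = (H1 * m1 a) $$ (i, j)"
      unfolding d_def sum_lessThan_add mat_mult_entry[OF car(3) ma(2) ij] using ij by (simp add: block_mod_entry H1_def d_def)
    finally show "(m a * H1) $$ (i, j) = (H1 * m1 a) $$ (i, j)" .
  qed (use car ma(1,2)[of a] in auto)
  define f where "f v = (if v \<in> tuples d2 then mat_tuple d (row_mat d2 v * G2) else 0)" for v
  define p where "p v = (if v \<in> tuples d then mat_tuple d1 (row_mat d v * H1) else 0)" for v
  have f: "f \<in> right_hom (tuples d2) (row_act d2 m2) (tuples d) (row_act d m)"
    unfolding f_def by (rule intertwiner_hom[OF car(2) ma(3,1) int2])
  have p: "p \<in> right_hom (tuples d) (row_act d m) (tuples d1) (row_act d1 m1)"
    unfolding p_def by (rule intertwiner_hom[OF car(3) ma(1,2) int1])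
  have rf: "row_mat d (f v) = row_mat d2 v * G2" if "v \<in> tuples d2" for v
    using that car by (simp add: f_def row_mat_mult)
  have rp: "row_mat d1 (p v) = row_mat d v * H1" if "v \<in> tuples d" for v
    using that car by (simp add: p_def row_mat_mult)
  have ft: "f v \<in> tuples d" for v by (simp add: f_def tuples_def mat_tuple_def)
  have pt: "p v \<in> tuples d1" for v by (simp add: p_def tuples_def mat_tuple_def)
  have inj: "inj_on f (tuples d2)"
  proof (rule inj_onI)
    fix u v assume uv: "u \<in> tuples d2" "v \<in> tuples d2" "f u = f v"
    have "row_mat d2 w = row_mat d (f w) * H2" if "w \<in> tuples d2" for w
      unfolding rf[OF that] using car G2H2 by (simp add: assoc_mult_mat[OF row_mat_carrier car(2,4)] right_mult_one_mat[OF row_mat_carrier])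
    with uv show "u = v" by (metis row_mat_inj)
  qed
  have surj: "p ` tuples d = tuples d1"
  proof (intro equalityI subsetI)
    fix u :: "nat \<Rightarrow> 'k" assume u: "u \<in> tuples d1"
    define w where "w = mat_tuple d (row_mat d1 u * G1)"
    have w: "w \<in> tuples d" "row_mat d w = row_mat d1 u * G1" unfolding w_def using car by (auto simp: row_mat_mult)
    have "row_mat d1 (p w) = row_mat d1 u"
      unfolding rp[OF w(1)] w(2) using G1H1 by (simp add: assoc_mult_mat[OF row_mat_carrier car(1,3)] right_mult_one_mat[OF row_mat_carrier])
    then have "p w = u" by (rule row_mat_inj[OF pt u])
    then show "u \<in> p ` tuples d" using w(1) by blast
  qed (use pt in auto)
  have exact: "f ` tuples d2 = {v \<in> tuples d. p v = 0}"
  proof (intro equalityI subsetI)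
    fix v assume "v \<in> f ` tuples d2"
    then obtain u where u: "u \<in> tuples d2" "v = f u" by blast
    have "row_mat d1 (p v) = row_mat d1 (0 :: nat \<Rightarrow> 'k)"
      unfolding u(2) rp[OF ft] rf[OF u(1)] using G2H1 car
      by (simp add: assoc_mult_mat[OF row_mat_carrier car(2,3)] right_mult_zero_mat[OF row_mat_carrier] row_mat_zero)
    then have "p v = 0" using row_mat_inj[OF pt[of v], of 0] by (simp add: tuples_def)
    then show "v \<in> {v \<in> tuples d. p v = 0}" using u ft by simp
  next
    fix v assume v: "v \<in> {v \<in> tuples d. p v = 0}"
    define u where "u = mat_tuple d2 (row_mat d v * H2)"
    have u: "u \<in> tuples d2" "row_mat d2 u = row_mat d v * H2" unfolding u_def using car by (auto simp: row_mat_mult)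
    have pv: "row_mat d v * H1 = 0\<^sub>m 1 d1" using rp[of v] v row_mat_zero[of d1, where 'k='k] by simp
    have "row_mat d v = row_mat d v * (H1 * G1 + H2 * G2)" unfolding HG by (simp add: right_mult_one_mat[OF row_mat_carrier])
    also have "\<dots> = row_mat d v * (H1 * G1) + row_mat d v * (H2 * G2)"
      using car by (intro mult_add_distrib_mat[OF row_mat_carrier]) auto
    also have "row_mat d v * (H1 * G1) = 0\<^sub>m 1 d"
      using pv car by (simp add: assoc_mult_mat[OF row_mat_carrier car(3,1), symmetric])
    also have "row_mat d v * (H2 * G2) = row_mat d (f u)"
      unfolding rf[OF u(1)] u(2) by (simp add: assoc_mult_mat[OF row_mat_carrier car(4,2)])
    finally have "row_mat d v = row_mat d (f u)"
      unfolding left_add_zero_mat[OF row_mat_carrier] .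
    then have "v = f u" using v by (intro row_mat_inj[OF _ ft]) auto
    then show "v \<in> f ` tuples d2" using u(1) by blast
  qed
  show ?thesis
    unfolding is_extension_def d_def[symmetric] using f p inj exact surj by blast
qed

lemma right_homD:
  assumes "f \<in> right_hom V act W act'"
  shows "v \<in> V \<Longrightarrow> f v \<in> W" "v \<notin> V \<Longrightarrow> f v = 0" "u \<in> V \<Longrightarrow> v \<in> V \<Longrightarrow> f (u + v) = f u + f v"
    "v \<in> V \<Longrightarrow> f (act v a) = act' (f v) a"
  using assms unfolding right_hom_def by blast+

lemma row_act_scale:
  assumes "m \<in> mod_var scale k" "v \<in> tuples k"
  shows "row_act k m v (scale c 1) = (\<lambda>i. c * v i)"
proof
  fix j
  show "row_act k m v (scale c 1) j = c * v j"
  proof (cases "j < k")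
    case True
    have "row_act k m v (scale c 1) j = (\<Sum>i<k. v i * (c * (if i = j then 1 else 0)))"
      unfolding row_act_def using True by (auto intro!: sum.cong simp: mod_var_entry[OF assms(1)])
    also have "\<dots> = (\<Sum>i<k. if i = j then c * v j else 0)" by (intro sum.cong) auto
    finally show ?thesis using True by simp
  qed (use assms(2) in \<open>auto simp: row_act_def tuples_def\<close>)
qed

text \<open>The algebra element \<open>scale c 1\<close> acts as multiplication by \<open>c\<close>,
  so compatibility with the action implies linearity.\<close>

lemma right_hom_scale:
  fixes f :: "(nat \<Rightarrow> 'k::field) \<Rightarrow> (nat \<Rightarrow> 'k)"
  assumes f: "f \<in> right_hom (tuples n) (row_act n m) (tuples n') (row_act n' m')"
    and m: "m \<in> mod_var scale n" "m' \<in> mod_var scale n'" and v: "v \<in> tuples n"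
  shows "f (\<lambda>i. c * v i) = (\<lambda>i. c * f v i)"
proof -
  have "f v \<in> tuples n'" by (rule right_homD(1)[OF f v])
  then show ?thesis using right_homD(4)[OF f v, of "scale c 1"] row_act_scale[OF m(1) v] row_act_scale[OF m(2), of "f v"] by simp
qed

lemma right_hom_lincomb:
  fixes f :: "(nat \<Rightarrow> 'k::field) \<Rightarrow> (nat \<Rightarrow> 'k)" and k :: nat
  assumes f: "f \<in> right_hom (tuples n) (row_act n m) (tuples n') (row_act n' m')"
    and m: "m \<in> mod_var scale n" "m' \<in> mod_var scale n'" and v: "\<And>i. i < k \<Longrightarrow> v i \<in> tuples n"
  shows "f (\<lambda>j. \<Sum>i<k. c i * v i j) = (\<lambda>j. \<Sum>i<k. c i * f (v i) j)"
  using v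
proof (induction k)
  case 0
  have z: "(0 :: nat \<Rightarrow> 'k) \<in> tuples n" by (simp add: tuples_def)
  have "f 0 = f 0 + f 0" using right_homD(3)[OF f z z] by (simp only: add_0_left)
  then have "f 0 = 0" by (metis add_cancel_right_right)
  then show ?case by (simp add: zero_fun_def)
next
  case (Suc k)
  have t: "(\<lambda>j. \<Sum>i<k. c i * v i j) \<in> tuples n" "(\<lambda>j. c k * v k j) \<in> tuples n"
    using Suc.prems unfolding tuples_def by (auto intro!: sum.neutral)
  have "f ((\<lambda>j. \<Sum>i<k. c i * v i j) + (\<lambda>j. c k * v k j)) = f (\<lambda>j. \<Sum>i<k. c i * v i j) + f (\<lambda>j. c k * v k j)"
    by (rule right_homD(3)[OF f t])
  then show ?case
    using Suc right_hom_scale[OF f m Suc.prems[of k], of "c k"] by (simp add: plus_fun_def)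
qed

text \<open>Lifts of the standard basis of the quotient followed by the images of the standard basis
  of the submodule form a basis, in which the action is block triangular; the rows of
  \<open>g\<close> are this basis.\<close>

lemma block_of_is_extension:
  fixes m :: "'a::ring_1 \<Rightarrow> 'k::field mat"
  assumes m: "m \<in> mod_var scale (d1 + d2)" and m1: "m1 \<in> mod_var scale d1" and m2: "m2 \<in> mod_var scale d2"
    and ext: "is_extension d2 m2 (d1 + d2) m d1 m1"
  shows "\<exists>g h D. mat_inverse_pair (d1 + d2) g h \<and> D \<in> derivs scale d1 m1 d2 m2 \<and>
    conj_mod g h m = block_mod d1 d2 m1 D m2"
proof -
  define d where "d = d1 + d2"
  note m = m[folded d_def]
  obtain f p where f: "f \<in> right_hom (tuples d2) (row_act d2 m2) (tuples d) (row_act d m)"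
    and p: "p \<in> right_hom (tuples d) (row_act d m) (tuples d1) (row_act d1 m1)"
    and inj: "inj_on f (tuples d2)" and exact: "f ` tuples d2 = {v \<in> tuples d. p v = 0}"
    and surj: "p ` tuples d = tuples d1"
    using ext unfolding is_extension_def d_def by blast
  define e :: "nat \<Rightarrow> nat \<Rightarrow> 'k" where "e i = (\<lambda>j. if j = i then 1 else 0)" for i
  have et: "e i \<in> tuples n" if "i < n" for i n using that unfolding e_def tuples_def by auto
  have expand: "v = (\<lambda>j. \<Sum>i<n. v i * e i j)" if v: "v \<in> tuples n" for v n
  proof
    fix j
    have "(\<Sum>i<n. v i * e i j) = (\<Sum>i<n. if i = j then v j else 0)" unfolding e_def by (intro sum.cong) auto
    then show "v j = (\<Sum>i<n. v i * e i j)" using v by (auto simp: tuples_def)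
  qed
  have "\<exists>v\<in>tuples d. p v = e i" if "i < d1" for i using surj et[OF that] by (metis imageE)
  then obtain w where w: "\<And>i. i < d1 \<Longrightarrow> w i \<in> tuples d" "\<And>i. i < d1 \<Longrightarrow> p (w i) = e i" by metis
  define r where "r i = (if i < d1 then w i else f (e (i - d1)))" for i
  have ft: "f v \<in> tuples d" if "v \<in> tuples d2" for v by (rule right_homD(1)[OF f that])
  have pt: "p v \<in> tuples d1" if "v \<in> tuples d" for v by (rule right_homD(1)[OF p that])
  have rt: "r i \<in> tuples d" if "i < d" for i
    using that w(1) ft et unfolding r_def d_def by auto
  have fexp: "f u = (\<lambda>j. \<Sum>i<d2. u i * r (d1 + i) j)" if "u \<in> tuples d2" for u
    using right_hom_lincomb[OF f m2 m, of d2 e u] et expand[OF that] unfolding r_def by simp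
  have pexp: "p (\<lambda>j. \<Sum>i<d1. c i * w i j) = (\<lambda>j. \<Sum>i<d1. c i * e i j)" for c
    using right_hom_lincomb[OF p m m1, of d1 w c] w by simp
  \<comment> \<open>Subtracting from \<open>v\<close> the combination of lifts with the same image
    under \<open>p\<close> leaves an element of the kernel, which by exactness comes from some
    \<open>u\<close>.\<close>
  have comb: "\<exists>u. u \<in> tuples d2 \<and> v = (\<lambda>j. (\<Sum>i<d1. p v i * r i j) + (\<Sum>i<d2. u i * r (d1 + i) j))" if v: "v \<in> tuples d" for v
  proof -
    define v1 where "v1 = (\<lambda>j. \<Sum>i<d1. p v i * w i j)"
    have v1: "v1 \<in> tuples d" using w(1) unfolding v1_def tuples_def by (auto intro!: sum.neutral)
    have pv1: "p v1 = p v" unfolding v1_def pexp using expand[OF pt[OF v]] by simp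
    have dt: "v - v1 \<in> tuples d" using v v1 unfolding tuples_def by simp
    have "p ((v - v1) + v1) = p (v - v1) + p v1" by (rule right_homD(3)[OF p dt v1])
    then have "p (v - v1) = 0" using pv1 by simp
    then obtain u where u: "u \<in> tuples d2" "v - v1 = f u" using exact dt by blast
    have "v j = (\<Sum>i<d1. p v i * r i j) + (\<Sum>i<d2. u i * r (d1 + i) j)" for j
    proof -
      have "v j = v1 j + f u j" using fun_cong[OF u(2), of j] by (simp add: algebra_simps)
      then show ?thesis unfolding fexp[OF u(1)] v1_def by (simp add: r_def)
    qed
    then show ?thesis using u(1) by blast
  qed
  then have "\<forall>v\<in>tuples d. \<exists>u. u \<in> tuples d2 \<and> v = (\<lambda>j. (\<Sum>i<d1. p v i * r i j) + (\<Sum>i<d2. u i * r (d1 + i) j))"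
    by (intro ballI)
  from bchoice[OF this] obtain U where
    "\<forall>v\<in>tuples d. U v \<in> tuples d2 \<and> v = (\<lambda>j. (\<Sum>i<d1. p v i * r i j) + (\<Sum>i<d2. U v i * r (d1 + i) j))"
    by (rule exE)
  note U' = bspec[OF this]
  have U: "U v \<in> tuples d2" "v = (\<lambda>j. (\<Sum>i<d1. p v i * r i j) + (\<Sum>i<d2. U v i * r (d1 + i) j))"
    if "v \<in> tuples d" for v using conjunct1[OF U'[OF that]] conjunct2[OF U'[OF that]] .
  define g where "g = mat d d (\<lambda>(i, j). r i j)"
  define h where "h = mat d d (\<lambda>(i, j). if j < d1 then p (e i) j else U (e i) (j - d1))"
  have car: "g \<in> carrier_mat d d" "h \<in> carrier_mat d d" unfolding g_def h_def by auto
  have "h * g = 1\<^sub>m d"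
  proof (rule eq_matI)
    fix i j assume "i < dim_row (1\<^sub>m d :: 'k mat)" "j < dim_col (1\<^sub>m d :: 'k mat)"
    then have ij: "i < d" "j < d" by auto
    have ij': "i < d1 + d2" "j < d1 + d2" using ij by (auto simp: d_def)
    have "(h * g) $$ (i, j) = (\<Sum>l<d. h $$ (i, l) * g $$ (l, j))" by (rule mat_mult_entry[OF car(2,1) ij])
    also have "\<dots> = (\<Sum>l<d1. p (e i) l * r l j) + (\<Sum>l<d2. U (e i) l * r (d1 + l) j)"
      unfolding h_def g_def d_def sum_lessThan_add using ij' by simp
    also have "\<dots> = e i j" using fun_cong[OF U(2)[OF et[OF ij(1)]], of j] by simp
    finally show "(h * g) $$ (i, j) = 1\<^sub>m d $$ (i, j)" using ij by (simp add: e_def)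
  qed (use car in auto)
  then have gh: "mat_inverse_pair d g h"
    unfolding mat_inverse_pair_def using mat_mult_left_right_inverse[OF car(2,1)] car by simp
  \<comment> \<open>The submodule coordinates of the lift \<open>w i\<close> acted on by
    \<open>a\<close>; its quotient coordinates are dictated by \<open>m1\<close>.\<close>
  define D where "D = (\<lambda>(a, i, j). if i < d1 \<and> j < d2 then U (row_act d m (w i) a) j else 0)"
  have rowg: "(g * m a) $$ (i, j) = row_act d m (r i) a j" if "i < d" "j < d" for a i j
    unfolding mat_mult_entry[OF car(1) mod_varD(1)[OF m] that] using that by (simp add: g_def row_act_def)
  have gm: "g * m a = block_mod d1 d2 m1 D m2 a * g" for a
  proof (rule eq_matI)
    have bc: "block_mod d1 d2 m1 D m2 a \<in> carrier_mat d d" unfolding d_def by (rule block_mod_carrier)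
    show "dim_row (g * m a) = dim_row (block_mod d1 d2 m1 D m2 a * g)"
      "dim_col (g * m a) = dim_col (block_mod d1 d2 m1 D m2 a * g)"
      using car bc mod_varD(1)[OF m, of a] by auto
    fix i j assume "i < dim_row (block_mod d1 d2 m1 D m2 a * g)" "j < dim_col (block_mod d1 d2 m1 D m2 a * g)"
    then have ij: "i < d" "j < d" using car bc by auto
    have "(block_mod d1 d2 m1 D m2 a * g) $$ (i, j) = (\<Sum>l<d. block_mod d1 d2 m1 D m2 a $$ (i, l) * g $$ (l, j))"
      by (rule mat_mult_entry[OF bc car(1) ij])
    also have "\<dots> = (\<Sum>l<d1. block_mod d1 d2 m1 D m2 a $$ (i, l) * r l j) +
        (\<Sum>l<d2. block_mod d1 d2 m1 D m2 a $$ (i, d1 + l) * r (d1 + l) j)"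
      using ij(2) unfolding d_def sum_lessThan_add g_def by simp
    finally have B: "(block_mod d1 d2 m1 D m2 a * g) $$ (i, j) = \<dots>" .
    have "i < d1 + d2" using ij(1) by (simp add: d_def)
    then show "(g * m a) $$ (i, j) = (block_mod d1 d2 m1 D m2 a * g) $$ (i, j)"
    proof (cases rule: less_add_cases)
      case 1
      have v: "row_act d m (w i) a \<in> tuples d" by (rule row_act_mem)
      have "p (row_act d m (w i) a) = row_act d1 m1 (e i) a"
        using right_homD(4)[OF p w(1)[OF 1]] w(2)[OF 1] by simp
      then have pv: "p (row_act d m (w i) a) l = m1 a $$ (i, l)" if "l < d1" for l
        using that 1 by (simp add: row_act_def e_def if_distrib[of "\<lambda>x. x * _"] cong: if_cong)
      have "(g * m a) $$ (i, j) = row_act d m (w i) a j" using rowg[OF ij] 1 by (simp add: r_def)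
      also have "\<dots> = (\<Sum>l<d1. p (row_act d m (w i) a) l * r l j) + (\<Sum>l<d2. U (row_act d m (w i) a) l * r (d1 + l) j)"
        using fun_cong[OF U(2)[OF v], of j] .
      also have "\<dots> = (block_mod d1 d2 m1 D m2 a * g) $$ (i, j)"
        unfolding B using 1 pv by (simp add: block_mod_entry D_def)
      finally show ?thesis .
    next
      case (2 k)
      have "row_act d m (f (e k)) a = f (row_act d2 m2 (e k) a)"
        using right_homD(4)[OF f et[OF 2(1)]] by simp
      also have "\<dots> = (\<lambda>j. \<Sum>l<d2. row_act d2 m2 (e k) a l * r (d1 + l) j)" by (rule fexp[OF row_act_mem])
      finally have "(g * m a) $$ (i, j) = (\<Sum>l<d2. row_act d2 m2 (e k) a l * r (d1 + l) j)"
        using rowg[OF ij] 2 by (simp add: r_def)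
      also have "\<dots> = (\<Sum>l<d2. m2 a $$ (k, l) * r (d1 + l) j)"
        using 2 by (intro sum.cong) (auto simp: row_act_def e_def if_distrib[of "\<lambda>x. x * _"] cong: if_cong)
      also have "\<dots> = (block_mod d1 d2 m1 D m2 a * g) $$ (i, j)"
        unfolding B using 2 by (simp add: block_mod_entry)
      finally show ?thesis .
    qed
  qed
  have conj: "conj_mod g h m = block_mod d1 d2 m1 D m2"
  proof
    fix a
    have "block_mod d1 d2 m1 D m2 a \<in> carrier_mat d d" unfolding d_def by (rule block_mod_carrier)
    then show "conj_mod g h m a = block_mod d1 d2 m1 D m2 a"
      unfolding conj_mod_def gm using mat_inverse_pairD[OF gh] by (simp add: assoc_mult_mat[of _ d d _ d _ d])
  qed
  have "D \<in> derivs scale d1 m1 d2 m2"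
    by (rule derivs_of_block) (use conj conj_mod_var[OF gh m] in \<open>auto simp: d_def D_def\<close>)
  with gh conj show ?thesis unfolding d_def by blast
qed

section \<open>Linear algebra in function spaces: quotients, images, finite supports\<close>

section \<open>Dimensions of quotients\<close>

context vector_space
begin

lemma fd_basis:
  assumes "subspace V" "V \<subseteq> span F" "finite F"
  obtains B where "B \<subseteq> V" "independent B" "finite B" "span B = V" "card B = dim V"
proof -
  obtain B where B: "B \<subseteq> V" "independent B" "V \<subseteq> span B" "card B = dim V" by (rule basis_exists)
  have "finite B" using independent_span_bound[OF assms(3) B(2)] B(1) assms(2) by blast
  with B span_subspace[OF B(1,3) assms(1)] that show ?thesis by blast
qed

lemma fd_dim_mono:
  assumes "V \<subseteq> W" "W \<subseteq> span F" "finite F"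
  shows "dim V \<le> dim W"
proof -
  obtain B where B: "B \<subseteq> V" "independent B" "V \<subseteq> span B" "card B = dim V" by (rule basis_exists)
  obtain C where C: "C \<subseteq> W" "independent C" "W \<subseteq> span C" "card C = dim W" by (rule basis_exists)
  have "finite C" using independent_span_bound[OF assms(3) C(2)] C(1) assms(2) by blast
  then show ?thesis using independent_span_bound[OF _ B(2), of C] B C assms(1) by auto
qed

lemma fd_dim_eq:
  assumes V: "subspace V" and "V \<subseteq> W" "W \<subseteq> span F" "finite F" "dim V = dim W"
  shows "V = W"
proof (rule ccontr)
  assume "V \<noteq> W"
  then obtain w where w: "w \<in> W" "w \<notin> V" using assms(2) by blast
  obtain B where B: "B \<subseteq> V" "independent B" "finite B" "span B = V" "card B = dim V"
    using fd_basis[OF V, of F] assms(2-4) by blast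
  have "w \<notin> B" using B(1) w(2) by blast
  have "independent (insert w B)" using B(2,4) w(2) by (intro independent_insertI) auto
  moreover have "insert w B \<subseteq> W" using w(1) B(1) assms(2) by blast
  ultimately have "card (insert w B) \<le> dim W"
    using fd_dim_mono[of "insert w B" W F] assms(3,4) dim_eq_card_independent[of "insert w B"] by simp
  then show False using B(3,5) \<open>w \<notin> B\<close> assms(5) by simp
qed

text \<open>Since the span of \<open>B\<close> meets \<open>W\<close> only in zero, a basis of
  \<open>W\<close> adjoined to \<open>B\<close> is a basis of \<open>V\<close>.\<close>

lemma quotient_basis_card:
  assumes V: "subspace V" "V \<subseteq> span F" "finite F" and W: "subspace W" "W \<subseteq> V"
    and B: "B \<subseteq> V" "independent B" "span B \<inter> W = {0}" "V \<subseteq> span (B \<union> W)"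
  shows "finite B" "card B + dim W = dim V"
proof -
  obtain C where C: "C \<subseteq> W" "independent C" "finite C" "span C = W" "card C = dim W"
    using fd_basis[OF W(1), of F] V W(2) by blast
  show fB: "finite B" using independent_span_bound[OF V(3) B(2)] B(1) V(2) by blast
  have "independent (B \<union> T)" if "T \<subseteq> C" for T
    using finite_subset[OF that C(3)] that
  proof (induction T rule: finite_induct)
    case empty
    then show ?case using B(2) by simp
  next
    case (insert a T)
    have ind: "independent (insert a T)" using independent_mono[OF C(2) insert.prems] .
    have "a \<notin> span (B \<union> T)"
    proof
      assume "a \<in> span (B \<union> T)"
      then obtain x y where xy: "a = x + y" "x \<in> span B" "y \<in> span T" unfolding span_Un by blast
      have "a \<in> W" "y \<in> W" using insert.prems C(1,4) xy(3) span_mono[of T C] by auto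
      then have "x \<in> W" using xy(1) subspace_diff[OF W(1), of a y] by simp
      then have "x = 0" using xy(2) B(3) by blast
      then have "a \<in> span T" using xy by simp
      then show False using ind insert.hyps(2) by (metis insert_Diff_single Diff_insert_absorb dependent_def insertI1)
    qed
    then show ?case using insert by (simp add: independent_insertI)
  qed
  then have ind: "independent (B \<union> C)" by blast
  have "B \<inter> C = {}"
  proof (rule ccontr)
    assume "B \<inter> C \<noteq> {}"
    then obtain b where b: "b \<in> B" "b \<in> C" by blast
    have "b \<in> span B" using b(1) by (rule span_base)
    moreover have "b \<in> W" using b(2) C(1) by blast
    ultimately have "b = 0" using B(3) by blast
    then have "0 \<in> B" using b(1) by simp
    then show False using B(2) dependent_zero by blast
  qed
  have "W \<subseteq> span (B \<union> C)" using C(4) span_mono[of C "B \<union> C"] by blast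
  moreover have "B \<subseteq> span (B \<union> C)" using span_base by blast
  ultimately have "span (B \<union> W) \<subseteq> span (B \<union> C)" by (intro span_minimal) auto
  then have "dim V = card (B \<union> C)"
    using B(1,4) C(1) W(2) ind by (intro dim_unique[OF _ _ _ refl]) auto
  then show "card B + dim W = dim V"
    using card_Un_disjoint[OF fB C(3) \<open>B \<inter> C = {}\<close>] C(5) by simp
qed

text \<open>Extend a basis of \<open>W\<close> to one of \<open>V\<close> and keep the new vectors.
  Together with \<open>quotient_basis_card\<close> this shows that the choice in
  \<open>quotient_dim\<close> is possible and does not affect the value.\<close>

lemma quotient_basis_exists:
  assumes V: "subspace V" "V \<subseteq> span F" "finite F" and W: "subspace W" "W \<subseteq> V"
  shows "\<exists>B. B \<subseteq> V \<and> independent B \<and> span B \<inter> W = {0} \<and> V \<subseteq> span (B \<union> W)"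
proof -
  obtain C where C: "C \<subseteq> W" "independent C" "finite C" "span C = W" "card C = dim W"
    using fd_basis[OF W(1), of F] V W(2) by blast
  obtain E where E: "C \<subseteq> E" "E \<subseteq> V" "independent E" "V \<subseteq> span E"
    using maximal_independent_subset_extend[of C V] C(1,2) W(2) by blast
  have fE: "finite E" using independent_span_bound[OF V(3) E(3)] E(2) V(2) by blast
  define B where "B = E - C"
  have BC: "E = B \<union> C" "B \<inter> C = {}" "finite B" using E(1) fE by (auto simp: B_def)
  have "x = 0" if x: "x \<in> span B" "x \<in> W" for x
  proof -
    obtain u where u: "x = (\<Sum>v\<in>B. u v *s v)" using x(1) span_finite[OF BC(3)] by auto
    obtain w where w: "x = (\<Sum>v\<in>C. w v *s v)" using x(2) C(4) span_finite[OF C(3)] by auto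
    define z where "z v = (if v \<in> B then u v else - w v)" for v
    have "(\<Sum>v\<in>E. z v *s v) = (\<Sum>v\<in>B. z v *s v) + (\<Sum>v\<in>C. z v *s v)"
      unfolding BC(1) by (rule sum.union_disjoint[OF BC(3) C(3) BC(2)])
    also have "(\<Sum>v\<in>B. z v *s v) = x" unfolding u z_def by (intro sum.cong) auto
    also have "(\<Sum>v\<in>C. z v *s v) = - x"
      unfolding w z_def sum_negf[symmetric] using BC(2) by (intro sum.cong) auto
    finally have "(\<Sum>v\<in>E. z v *s v) = 0" by simp
    then have "z v = 0" if "v \<in> B" for v using independentD[OF E(3) fE order.refl] that BC(1) by blast
    then show ?thesis unfolding u z_def by (intro sum.neutral) (metis scale_zero_left)
  qed
  moreover have "0 \<in> span B \<inter> W" using W(1) span_zero subspace_0 by blast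
  moreover have "span E \<subseteq> span (B \<union> W)" unfolding BC(1) using C(1) by (intro span_mono) blast
  ultimately show ?thesis
    using E(2-4) BC(1) independent_mono[OF E(3), of B] by (intro exI[of _ B]) blast
qed

end

context vector_space_pair
begin

lemma inj_image_dim:
  assumes lin: "Vector_Spaces.linear s1 s2 f" and V: "vs1.subspace V" and inj: "inj_on f V"
  shows "vs2.dim (f ` V) = vs1.dim V"
proof -
  interpret f: Vector_Spaces.linear s1 s2 f by (rule lin)
  obtain B where B: "B \<subseteq> V" "vs1.independent B" "V \<subseteq> vs1.span B" "card B = vs1.dim V" by (rule vs1.basis_exists)
  have sp: "vs1.span B = V" by (rule vs1.span_subspace[OF B(1,3) V])
  have "vs2.independent (f ` B)" by (rule f.independent_injective_image[OF B(2)]) (simp add: sp inj)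
  moreover have "f ` V \<subseteq> vs2.span (f ` B)" unfolding f.span_image sp by simp
  moreover have "card (f ` B) = card B" using inj B(1) by (intro card_image) (auto intro: inj_on_subset)
  ultimately show ?thesis using B(1,4) by (intro vs2.dim_unique) auto
qed

lemma inj_image_fd:
  assumes lin: "Vector_Spaces.linear s1 s2 f" and V: "vs1.subspace V" and inj: "inj_on f V"
    and F: "f ` V \<subseteq> vs2.span F" "finite F"
  obtains E where "finite E" "V \<subseteq> vs1.span E"
proof -
  interpret f: Vector_Spaces.linear s1 s2 f by (rule lin)
  obtain B where B: "B \<subseteq> V" "vs1.independent B" "V \<subseteq> vs1.span B" "card B = vs1.dim V" by (rule vs1.basis_exists)
  have sp: "vs1.span B = V" by (rule vs1.span_subspace[OF B(1,3) V])
  have "vs2.independent (f ` B)" by (rule f.independent_injective_image[OF B(2)]) (simp add: sp inj)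
  then have "finite (f ` B)" using vs2.independent_span_bound[OF F(2)] F(1) B(1) by blast
  then have "finite B" using finite_imageD inj B(1) inj_on_subset by blast
  with B(3) that show ?thesis by blast
qed

end

definition fscale :: "'k::field \<Rightarrow> ('j \<Rightarrow> 'k) \<Rightarrow> ('j \<Rightarrow> 'k)" where
  "fscale c f = (\<lambda>j. c * f j)"

interpretation fs: vector_space fscale
  by unfold_locales (auto simp: fscale_def fun_eq_iff algebra_simps)

interpretation fn: vector_space fun_scale
  by (rule vector_space_fun_scale)

interpretation fsfn: vector_space_pair fscale fun_scale ..

interpretation fsfs: vector_space_pair fscale fscale ..

lemma fs_linearI:
  assumes "\<And>f g. T (f + g) = T f + T g" "\<And>c f. T (fscale c f) = fscale c (T f)"
  shows "Vector_Spaces.linear fscale fscale T"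
  unfolding Vector_Spaces.linear_iff by (intro conjI allI assms fs.vector_space_axioms)

lemma quotient_dim_eq:
  assumes V: "fn.subspace V" "V \<subseteq> fn.span F" "finite F" and W: "fn.subspace W" "W \<subseteq> V"
  shows "quotient_dim V W + fn.dim W = fn.dim V"
proof -
  define B where "B = (SOME B. B \<subseteq> V \<and> \<not> fn.dependent B \<and> fn.span B \<inter> W = {0} \<and> V \<subseteq> fn.span (B \<union> W))"
  have "B \<subseteq> V \<and> \<not> fn.dependent B \<and> fn.span B \<inter> W = {0} \<and> V \<subseteq> fn.span (B \<union> W)"
    unfolding B_def by (rule someI_ex) (rule fn.quotient_basis_exists[OF V W])
  then have "card B + fn.dim W = fn.dim V" by (intro fn.quotient_basis_card[OF V W]) auto
  then show ?thesis unfolding quotient_dim_def B_def .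
qed

definition supp_in :: "'j set \<Rightarrow> ('j \<Rightarrow> 'k::zero) set" where
  "supp_in J = {v. \<forall>j. j \<notin> J \<longrightarrow> v j = 0}"

definition unit_fun :: "'j \<Rightarrow> ('j \<Rightarrow> 'k::{zero,one})" where
  "unit_fun j = (\<lambda>i. if i = j then 1 else 0)"

lemma sum_fun_apply: "(\<Sum>i\<in>S. f i) x = (\<Sum>i\<in>S. f i x)"
  for f :: "'i \<Rightarrow> 'x \<Rightarrow> 'b::comm_monoid_add"
  by (induction S rule: infinite_finite_induct) auto

lemma supp_in_subspace: "fs.subspace (supp_in J)"
  unfolding fs.subspace_def supp_in_def by (auto simp: fscale_def)

lemma supp_in_sum:
  assumes "finite J" "v \<in> supp_in J"
  shows "v = (\<Sum>j\<in>J. fscale (v j) (unit_fun j))"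
proof
  fix x
  have "(\<Sum>j\<in>J. fscale (v j) (unit_fun j)) x = (\<Sum>j\<in>J. if j = x then v x else 0)"
    unfolding sum_fun_apply fscale_def unit_fun_def by (intro sum.cong) auto
  then show "v x = (\<Sum>j\<in>J. fscale (v j) (unit_fun j)) x" using assms by (auto simp: supp_in_def)
qed

lemma supp_in_span:
  assumes "finite J"
  shows "supp_in J = fs.span (unit_fun ` J :: ('j \<Rightarrow> 'k::field) set)"
proof
  show "fs.span (unit_fun ` J) \<subseteq> (supp_in J :: ('j \<Rightarrow> 'k) set)"
    by (rule fs.span_minimal[OF _ supp_in_subspace]) (auto simp: supp_in_def unit_fun_def)
  show "supp_in J \<subseteq> fs.span (unit_fun ` J :: ('j \<Rightarrow> 'k) set)"
  proof
    fix v :: "'j \<Rightarrow> 'k" assume "v \<in> supp_in J"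
    from supp_in_sum[OF assms this] show "v \<in> fs.span (unit_fun ` J)"
      by (metis (no_types, lifting) fs.span_base fs.span_scale fs.span_sum image_eqI)
  qed
qed

lemma supp_in_dim:
  assumes "finite J"
  shows "fs.dim (supp_in J :: ('j \<Rightarrow> 'k::field) set) = card J"
proof -
  have inj: "inj_on (unit_fun :: 'j \<Rightarrow> 'j \<Rightarrow> 'k) J"
    by (rule inj_onI) (metis unit_fun_def zero_neq_one)
  have "fs.independent (unit_fun ` J :: ('j \<Rightarrow> 'k) set)"
    unfolding fs.dependent_finite[OF finite_imageI[OF assms]]
  proof
    assume "\<exists>u. (\<exists>v\<in>unit_fun ` J. u v \<noteq> 0) \<and> (\<Sum>v\<in>unit_fun ` J. fscale (u v) v) = (0 :: 'j \<Rightarrow> 'k)"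
    then obtain u j where u: "j \<in> J" "u (unit_fun j) \<noteq> 0" "(\<Sum>v\<in>unit_fun ` J. fscale (u v) v) = (0 :: 'j \<Rightarrow> 'k)" by blast
    have "(\<Sum>i\<in>J. fscale (u (unit_fun i)) (unit_fun i)) = (0 :: 'j \<Rightarrow> 'k)"
      using u(3) by (simp add: sum.reindex[OF inj])
    then have "(\<Sum>i\<in>J. fscale (u (unit_fun i)) (unit_fun i) j) = (0 :: 'k)"
      using sum_fun_apply[of "\<lambda>i. fscale (u (unit_fun i)) (unit_fun i)" J j] by simp
    moreover have "(\<Sum>i\<in>J. fscale (u (unit_fun i)) (unit_fun i) j) = (\<Sum>i\<in>J. if i = j then u (unit_fun j) else 0)"
      by (intro sum.cong) (auto simp: fscale_def unit_fun_def)
    ultimately show False using u(1,2) assms by simp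
  qed
  then show ?thesis
    unfolding supp_in_span[OF assms] fs.dim_span using fs.dim_eq_card_independent card_image[OF inj] by metis
qed

section \<open>Ext as derivations modulo inner derivations\<close>

section \<open>Ext as derivations modulo inner derivations\<close>

definition inner_deriv :: "nat \<Rightarrow> ('a \<Rightarrow> 'k::field mat) \<Rightarrow> nat \<Rightarrow> ('a \<Rightarrow> 'k mat) \<Rightarrow> (nat \<times> nat \<Rightarrow> 'k) \<Rightarrow>
    ('a \<times> nat \<times> nat \<Rightarrow> 'k)" where
  "inner_deriv c m e n h = (\<lambda>(a, i, j). if i < c \<and> j < e then
     (\<Sum>l<e. h (i, l) * n a $$ (l, j)) - (\<Sum>l<c. m a $$ (i, l) * h (l, j)) else 0)"

definition inner_derivs :: "nat \<Rightarrow> ('a \<Rightarrow> 'k::field mat) \<Rightarrow> nat \<Rightarrow> ('a \<Rightarrow> 'k mat) \<Rightarrow>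
    ('a \<times> nat \<times> nat \<Rightarrow> 'k) set" where
  "inner_derivs c m e n = inner_deriv c m e n ` supp_in ({..<c} \<times> {..<e})"

lemma derivs_subspace: "fs.subspace (derivs scale c m e n)"
  unfolding fs.subspace_def
proof (intro conjI ballI allI)
  show "0 \<in> derivs scale c m e n" by (rule derivsI) auto
  fix D D' assume D: "D \<in> derivs scale c m e n" "D' \<in> derivs scale c m e n"
  show "D + D' \<in> derivs scale c m e n"
    by (rule derivsI) (simp_all add: derivsD[OF D(1)] derivsD[OF D(2)] algebra_simps sum.distrib)
next
  fix s D assume D: "D \<in> derivs scale c m e n"
  show "fscale s D \<in> derivs scale c m e n"
    by (rule derivsI) (simp_all add: fscale_def derivsD[OF D] algebra_simps sum_distrib_left)
qed

lemma linear_inner_deriv: "Vector_Spaces.linear fscale fscale (inner_deriv c m e n)"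
  by (rule fs_linearI)
    (auto simp: fun_eq_iff inner_deriv_def fscale_def algebra_simps sum.distrib sum_distrib_left)

lemma inner_derivs_subspace: "fs.subspace (inner_derivs c m e n)"
  unfolding inner_derivs_def
  by (rule fsfs.linear_subspace_image[OF linear_inner_deriv supp_in_subspace])

lemma inner_deriv_mem:
  fixes m n :: "'a::ring_1 \<Rightarrow> 'k::field mat"
  assumes m: "m \<in> mod_var scale c" and n: "n \<in> mod_var scale e"
  shows "inner_deriv c m e n h \<in> derivs scale c m e n"
proof (rule derivsI)
  note em = mod_var_entry[OF m] and en = mod_var_entry[OF n]
  fix i j assume ij: "i < c" "j < e"
  show "inner_deriv c m e n h (a + b, i, j) = inner_deriv c m e n h (a, i, j) + inner_deriv c m e n h (b, i, j)" for a b
    using ij by (simp add: inner_deriv_def em en algebra_simps sum.distrib)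
  show "inner_deriv c m e n h (scale s a, i, j) = s * inner_deriv c m e n h (a, i, j)" for a s
    using ij by (simp add: inner_deriv_def em en algebra_simps sum_distrib_left)
  have "(\<Sum>l<e. h (i, l) * (if l = j then 1 else 0)) = h (i, j)" "(\<Sum>l<c. (if i = l then 1 else 0) * h (l, j)) = h (i, j)"
    using ij by (simp_all add: if_distrib[of "\<lambda>x. _ * x"] if_distrib[of "\<lambda>x. x * _"] cong: if_cong)
  then show "inner_deriv c m e n h (1, i, j) = 0"
    using ij by (simp add: inner_deriv_def em en)
  show "inner_deriv c m e n h (a * b, i, j) = (\<Sum>l<c. m a $$ (i, l) * inner_deriv c m e n h (b, l, j)) +
      (\<Sum>l<e. inner_deriv c m e n h (a, i, l) * n b $$ (l, j))" for a b
  proof -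
    have "(\<Sum>l<e. h (i, l) * (\<Sum>k<e. n a $$ (l, k) * n b $$ (k, j))) = (\<Sum>k<e. (\<Sum>l<e. h (i, l) * n a $$ (l, k)) * n b $$ (k, j))"
      unfolding sum_distrib_left sum_distrib_right by (subst sum.swap) (simp add: mult.assoc)
    moreover have "(\<Sum>l<c. (\<Sum>k<c. m a $$ (i, k) * m b $$ (k, l)) * h (l, j)) = (\<Sum>k<c. m a $$ (i, k) * (\<Sum>l<c. m b $$ (k, l) * h (l, j)))"
      unfolding sum_distrib_left sum_distrib_right by (subst sum.swap) (simp add: mult.assoc)
    moreover have "(\<Sum>k<c. m a $$ (i, k) * (\<Sum>l<e. h (k, l) * n b $$ (l, j))) = (\<Sum>l<e. (\<Sum>k<c. m a $$ (i, k) * h (k, l)) * n b $$ (l, j))"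
      unfolding sum_distrib_left sum_distrib_right by (subst sum.swap) (simp add: mult.assoc)
    ultimately show ?thesis
      using ij by (simp add: inner_deriv_def em en right_diff_distrib left_diff_distrib sum_subtractf)
  qed
qed (auto simp: inner_deriv_def)

lemma inner_derivs_subset:
  fixes m n :: "'a::ring_1 \<Rightarrow> 'k::field mat"
  assumes "m \<in> mod_var scale c" "n \<in> mod_var scale e"
  shows "inner_derivs c m e n \<subseteq> derivs scale c m e n"
  unfolding inner_derivs_def using inner_deriv_mem[OF assms] by blast

lemma syzygy_iff:
  "w \<in> syzygy c m \<longleftrightarrow> w \<in> tuples c \<and> (\<forall>j<c. (\<Sum>i<c. m (w i) $$ (i, j)) = 0)"
proof -
  have "free_cover c m w j = (if j < c then \<Sum>i<c. m (w i) $$ (i, j) else 0)" for j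
  proof -
    have "free_cover c m w j = (\<Sum>i<c. if j < c then \<Sum>k<c. (if k = i then 1 else 0) * m (w i) $$ (k, j) else 0)"
      unfolding free_cover_def row_act_def by (simp add: sum_fun_apply)
    also have "\<dots> = (\<Sum>i<c. if j < c then m (w i) $$ (i, j) else 0)"
      by (intro sum.cong) (auto simp: if_distrib[of "\<lambda>x. x * _"] cong: if_cong)
    finally show ?thesis by auto
  qed
  then show ?thesis unfolding syzygy_def by (auto simp: fun_eq_iff)
qed

text \<open>A derivation extends to the free module by applying it to component \<open>i\<close> of
  \<open>w\<close>, taking row \<open>i\<close> and summing over \<open>i\<close>; this is the
  restriction to the syzygies, where it is a module homomorphism.\<close>

definition ext_map :: "nat \<Rightarrow> ('a::ring_1 \<Rightarrow> 'k::field mat) \<Rightarrow> nat \<Rightarrow> ('a \<times> nat \<times> nat \<Rightarrow> 'k) \<Rightarrow>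
    (nat \<Rightarrow> 'a) \<Rightarrow> (nat \<Rightarrow> 'k)" where
  "ext_map c m e D = (\<lambda>w j. if w \<in> syzygy c m \<and> j < e then \<Sum>i<c. D (w i, i, j) else 0)"

lemma linear_ext_map: "Vector_Spaces.linear fscale fun_scale (ext_map c m e)"
  unfolding Vector_Spaces.linear_iff
  by (intro conjI allI fs.vector_space_axioms fn.vector_space_axioms)
    (auto simp: fun_eq_iff ext_map_def fscale_def fun_scale_def sum.distrib sum_distrib_left)

lemma derivs_diff:
  assumes "D \<in> derivs scale c m e n"
  shows "D (a - b, i, j) = D (a, i, j) - D (b, i, j)"
proof (cases "i < c \<and> j < e")
  case True
  then have "D ((a - b) + b, i, j) = D (a - b, i, j) + D (b, i, j)" using derivsD(2)[OF assms] by blast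
  then show ?thesis by simp
qed (simp add: derivsD(1)[OF assms])

lemma derivs_zero: "D \<in> derivs scale c m e n \<Longrightarrow> D (0, i, j) = 0"
  using derivs_diff[of D scale c m e n 0 0] by simp

lemma mod_var_diff:
  assumes "m \<in> mod_var scale d" "i < d" "j < d"
  shows "m (a - b) $$ (i, j) = m a $$ (i, j) - m b $$ (i, j)"
  using mod_var_entry(1)[OF assms, of "a - b" b] by simp

lemma mod_var_zero: "m \<in> mod_var scale d \<Longrightarrow> i < d \<Longrightarrow> j < d \<Longrightarrow> m 0 $$ (i, j) = 0"
  using mod_var_diff[of m scale d i j 0 0] by simp

lemma syzygy_add:
  assumes "m \<in> mod_var scale c" "u \<in> syzygy c m" "v \<in> syzygy c m"
  shows "u + v \<in> syzygy c m"
  using assms(2,3) unfolding syzygy_iff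
  by (auto simp: tuples_def mod_var_entry[OF assms(1)] sum.distrib)

lemma syzygy_free_act:
  assumes "m \<in> mod_var scale c" "u \<in> syzygy c m"
  shows "free_act u a \<in> syzygy c m"
proof -
  have "(\<Sum>i<c. m (u i * a) $$ (i, j)) = 0" if "j < c" for j
  proof -
    have "(\<Sum>i<c. m (u i * a) $$ (i, j)) = (\<Sum>i<c. \<Sum>l<c. m (u i) $$ (i, l) * m a $$ (l, j))"
      using that by (intro sum.cong) (auto simp: mod_var_entry[OF assms(1)])
    also have "\<dots> = (\<Sum>l<c. (\<Sum>i<c. m (u i) $$ (i, l)) * m a $$ (l, j))"
      by (subst sum.swap) (simp add: sum_distrib_right)
    also have "\<dots> = 0" using assms(2) unfolding syzygy_iff by (intro sum.neutral) auto
    finally show ?thesis .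
  qed
  then show ?thesis using assms(2) unfolding syzygy_iff by (auto simp: free_act_def tuples_def)
qed

text \<open>By the product rule the deviation from compatibility with the action is a combination of
  the sums of \<open>m (w i) $$ (i, l)\<close> over \<open>i\<close>, and these vanish for a syzygy
  \<open>w\<close>.\<close>

lemma ext_map_hom:
  assumes m: "m \<in> mod_var scale c" and D: "D \<in> derivs scale c m e n"
  shows "ext_map c m e D \<in> right_hom (syzygy c m) free_act (tuples e) (row_act e n)"
proof -
  have "ext_map c m e D (u + v) = ext_map c m e D u + ext_map c m e D v"
    if "u \<in> syzygy c m" "v \<in> syzygy c m" for u v
  proof
    fix j
    have "(\<Sum>i<c. D (u i + v i, i, j)) = (\<Sum>i<c. D (u i, i, j)) + (\<Sum>i<c. D (v i, i, j))" if "j < e"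
      unfolding sum.distrib[symmetric] using that by (intro sum.cong) (auto simp: derivsD(2)[OF D])
    then show "ext_map c m e D (u + v) j = (ext_map c m e D u + ext_map c m e D v) j"
      using that syzygy_add[OF m that] by (simp add: ext_map_def)
  qed
  moreover have "ext_map c m e D (free_act w a) = row_act e n (ext_map c m e D w) a" if w: "w \<in> syzygy c m" for w a
  proof
    fix j
    show "ext_map c m e D (free_act w a) j = row_act e n (ext_map c m e D w) a j"
    proof (cases "j < e")
      case True
      have "ext_map c m e D (free_act w a) j = (\<Sum>i<c. D (w i * a, i, j))"
        using True syzygy_free_act[OF m w] by (simp add: ext_map_def free_act_def)
      also have "\<dots> = (\<Sum>i<c. (\<Sum>l<c. m (w i) $$ (i, l) * D (a, l, j)) + (\<Sum>l<e. D (w i, i, l) * n a $$ (l, j)))"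
        using True by (intro sum.cong) (auto simp: derivsD(4)[OF D])
      also have "\<dots> = (\<Sum>l<c. (\<Sum>i<c. m (w i) $$ (i, l)) * D (a, l, j)) + (\<Sum>l<e. (\<Sum>i<c. D (w i, i, l)) * n a $$ (l, j))"
        unfolding sum.distrib sum_distrib_right by (intro arg_cong2[where f = "(+)"] sum.swap)
      also have "(\<Sum>l<c. (\<Sum>i<c. m (w i) $$ (i, l)) * D (a, l, j)) = 0"
        using w unfolding syzygy_iff by (intro sum.neutral) auto
      finally show ?thesis using True w by (simp add: row_act_def ext_map_def)
    qed (simp add: ext_map_def row_act_def)
  qed
  ultimately show ?thesis
    unfolding right_hom_def by (auto simp: ext_map_def tuples_def fun_eq_iff)
qed

context fg_algebra
begin

text \<open>The syzygy \<open>e\<^sub>i a - \<Sum>\<^sub>l m(a)\<^sub>i\<^sub>l e\<^sub>l\<close>; the value of a homomorphism at these syzygies is a derivation.\<close>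

definition basic_syzygy :: "nat \<Rightarrow> ('a \<Rightarrow> 'k mat) \<Rightarrow> 'a \<Rightarrow> nat \<Rightarrow> (nat \<Rightarrow> 'a)" where
  "basic_syzygy c m a i = (\<lambda>l. if l < c then (if l = i then a else 0) - scale (m a $$ (i, l)) 1 else 0)"

lemma basic_syzygy_mem:
  assumes m: "m \<in> MV c" and i: "i < c"
  shows "basic_syzygy c m a i \<in> syzygy c m"
  unfolding syzygy_iff
proof (intro conjI allI impI)
  show "basic_syzygy c m a i \<in> tuples c" by (simp add: basic_syzygy_def tuples_def)
  fix j assume j: "j < c"
  have "(\<Sum>l<c. m (basic_syzygy c m a i l) $$ (l, j)) = (\<Sum>l<c. (if l = i then m a $$ (i, j) else 0) - (if l = j then m a $$ (i, j) else 0))"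
    using j by (intro sum.cong) (auto simp: basic_syzygy_def mod_var_diff[OF m] mod_var_zero[OF m] mod_var_entry[OF m])
  then show "(\<Sum>l<c. m (basic_syzygy c m a i l) $$ (l, j)) = 0"
    using i j by (simp add: sum_subtractf)
qed

lemma ext_map_basic_syzygy:
  assumes m: "m \<in> MV c" and D: "D \<in> derivs scale c m e n" and ij: "i < c" "j < e"
  shows "ext_map c m e D (basic_syzygy c m a i) j = D (a, i, j)"
proof -
  have "ext_map c m e D (basic_syzygy c m a i) j = (\<Sum>l<c. D (basic_syzygy c m a i l, l, j))"
    using basic_syzygy_mem[OF m ij(1)] ij(2) by (simp add: ext_map_def)
  also have "\<dots> = (\<Sum>l<c. if l = i then D (a, i, j) else 0)"
    using ij(2) by (intro sum.cong)
      (auto simp: basic_syzygy_def derivs_diff[OF D] derivs_zero[OF D] derivsD(3,5)[OF D])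
  finally show ?thesis using ij(1) by simp
qed

lemma inj_ext_map:
  assumes "m \<in> MV c"
  shows "inj_on (ext_map c m e) (derivs scale c m e n)"
proof (rule inj_onI)
  fix D D' assume D: "D \<in> derivs scale c m e n" "D' \<in> derivs scale c m e n" and eq: "ext_map c m e D = ext_map c m e D'"
  have "D (a, i, j) = D' (a, i, j)" for a i j
  proof (cases "i < c \<and> j < e")
    case True
    then show ?thesis
      using ext_map_basic_syzygy[OF assms D(1), of i j a] ext_map_basic_syzygy[OF assms D(2), of i j a] eq by simp
  qed (simp add: derivsD(1)[OF D(1)] derivsD(1)[OF D(2)])
  then show "D = D'" by (auto simp: fun_eq_iff)
qed

lemma right_hom_sum:
  assumes f: "f \<in> right_hom (syzygy c m) free_act (tuples e) (row_act e n)" and m: "m \<in> MV c"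
    and u: "\<And>i. i \<in> S \<Longrightarrow> u i \<in> syzygy c m"
  shows "(\<Sum>i\<in>S. u i) \<in> syzygy c m \<and> f (\<Sum>i\<in>S. u i) = (\<Sum>i\<in>S. f (u i))"
proof -
  have z: "0 \<in> syzygy c m" unfolding syzygy_iff by (auto simp: tuples_def mod_var_zero[OF m])
  have "f 0 = f 0 + f 0" using right_homD(3)[OF f z z] by (simp only: add_0_left)
  then have f0: "f 0 = 0" by (metis add_cancel_right_right)
  show ?thesis
    using u
    by (induction S rule: infinite_finite_induct)
      (auto simp: z f0 right_homD(3)[OF f] intro!: syzygy_add[OF m])
qed

text \<open>The basic syzygies satisfy, as functions of \<open>a\<close>, the rules of a derivation,
  and every syzygy is a sum of them. So the values of \<open>f\<close> on them form a derivation
  from which \<open>f\<close> is recovered.\<close>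

lemma surj_ext_map:
  assumes m: "m \<in> MV c" and n: "n \<in> MV e"
    and f: "f \<in> right_hom (syzygy c m) free_act (tuples e) (row_act e n)"
  shows "\<exists>D\<in>derivs scale c m e n. ext_map c m e D = f"
proof -
  define \<omega> where "\<omega> = basic_syzygy c m"
  have \<omega>: "\<omega> a i \<in> syzygy c m" if "i < c" for a i unfolding \<omega>_def by (rule basic_syzygy_mem[OF m that])
  define D where "D = (\<lambda>(a, i, j). if i < c \<and> j < e then f (\<omega> a i) j else 0)"
  note em = mod_var_entry[OF m]
  have sc1: "x * scale s 1 = scale s x" for x s using scale_mult_right[of s x 1] by simp
  have "D \<in> derivs scale c m e n"
  proof (rule derivsI)
    fix i j assume ij: "i < c" "j < e"
    show "D (a + b, i, j) = D (a, i, j) + D (b, i, j)" for a b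
    proof -
      have "\<omega> (a + b) i = \<omega> a i + \<omega> b i"
        using ij(1) by (auto simp: \<omega>_def basic_syzygy_def fun_eq_iff em scale_left_distrib)
      then show ?thesis using ij right_homD(3)[OF f \<omega>[OF ij(1)] \<omega>[OF ij(1)], of a b] by (simp add: D_def)
    qed
    show "D (scale s a, i, j) = s * D (a, i, j)" for a s
    proof -
      have "\<omega> (scale s a) i = free_act (\<omega> a i) (scale s 1)"
        using ij(1) by (auto simp: \<omega>_def basic_syzygy_def free_act_def fun_eq_iff em sc1 scale_right_diff_distrib)
      then show ?thesis
        using ij right_homD(4)[OF f \<omega>[OF ij(1)], of a "scale s 1"] row_act_scale[OF n right_homD(1)[OF f \<omega>[OF ij(1)]]]
        by (simp add: D_def)
    qed
    show "D (1, i, j) = 0"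
    proof -
      have "\<omega> 1 i = 0" using ij(1) by (auto simp: \<omega>_def basic_syzygy_def fun_eq_iff em)
      then show ?thesis using right_hom_sum[OF f m, of "{}"] ij by (simp add: D_def)
    qed
    show "D (a * b, i, j) = (\<Sum>l<c. m a $$ (i, l) * D (b, l, j)) + (\<Sum>l<e. D (a, i, l) * n b $$ (l, j))" for a b
    proof -
      have fa: "free_act (\<omega> b l) (scale (m a $$ (i, l)) 1) \<in> syzygy c m" if "l < c" for l
        by (rule syzygy_free_act[OF m \<omega>[OF that]])
      have s: "(\<Sum>l<c. free_act (\<omega> b l) (scale (m a $$ (i, l)) 1)) \<in> syzygy c m"
        "f (\<Sum>l<c. free_act (\<omega> b l) (scale (m a $$ (i, l)) 1)) = (\<Sum>l<c. f (free_act (\<omega> b l) (scale (m a $$ (i, l)) 1)))"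
        using right_hom_sum[OF f m, of "{..<c}" "\<lambda>l. free_act (\<omega> b l) (scale (m a $$ (i, l)) 1)"] fa by auto
      \<comment> \<open>This identity between syzygies becomes the product rule when
        \<open>f\<close> is applied.\<close>
      have "\<omega> (a * b) i = free_act (\<omega> a i) b + (\<Sum>l<c. free_act (\<omega> b l) (scale (m a $$ (i, l)) 1))"
      proof
        fix k
        show "\<omega> (a * b) i k = (free_act (\<omega> a i) b + (\<Sum>l<c. free_act (\<omega> b l) (scale (m a $$ (i, l)) 1))) k"
        proof (cases "k < c")
          case True
          have "(\<Sum>l<c. free_act (\<omega> b l) (scale (m a $$ (i, l)) 1)) k =
              (\<Sum>l<c. (if l = k then scale (m a $$ (i, k)) b else 0) - scale (m a $$ (i, l) * m b $$ (l, k)) 1)"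
            unfolding sum_fun_apply using True
            by (intro sum.cong) (auto simp: free_act_def \<omega>_def basic_syzygy_def sc1 scale_right_diff_distrib)
          also have "\<dots> = scale (m a $$ (i, k)) b - scale (m (a * b) $$ (i, k)) 1"
            using True ij(1) by (simp add: sum_subtractf em scale_sum_left)
          moreover have "scale (m a $$ (i, k)) 1 * b = scale (m a $$ (i, k)) b"
            using scale_mult_left[of "m a $$ (i, k)" 1 b] by simp
          ultimately show ?thesis
            using True by (simp add: free_act_def \<omega>_def basic_syzygy_def left_diff_distrib)
        qed (simp add: \<omega>_def basic_syzygy_def free_act_def sum_fun_apply)
      qed
      then have "f (\<omega> (a * b) i) = row_act e n (f (\<omega> a i)) b + (\<Sum>l<c. f (free_act (\<omega> b l) (scale (m a $$ (i, l)) 1)))"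
        using right_homD(3)[OF f syzygy_free_act[OF m \<omega>[OF ij(1)]] s(1)] s(2) right_homD(4)[OF f \<omega>[OF ij(1)]] by simp
      then have "f (\<omega> (a * b) i) j = row_act e n (f (\<omega> a i)) b j + (\<Sum>l<c. f (free_act (\<omega> b l) (scale (m a $$ (i, l)) 1)) j)"
        by (simp add: sum_fun_apply)
      also have "(\<Sum>l<c. f (free_act (\<omega> b l) (scale (m a $$ (i, l)) 1)) j) = (\<Sum>l<c. m a $$ (i, l) * D (b, l, j))"
      proof (intro sum.cong refl)
        fix l assume "l \<in> {..<c}"
        then have l: "l < c" by simp
        show "f (free_act (\<omega> b l) (scale (m a $$ (i, l)) 1)) j = m a $$ (i, l) * D (b, l, j)"
          using right_homD(4)[OF f \<omega>[OF l]] row_act_scale[OF n right_homD(1)[OF f \<omega>[OF l]]] l ij by (simp add: D_def)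
      qed
      also have "row_act e n (f (\<omega> a i)) b j = (\<Sum>l<e. D (a, i, l) * n b $$ (l, j))"
        using ij by (simp add: row_act_def D_def)
      finally show ?thesis using ij by (simp add: D_def add.commute)
    qed
  qed (auto simp: D_def)
  moreover have "ext_map c m e D = f"
  proof (rule ext)
    fix w
    show "ext_map c m e D w = f w"
    proof (cases "w \<in> syzygy c m")
      case True
      \<comment> \<open>The scalar corrections in the basic syzygies add up to zero exactly because
        \<open>w\<close> is a syzygy.\<close>
      have w: "(\<Sum>i<c. \<omega> (w i) i) = w"
      proof
        fix l
        show "(\<Sum>i<c. \<omega> (w i) i) l = w l"
        proof (cases "l < c")
          case l: True
          have "(\<Sum>i<c. \<omega> (w i) i) l = (\<Sum>i<c. (if i = l then w l else 0) - scale (m (w i) $$ (i, l)) 1)"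
            unfolding sum_fun_apply using l by (intro sum.cong) (auto simp: \<omega>_def basic_syzygy_def)
          also have "\<dots> = w l - scale (\<Sum>i<c. m (w i) $$ (i, l)) 1"
            using l by (simp add: sum_subtractf scale_sum_left)
          finally show ?thesis using True l unfolding syzygy_iff by simp
        next
          case False
          then show ?thesis using True unfolding syzygy_iff sum_fun_apply by (simp add: \<omega>_def basic_syzygy_def tuples_def)
        qed
      qed
      have "f w = (\<Sum>i<c. f (\<omega> (w i) i))"
        using right_hom_sum[OF f m, of "{..<c}" "\<lambda>i. \<omega> (w i) i"] \<omega> unfolding w by auto
      then have "f w j = (\<Sum>i<c. f (\<omega> (w i) i) j)" for j by (simp add: sum_fun_apply)
      moreover have "f w j = 0" if "\<not> j < e" for j using right_homD(1)[OF f True] that by (simp add: tuples_def)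
      ultimately show ?thesis using True by (auto simp: ext_map_def D_def fun_eq_iff)
    next
      case False
      then show ?thesis using right_homD(2)[OF f False] by (auto simp: ext_map_def fun_eq_iff)
    qed
  qed
  ultimately show ?thesis by blast
qed

lemma ext_map_derivs:
  assumes "m \<in> MV c" "n \<in> MV e"
  shows "ext_map c m e ` derivs scale c m e n = right_hom (syzygy c m) free_act (tuples e) (row_act e n)"
  using ext_map_hom[OF assms(1)] surj_ext_map[OF assms] by blast

lemma row_act_mult:
  assumes "n \<in> MV e"
  shows "row_act e n v (a * b) = row_act e n (row_act e n v a) b"
proof
  fix j
  have "(\<Sum>i<e. v i * (\<Sum>l<e. n a $$ (i, l) * n b $$ (l, j))) = (\<Sum>l<e. (\<Sum>i<e. v i * n a $$ (i, l)) * n b $$ (l, j))"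
    unfolding sum_distrib_left sum_distrib_right by (subst sum.swap) (simp add: mult.assoc)
  then show "row_act e n v (a * b) j = row_act e n (row_act e n v a) b j"
    by (simp add: row_act_def mod_var_entry[OF assms])
qed

text \<open>A homomorphism from the free module is determined by the images of the free generators,
  that is, by a matrix \<open>h\<close>. On syzygies it agrees with the map belonging to the inner
  derivation of \<open>h\<close>, because the terms with \<open>m\<close> on the left of
  \<open>h\<close> sum to zero there.\<close>

lemma ext_map_inner_derivs:
  assumes m: "m \<in> MV c" and n: "n \<in> MV e"
  shows "ext_map c m e ` inner_derivs c m e n =
    (\<lambda>f w. if w \<in> syzygy c m then f w else 0) ` right_hom (tuples c) free_act (tuples e) (row_act e n)"
    (is "_ = ?res ` ?H")
proof -
  define \<psi> where "\<psi> h w = (\<lambda>j. if w \<in> tuples c \<and> j < e then \<Sum>i<c. \<Sum>l<e. h (i, l) * n (w i) $$ (l, j) else 0)"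
    for h :: "nat \<times> nat \<Rightarrow> 'k" and w
  have \<psi>: "\<psi> h \<in> ?H" for h
  proof -
    have "\<psi> h (u + v) = \<psi> h u + \<psi> h v" if "u \<in> tuples c" "v \<in> tuples c" for u v
      using that by (auto simp: \<psi>_def fun_eq_iff tuples_def mod_var_entry[OF n] distrib_left sum.distrib)
    moreover have "\<psi> h (free_act u a) = row_act e n (\<psi> h u) a" if "u \<in> tuples c" for u a
    proof
      fix j
      have t: "free_act u a \<in> tuples c" using that by (simp add: free_act_def tuples_def)
      have "(\<Sum>l<e. h (i, l) * (\<Sum>k<e. n (u i) $$ (l, k) * n a $$ (k, j))) = (\<Sum>k<e. (\<Sum>l<e. h (i, l) * n (u i) $$ (l, k)) * n a $$ (k, j))" for i
        unfolding sum_distrib_left sum_distrib_right by (subst sum.swap) (simp add: mult.assoc)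
      then have "(\<Sum>i<c. \<Sum>l<e. h (i, l) * (\<Sum>k<e. n (u i) $$ (l, k) * n a $$ (k, j))) =
          (\<Sum>k<e. (\<Sum>i<c. \<Sum>l<e. h (i, l) * n (u i) $$ (l, k)) * n a $$ (k, j))"
        by (simp add: sum_distrib_right) (rule sum.swap)
      then show "\<psi> h (free_act u a) j = row_act e n (\<psi> h u) a j"
        using that t by (auto simp: \<psi>_def free_act_def row_act_def mod_var_entry[OF n])
    qed
    ultimately show ?thesis unfolding right_hom_def by (auto simp: \<psi>_def tuples_def fun_eq_iff)
  qed
  have eq: "ext_map c m e (inner_deriv c m e n h) = ?res (\<psi> h)" for h
  proof (intro ext)
    fix w j
    show "ext_map c m e (inner_deriv c m e n h) w j = ?res (\<psi> h) w j"
    proof (cases "w \<in> syzygy c m \<and> j < e")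
      case True
      have "(\<Sum>i<c. \<Sum>l<c. m (w i) $$ (i, l) * h (l, j)) = (\<Sum>l<c. (\<Sum>i<c. m (w i) $$ (i, l)) * h (l, j))"
        by (subst sum.swap) (simp add: sum_distrib_right)
      also have "\<dots> = 0" using True unfolding syzygy_iff by (intro sum.neutral) auto
      finally show ?thesis
        using True by (auto simp: ext_map_def inner_deriv_def \<psi>_def sum_subtractf syzygy_iff)
    qed (auto simp: ext_map_def \<psi>_def)
  qed
  have "\<exists>h\<in>supp_in ({..<c} \<times> {..<e}). f = \<psi> h" if f: "f \<in> ?H" for f
  proof -
    define \<epsilon> :: "nat \<Rightarrow> nat \<Rightarrow> 'a" where "\<epsilon> i = (\<lambda>l. if l = i then 1 else 0)" for i
    define h where "h = (\<lambda>(i, j). if i < c \<and> j < e then f (\<epsilon> i) j else 0)"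
    have \<epsilon>t: "\<epsilon> i \<in> tuples c" if "i < c" for i using that by (auto simp: \<epsilon>_def tuples_def)
    have ft: "free_act u a \<in> tuples c" if "u \<in> tuples c" for u :: "nat \<Rightarrow> 'a" and a using that by (simp add: free_act_def tuples_def)
    have z: "(0 :: nat \<Rightarrow> 'a) \<in> tuples c" by (simp add: tuples_def)
    have "f 0 = f 0 + f 0" using right_homD(3)[OF f z z] by (simp only: add_0_left)
    then have f0: "f 0 = 0" by (metis add_cancel_right_right)
    have add: "(\<Sum>i\<in>S. u i) \<in> tuples c \<and> f (\<Sum>i\<in>S. u i) = (\<Sum>i\<in>S. f (u i))"
      if "\<And>i. i \<in> S \<Longrightarrow> u i \<in> tuples c" for S and u :: "nat \<Rightarrow> nat \<Rightarrow> 'a"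
      using that
    proof (induction S rule: infinite_finite_induct)
      case (insert x F)
      have x: "u x \<in> tuples c" using insert.prems by blast
      have IH: "sum u F \<in> tuples c" "f (sum u F) = (\<Sum>i\<in>F. f (u i))" using insert.IH insert.prems by blast+
      have "u x + sum u F \<in> tuples c" using x IH(1) by (simp add: tuples_def)
      then show ?case
        unfolding sum.insert[OF insert.hyps] IH(2)[symmetric] right_homD(3)[OF f x IH(1), symmetric] by blast
    qed (auto simp: z f0)
    have "f w j = \<psi> h w j" for w j
    proof (cases "w \<in> tuples c \<and> j < e")
      case True
      have "w = (\<Sum>i<c. free_act (\<epsilon> i) (w i))"
      proof
        fix l
        have "(\<Sum>i<c. free_act (\<epsilon> i) (w i)) l = (\<Sum>i<c. if i = l then w l else 0)"
          unfolding sum_fun_apply by (intro sum.cong) (auto simp: free_act_def \<epsilon>_def)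
        then show "w l = (\<Sum>i<c. free_act (\<epsilon> i) (w i)) l" using True by (auto simp: tuples_def)
      qed
      then have "f w = (\<Sum>i<c. f (free_act (\<epsilon> i) (w i)))"
        using add[of "{..<c}" "\<lambda>i. free_act (\<epsilon> i) (w i)"] \<epsilon>t ft by simp
      then have "f w j = (\<Sum>i<c. f (free_act (\<epsilon> i) (w i)) j)"
        by (simp only: sum_fun_apply)
      also have "\<dots> = (\<Sum>i<c. row_act e n (f (\<epsilon> i)) (w i) j)"
        by (intro sum.cong) (auto simp: right_homD(4)[OF f \<epsilon>t])
      finally show ?thesis using True by (simp add: \<psi>_def row_act_def h_def)
    next
      case False
      have "f w j = 0"
      proof (cases "w \<in> tuples c")
        case True
        then show ?thesis using False right_homD(1)[OF f True] by (simp add: tuples_def)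
      qed (simp add: right_homD(2)[OF f])
      then show ?thesis using False by (auto simp: \<psi>_def)
    qed
    then have "f = \<psi> h" by (auto simp: fun_eq_iff)
    moreover have "h \<in> supp_in ({..<c} \<times> {..<e})" by (auto simp: supp_in_def h_def)
    ultimately show ?thesis by blast
  qed
  then have "?H = \<psi> ` supp_in ({..<c} \<times> {..<e})" using \<psi> by blast
  then show ?thesis
    unfolding inner_derivs_def by (simp only: image_image eq)
qed

definition restrict_gens :: "nat \<Rightarrow> nat \<Rightarrow> ('a \<times> nat \<times> nat \<Rightarrow> 'k) \<Rightarrow> ('a \<times> nat \<times> nat \<Rightarrow> 'k)" where
  "restrict_gens c e D = (\<lambda>q. if q \<in> X \<times> {..<c} \<times> {..<e} then D q else 0)"

lemma linear_restrict_gens: "Vector_Spaces.linear fscale fscale (restrict_gens c e)"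
  by (rule fs_linearI) (auto simp: fun_eq_iff restrict_gens_def fscale_def)

lemma restrict_gens_supp: "restrict_gens c e D \<in> supp_in (X \<times> {..<c} \<times> {..<e})"
  by (auto simp: supp_in_def restrict_gens_def)

lemma derivs_zero_on_gens:
  assumes D: "D \<in> derivs scale c t e p" and z: "\<And>x i j. x \<in> X \<Longrightarrow> D (x, i, j) = 0"
  shows "D = 0"
proof -
  have "\<forall>i j. D (a, i, j) = 0" for a
  proof -
    have "a \<in> generated_subalgebra scale X" using generated by simp
    then show ?thesis
    proof induction
      case (gen x)
      then show ?case using z by blast
    next
      case one
      then show ?case using derivsD(1,5)[OF D] by (metis (full_types))
    next
      case (add a b)
      then show ?case using derivsD(1,2)[OF D] by (metis (full_types) add_0)
    next
      case (mult a b)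
      have "D (a * b, i, j) = 0" for i j
        by (cases "i < c \<and> j < e") (simp_all add: derivsD(1,4)[OF D] mult.IH)
      then show ?case by blast
    next
      case (scale a s)
      then show ?case using derivsD(1,3)[OF D] by (metis (full_types) mult_zero_right)
    qed
  qed
  then show ?thesis by (auto simp: fun_eq_iff)
qed

lemma inj_restrict_gens: "inj_on (restrict_gens c e) (derivs scale c t e p)"
proof (rule inj_onI)
  fix D D' assume D: "D \<in> derivs scale c t e p" "D' \<in> derivs scale c t e p"
    and eq: "restrict_gens c e D = restrict_gens c e D'"
  have "D - D' = 0"
  proof (rule derivs_zero_on_gens)
    show "D - D' \<in> derivs scale c t e p" using fs.subspace_diff[OF derivs_subspace D] .
    fix x i j assume "x \<in> X"
    then show "(D - D') (x, i, j) = 0"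
      using fun_cong[OF eq, of "(x, i, j)"] derivsD(1)[OF D(1), of i j x] derivsD(1)[OF D(2), of i j x]
      by (auto simp: restrict_gens_def split: if_splits)
  qed
  then show "D = D'" by simp
qed

lemma derivs_fd:
  obtains F where "finite F" "derivs scale c t e p \<subseteq> fs.span F"
proof (rule fsfs.inj_image_fd[OF linear_restrict_gens derivs_subspace inj_restrict_gens])
  have fin: "finite (X \<times> {..<c} \<times> {..<e})" using finite_X by simp
  show "finite (unit_fun ` (X \<times> {..<c} \<times> {..<e}))" using fin by blast
  show "restrict_gens c e ` derivs scale c t e p \<subseteq> fs.span (unit_fun ` (X \<times> {..<c} \<times> {..<e}))"
    unfolding supp_in_span[OF fin, symmetric] using restrict_gens_supp by blast
qed

text \<open>\<open>ext_map\<close> is injective and identifies the derivations with the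
  homomorphisms on the syzygies, and the inner derivations with those that extend to the free
  module. Finite dimension comes from the fact that a derivation is determined by its values on the
  generators.\<close>

theorem ext1_dim_derivs:
  assumes m: "m \<in> MV c" and n: "n \<in> MV e"
  shows "ext1_dim c m e n + fs.dim (inner_derivs c m e n) = fs.dim (derivs scale c m e n)"
proof -
  obtain F where F: "finite F" "derivs scale c m e n \<subseteq> fs.span F" by (rule derivs_fd)
  have sub: "inner_derivs c m e n \<subseteq> derivs scale c m e n" by (rule inner_derivs_subset[OF m n])
  have inj: "inj_on (ext_map c m e) (derivs scale c m e n)" by (rule inj_ext_map[OF m])
  interpret L: Vector_Spaces.linear fscale fun_scale "ext_map c m e" by (rule linear_ext_map)
  have "ext_map c m e ` derivs scale c m e n \<subseteq> fn.span (ext_map c m e ` F)"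
    unfolding L.span_image using F(2) by blast
  then have "quotient_dim (ext_map c m e ` derivs scale c m e n) (ext_map c m e ` inner_derivs c m e n) +
      fn.dim (ext_map c m e ` inner_derivs c m e n) = fn.dim (ext_map c m e ` derivs scale c m e n)"
    using F(1) sub
    by (intro quotient_dim_eq L.subspace_image derivs_subspace inner_derivs_subspace) auto
  then show ?thesis
    unfolding fsfn.inj_image_dim[OF linear_ext_map derivs_subspace inj]
      fsfn.inj_image_dim[OF linear_ext_map inner_derivs_subspace inj_on_subset[OF inj sub]]
    unfolding ext1_dim_def ext_map_derivs[OF m n] ext_map_inner_derivs[OF m n] .
qed

end

section \<open>Semicontinuity of the spaces of derivations and inner derivations\<close>

section \<open>Semicontinuity\<close>

text \<open>Restriction to the coordinates in \<open>B\<close> embeds \<open>V\<close> into a space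
  of dimension \<open>card B\<close>, and it is onto exactly when the dimensions agree.\<close>

lemma dim_coordinates:
  fixes V :: "('j \<Rightarrow> 'k::field) set"
  assumes V: "fs.subspace V" and B: "finite B" and inj: "\<And>v. v \<in> V \<Longrightarrow> (\<And>b. b \<in> B \<Longrightarrow> v b = 0) \<Longrightarrow> v = 0"
  shows "fs.dim V \<le> card B" "(\<forall>w. \<exists>v\<in>V. \<forall>b\<in>B. v b = w b) \<longleftrightarrow> fs.dim V = card B"
proof -
  define r :: "('j \<Rightarrow> 'k) \<Rightarrow> ('j \<Rightarrow> 'k)" where "r v = (\<lambda>j. if j \<in> B then v j else 0)" for v
  have lin: "Vector_Spaces.linear fscale fscale r"
    by (rule fs_linearI) (auto simp: r_def fscale_def fun_eq_iff)
  have injr: "inj_on r V"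
  proof (rule inj_onI)
    fix u v assume uv: "u \<in> V" "v \<in> V" "r u = r v"
    have "(u - v) b = 0" if "b \<in> B" for b using fun_cong[OF uv(3), of b] that by (simp add: r_def)
    then have "u - v = 0" using inj[OF fs.subspace_diff[OF V uv(1,2)]] by blast
    then show "u = v" by simp
  qed
  have sub: "r ` V \<subseteq> supp_in B" by (auto simp: supp_in_def r_def)
  have dim: "fs.dim (r ` V) = fs.dim V" by (rule fsfs.inj_image_dim[OF lin V injr])
  have fin: "finite (unit_fun ` B :: ('j \<Rightarrow> 'k) set)" using B by simp
  have sp: "supp_in B \<subseteq> fs.span (unit_fun ` B :: ('j \<Rightarrow> 'k) set)" using supp_in_span[OF B, where 'k='k] by simp
  show "fs.dim V \<le> card B"
    using fs.fd_dim_mono[OF sub sp fin] unfolding dim supp_in_dim[OF B] .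
  show "(\<forall>w. \<exists>v\<in>V. \<forall>b\<in>B. v b = w b) \<longleftrightarrow> fs.dim V = card B"
  proof
    assume *: "\<forall>w. \<exists>v\<in>V. \<forall>b\<in>B. v b = w b"
    have "supp_in B \<subseteq> r ` V"
    proof
      fix w :: "'j \<Rightarrow> 'k" assume w: "w \<in> supp_in B"
      obtain v where "v \<in> V" "\<forall>b\<in>B. v b = w b" using * by blast
      moreover from this have "r v = w" using w by (auto simp: r_def supp_in_def fun_eq_iff)
      ultimately show "w \<in> r ` V" by blast
    qed
    then have "r ` V = supp_in B" using sub by blast
    then show "fs.dim V = card B" using dim supp_in_dim[OF B, where 'k='k] by simp
  next
    assume eq: "fs.dim V = card B"
    have "r ` V = supp_in B"
      by (rule fs.fd_dim_eq[OF fsfs.linear_subspace_image[OF lin V] sub sp fin]) (simp add: dim supp_in_dim[OF B] eq)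
    show "\<forall>w. \<exists>v\<in>V. \<forall>b\<in>B. v b = w b"
    proof
      fix w :: "'j \<Rightarrow> 'k"
      have "r w \<in> supp_in B" by (auto simp: r_def supp_in_def)
      then have "r w \<in> r ` V" using \<open>r ` V = supp_in B\<close> by simp
      then obtain v where v: "v \<in> V" "r w = r v" by (rule imageE)
      have "v b = w b" if "b \<in> B" for b using fun_cong[OF v(2), of b] that by (simp add: r_def)
      then show "\<exists>v\<in>V. \<forall>b\<in>B. v b = w b" using v(1) by blast
    qed
  qed
qed

lemma inner_derivs_fd: "inner_derivs c m e n \<subseteq> fs.span (inner_deriv c m e n ` unit_fun ` ({..<c} \<times> {..<e}))"
proof -
  interpret L: Vector_Spaces.linear fscale fscale "inner_deriv c m e n" by (rule linear_inner_deriv)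
  show ?thesis unfolding inner_derivs_def supp_in_span[OF finite_cartesian_product[OF finite_lessThan finite_lessThan]] L.span_image by simp
qed

text \<open>Lower semicontinuity of rank. By the chart, near \<open>x0\<close> a kernel vector with
  zero coordinates in \<open>B\<close> is zero, so \<open>inner_deriv\<close> is injective on the
  space \<open>K\<close> of vectors supported off \<open>B\<close>. At \<open>x0\<close> this space
  is a complement of the kernel, so its image is everything there.\<close>

lemma (in fun_algebra) inner_derivs_lsc:
  fixes t p :: "'x \<Rightarrow> 'a \<Rightarrow> 'k mat"
  assumes t: "\<And>a i j. i < c \<Longrightarrow> j < c \<Longrightarrow> (\<lambda>x. t x a $$ (i, j)) \<in> R"
    and p: "\<And>a i j. i < e \<Longrightarrow> j < e \<Longrightarrow> (\<lambda>x. p x a $$ (i, j)) \<in> R"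
  shows "\<exists>s\<in>R. s x0 \<noteq> 0 \<and> (\<forall>x. s x \<noteq> 0 \<longrightarrow>
    fs.dim (inner_derivs c (t x0) e (p x0)) \<le> fs.dim (inner_derivs c (t x) e (p x)))"
proof -
  define J where "J = {..<c} \<times> {..<e}"
  have J: "finite J" by (simp add: J_def)
  define \<kappa> where "\<kappa> a i j = (\<lambda>(k, l) x. (if k = i then p x a $$ (l, j) else 0) - (if l = j then t x a $$ (i, k) else 0))" for a i j
  define \<Lambda> where "\<Lambda> = {\<kappa> a i j | a i j. i < c \<and> j < e}"
  have R\<Lambda>: "l q \<in> R" if "l \<in> \<Lambda>" "q \<in> J" for l q
  proof -
    obtain a i j where l: "l = \<kappa> a i j" "i < c" "j < e" using \<open>l \<in> \<Lambda>\<close> unfolding \<Lambda>_def by blast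
    obtain k k' where q: "q = (k, k')" "k < c" "k' < e" using \<open>q \<in> J\<close> unfolding J_def by auto
    have "(\<lambda>x. if k = i then p x a $$ (k', j) else 0) \<in> R"
      using l q by (cases "k = i") (simp_all add: p const)
    moreover have "(\<lambda>x. if k' = j then t x a $$ (i, k) else 0) \<in> R"
      using l q by (cases "k' = j") (simp_all add: t const)
    ultimately show ?thesis unfolding l(1) q(1) \<kappa>_def prod.case by (rule diff)
  qed
  have ker: "(\<Sum>q\<in>J. \<kappa> a i j q x * h q) = inner_deriv c (t x) e (p x) h (a, i, j)" if "i < c" "j < e" for a i j x h
  proof -
    have "(\<Sum>q\<in>J. \<kappa> a i j q x * h q) = (\<Sum>k<c. \<Sum>l<e. (if k = i then p x a $$ (l, j) * h (k, l) else 0) - (if l = j then t x a $$ (i, k) * h (k, l) else 0))"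
      unfolding J_def sum.cartesian_product' \<kappa>_def prod.case
      by (intro sum.cong refl) (auto simp: left_diff_distrib)
    also have "\<dots> = (\<Sum>k<c. \<Sum>l<e. if k = i then p x a $$ (l, j) * h (k, l) else 0) - (\<Sum>k<c. \<Sum>l<e. if l = j then t x a $$ (i, k) * h (k, l) else 0)"
      by (simp only: sum_subtractf)
    also have "(\<Sum>k<c. \<Sum>l<e. if k = i then p x a $$ (l, j) * h (k, l) else 0) = (\<Sum>l<e. h (i, l) * p x a $$ (l, j))"
      using that by (subst sum.swap) (auto intro!: sum.cong simp: mult.commute)
    also have "(\<Sum>k<c. \<Sum>l<e. if l = j then t x a $$ (i, k) * h (k, l) else 0) = (\<Sum>l<c. t x a $$ (i, l) * h (l, j))"
      using that by (intro sum.cong) auto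
    finally show ?thesis using that by (simp add: inner_deriv_def)
  qed
  have lk: "h \<in> lin_kernel \<Lambda> J x \<longleftrightarrow> h \<in> supp_in J \<and> inner_deriv c (t x) e (p x) h = 0" for h x
  proof -
    have "(\<forall>l\<in>\<Lambda>. (\<Sum>q\<in>J. l q x * h q) = 0) \<longleftrightarrow> (\<forall>a i j. i < c \<longrightarrow> j < e \<longrightarrow> inner_deriv c (t x) e (p x) h (a, i, j) = 0)"
    proof (intro iffI allI impI ballI)
      fix a i j assume *: "\<forall>l\<in>\<Lambda>. (\<Sum>q\<in>J. l q x * h q) = 0" "i < c" "j < e"
      then have "\<kappa> a i j \<in> \<Lambda>" unfolding \<Lambda>_def by blast
      then have "(\<Sum>q\<in>J. \<kappa> a i j q x * h q) = 0" using *(1) by blast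
      then show "inner_deriv c (t x) e (p x) h (a, i, j) = 0" unfolding ker[OF *(2,3)] .
    next
      fix l assume *: "\<forall>a i j. i < c \<longrightarrow> j < e \<longrightarrow> inner_deriv c (t x) e (p x) h (a, i, j) = 0" "l \<in> \<Lambda>"
      then obtain a i j where l: "l = \<kappa> a i j" "i < c" "j < e" unfolding \<Lambda>_def by blast
      show "(\<Sum>q\<in>J. l q x * h q) = 0" unfolding l(1) ker[OF l(2,3)] using *(1) l(2,3) by blast
    qed
    also have "\<dots> \<longleftrightarrow> inner_deriv c (t x) e (p x) h = 0"
      unfolding fun_eq_iff by (auto simp: inner_deriv_def)
    finally show ?thesis unfolding lin_kernel_def supp_in_def by blast
  qed
  obtain B s C where B: "B \<subseteq> J" "s \<in> R" "s x0 \<noteq> 0" "\<forall>j\<in>J. \<forall>b\<in>B. C j b \<in> R"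
    "\<forall>x v. s x \<noteq> 0 \<longrightarrow> v \<in> lin_kernel \<Lambda> J x \<longrightarrow> (\<forall>j\<in>J. s x * v j = (\<Sum>b\<in>B. C j b x * v b))"
    "\<forall>w. \<exists>v\<in>lin_kernel \<Lambda> J x0. \<forall>b\<in>B. v b = w b"
    using R\<Lambda> by (rule lin_kernel_chart[OF J, where \<Lambda> = \<Lambda>])
  define K where "K = (supp_in (J - B) :: (nat \<times> nat \<Rightarrow> 'k) set)"
  have dimK: "fs.dim K = card (J - B)" unfolding K_def using J by (intro supp_in_dim) simp
  have subK: "fs.subspace K" unfolding K_def by (rule supp_in_subspace)
  have inj: "inj_on (inner_deriv c (t x) e (p x)) K" if x: "s x \<noteq> 0" for x
  proof (rule inj_onI)
    interpret L: Vector_Spaces.linear fscale fscale "inner_deriv c (t x) e (p x)" by (rule linear_inner_deriv)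
    fix u v assume uv: "u \<in> K" "v \<in> K" "inner_deriv c (t x) e (p x) u = inner_deriv c (t x) e (p x) v"
    have d: "u - v \<in> K" by (rule fs.subspace_diff[OF subK uv(1,2)])
    have "inner_deriv c (t x) e (p x) (u - v) = 0" unfolding L.diff using uv(3) by simp
    moreover have "u - v \<in> supp_in J" using d unfolding K_def supp_in_def by blast
    ultimately have k: "u - v \<in> lin_kernel \<Lambda> J x" unfolding lk by blast
    have "(u - v) q = 0" for q
    proof (cases "q \<in> J - B")
      case True
      have "(\<Sum>b\<in>B. C q b x * (u - v) b) = 0"
        using d by (intro sum.neutral) (auto simp: K_def supp_in_def)
      have "q \<in> J" using True by blast
      then have "s x * (u - v) q = (\<Sum>b\<in>B. C q b x * (u - v) b)"
        by (rule B(5)[rule_format, OF x k])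
      then show ?thesis using \<open>(\<Sum>b\<in>B. C q b x * (u - v) b) = 0\<close> x by simp
    next
      case False
      then show ?thesis using d unfolding K_def supp_in_def by blast
    qed
    then have "u - v = 0" by (intro ext) simp
    then show "u = v" by simp
  qed
  have im: "inner_deriv c (t x) e (p x) ` K \<subseteq> inner_derivs c (t x) e (p x)" for x
    unfolding inner_derivs_def K_def J_def supp_in_def by blast
  have ge: "card (J - B) \<le> fs.dim (inner_derivs c (t x) e (p x))" if x: "s x \<noteq> 0" for x
    using fs.fd_dim_mono[OF im[of x] inner_derivs_fd]
    unfolding fsfs.inj_image_dim[OF linear_inner_deriv subK inj[OF x]] dimK by simp
  have "inner_derivs c (t x0) e (p x0) \<subseteq> inner_deriv c (t x0) e (p x0) ` K"
  proof
    interpret L: Vector_Spaces.linear fscale fscale "inner_deriv c (t x0) e (p x0)" by (rule linear_inner_deriv)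
    fix D assume "D \<in> inner_derivs c (t x0) e (p x0)"
    then obtain h where h: "D = inner_deriv c (t x0) e (p x0) h" "h \<in> supp_in J" unfolding inner_derivs_def J_def by blast
    obtain v where v: "v \<in> lin_kernel \<Lambda> J x0" "\<forall>b\<in>B. v b = h b" using B(6) by blast
    have vJ: "v \<in> supp_in J" and v0: "inner_deriv c (t x0) e (p x0) v = 0" using v(1) unfolding lk by blast+
    have "(h - v) j = 0" if "j \<notin> J - B" for j
    proof (cases "j \<in> B")
      case True
      then show ?thesis using v(2) by simp
    next
      case False
      then have "j \<notin> J" using that by blast
      have "h j = 0" "v j = 0" using h(2) vJ \<open>j \<notin> J\<close> unfolding supp_in_def by blast+
      then show ?thesis by simp
    qed
    then have "h - v \<in> K" unfolding K_def supp_in_def by blast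
    moreover have "inner_deriv c (t x0) e (p x0) (h - v) = D" unfolding L.diff h(1) v0 by simp
    ultimately show "D \<in> inner_deriv c (t x0) e (p x0) ` K" by blast
  qed
  then have "inner_derivs c (t x0) e (p x0) = inner_deriv c (t x0) e (p x0) ` K" using im by blast
  then have "fs.dim (inner_derivs c (t x0) e (p x0)) = card (J - B)"
    using fsfs.inj_image_dim[OF linear_inner_deriv subK inj[OF B(3)]] dimK by simp
  then show ?thesis using B(2,3) ge by auto
qed

context fg_algebra
begin

text \<open>Expanding \<open>a\<close> in the generators with the product rule gives coefficients
  that are polynomial in the entries of \<open>t\<close> and \<open>p\<close>, and the same
  expansion serves all parameters \<open>x\<close>.\<close>

lemma deriv_linear_form:
  fixes t p :: "'x \<Rightarrow> 'a \<Rightarrow> 'k mat"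
  assumes R: "fun_algebra R"
    and t: "\<And>a i j. i < c \<Longrightarrow> j < c \<Longrightarrow> (\<lambda>x. t x a $$ (i, j)) \<in> R"
    and p: "\<And>a i j. i < e \<Longrightarrow> j < e \<Longrightarrow> (\<lambda>x. p x a $$ (i, j)) \<in> R"
    and ij: "i < c" "j < e"
  shows "\<exists>l. (\<forall>q. l q \<in> R) \<and> (\<forall>x. \<forall>D\<in>derivs scale c (t x) e (p x).
    D (a, i, j) = (\<Sum>q\<in>X \<times> {..<c} \<times> {..<e}. l q x * D q))"
proof -
  interpret fun_algebra R by (rule R)
  define J where "J = X \<times> {..<c} \<times> {..<e}"
  have J: "finite J" unfolding J_def using finite_X by simp
  have "a \<in> generated_subalgebra scale X" using generated by simp
  then have "\<exists>l. (\<forall>q. l q \<in> R) \<and> (\<forall>x. \<forall>D\<in>derivs scale c (t x) e (p x). D (a, i, j) = (\<Sum>q\<in>J. l q x * D q))"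
    using ij
  proof (induction arbitrary: i j)
    case (gen x)
    define l where "l q = (\<lambda>_ :: 'x. if q = (x, i, j) then 1 else 0 :: 'k)" for q
    have "(\<Sum>q\<in>J. l q y * D q) = D (x, i, j)" for y and D :: "'a \<times> nat \<times> nat \<Rightarrow> 'k"
    proof -
      have "(\<Sum>q\<in>J. l q y * D q) = (\<Sum>q\<in>J. if q = (x, i, j) then D (x, i, j) else 0)"
        unfolding l_def by (intro sum.cong) auto
      then show ?thesis using gen J by (simp add: J_def)
    qed
    moreover have "l q \<in> R" for q unfolding l_def by (rule const)
    ultimately show ?case by (intro exI[of _ l]) simp
  next
    case one
    then show ?case by (intro exI[of _ "\<lambda>q x. 0"]) (auto simp: derivsD(5) const)
  next
    case (add a b)
    from add.IH(1)[OF add.prems] obtain l where l: "\<forall>q. l q \<in> R"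
      "\<forall>x. \<forall>D\<in>derivs scale c (t x) e (p x). D (a, i, j) = (\<Sum>q\<in>J. l q x * D q)" by (elim exE conjE)
    from add.IH(2)[OF add.prems] obtain l' where l': "\<forall>q. l' q \<in> R"
      "\<forall>x. \<forall>D\<in>derivs scale c (t x) e (p x). D (b, i, j) = (\<Sum>q\<in>J. l' q x * D q)" by (elim exE conjE)
    show ?case
    proof (intro exI[of _ "\<lambda>q x. l q x + l' q x"] conjI allI ballI)
      show "(\<lambda>x. l q x + l' q x) \<in> R" for q by (rule fun_algebra.add[OF R spec[OF l(1)] spec[OF l'(1)]])
      fix x D assume D: "D \<in> derivs scale c (t x) e (p x)"
      show "D (a + b, i, j) = (\<Sum>q\<in>J. (l q x + l' q x) * D q)"
        using derivsD(2)[OF D add.prems] bspec[OF spec[OF l(2)] D] bspec[OF spec[OF l'(2)] D]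
        by (simp add: distrib_right sum.distrib)
    qed
  next
    case (mult a b)
    have "\<forall>k. \<exists>l. k < c \<longrightarrow> (\<forall>q. l q \<in> R) \<and> (\<forall>x. \<forall>D\<in>derivs scale c (t x) e (p x). D (b, k, j) = (\<Sum>q\<in>J. l q x * D q))"
      using mult.IH(2)[OF _ mult.prems(2)] by blast
    from choice[OF this] obtain l where
      "\<forall>k. k < c \<longrightarrow> (\<forall>q. l k q \<in> R) \<and> (\<forall>x. \<forall>D\<in>derivs scale c (t x) e (p x). D (b, k, j) = (\<Sum>q\<in>J. l k q x * D q))" by (rule exE)
    note l = this[rule_format]
    have "\<forall>k. \<exists>l. k < e \<longrightarrow> (\<forall>q. l q \<in> R) \<and> (\<forall>x. \<forall>D\<in>derivs scale c (t x) e (p x). D (a, i, k) = (\<Sum>q\<in>J. l q x * D q))"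
      using mult.IH(1)[OF mult.prems(1)] by blast
    from choice[OF this] obtain l' where
      "\<forall>k. k < e \<longrightarrow> (\<forall>q. l' k q \<in> R) \<and> (\<forall>x. \<forall>D\<in>derivs scale c (t x) e (p x). D (a, i, k) = (\<Sum>q\<in>J. l' k q x * D q))" by (rule exE)
    note l' = this[rule_format]
    show ?case
    proof (intro exI[of _ "\<lambda>q x. (\<Sum>k<c. t x a $$ (i, k) * l k q x) + (\<Sum>k<e. l' k q x * p x b $$ (k, j))"] conjI allI ballI)
      show "(\<lambda>x. (\<Sum>k<c. t x a $$ (i, k) * l k q x) + (\<Sum>k<e. l' k q x * p x b $$ (k, j))) \<in> R" for q
        by (intro fun_algebra.add[OF R] sum fun_algebra.mult[OF R] t p mult.prems
            spec[OF conjunct1[OF l]] spec[OF conjunct1[OF l']]) simp_all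
      fix x D assume D: "D \<in> derivs scale c (t x) e (p x)"
      have "D (a * b, i, j) = (\<Sum>k<c. t x a $$ (i, k) * (\<Sum>q\<in>J. l k q x * D q)) + (\<Sum>k<e. (\<Sum>q\<in>J. l' k q x * D q) * p x b $$ (k, j))"
        unfolding derivsD(4)[OF D mult.prems] using l l' D by (intro arg_cong2[where f = "(+)"] sum.cong) auto
      also have "(\<Sum>k<c. t x a $$ (i, k) * (\<Sum>q\<in>J. l k q x * D q)) = (\<Sum>q\<in>J. (\<Sum>k<c. t x a $$ (i, k) * l k q x) * D q)"
        unfolding sum_distrib_left sum_distrib_right by (subst sum.swap) (simp add: mult.assoc)
      also have "(\<Sum>k<e. (\<Sum>q\<in>J. l' k q x * D q) * p x b $$ (k, j)) = (\<Sum>q\<in>J. (\<Sum>k<e. l' k q x * p x b $$ (k, j)) * D q)"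
        unfolding sum_distrib_left sum_distrib_right by (subst sum.swap) (simp add: mult_ac)
      finally show "D (a * b, i, j) = (\<Sum>q\<in>J. ((\<Sum>k<c. t x a $$ (i, k) * l k q x) + (\<Sum>k<e. l' k q x * p x b $$ (k, j))) * D q)"
        by (simp add: distrib_right sum.distrib)
    qed
  next
    case (scale a r)
    from scale.IH[OF scale.prems] obtain l where l: "\<forall>q. l q \<in> R"
      "\<forall>x. \<forall>D\<in>derivs scale c (t x) e (p x). D (a, i, j) = (\<Sum>q\<in>J. l q x * D q)" by (elim exE conjE)
    show ?case
    proof (intro exI[of _ "\<lambda>q x. r * l q x"] conjI allI ballI)
      show "(\<lambda>x. r * l q x) \<in> R" for q by (rule fun_algebra.mult[OF R const spec[OF l(1)]])
      fix x D assume D: "D \<in> derivs scale c (t x) e (p x)"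
      show "D (scale r a, i, j) = (\<Sum>q\<in>J. r * l q x * D q)"
        using derivsD(3)[OF D scale.prems] bspec[OF spec[OF l(2)] D]
        by (simp add: sum_distrib_left mult.assoc)
    qed
  qed
  then show ?thesis unfolding J_def .
qed

text \<open>Values on the generators that extend to a derivation are the solutions of a linear
  system over \<open>R\<close>; this makes derivations accessible to
  \<open>lin_kernel_chart\<close>.\<close>

lemma derivs_lin_kernel:
  fixes t p :: "'x \<Rightarrow> 'a \<Rightarrow> 'k mat"
  assumes R: "fun_algebra R"
    and t: "\<And>a i j. i < c \<Longrightarrow> j < c \<Longrightarrow> (\<lambda>x. t x a $$ (i, j)) \<in> R"
    and p: "\<And>a i j. i < e \<Longrightarrow> j < e \<Longrightarrow> (\<lambda>x. p x a $$ (i, j)) \<in> R"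
  shows "\<exists>\<Lambda>. (\<forall>l\<in>\<Lambda>. \<forall>q\<in>X \<times> {..<c} \<times> {..<e}. l q \<in> R) \<and> (\<forall>x.
    restrict_gens c e ` derivs scale c (t x) e (p x) = lin_kernel \<Lambda> (X \<times> {..<c} \<times> {..<e}) x)"
proof -
  interpret fun_algebra R by (rule R)
  define J where "J = X \<times> {..<c} \<times> {..<e}"
  \<comment> \<open>In place of a list of equations derived from the relations of the algebra, the
    system consists of all forms over \<open>R\<close> that vanish on the derivations at every
    parameter.\<close>
  define \<Lambda> where "\<Lambda> = {l. (\<forall>q. l q \<in> R) \<and> (\<forall>x. \<forall>D\<in>derivs scale c (t x) e (p x). (\<Sum>q\<in>J. l q x * D q) = 0)}"
  have "\<forall>z. \<exists>l. fst (snd z) < c \<and> snd (snd z) < e \<longrightarrow> (\<forall>q. l q \<in> R) \<and> (\<forall>x. \<forall>D\<in>derivs scale c (t x) e (p x). D z = (\<Sum>q\<in>J. l q x * D q))"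
  proof
    fix z :: "'a \<times> nat \<times> nat"
    obtain a i j where z: "z = (a, i, j)" by (rule prod_cases3)
    show "\<exists>l. fst (snd z) < c \<and> snd (snd z) < e \<longrightarrow> (\<forall>q. l q \<in> R) \<and> (\<forall>x. \<forall>D\<in>derivs scale c (t x) e (p x). D z = (\<Sum>q\<in>J. l q x * D q))"
    proof (cases "i < c \<and> j < e")
      case True
      have "\<exists>l. (\<forall>q. l q \<in> R) \<and> (\<forall>x. \<forall>D\<in>derivs scale c (t x) e (p x). D z = (\<Sum>q\<in>J. l q x * D q))"
        unfolding z J_def by (rule deriv_linear_form[OF R]) (use t p True in simp_all)
      then show ?thesis by (elim exE) (intro exI impI)
    next
      case False
      then have "\<not> (fst (snd z) < c \<and> snd (snd z) < e)" unfolding z by simp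
      then show ?thesis by (intro exI impI) (erule notE)
    qed
  qed
  from choice[OF this] obtain L where
    "\<forall>z. fst (snd z) < c \<and> snd (snd z) < e \<longrightarrow> (\<forall>q. L z q \<in> R) \<and> (\<forall>x. \<forall>D\<in>derivs scale c (t x) e (p x). D z = (\<Sum>q\<in>J. L z q x * D q))" by (rule exE)
  note L0 = this[rule_format]
  have L: "L (a, i, j) q \<in> R" "D \<in> derivs scale c (t x) e (p x) \<Longrightarrow> (\<Sum>q\<in>J. L (a, i, j) q x * D q) = D (a, i, j)"
    if "i < c" "j < e" for a i j q x D
  proof -
    have ij: "fst (snd (a, i, j)) < c \<and> snd (snd (a, i, j)) < e" using that by simp
    show "L (a, i, j) q \<in> R" by (rule spec[OF conjunct1[OF L0[OF ij]]])
    assume D: "D \<in> derivs scale c (t x) e (p x)"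
    show "(\<Sum>q\<in>J. L (a, i, j) q x * D q) = D (a, i, j)"
      by (rule bspec[OF spec[OF conjunct2[OF L0[OF ij]]] D, symmetric])
  qed
  have "restrict_gens c e ` derivs scale c (t x) e (p x) = lin_kernel \<Lambda> J x" for x
  proof
    show "restrict_gens c e ` derivs scale c (t x) e (p x) \<subseteq> lin_kernel \<Lambda> J x"
    proof
      fix v assume "v \<in> restrict_gens c e ` derivs scale c (t x) e (p x)"
      then obtain D where D: "D \<in> derivs scale c (t x) e (p x)" "v = restrict_gens c e D" by blast
      have "(\<Sum>q\<in>J. l q x * v q) = (\<Sum>q\<in>J. l q x * D q)" for l :: "_ \<Rightarrow> 'x \<Rightarrow> 'k"
        unfolding D(2) restrict_gens_def J_def by (intro sum.cong) auto
      moreover have "(\<Sum>q\<in>J. l q x * D q) = 0" if "l \<in> \<Lambda>" for l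
        using that D(1) unfolding \<Lambda>_def by blast
      moreover have "v q = 0" if "q \<notin> J" for q using that unfolding D(2) restrict_gens_def J_def by simp
      ultimately show "v \<in> lin_kernel \<Lambda> J x"
        unfolding lin_kernel_def by simp
    qed
    show "lin_kernel \<Lambda> J x \<subseteq> restrict_gens c e ` derivs scale c (t x) e (p x)"
    proof
      fix v assume v: "v \<in> lin_kernel \<Lambda> J x"
      have form: "(\<Sum>q\<in>J. l q x * v q) = 0" if "\<And>q. l q \<in> R"
        "\<And>y D. D \<in> derivs scale c (t y) e (p y) \<Longrightarrow> (\<Sum>q\<in>J. l q y * D q) = 0" for l
        using v that unfolding lin_kernel_def \<Lambda>_def by blast
      \<comment> \<open>\<open>V\<close> extends the solution \<open>v\<close> to all algebra
        elements by the forms \<open>L\<close>. Each identity required of a derivation is a form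
        vanishing on all true derivations, hence belongs to \<open>\<Lambda>\<close> and vanishes on
        \<open>v\<close>.\<close>
      define V where "V z = (\<Sum>q\<in>J. L z q x * v q)" for z
      define D where "D = (\<lambda>(a, i, j). if i < c \<and> j < e then V (a, i, j) else 0)"
      have "D \<in> derivs scale c (t x) e (p x)"
      proof (rule derivsI)
        fix i j assume ij: "i < c" "j < e"
        show "D (a + b, i, j) = D (a, i, j) + D (b, i, j)" for a b
        proof -
          have "(\<Sum>q\<in>J. (L (a + b, i, j) q x - L (a, i, j) q x - L (b, i, j) q x) * v q) = 0"
          proof (rule form)
            show "(\<lambda>x. L (a + b, i, j) q x - L (a, i, j) q x - L (b, i, j) q x) \<in> R" for q
              by (intro diff L(1) ij)
            fix y D assume D: "D \<in> derivs scale c (t y) e (p y)"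
            show "(\<Sum>q\<in>J. (L (a + b, i, j) q y - L (a, i, j) q y - L (b, i, j) q y) * D q) = 0"
              using derivsD(2)[OF D ij, of a b] by (simp add: left_diff_distrib sum_subtractf L(2)[OF ij D])
          qed
          then show ?thesis using ij by (simp add: D_def V_def left_diff_distrib sum_subtractf diff_eq_eq add.commute)
        qed
        show "D (scale r a, i, j) = r * D (a, i, j)" for a r
        proof -
          have "(\<Sum>q\<in>J. (L (scale r a, i, j) q x - r * L (a, i, j) q x) * v q) = 0"
          proof (rule form)
            show "(\<lambda>x. L (scale r a, i, j) q x - r * L (a, i, j) q x) \<in> R" for q
              by (intro diff mult const L(1) ij)
            fix y D assume D: "D \<in> derivs scale c (t y) e (p y)"
            show "(\<Sum>q\<in>J. (L (scale r a, i, j) q y - r * L (a, i, j) q y) * D q) = 0"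
              using derivsD(3)[OF D ij, of r a]
              by (simp add: left_diff_distrib sum_subtractf mult.assoc L(2)[OF ij D] flip: sum_distrib_left)
          qed
          then show ?thesis using ij by (simp add: D_def V_def left_diff_distrib sum_subtractf mult.assoc flip: sum_distrib_left)
        qed
        show "D (1, i, j) = 0"
        proof -
          have "(\<Sum>q\<in>J. L (1, i, j) q x * v q) = 0"
            by (rule form) (auto simp: L ij derivsD(5))
          then show ?thesis using ij by (simp add: D_def V_def)
        qed
        show "D (a * b, i, j) = (\<Sum>l<c. t x a $$ (i, l) * D (b, l, j)) + (\<Sum>l<e. D (a, i, l) * p x b $$ (l, j))" for a b
        proof -
          have ex: "(\<Sum>q\<in>J. (L (a * b, i, j) q y - (\<Sum>l<c. t y a $$ (i, l) * L (b, l, j) q y) - (\<Sum>l<e. L (a, i, l) q y * p y b $$ (l, j))) * w q) =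
              (\<Sum>q\<in>J. L (a * b, i, j) q y * w q) - (\<Sum>l<c. t y a $$ (i, l) * (\<Sum>q\<in>J. L (b, l, j) q y * w q)) -
              (\<Sum>l<e. (\<Sum>q\<in>J. L (a, i, l) q y * w q) * p y b $$ (l, j))" for y and w :: "_ \<Rightarrow> 'k"
          proof -
            have "(\<Sum>q\<in>J. (\<Sum>l<c. t y a $$ (i, l) * L (b, l, j) q y) * w q) = (\<Sum>l<c. t y a $$ (i, l) * (\<Sum>q\<in>J. L (b, l, j) q y * w q))"
              unfolding sum_distrib_left sum_distrib_right by (subst sum.swap) (simp add: mult.assoc)
            moreover have "(\<Sum>q\<in>J. (\<Sum>l<e. L (a, i, l) q y * p y b $$ (l, j)) * w q) = (\<Sum>l<e. (\<Sum>q\<in>J. L (a, i, l) q y * w q) * p y b $$ (l, j))"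
              unfolding sum_distrib_left sum_distrib_right by (subst sum.swap) (simp add: mult_ac)
            ultimately show ?thesis by (simp add: left_diff_distrib sum_subtractf)
          qed
          have "(\<Sum>q\<in>J. (L (a * b, i, j) q x - (\<Sum>l<c. t x a $$ (i, l) * L (b, l, j) q x) - (\<Sum>l<e. L (a, i, l) q x * p x b $$ (l, j))) * v q) = 0"
          proof (rule form)
            show "(\<lambda>x. L (a * b, i, j) q x - (\<Sum>l<c. t x a $$ (i, l) * L (b, l, j) q x) - (\<Sum>l<e. L (a, i, l) q x * p x b $$ (l, j))) \<in> R" for q
              using ij by (intro diff sum mult L(1) t p) auto
            fix y D assume D: "D \<in> derivs scale c (t y) e (p y)"
            show "(\<Sum>q\<in>J. (L (a * b, i, j) q y - (\<Sum>l<c. t y a $$ (i, l) * L (b, l, j) q y) - (\<Sum>l<e. L (a, i, l) q y * p y b $$ (l, j))) * D q) = 0"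
              unfolding ex using derivsD(4)[OF D ij, of a b] ij by (simp add: L(2)[OF _ _ D])
          qed
          then show ?thesis unfolding ex using ij by (simp add: D_def V_def diff_eq_eq add.commute)
        qed
      qed (auto simp: D_def)
      moreover have "restrict_gens c e D = v"
      proof
        fix z
        show "restrict_gens c e D z = v z"
        proof (cases "z \<in> J")
          case True
          then obtain y i j where z: "z = (y, i, j)" "y \<in> X" "i < c" "j < e" unfolding J_def by auto
          have J: "finite J" unfolding J_def using finite_X by simp
          have single: "(\<Sum>q\<in>J. (if q = z then 1 else 0) * w q) = w z" for w :: "_ \<Rightarrow> 'k"
          proof -
            have "(\<Sum>q\<in>J. (if q = z then 1 else 0) * w q) = (\<Sum>q\<in>J. if q = z then w z else 0)" by (intro sum.cong) auto
            then show ?thesis using J True by simp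
          qed
          \<comment> \<open>On a generator the chosen form \<open>L z\<close> may differ from the
            coordinate form, but the difference vanishes on derivations and therefore on
            \<open>v\<close>.\<close>
          have "(\<Sum>q\<in>J. (L z q x - (if q = z then 1 else 0)) * v q) = 0"
          proof (rule form)
            show "(\<lambda>x. L z q x - (if q = z then 1 else 0)) \<in> R" for q unfolding z(1) by (intro diff const L(1) z)
            fix y D assume D: "D \<in> derivs scale c (t y) e (p y)"
            show "(\<Sum>q\<in>J. (L z q y - (if q = z then 1 else 0)) * D q) = 0"
              unfolding left_diff_distrib sum_subtractf single using L(2)[OF z(3,4) D] z(1) by simp
          qed
          then have "V z = v z" unfolding left_diff_distrib sum_subtractf single V_def by simp
          then show ?thesis using True z by (simp add: restrict_gens_def D_def J_def)
        next
          case False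
          then have "v z = 0" using v unfolding lin_kernel_def by blast
          then show ?thesis using False by (simp add: restrict_gens_def J_def)
        qed
      qed
      ultimately show "v \<in> restrict_gens c e ` derivs scale c (t x) e (p x)" by blast
    qed
  qed
  moreover have "\<forall>l\<in>\<Lambda>. \<forall>q\<in>J. l q \<in> R" unfolding \<Lambda>_def by blast
  ultimately show ?thesis unfolding J_def by (intro exI[of _ \<Lambda>]) blast
qed

text \<open>Near \<open>x0\<close> the dimension of the space of derivations does not increase, and where it is constant every
  derivation at \<open>x0\<close> extends to a polynomial family of derivations.\<close>

theorem derivs_chart:
  fixes t p :: "'x \<Rightarrow> 'a \<Rightarrow> 'k mat"
  assumes R: "fun_algebra R"
    and t: "\<And>a i j. i < c \<Longrightarrow> j < c \<Longrightarrow> (\<lambda>x. t x a $$ (i, j)) \<in> R"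
    and p: "\<And>a i j. i < e \<Longrightarrow> j < e \<Longrightarrow> (\<lambda>x. p x a $$ (i, j)) \<in> R"
  shows "\<exists>s\<in>R. s x0 \<noteq> 0 \<and>
    (\<forall>x. s x \<noteq> 0 \<longrightarrow> fs.dim (derivs scale c (t x) e (p x)) \<le> fs.dim (derivs scale c (t x0) e (p x0))) \<and>
    (\<forall>D0\<in>derivs scale c (t x0) e (p x0). \<exists>\<sigma>. (\<forall>q\<in>X \<times> {..<c} \<times> {..<e}. \<sigma> q \<in> R \<and> \<sigma> q x0 = D0 q) \<and>
      (\<forall>x. s x \<noteq> 0 \<longrightarrow> fs.dim (derivs scale c (t x) e (p x)) = fs.dim (derivs scale c (t x0) e (p x0)) \<longrightarrow>
        (\<exists>D\<in>derivs scale c (t x) e (p x). \<forall>q\<in>X \<times> {..<c} \<times> {..<e}. D q = \<sigma> q x)))"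
proof -
  interpret fun_algebra R by (rule R)
  define J where "J = X \<times> {..<c} \<times> {..<e}"
  define Der where "Der x = derivs scale c (t x) e (p x)" for x
  have J: "finite J" unfolding J_def using finite_X by simp
  have "\<exists>\<Lambda>. (\<forall>l\<in>\<Lambda>. \<forall>q\<in>X \<times> {..<c} \<times> {..<e}. l q \<in> R) \<and> (\<forall>x.
    restrict_gens c e ` derivs scale c (t x) e (p x) = lin_kernel \<Lambda> (X \<times> {..<c} \<times> {..<e}) x)"
    by (rule derivs_lin_kernel[OF R]) (use t p in simp_all)
  then obtain \<Lambda> where \<Lambda>: "\<forall>l\<in>\<Lambda>. \<forall>q\<in>J. l q \<in> R"
    "\<forall>x. restrict_gens c e ` Der x = lin_kernel \<Lambda> J x" unfolding J_def Der_def by (elim exE conjE)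
  have R\<Lambda>: "l q \<in> R" if "l \<in> \<Lambda>" "q \<in> J" for l q using \<Lambda>(1) that by blast
  obtain B s C where B: "B \<subseteq> J" "s \<in> R" "s x0 \<noteq> 0" "\<forall>j\<in>J. \<forall>b\<in>B. C j b \<in> R"
    "\<forall>x v. s x \<noteq> 0 \<longrightarrow> v \<in> lin_kernel \<Lambda> J x \<longrightarrow> (\<forall>j\<in>J. s x * v j = (\<Sum>b\<in>B. C j b x * v b))"
    "\<forall>w. \<exists>v\<in>lin_kernel \<Lambda> J x0. \<forall>b\<in>B. v b = w b"
    using R\<Lambda> by (rule lin_kernel_chart[OF J, where \<Lambda> = \<Lambda>])
  have rg: "restrict_gens c e D q = D q" if "q \<in> J" for D q using that unfolding restrict_gens_def J_def by simp
  have eqn: "s x * D q = (\<Sum>b\<in>B. C q b x * D b)" if "s x \<noteq> 0" "D \<in> Der x" "q \<in> J" for x D q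
  proof -
    have "restrict_gens c e D \<in> lin_kernel \<Lambda> J x" using \<Lambda>(2) that(2) by blast
    then have "s x * restrict_gens c e D q = (\<Sum>b\<in>B. C q b x * restrict_gens c e D b)" using B(5) that(1,3) by blast
    moreover have "(\<Sum>b\<in>B. C q b x * restrict_gens c e D b) = (\<Sum>b\<in>B. C q b x * D b)"
      using B(1) rg by (intro sum.cong) auto
    ultimately show ?thesis using rg[OF that(3)] by simp
  qed
  have sub: "fs.subspace (Der x)" for x unfolding Der_def by (rule derivs_subspace)
  have fB: "finite B" using finite_subset[OF B(1) J] .
  have inj: "D = 0" if x: "s x \<noteq> 0" and D: "D \<in> Der x" and z: "\<And>b. b \<in> B \<Longrightarrow> D b = 0" for x D
  proof (rule derivs_zero_on_gens)
    show "D \<in> derivs scale c (t x) e (p x)" using D unfolding Der_def .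
    fix y i j assume y: "y \<in> X"
    show "D (y, i, j) = 0"
    proof (cases "i < c \<and> j < e")
      case True
      then have "(y, i, j) \<in> J" using y unfolding J_def by auto
      from eqn[OF x D this] z x show ?thesis by simp
    next
      case False
      then show ?thesis using derivsD(1)[OF D[unfolded Der_def]] by blast
    qed
  qed
  have all: "\<forall>w. \<exists>D\<in>Der x0. \<forall>b\<in>B. D b = w b"
  proof
    fix w
    obtain v where v: "v \<in> lin_kernel \<Lambda> J x0" "\<forall>b\<in>B. v b = w b" using B(6) by blast
    have "v \<in> restrict_gens c e ` Der x0" using v(1) spec[OF \<Lambda>(2), of x0] by simp
    then obtain D where D: "v = restrict_gens c e D" "D \<in> Der x0" by (rule imageE)
    have "D b = w b" if "b \<in> B" for b
    proof -
      have "b \<in> J" using that B(1) by blast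
      then have "v b = D b" unfolding D(1) by (rule rg)
      then show ?thesis using v(2) that by simp
    qed
    then show "\<exists>D\<in>Der x0. \<forall>b\<in>B. D b = w b" using D(2) by blast
  qed
  have dim0: "fs.dim (Der x0) = card B"
    using dim_coordinates(2)[OF sub fB inj[OF B(3)]] all by blast
  have dim: "fs.dim (Der x) \<le> card B" if "s x \<noteq> 0" for x
    by (rule dim_coordinates(1)[OF sub fB inj[OF that]])
  \<comment> \<open>Prescribe at each \<open>b\<close> in \<open>B\<close> the value
    \<open>D0 b\<close>, rescaled by \<open>s x / s x0\<close>. The chart then makes all other
    values polynomial without division by \<open>s x\<close>, and where the dimension is still
    \<open>card B\<close> a derivation with these values exists.\<close>
  have ext: "\<exists>\<sigma>. (\<forall>q\<in>J. \<sigma> q \<in> R \<and> \<sigma> q x0 = D0 q) \<and>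
      (\<forall>x. s x \<noteq> 0 \<longrightarrow> fs.dim (Der x) = fs.dim (Der x0) \<longrightarrow> (\<exists>D\<in>Der x. \<forall>q\<in>J. D q = \<sigma> q x))" if D0: "D0 \<in> Der x0" for D0
  proof (intro exI[of _ "\<lambda>q x. \<Sum>b\<in>B. C q b x * (D0 b / s x0)"] conjI ballI allI impI)
    fix q assume q: "q \<in> J"
    show "(\<lambda>x. \<Sum>b\<in>B. C q b x * (D0 b / s x0)) \<in> R" using B(4) q by (intro sum mult const) auto
    show "(\<Sum>b\<in>B. C q b x0 * (D0 b / s x0)) = D0 q"
      using eqn[OF B(3) D0 q] B(3) by (simp add: sum_divide_distrib[symmetric] field_simps)
  next
    fix x assume x: "s x \<noteq> 0" and eq: "fs.dim (Der x) = fs.dim (Der x0)"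
    have "\<forall>w. \<exists>D\<in>Der x. \<forall>b\<in>B. D b = w b"
      using dim_coordinates(2)[OF sub fB inj[OF x]] eq dim0 by simp
    from spec[OF this, of "\<lambda>b. s x * (D0 b / s x0)"]
    obtain D where D: "D \<in> Der x" "\<forall>b\<in>B. D b = s x * (D0 b / s x0)" by (rule bexE)
    have "D q = (\<Sum>b\<in>B. C q b x * (D0 b / s x0))" if "q \<in> J" for q
    proof -
      have "s x * D q = (\<Sum>b\<in>B. C q b x * (s x * (D0 b / s x0)))"
        unfolding eqn[OF x D(1) that] using D(2) by (intro sum.cong) auto
      also have "\<dots> = s x * (\<Sum>b\<in>B. C q b x * (D0 b / s x0))"
        unfolding sum_distrib_left by (intro sum.cong) auto
      finally show ?thesis using x by simp
    qed
    with D(1) show "\<exists>D\<in>Der x. \<forall>q\<in>J. D q = (\<Sum>b\<in>B. C q b x * (D0 b / s x0))" by blast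
  qed
  show ?thesis
    unfolding J_def[symmetric] Der_def[symmetric]
    using B(2,3) dim unfolding dim0[symmetric] by (intro bexI[of _ s] conjI allI impI ballI ext) blast+
qed

end

section \<open>Invariance of the dimension of Ext under isomorphism\<close>

lemma mat_mult_assoc_dim:
  fixes A :: "'k::field mat"
  assumes "dim_col A = dim_row B" "dim_col B = dim_row C"
  shows "A * B * C = A * (B * C)"
  by (rule assoc_mult_mat[OF carrier_matI[OF refl refl] carrier_matI[OF _ refl] carrier_matI[OF _ refl]]) (simp_all only: assms)

lemma mat_distrib_dim:
  fixes A :: "'k::field mat"
  shows "dim_row A = dim_row B \<Longrightarrow> dim_col A = dim_col B \<Longrightarrow> dim_col A = dim_row C \<Longrightarrow> (A + B) * C = A * C + B * C"
    and "dim_row A = dim_row B \<Longrightarrow> dim_col A = dim_col B \<Longrightarrow> dim_col C = dim_row A \<Longrightarrow> C * (A + B) = C * A + C * B"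
    and "dim_row A = dim_row B \<Longrightarrow> dim_col A = dim_col B \<Longrightarrow> dim_col A = dim_row C \<Longrightarrow> (A - B) * C = A * C - B * C"
    and "dim_row A = dim_row B \<Longrightarrow> dim_col A = dim_col B \<Longrightarrow> dim_col C = dim_row A \<Longrightarrow> C * (A - B) = C * A - C * B"
    and "dim_col A = dim_row C \<Longrightarrow> (s \<cdot>\<^sub>m A) * C = s \<cdot>\<^sub>m (A * C)"
    and "dim_col C = dim_row A \<Longrightarrow> C * (s \<cdot>\<^sub>m A) = s \<cdot>\<^sub>m (C * A)"
    and "dim_col C = n \<Longrightarrow> C * 0\<^sub>m n l = 0\<^sub>m (dim_row C) l"
    and "dim_row C = l \<Longrightarrow> 0\<^sub>m n l * C = 0\<^sub>m n (dim_col C)"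
proof -
  note c = carrier_matI[OF refl refl] carrier_matI[OF sym sym] carrier_matI[OF sym refl] carrier_matI[OF refl sym]
  show "(A + B) * C = A * C + B * C" if "dim_row A = dim_row B" "dim_col A = dim_col B" "dim_col A = dim_row C"
    by (rule add_mult_distrib_mat[OF c(1) c(2) c(3)]) (fact that)+
  show "C * (A + B) = C * A + C * B" if "dim_row A = dim_row B" "dim_col A = dim_col B" "dim_col C = dim_row A"
    by (rule mult_add_distrib_mat[OF c(4) c(1) c(2)]) (fact that that[symmetric])+
  show "(A - B) * C = A * C - B * C" if "dim_row A = dim_row B" "dim_col A = dim_col B" "dim_col A = dim_row C"
    by (rule minus_mult_distrib_mat[OF c(1) c(2) c(3)]) (fact that)+
  show "C * (A - B) = C * A - C * B" if "dim_row A = dim_row B" "dim_col A = dim_col B" "dim_col C = dim_row A"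
    by (rule mult_minus_distrib_mat[OF c(4) c(1) c(2)]) (fact that that[symmetric])+
  show "(s \<cdot>\<^sub>m A) * C = s \<cdot>\<^sub>m (A * C)" if "dim_col A = dim_row C"
    by (rule mult_smult_assoc_mat[OF c(1) c(3)]) (fact that)
  show "C * (s \<cdot>\<^sub>m A) = s \<cdot>\<^sub>m (C * A)" if "dim_col C = dim_row A"
    by (rule mult_smult_distrib[OF c(1) c(3)]) (fact that)
  show "C * 0\<^sub>m n l = 0\<^sub>m (dim_row C) l" if "dim_col C = n"
    by (rule right_mult_zero_mat[OF carrier_matI[OF refl that]])
  show "0\<^sub>m n l * C = 0\<^sub>m n (dim_col C)" if "dim_row C = l"
    by (rule left_mult_zero_mat[OF carrier_matI[OF that refl]])
qed

definition deriv_mat :: "nat \<Rightarrow> nat \<Rightarrow> ('a \<times> nat \<times> nat \<Rightarrow> 'k) \<Rightarrow> 'a \<Rightarrow> 'k mat" where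
  "deriv_mat c e D a = mat c e (\<lambda>(i, j). D (a, i, j))"

lemma deriv_mat_dim [simp]: "dim_row (deriv_mat c e D a) = c" "dim_col (deriv_mat c e D a) = e"
  by (simp_all add: deriv_mat_def)

lemma deriv_mat_entry: "i < c \<Longrightarrow> j < e \<Longrightarrow> deriv_mat c e D a $$ (i, j) = D (a, i, j)"
  by (simp add: deriv_mat_def)

lemma derivs_mat_iff:
  assumes t: "t \<in> mod_var scale c" and p: "p \<in> mod_var scale e"
  shows "D \<in> derivs scale c t e p \<longleftrightarrow> (\<forall>a i j. \<not> (i < c \<and> j < e) \<longrightarrow> D (a, i, j) = 0) \<and>
    (\<forall>a b. deriv_mat c e D (a + b) = deriv_mat c e D a + deriv_mat c e D b) \<and>
    (\<forall>s a. deriv_mat c e D (scale s a) = s \<cdot>\<^sub>m deriv_mat c e D a) \<and>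
    (\<forall>a b. deriv_mat c e D (a * b) = t a * deriv_mat c e D b + deriv_mat c e D a * p b) \<and>
    deriv_mat c e D 1 = 0\<^sub>m c e"
proof -
  note dims = mod_var_dim[OF t] mod_var_dim[OF p]
  have car: "t a \<in> carrier_mat c c" "p a \<in> carrier_mat e e" "deriv_mat c e D a \<in> carrier_mat c e" for a
    using mod_varD(1)[OF t] mod_varD(1)[OF p] by (auto simp: deriv_mat_def)
  have 1: "(t a * deriv_mat c e D b) $$ (i, j) = (\<Sum>l<c. t a $$ (i, l) * D (b, l, j))"
    "(deriv_mat c e D a * p b) $$ (i, j) = (\<Sum>l<e. D (a, i, l) * p b $$ (l, j))" if "i < c" "j < e" for a b i j
    unfolding mat_mult_entry[OF car(1) car(3) that] mat_mult_entry[OF car(3) car(2) that]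
    by (rule sum.cong; simp add: deriv_mat_entry that)+
  show ?thesis
    unfolding derivs_def mem_Collect_eq mat_eq_iff
    by (simp add: dims deriv_mat_entry 1 del: index_mult_mat(1))
qed

text \<open>Transport of a derivation to conjugated modules: \<open>g\<close> conjugates the first
  module, and \<open>h\<close> will be the inverse of the matrix that conjugates the second.\<close>

definition twist :: "nat \<Rightarrow> nat \<Rightarrow> 'k::field mat \<Rightarrow> 'k mat \<Rightarrow> ('a \<times> nat \<times> nat \<Rightarrow> 'k) \<Rightarrow> ('a \<times> nat \<times> nat \<Rightarrow> 'k)" where
  "twist c e g h D = (\<lambda>(a, i, j). if i < c \<and> j < e then (g * deriv_mat c e D a * h) $$ (i, j) else 0)"

lemma deriv_mat_twist:
  assumes "dim_row g = c" "dim_col h = e"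
  shows "deriv_mat c e (twist c e g h D) a = g * deriv_mat c e D a * h"
proof (rule eq_matI)
  fix i j assume "i < dim_row (g * deriv_mat c e D a * h)" "j < dim_col (g * deriv_mat c e D a * h)"
  then have ij: "i < c" "j < e" using assms by simp_all
  show "deriv_mat c e (twist c e g h D) a $$ (i, j) = (g * deriv_mat c e D a * h) $$ (i, j)"
    unfolding deriv_mat_entry[OF ij] unfolding twist_def prod.case using ij by (simp del: index_mult_mat(1))
qed (use assms in simp_all)

lemma deriv_mat_linear:
  fixes D :: "'a \<times> nat \<times> nat \<Rightarrow> 'k::field"
  shows "deriv_mat c e (D + D') a = deriv_mat c e D a + deriv_mat c e D' a"
  "deriv_mat c e (fscale s D) a = s \<cdot>\<^sub>m deriv_mat c e D a"
  by (rule eq_matI; simp add: deriv_mat_def fscale_def)+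

lemma twist_linear:
  assumes "g \<in> carrier_mat c c" "h \<in> carrier_mat e e"
  shows "Vector_Spaces.linear fscale fscale (twist c e g h :: ('a \<times> nat \<times> nat \<Rightarrow> 'k::field) \<Rightarrow> _)"
proof (rule fs_linearI)
  have d: "dim_row g = c" "dim_col g = c" "dim_row h = e" "dim_col h = e" using assms by auto
  show "twist c e g h (D + D') = twist c e g h D + twist c e g h D'" for D D' :: "'a \<times> nat \<times> nat \<Rightarrow> 'k"
    by (auto simp: twist_def deriv_mat_linear mat_distrib_dim d fun_eq_iff simp del: index_mult_mat(1))
  show "twist c e g h (fscale s D) = fscale s (twist c e g h D)" for s and D :: "'a \<times> nat \<times> nat \<Rightarrow> 'k"
    unfolding fscale_def[of s "twist c e g h D"]
    by (auto simp: twist_def deriv_mat_linear mat_distrib_dim d fun_eq_iff simp del: index_mult_mat(1))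
qed

lemma twist_inverse:
  assumes gh: "mat_inverse_pair c g h" and gh': "mat_inverse_pair e g' h'"
    and D: "\<And>a i j. \<not> (i < c \<and> j < e) \<Longrightarrow> D (a, i, j) = 0"
  shows "twist c e h g' (twist c e g h' D) = D"
proof -
  note c = mat_inverse_pairD[OF gh] mat_inverse_pairD[OF gh']
  have d: "dim_row g = c" "dim_col g = c" "dim_row h = c" "dim_col h = c" "dim_row g' = e" "dim_col g' = e" "dim_row h' = e" "dim_col h' = e"
    using c by auto
  have "h * (g * deriv_mat c e D a * h') * g' = deriv_mat c e D a" for a
  proof -
    have "h * (g * deriv_mat c e D a * h') * g' = (h * g) * deriv_mat c e D a * (h' * g')"
      by (simp add: mat_mult_assoc_dim d)
    moreover have "deriv_mat c e D a \<in> carrier_mat c e" by (rule carrier_matI) simp_all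
    ultimately show ?thesis unfolding c(4) c(8) by (simp only: left_mult_one_mat right_mult_one_mat)
  qed
  then have "twist c e h g' (twist c e g h' D) (a, i, j) = D (a, i, j)" for a i j
    using D[of i j a] by (auto simp: twist_def[of c e h] deriv_mat_twist d deriv_mat_entry simp del: index_mult_mat(1))
  then show ?thesis by (simp add: fun_eq_iff)
qed

context fg_algebra
begin

lemma twist_derivs:
  assumes gh: "mat_inverse_pair c g h" and gh': "mat_inverse_pair e g' h'"
    and m: "m \<in> MV c" and n: "n \<in> MV e" and D: "D \<in> derivs scale c m e n"
  shows "twist c e g h' D \<in> derivs scale c (conj_mod g h m) e (conj_mod g' h' n)"
proof -
  note c = mat_inverse_pairD[OF gh] mat_inverse_pairD[OF gh']
  have d: "dim_row g = c" "dim_col g = c" "dim_row h = c" "dim_col h = c" "dim_row g' = e" "dim_col g' = e" "dim_row h' = e" "dim_col h' = e"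
    using c by auto
  note dims = d mod_var_dim[OF m] mod_var_dim[OF n]
  note D' = D[unfolded derivs_mat_iff[OF m n]]
  have 1: "h * (g * x) = x" if "dim_row x = c" for x
    by (rule mat_inverse_pair_cancel(2)[OF gh carrier_matI[OF that refl]])
  have 2: "h' * (g' * x) = x" if "dim_row x = e" for x
    by (rule mat_inverse_pair_cancel(2)[OF gh' carrier_matI[OF that refl]])
  show ?thesis
    unfolding derivs_mat_iff[OF conj_mod_var[OF gh m] conj_mod_var[OF gh' n]] deriv_mat_twist[OF d(1) d(8)]
    using D' by (auto simp: twist_def[of c e g h' D] conj_mod_def dims mat_distrib_dim mat_mult_assoc_dim 1 2)
qed

lemma twist_inner_derivs:
  assumes gh: "mat_inverse_pair c g h" and gh': "mat_inverse_pair e g' h'"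
    and m: "m \<in> MV c" and n: "n \<in> MV e" and D: "D \<in> inner_derivs c m e n"
  shows "twist c e g h' D \<in> inner_derivs c (conj_mod g h m) e (conj_mod g' h' n)"
proof -
  note c = mat_inverse_pairD[OF gh] mat_inverse_pairD[OF gh']
  have d: "dim_row g = c" "dim_col g = c" "dim_row h = c" "dim_col h = c" "dim_row g' = e" "dim_col g' = e" "dim_row h' = e" "dim_col h' = e"
    using c by auto
  note dims = d mod_var_dim[OF m] mod_var_dim[OF n]
  have 1: "h * (g * x) = x" if "dim_row x = c" for x
    by (rule mat_inverse_pair_cancel(2)[OF gh carrier_matI[OF that refl]])
  have 2: "h' * (g' * x) = x" if "dim_row x = e" for x
    by (rule mat_inverse_pair_cancel(2)[OF gh' carrier_matI[OF that refl]])
  have eq: "(\<Sum>l<e. U $$ (i, l) * n' a $$ (l, j)) - (\<Sum>l<c. m' a $$ (i, l) * U $$ (l, j)) = (U * n' a - m' a * U) $$ (i, j)"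
    if "i < c" "j < e" "dim_row U = c" "dim_col U = e" "m' \<in> MV c" "n' \<in> MV e" for U :: "'k mat" and m' n' a i j
  proof -
    have car: "U \<in> carrier_mat c e" using that(3,4) by (rule carrier_matI)
    show ?thesis
      using mat_mult_entry[OF car mod_varD(1)[OF that(6)] that(1,2)] mat_mult_entry[OF mod_varD(1)[OF that(5)] car that(1,2)]
        mod_var_dim[OF that(5), of a] that(1-4) mod_var_dim[OF that(6), of a] by (simp del: index_mult_mat(1))
  qed
  obtain u where u: "D = inner_deriv c m e n u" using D unfolding inner_derivs_def by blast
  define U where "U = mat c e u"
  have dU: "dim_row U = c" "dim_col U = e" by (simp_all add: U_def)
  define u' where "u' = (\<lambda>(i, j). if i < c \<and> j < e then (g * U * h') $$ (i, j) else 0)"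
  have Da: "deriv_mat c e D a = U * n a - m a * U" for a
  proof (rule eq_matI)
    show "deriv_mat c e D a $$ (i, j) = (U * n a - m a * U) $$ (i, j)"
      if "i < dim_row (U * n a - m a * U)" "j < dim_col (U * n a - m a * U)" for i j
    proof -
      have ij: "i < c" "j < e" using that by (simp_all add: dims dU)
      show ?thesis unfolding eq[OF ij dU m n, symmetric] deriv_mat_entry[OF ij] u
        using ij by (simp add: inner_deriv_def U_def)
    qed
  qed (simp_all add: dims dU)
  have "twist c e g h' D (a, i, j) = inner_deriv c (conj_mod g h m) e (conj_mod g' h' n) u' (a, i, j)" for a i j
  proof (cases "i < c \<and> j < e")
    case True
    then have ij: "i < c" "j < e" by auto
    have dW: "dim_row (g * U * h') = c" "dim_col (g * U * h') = e" by (simp_all add: dims)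
    have "inner_deriv c (conj_mod g h m) e (conj_mod g' h' n) u' (a, i, j) =
        ((g * U * h') * conj_mod g' h' n a - conj_mod g h m a * (g * U * h')) $$ (i, j)"
      unfolding eq[OF ij dW conj_mod_var[OF gh m] conj_mod_var[OF gh' n], symmetric]
      using ij by (simp add: inner_deriv_def u'_def del: index_mult_mat(1))
    also have "(g * U * h') * conj_mod g' h' n a - conj_mod g h m a * (g * U * h') = g * deriv_mat c e D a * h'"
      unfolding Da by (simp add: conj_mod_def dims dU mat_distrib_dim mat_mult_assoc_dim 1 2)
    finally show ?thesis using ij by (simp add: twist_def del: index_mult_mat(1))
  qed (auto simp: twist_def inner_deriv_def)
  then have "twist c e g h' D = inner_deriv c (conj_mod g h m) e (conj_mod g' h' n) u'" by (simp add: fun_eq_iff)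
  moreover have "u' \<in> supp_in ({..<c} \<times> {..<e})" by (auto simp: u'_def supp_in_def)
  ultimately show ?thesis unfolding inner_derivs_def by blast
qed

lemma twist_dim_le:
  assumes gh: "mat_inverse_pair c g h" and gh': "mat_inverse_pair e g' h'" and m: "m \<in> MV c" and n: "n \<in> MV e"
  shows "fs.dim (derivs scale c m e n) \<le> fs.dim (derivs scale c (conj_mod g h m) e (conj_mod g' h' n))"
    and "fs.dim (inner_derivs c m e n) \<le> fs.dim (inner_derivs c (conj_mod g h m) e (conj_mod g' h' n))"
proof -
  have lin: "Vector_Spaces.linear fscale fscale (twist c e g h' :: ('a \<times> nat \<times> nat \<Rightarrow> 'k) \<Rightarrow> _)"
    by (rule twist_linear[OF mat_inverse_pairD(1)[OF gh] mat_inverse_pairD(2)[OF gh']])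
  have inj: "inj_on (twist c e g h') (derivs scale c m e n)"
    by (rule inj_on_inverseI[of _ "twist c e h g'"]) (rule twist_inverse[OF gh gh'], rule derivsD(1))
  obtain F where F: "finite F" "derivs scale c (conj_mod g h m) e (conj_mod g' h' n) \<subseteq> fs.span F"
    by (rule derivs_fd)
  have "twist c e g h' ` derivs scale c m e n \<subseteq> derivs scale c (conj_mod g h m) e (conj_mod g' h' n)"
    using twist_derivs[OF gh gh' m n] by blast
  from fs.fd_dim_mono[OF this F(2,1)]
  show "fs.dim (derivs scale c m e n) \<le> fs.dim (derivs scale c (conj_mod g h m) e (conj_mod g' h' n))"
    unfolding fsfs.inj_image_dim[OF lin derivs_subspace inj] .
  have inj': "inj_on (twist c e g h') (inner_derivs c m e n)"
    by (rule inj_on_subset[OF inj inner_derivs_subset[OF m n]])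
  have "twist c e g h' ` inner_derivs c m e n \<subseteq> inner_derivs c (conj_mod g h m) e (conj_mod g' h' n)"
    using twist_inner_derivs[OF gh gh' m n] by blast
  from fs.fd_dim_mono[OF this inner_derivs_fd]
  show "fs.dim (inner_derivs c m e n) \<le> fs.dim (inner_derivs c (conj_mod g h m) e (conj_mod g' h' n))"
    unfolding fsfs.inj_image_dim[OF lin inner_derivs_subspace inj'] by simp
qed

text \<open>Transport embeds derivations and inner derivations into those of the conjugates; the
  inverse conjugation gives the opposite inequalities.\<close>

lemma ext1_dim_conj:
  assumes gh: "mat_inverse_pair c g h" and gh': "mat_inverse_pair e g' h'" and m: "m \<in> MV c" and n: "n \<in> MV e"
  shows "ext1_dim c (conj_mod g h m) e (conj_mod g' h' n) = ext1_dim c m e n"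
proof -
  have m': "conj_mod g h m \<in> MV c" and n': "conj_mod g' h' n \<in> MV e"
    using conj_mod_var[OF gh m] conj_mod_var[OF gh' n] by blast+
  note le = twist_dim_le[OF gh gh' m n]
    twist_dim_le[OF mat_inverse_pair_sym[OF gh] mat_inverse_pair_sym[OF gh'] m' n',
      unfolded conj_inverse[OF gh m] conj_inverse[OF gh' n]]
  show ?thesis
    using ext1_dim_derivs[OF m n] ext1_dim_derivs[OF m' n'] le by linarith
qed

text \<open>Since \<open>dim Ext = dim Der - dim Inn\<close> with upper semicontinuous \<open>dim Der\<close> and lower semicontinuous
  \<open>dim Inn\<close>, the dimension of \<open>Der\<close> is constant where the dimension of \<open>Ext\<close> is.\<close>

theorem ext_chart:
  fixes t p :: "'x \<Rightarrow> 'a \<Rightarrow> 'k mat"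
  assumes R: "fun_algebra R"
    and t: "\<And>a i j. i < c \<Longrightarrow> j < c \<Longrightarrow> (\<lambda>x. t x a $$ (i, j)) \<in> R"
    and p: "\<And>a i j. i < e \<Longrightarrow> j < e \<Longrightarrow> (\<lambda>x. p x a $$ (i, j)) \<in> R"
    and x0: "t x0 \<in> MV c" "p x0 \<in> MV e"
  shows "\<exists>s\<in>R. s x0 \<noteq> 0 \<and>
    (\<forall>x. s x \<noteq> 0 \<longrightarrow> t x \<in> MV c \<longrightarrow> p x \<in> MV e \<longrightarrow> ext1_dim c (t x) e (p x) \<le> ext1_dim c (t x0) e (p x0)) \<and>
    (\<forall>D0\<in>derivs scale c (t x0) e (p x0). \<exists>\<sigma>. (\<forall>q\<in>X \<times> {..<c} \<times> {..<e}. \<sigma> q \<in> R \<and> \<sigma> q x0 = D0 q) \<and>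
      (\<forall>x. s x \<noteq> 0 \<longrightarrow> t x \<in> MV c \<longrightarrow> p x \<in> MV e \<longrightarrow> ext1_dim c (t x) e (p x) = ext1_dim c (t x0) e (p x0) \<longrightarrow>
        (\<exists>D\<in>derivs scale c (t x) e (p x). \<forall>q\<in>X \<times> {..<c} \<times> {..<e}. D q = \<sigma> q x)))"
proof -
  interpret fun_algebra R by (rule R)
  have "\<exists>s\<in>R. s x0 \<noteq> 0 \<and>
    (\<forall>x. s x \<noteq> 0 \<longrightarrow> fs.dim (derivs scale c (t x) e (p x)) \<le> fs.dim (derivs scale c (t x0) e (p x0))) \<and>
    (\<forall>D0\<in>derivs scale c (t x0) e (p x0). \<exists>\<sigma>. (\<forall>q\<in>X \<times> {..<c} \<times> {..<e}. \<sigma> q \<in> R \<and> \<sigma> q x0 = D0 q) \<and>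
      (\<forall>x. s x \<noteq> 0 \<longrightarrow> fs.dim (derivs scale c (t x) e (p x)) = fs.dim (derivs scale c (t x0) e (p x0)) \<longrightarrow>
        (\<exists>D\<in>derivs scale c (t x) e (p x). \<forall>q\<in>X \<times> {..<c} \<times> {..<e}. D q = \<sigma> q x)))"
    by (rule derivs_chart[OF R]) (use t p in simp_all)
  then obtain s where s: "s \<in> R" "s x0 \<noteq> 0"
    "\<forall>x. s x \<noteq> 0 \<longrightarrow> fs.dim (derivs scale c (t x) e (p x)) \<le> fs.dim (derivs scale c (t x0) e (p x0))"
    "\<forall>D0\<in>derivs scale c (t x0) e (p x0). \<exists>\<sigma>. (\<forall>q\<in>X \<times> {..<c} \<times> {..<e}. \<sigma> q \<in> R \<and> \<sigma> q x0 = D0 q) \<and>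
      (\<forall>x. s x \<noteq> 0 \<longrightarrow> fs.dim (derivs scale c (t x) e (p x)) = fs.dim (derivs scale c (t x0) e (p x0)) \<longrightarrow>
        (\<exists>D\<in>derivs scale c (t x) e (p x). \<forall>q\<in>X \<times> {..<c} \<times> {..<e}. D q = \<sigma> q x))"
    by (elim bexE conjE)
  have "\<exists>s\<in>R. s x0 \<noteq> 0 \<and> (\<forall>x. s x \<noteq> 0 \<longrightarrow>
    fs.dim (inner_derivs c (t x0) e (p x0)) \<le> fs.dim (inner_derivs c (t x) e (p x)))"
    by (rule inner_derivs_lsc) (use t p in simp_all)
  then obtain s' where s': "s' \<in> R" "s' x0 \<noteq> 0" "\<forall>x. s' x \<noteq> 0 \<longrightarrow>
    fs.dim (inner_derivs c (t x0) e (p x0)) \<le> fs.dim (inner_derivs c (t x) e (p x))"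
    by (elim bexE conjE)
  have R': "(\<lambda>x. s x * s' x) \<in> R" "s x0 * s' x0 \<noteq> 0" using mult[OF s(1) s'(1)] s(2) s'(2) by simp_all
  have cmp: "ext1_dim c (t x) e (p x) \<le> ext1_dim c (t x0) e (p x0)"
    "ext1_dim c (t x) e (p x) = ext1_dim c (t x0) e (p x0) \<Longrightarrow>
      fs.dim (derivs scale c (t x) e (p x)) = fs.dim (derivs scale c (t x0) e (p x0))"
    if x: "s x * s' x \<noteq> 0" "t x \<in> MV c" "p x \<in> MV e" for x
  proof -
    have nz: "s x \<noteq> 0" "s' x \<noteq> 0" using x(1) by auto
    note * = ext1_dim_derivs[OF x(2,3)] ext1_dim_derivs[OF x0] s(3)[rule_format, OF nz(1)] s'(3)[rule_format, OF nz(2)]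
    show "ext1_dim c (t x) e (p x) \<le> ext1_dim c (t x0) e (p x0)" using * by linarith
    show "fs.dim (derivs scale c (t x) e (p x)) = fs.dim (derivs scale c (t x0) e (p x0))"
      if "ext1_dim c (t x) e (p x) = ext1_dim c (t x0) e (p x0)" using * that by linarith
  qed
  show ?thesis
  proof (rule bexI[OF _ R'(1)], intro conjI ballI allI impI)
    show "s x0 * s' x0 \<noteq> 0" by (rule R'(2))
    show "ext1_dim c (t x) e (p x) \<le> ext1_dim c (t x0) e (p x0)" if "s x * s' x \<noteq> 0" "t x \<in> MV c" "p x \<in> MV e" for x
      by (rule cmp(1)[OF that])
    fix D0 assume "D0 \<in> derivs scale c (t x0) e (p x0)"
    from bspec[OF s(4) this] obtain \<sigma> where \<sigma>: "\<forall>q\<in>X \<times> {..<c} \<times> {..<e}. \<sigma> q \<in> R \<and> \<sigma> q x0 = D0 q"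
      "\<forall>x. s x \<noteq> 0 \<longrightarrow> fs.dim (derivs scale c (t x) e (p x)) = fs.dim (derivs scale c (t x0) e (p x0)) \<longrightarrow>
        (\<exists>D\<in>derivs scale c (t x) e (p x). \<forall>q\<in>X \<times> {..<c} \<times> {..<e}. D q = \<sigma> q x)" by (elim exE conjE)
    show "\<exists>\<sigma>. (\<forall>q\<in>X \<times> {..<c} \<times> {..<e}. \<sigma> q \<in> R \<and> \<sigma> q x0 = D0 q) \<and>
      (\<forall>x. s x * s' x \<noteq> 0 \<longrightarrow> t x \<in> MV c \<longrightarrow> p x \<in> MV e \<longrightarrow> ext1_dim c (t x) e (p x) = ext1_dim c (t x0) e (p x0) \<longrightarrow>
        (\<exists>D\<in>derivs scale c (t x) e (p x). \<forall>q\<in>X \<times> {..<c} \<times> {..<e}. D q = \<sigma> q x))"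
    proof (rule exI[of _ \<sigma>], rule conjI[OF \<sigma>(1)], intro allI impI)
      fix x assume x: "s x * s' x \<noteq> 0" "t x \<in> MV c" "p x \<in> MV e"
        and eq: "ext1_dim c (t x) e (p x) = ext1_dim c (t x0) e (p x0)"
      have "s x \<noteq> 0" using x(1) by simp
      from \<sigma>(2)[rule_format, OF this cmp(2)[OF x eq]]
      show "\<exists>D\<in>derivs scale c (t x) e (p x). \<forall>q\<in>X \<times> {..<c} \<times> {..<e}. D q = \<sigma> q x" .
    qed
  qed
qed

end

section \<open>Irreducibility of E(S) and closedness of E(C1 x C2)\<close>

section \<open>The extension set\<close>

definition blocks :: "('k::field \<Rightarrow> 'a::ring_1 \<Rightarrow> 'a) \<Rightarrow> nat \<Rightarrow> nat \<Rightarrow> (('a \<Rightarrow> 'k mat) \<times> ('a \<Rightarrow> 'k mat)) set \<Rightarrow>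
    ('a \<Rightarrow> 'k mat) set" where
  "blocks scale d1 d2 P = {block_mod d1 d2 m1 D m2 | m1 D m2. (m1, m2) \<in> P \<and> D \<in> derivs scale d1 m1 d2 m2}"

lemma gl_orbit_self: "m \<in> mod_var scale d \<Longrightarrow> m \<in> gl_orbit d m"
  unfolding gl_orbit_alt using conj_one[of m scale d] mat_inverse_pair_one[of d] by force

context fg_algebra
begin

text \<open>Only the values of \<open>D\<close> on generators enter the coordinates of the block
  module, so it is enough that \<open>\<sigma>\<close> prescribes those.\<close>

lemma block_mod_compose:
  assumes R: "fun_algebra R" and f: "f \<in> RF (d1 + d2)"
    and t: "\<And>a i j. i < d1 \<Longrightarrow> j < d1 \<Longrightarrow> (\<lambda>x. t x a $$ (i, j)) \<in> R"
    and p: "\<And>a i j. i < d2 \<Longrightarrow> j < d2 \<Longrightarrow> (\<lambda>x. p x a $$ (i, j)) \<in> R"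
    and \<sigma>: "\<And>q. q \<in> X \<times> {..<d1} \<times> {..<d2} \<Longrightarrow> \<sigma> q \<in> R"
  shows "\<exists>F\<in>R. \<forall>x D. block_mod d1 d2 (t x) D (p x) \<in> MV (d1 + d2) \<longrightarrow> (\<forall>q\<in>X \<times> {..<d1} \<times> {..<d2}. D q = \<sigma> q x) \<longrightarrow>
    F x = f (block_mod d1 d2 (t x) D (p x))"
proof -
  interpret fun_algebra R by (rule R)
  define \<zeta> where "\<zeta> = (\<lambda>x (a, i, j). if i < d1 then if j < d1 then t x a $$ (i, j) else \<sigma> (a, i, j - d1) x
     else if j < d1 then 0 else p x a $$ (i - d1, j - d1))"
  obtain F where F: "F \<in> R" "\<And>x m. m \<in> MV (d1 + d2) \<Longrightarrow>
      (\<And>i. i \<in> Idx (d1 + d2) \<Longrightarrow> mod_coords X (d1 + d2) m i = \<zeta> x i) \<Longrightarrow> F x = f m"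
  proof (rule regular_on_compose[OF f, where \<zeta> = \<zeta>])
    fix z assume "z \<in> Idx (d1 + d2)"
    then obtain a i j where z: "z = (a, i, j)" "a \<in> X" "i < d1 + d2" "j < d1 + d2" by auto
    consider "i < d1" "j < d1" | "i < d1" "\<not> j < d1" | "\<not> i < d1" "j < d1" | "\<not> i < d1" "\<not> j < d1" by blast
    then show "(\<lambda>x. \<zeta> x z) \<in> R"
    proof cases
      case 1
      then show ?thesis unfolding z(1) \<zeta>_def using t by simp
    next
      case 2
      then have "j - d1 < d2" using z(4) by simp
      then show ?thesis unfolding z(1) \<zeta>_def using 2 \<sigma>[of "(a, i, j - d1)"] z(2) by simp
    next
      case 3
      then show ?thesis unfolding z(1) \<zeta>_def using const by simp
    next
      case 4
      then have "i - d1 < d2" "j - d1 < d2" using z(3,4) by simp_all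
      then show ?thesis unfolding z(1) \<zeta>_def using 4 p by simp
    qed
  qed blast
  show ?thesis
  proof (rule bexI[OF _ F(1)], intro allI impI)
    fix x D assume mv: "block_mod d1 d2 (t x) D (p x) \<in> MV (d1 + d2)"
      and D: "\<forall>q\<in>X \<times> {..<d1} \<times> {..<d2}. D q = \<sigma> q x"
    show "F x = f (block_mod d1 d2 (t x) D (p x))"
    proof (rule F(2)[OF mv])
      fix z assume "z \<in> Idx (d1 + d2)"
      then obtain a i j where z: "z = (a, i, j)" "a \<in> X" "i < d1 + d2" "j < d1 + d2" by auto
      have "D (a, i, j - d1) = \<sigma> (a, i, j - d1) x" if "i < d1" "\<not> j < d1"
        using D z that by auto
      then show "mod_coords X (d1 + d2) (block_mod d1 d2 (t x) D (p x)) z = \<zeta> x z"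
        unfolding z(1) mod_coords_eq[OF z(2-4)] \<zeta>_def block_mod_def using z(3,4) by simp
    qed
  qed
qed

lemma ext1_dim_usc:
  fixes t p :: "'x \<Rightarrow> 'a \<Rightarrow> 'k mat"
  assumes R: "fun_algebra R"
    and t: "\<And>a i j. i < c \<Longrightarrow> j < c \<Longrightarrow> (\<lambda>x. t x a $$ (i, j)) \<in> R"
    and p: "\<And>a i j. i < e \<Longrightarrow> j < e \<Longrightarrow> (\<lambda>x. p x a $$ (i, j)) \<in> R"
    and x0: "t x0 \<in> MV c" "p x0 \<in> MV e"
  shows "\<exists>s\<in>R. s x0 \<noteq> 0 \<and> (\<forall>x. s x \<noteq> 0 \<longrightarrow> t x \<in> MV c \<longrightarrow> p x \<in> MV e \<longrightarrow>
    ext1_dim c (t x) e (p x) \<le> ext1_dim c (t x0) e (p x0))"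
proof -
  have "\<exists>s\<in>R. s x0 \<noteq> 0 \<and>
    (\<forall>x. s x \<noteq> 0 \<longrightarrow> t x \<in> MV c \<longrightarrow> p x \<in> MV e \<longrightarrow> ext1_dim c (t x) e (p x) \<le> ext1_dim c (t x0) e (p x0)) \<and>
    (\<forall>D0\<in>derivs scale c (t x0) e (p x0). \<exists>\<sigma>. (\<forall>q\<in>X \<times> {..<c} \<times> {..<e}. \<sigma> q \<in> R \<and> \<sigma> q x0 = D0 q) \<and>
      (\<forall>x. s x \<noteq> 0 \<longrightarrow> t x \<in> MV c \<longrightarrow> p x \<in> MV e \<longrightarrow> ext1_dim c (t x) e (p x) = ext1_dim c (t x0) e (p x0) \<longrightarrow>
        (\<exists>D\<in>derivs scale c (t x) e (p x). \<forall>q\<in>X \<times> {..<c} \<times> {..<e}. D q = \<sigma> q x)))"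
    by (rule ext_chart[OF R]) (use t p x0 in simp_all)
  then obtain s where s: "s \<in> R" "s x0 \<noteq> 0" "\<forall>x. s x \<noteq> 0 \<longrightarrow> t x \<in> MV c \<longrightarrow> p x \<in> MV e \<longrightarrow>
    ext1_dim c (t x) e (p x) \<le> ext1_dim c (t x0) e (p x0)" by (elim bexE conjE)
  then show ?thesis by (intro bexI conjI)
qed

text \<open>For a stable \<open>P\<close>, extensions are the conjugates of block triangular modules
  with diagonal in \<open>P\<close>; from here on short exact sequences are replaced by
  matrices.\<close>

lemma extension_set_blocks:
  assumes P: "P \<subseteq> MV d1 \<times> MV d2"
    and conj: "\<And>m1 m2 g h g' h'. (m1, m2) \<in> P \<Longrightarrow> mat_inverse_pair d1 g h \<Longrightarrow> mat_inverse_pair d2 g' h' \<Longrightarrow>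
      (conj_mod g h m1, conj_mod g' h' m2) \<in> P"
  shows "extension_set scale d1 d2 P = gl_saturate (d1 + d2) (blocks scale d1 d2 P)"
proof
  show "extension_set scale d1 d2 P \<subseteq> gl_saturate (d1 + d2) (blocks scale d1 d2 P)"
  proof
    fix m assume "m \<in> extension_set scale d1 d2 P"
    then obtain m1 m2 where m: "m \<in> MV (d1 + d2)" "m1 \<in> MV d1" "m2 \<in> MV d2" "gl_orbit d1 m1 \<times> gl_orbit d2 m2 \<subseteq> P"
      "is_extension d2 m2 (d1 + d2) m d1 m1" unfolding extension_set_def by blast
    have mP: "(m1, m2) \<in> P" using m(4) gl_orbit_self[OF m(2)] gl_orbit_self[OF m(3)] by blast
    obtain g h D where gh: "mat_inverse_pair (d1 + d2) g h" "D \<in> derivs scale d1 m1 d2 m2"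
      "conj_mod g h m = block_mod d1 d2 m1 D m2" using block_of_is_extension[OF m(1-3,5)] by blast
    have "m = conj_mod h g (block_mod d1 d2 m1 D m2)" using conj_inverse[OF gh(1) m(1)] gh(3) by simp
    moreover have "block_mod d1 d2 m1 D m2 \<in> blocks scale d1 d2 P" unfolding blocks_def using mP gh(2) by blast
    ultimately show "m \<in> gl_saturate (d1 + d2) (blocks scale d1 d2 P)"
      unfolding gl_saturate_def using mat_inverse_pair_sym[OF gh(1)] by blast
  qed
  show "gl_saturate (d1 + d2) (blocks scale d1 d2 P) \<subseteq> extension_set scale d1 d2 P"
  proof
    fix m assume "m \<in> gl_saturate (d1 + d2) (blocks scale d1 d2 P)"
    then obtain g h m1 D m2 where m: "m = conj_mod g h (block_mod d1 d2 m1 D m2)" "mat_inverse_pair (d1 + d2) g h"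
      "(m1, m2) \<in> P" "D \<in> derivs scale d1 m1 d2 m2" unfolding gl_saturate_def blocks_def by blast
    have m12: "m1 \<in> MV d1" "m2 \<in> MV d2" using m(3) P by blast+
    have b: "block_mod d1 d2 m1 D m2 \<in> MV (d1 + d2)" by (rule block_mod_mem[OF m12 m(4)])
    have mV: "m \<in> MV (d1 + d2)" unfolding m(1) by (rule conj_mod_var[OF m(2) b])
    have "conj_mod h g m = block_mod d1 d2 m1 D m2" unfolding m(1) by (rule conj_inverse[OF m(2) b])
    from is_extension_of_block[OF mV m12 mat_inverse_pair_sym[OF m(2)] this]
    have "is_extension d2 m2 (d1 + d2) m d1 m1" .
    moreover have "gl_orbit d1 m1 \<times> gl_orbit d2 m2 \<subseteq> P" unfolding gl_orbit_alt using conj[OF m(3)] by blast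
    ultimately show "m \<in> extension_set scale d1 d2 P" unfolding extension_set_def using mV m12 by blast
  qed
qed

lemma blocks_subset: "P \<subseteq> MV d1 \<times> MV d2 \<Longrightarrow> blocks scale d1 d2 P \<subseteq> MV (d1 + d2)"
  unfolding blocks_def using block_mod_mem by blast

text \<open>Components are stable under conjugation, so an orbit is contained in one as soon as one
  of its points is, and the minimum ranges over the elements of \<open>C\<close> and
  \<open>D\<close> themselves.\<close>

lemma ext1_min_component:
  assumes inf: "infinite (UNIV :: 'k set)" and C: "component c C" and D: "component e D"
  shows "\<exists>m\<in>C. \<exists>n\<in>D. ext1_dim c m e n = ext1_min scale c C e D"
    and "m \<in> C \<Longrightarrow> n \<in> D \<Longrightarrow> ext1_min scale c C e D \<le> ext1_dim c m e n"
proof -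
  have orb: "gl_orbit d m \<subseteq> C' \<longleftrightarrow> m \<in> C'" if "component d C'" "m \<in> MV d" for d C' m
    using component_conj[OF inf that(1), of m] gl_orbit_self[OF that(2)] unfolding gl_orbit_alt by blast
  have "(\<exists>m \<in> MV c. \<exists>n \<in> MV e. gl_orbit c m \<subseteq> C \<and> gl_orbit e n \<subseteq> D \<and> r = ext1_dim c m e n) \<longleftrightarrow>
    (\<exists>m\<in>C. \<exists>n\<in>D. r = ext1_dim c m e n)" for r
    using orb[OF C] orb[OF D] componentD(1)[OF C] componentD(1)[OF D] by blast
  then have min: "ext1_min scale c C e D = (LEAST r. \<exists>m\<in>C. \<exists>n\<in>D. r = ext1_dim c m e n)"
    unfolding ext1_min_def by simp
  obtain m0 n0 where "m0 \<in> C" "n0 \<in> D"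
    using irred_nonempty[OF componentD(2)[OF C]] irred_nonempty[OF componentD(2)[OF D]] by blast
  then have "\<exists>m'\<in>C. \<exists>n'\<in>D. ext1_dim c m0 e n0 = ext1_dim c m' e n'" by blast
  from LeastI[of "\<lambda>r. \<exists>m\<in>C. \<exists>n\<in>D. r = ext1_dim c m e n", OF this]
  show "\<exists>m\<in>C. \<exists>n\<in>D. ext1_dim c m e n = ext1_min scale c C e D" unfolding min by metis
  show "ext1_min scale c C e D \<le> ext1_dim c m e n" if "m \<in> C" "n \<in> D"
    unfolding min using that by (intro Least_le) blast
qed

end

locale ext_vanishing = fg_algebra_closed scale X
  for scale :: "'k::alg_closed_field \<Rightarrow> 'a::ring_1 \<Rightarrow> 'a" and X +
  fixes d1 d2 :: nat and C1 C2 :: "('a \<Rightarrow> 'k mat) set"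
  assumes C1: "component d1 C1" and C2: "component d2 C2" and ext_min: "ext1_min scale d2 C2 d1 C1 = 0"
begin

lemma inf: "infinite (UNIV :: 'k set)" by (rule infinite_UNIV_alg_closed)

text \<open>The set \<open>S\<close> of the theorem.\<close>

definition good :: "(('a \<Rightarrow> 'k mat) \<times> ('a \<Rightarrow> 'k mat)) set" where
  "good = {(m1, m2) \<in> C1 \<times> C2. ext1_dim d2 m2 d1 m1 = 0 \<and> ext1_dim d1 m1 d2 m2 = ext1_min scale d1 C1 d2 C2}"

lemma goodD:
  assumes "(m1, m2) \<in> good"
  shows "m1 \<in> C1" "m2 \<in> C2" "m1 \<in> MV d1" "m2 \<in> MV d2" "ext1_dim d2 m2 d1 m1 = 0"
    "ext1_dim d1 m1 d2 m2 = ext1_min scale d1 C1 d2 C2"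
  using assms componentD(1)[OF C1] componentD(1)[OF C2] unfolding good_def by auto

lemma pair_entries:
  "i < d1 \<Longrightarrow> j < d1 \<Longrightarrow> (\<lambda>p. fst p a $$ (i, j)) \<in> RP d1 d2"
  "i < d2 \<Longrightarrow> j < d2 \<Longrightarrow> (\<lambda>p. snd p a $$ (i, j)) \<in> RP d1 d2"
  using pair_regular(1)[OF entry_regular] pair_regular(2)[OF entry_regular] by blast+

lemma irred_pairs: "irred (RP d1 d2) (C1 \<times> C2)"
  by (rule irred_product[OF componentD(1,2)[OF C1] componentD(1,2)[OF C2]])

lemma ext_upper:
  assumes "p0 \<in> C1 \<times> C2"
  shows "\<exists>s\<in>RP d1 d2. s p0 \<noteq> 0 \<and> (\<forall>p\<in>C1 \<times> C2. s p \<noteq> 0 \<longrightarrow>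
    ext1_dim d1 (fst p) d2 (snd p) \<le> ext1_dim d1 (fst p0) d2 (snd p0) \<and>
    ext1_dim d2 (snd p) d1 (fst p) \<le> ext1_dim d2 (snd p0) d1 (fst p0))"
proof -
  note R = fun_algebra_regular_on[of "MV d1 \<times> MV d2" "pair_coords d1 d2" "Idx d1 <+> Idx d2"]
  have mv: "fst p \<in> MV d1" "snd p \<in> MV d2" if "p \<in> C1 \<times> C2" for p
    using that componentD(1)[OF C1] componentD(1)[OF C2] by auto
  have "\<exists>s\<in>RP d1 d2. s p0 \<noteq> 0 \<and> (\<forall>x. s x \<noteq> 0 \<longrightarrow> fst x \<in> MV d1 \<longrightarrow> snd x \<in> MV d2 \<longrightarrow>
    ext1_dim d1 (fst x) d2 (snd x) \<le> ext1_dim d1 (fst p0) d2 (snd p0))"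
    by (rule ext1_dim_usc[OF R]) (use pair_entries mv[OF assms] in simp_all)
  then obtain s where s: "s \<in> RP d1 d2" "s p0 \<noteq> 0"
    "\<forall>x. s x \<noteq> 0 \<longrightarrow> fst x \<in> MV d1 \<longrightarrow> snd x \<in> MV d2 \<longrightarrow> ext1_dim d1 (fst x) d2 (snd x) \<le> ext1_dim d1 (fst p0) d2 (snd p0)"
    by (elim bexE conjE)
  have "\<exists>s\<in>RP d1 d2. s p0 \<noteq> 0 \<and> (\<forall>x. s x \<noteq> 0 \<longrightarrow> snd x \<in> MV d2 \<longrightarrow> fst x \<in> MV d1 \<longrightarrow>
    ext1_dim d2 (snd x) d1 (fst x) \<le> ext1_dim d2 (snd p0) d1 (fst p0))"
    by (rule ext1_dim_usc[OF R]) (use pair_entries mv[OF assms] in simp_all)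
  then obtain s' where s': "s' \<in> RP d1 d2" "s' p0 \<noteq> 0"
    "\<forall>x. s' x \<noteq> 0 \<longrightarrow> snd x \<in> MV d2 \<longrightarrow> fst x \<in> MV d1 \<longrightarrow> ext1_dim d2 (snd x) d1 (fst x) \<le> ext1_dim d2 (snd p0) d1 (fst p0)"
    by (elim bexE conjE)
  show ?thesis
  proof (rule bexI[OF _ fun_algebra.mult[OF R s(1) s'(1)]], intro conjI ballI impI)
    show "s p0 * s' p0 \<noteq> 0" using s(2) s'(2) by simp
    fix p assume p: "p \<in> C1 \<times> C2" "s p * s' p \<noteq> 0"
    then have nz: "s p \<noteq> 0" "s' p \<noteq> 0" by auto
    show "ext1_dim d1 (fst p) d2 (snd p) \<le> ext1_dim d1 (fst p0) d2 (snd p0)"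
      using s(3) nz(1) mv[OF p(1)] by blast
    show "ext1_dim d2 (snd p) d1 (fst p) \<le> ext1_dim d2 (snd p0) d1 (fst p0)"
      using s'(3) nz(2) mv[OF p(1)] by blast
  qed
qed

lemma goodI:
  assumes "p \<in> C1 \<times> C2" "ext1_dim d2 (snd p) d1 (fst p) \<le> 0"
    "ext1_dim d1 (fst p) d2 (snd p) \<le> ext1_min scale d1 C1 d2 C2"
  shows "p \<in> good"
proof -
  have "ext1_min scale d1 C1 d2 C2 \<le> ext1_dim d1 (fst p) d2 (snd p)"
    using assms(1) by (intro ext1_min_component(2)[OF inf C1 C2]) auto
  then show ?thesis using assms unfolding good_def by (auto simp: case_prod_beta)
qed

lemma good_open:
  assumes "p0 \<in> good"
  shows "\<exists>s\<in>RP d1 d2. s p0 \<noteq> 0 \<and> (\<forall>p\<in>C1 \<times> C2. s p \<noteq> 0 \<longrightarrow> p \<in> good)"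
proof -
  have p0: "p0 \<in> C1 \<times> C2" "ext1_dim d2 (snd p0) d1 (fst p0) = 0"
    "ext1_dim d1 (fst p0) d2 (snd p0) = ext1_min scale d1 C1 d2 C2" using assms unfolding good_def by auto
  from ext_upper[OF p0(1)] obtain s where s: "s \<in> RP d1 d2" "s p0 \<noteq> 0" "\<forall>p\<in>C1 \<times> C2. s p \<noteq> 0 \<longrightarrow>
    ext1_dim d1 (fst p) d2 (snd p) \<le> ext1_dim d1 (fst p0) d2 (snd p0) \<and>
    ext1_dim d2 (snd p) d1 (fst p) \<le> ext1_dim d2 (snd p0) d1 (fst p0)" by (elim bexE conjE)
  show ?thesis
    using s(3) p0(2,3) by (intro bexI[OF _ s(1)] conjI s(2) ballI impI goodI) auto
qed

text \<open>Vanishing of one Ext and minimality of the other are open conditions by semicontinuity.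
  Each holds somewhere on the irreducible set of pairs, hence both hold at a common pair, and a
  nonempty open subset of an irreducible set is irreducible.\<close>

lemma irred_good: "irred (RP d1 d2) good"
proof -
  interpret RP: fun_algebra "RP d1 d2" by (rule fun_algebra_regular_on)
  obtain a2 a1 where a: "a2 \<in> C2" "a1 \<in> C1" "ext1_dim d2 a2 d1 a1 = 0"
    using ext1_min_component(1)[OF inf C2 C1] unfolding ext_min by blast
  obtain b1 b2 where b: "b1 \<in> C1" "b2 \<in> C2" "ext1_dim d1 b1 d2 b2 = ext1_min scale d1 C1 d2 C2"
    using ext1_min_component(1)[OF inf C1 C2] by blast
  have aC: "(a1, a2) \<in> C1 \<times> C2" and bC: "(b1, b2) \<in> C1 \<times> C2" using a b by auto
  from ext_upper[OF aC] obtain s where s: "s \<in> RP d1 d2" "s (a1, a2) \<noteq> 0" "\<forall>p\<in>C1 \<times> C2. s p \<noteq> 0 \<longrightarrow>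
    ext1_dim d1 (fst p) d2 (snd p) \<le> ext1_dim d1 (fst (a1, a2)) d2 (snd (a1, a2)) \<and>
    ext1_dim d2 (snd p) d1 (fst p) \<le> ext1_dim d2 (snd (a1, a2)) d1 (fst (a1, a2))" by (elim bexE conjE)
  from ext_upper[OF bC] obtain s' where s': "s' \<in> RP d1 d2" "s' (b1, b2) \<noteq> 0" "\<forall>p\<in>C1 \<times> C2. s' p \<noteq> 0 \<longrightarrow>
    ext1_dim d1 (fst p) d2 (snd p) \<le> ext1_dim d1 (fst (b1, b2)) d2 (snd (b1, b2)) \<and>
    ext1_dim d2 (snd p) d1 (fst p) \<le> ext1_dim d2 (snd (b1, b2)) d1 (fst (b1, b2))" by (elim bexE conjE)
  from irredD[OF irred_pairs s(1) s'(1) aC s(2) bC s'(2)] obtain p where p: "p \<in> C1 \<times> C2" "s p \<noteq> 0" "s' p \<noteq> 0" by blast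
  have "p \<in> good" using bspec[OF s(3) p(1)] bspec[OF s'(3) p(1)] p a(3) b(3) by (intro goodI) auto
  then have ne: "good \<noteq> {}" by blast
  show ?thesis
    unfolding irred_def
  proof (intro conjI ne ballI impI)
    fix f g assume f: "f \<in> RP d1 d2" and g: "g \<in> RP d1 d2" and "\<exists>t\<in>good. f t \<noteq> 0" "\<exists>t\<in>good. g t \<noteq> 0"
    then obtain t u where t: "t \<in> good" "f t \<noteq> 0" and u: "u \<in> good" "g u \<noteq> 0" by blast
    have tu: "t \<in> C1 \<times> C2" "u \<in> C1 \<times> C2" using t(1) u(1) unfolding good_def by auto
    from good_open[OF t(1)] obtain w where w: "w \<in> RP d1 d2" "w t \<noteq> 0" "\<forall>p\<in>C1 \<times> C2. w p \<noteq> 0 \<longrightarrow> p \<in> good"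
      by (elim bexE conjE)
    have "f t * w t \<noteq> 0" using t(2) w(2) by simp
    from irredD[OF irred_pairs RP.mult[OF f w(1)] g tu(1) this tu(2) u(2)]
    obtain p where "p \<in> C1 \<times> C2" "f p * w p \<noteq> 0" "g p \<noteq> 0" by blast
    then show "\<exists>t\<in>good. f t \<noteq> 0 \<and> g t \<noteq> 0" using w(3) by (intro bexI[of _ p]) auto
  qed
qed

lemma good_conj:
  assumes "(m1, m2) \<in> good" "mat_inverse_pair d1 g h" "mat_inverse_pair d2 g' h'"
  shows "(conj_mod g h m1, conj_mod g' h' m2) \<in> good"
  using goodD[OF assms(1)] ext1_dim_conj[OF assms(2,3)] ext1_dim_conj[OF assms(3,2)]
    component_conj[OF inf C1 _ assms(2)] component_conj[OF inf C2 _ assms(3)]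
  unfolding good_def by simp

lemma good_subset: "good \<subseteq> MV d1 \<times> MV d2"
  using goodD by auto

text \<open>Over good pairs dim Ext is constant, so by \<open>ext_chart\<close> every derivation is
  a member of a regular family and the block modules behave like a vector bundle. Irreducibility of
  the base reduces the question to a single fibre, and a fibre is a vector space, in which two
  points are joined by a line.\<close>

lemma irred_blocks: "irred (RF (d1 + d2)) (blocks scale d1 d2 good)"
  unfolding irred_def
proof (intro conjI ballI impI)
  note RP = fun_algebra_regular_on[of "MV d1 \<times> MV d2" "pair_coords d1 d2" "Idx d1 <+> Idx d2"]
  interpret RP: fun_algebra "RP d1 d2" by (rule RP)
  obtain m1 m2 where m: "(m1, m2) \<in> good" using irred_nonempty[OF irred_good] by auto
  then have "block_mod d1 d2 m1 0 m2 \<in> blocks scale d1 d2 good"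
    unfolding blocks_def using fs.subspace_0[OF derivs_subspace] by blast
  then show "blocks scale d1 d2 good \<noteq> {}" by blast
  \<comment> \<open>If \<open>f\<close> is nonzero at one point of a fibre, following the regular
    family through that point shows that it is nonzero somewhere on all nearby fibres.\<close>
  have spread: "\<exists>F\<in>RP d1 d2. F (m1, m2) \<noteq> 0 \<and> (\<forall>n1 n2. (n1, n2) \<in> good \<longrightarrow> F (n1, n2) \<noteq> 0 \<longrightarrow>
      (\<exists>D\<in>derivs scale d1 n1 d2 n2. f (block_mod d1 d2 n1 D n2) \<noteq> 0))"
    if f: "f \<in> RF (d1 + d2)" and m: "(m1, m2) \<in> good" and D0: "D0 \<in> derivs scale d1 m1 d2 m2"
      and nz: "f (block_mod d1 d2 m1 D0 m2) \<noteq> 0" for f m1 m2 D0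
  proof -
    note mD = goodD[OF m]
    have "\<exists>s\<in>RP d1 d2. s (m1, m2) \<noteq> 0 \<and>
      (\<forall>x. s x \<noteq> 0 \<longrightarrow> fst x \<in> MV d1 \<longrightarrow> snd x \<in> MV d2 \<longrightarrow> ext1_dim d1 (fst x) d2 (snd x) \<le> ext1_dim d1 (fst (m1, m2)) d2 (snd (m1, m2))) \<and>
      (\<forall>D0\<in>derivs scale d1 (fst (m1, m2)) d2 (snd (m1, m2)). \<exists>\<sigma>. (\<forall>q\<in>X \<times> {..<d1} \<times> {..<d2}. \<sigma> q \<in> RP d1 d2 \<and> \<sigma> q (m1, m2) = D0 q) \<and>
      (\<forall>x. s x \<noteq> 0 \<longrightarrow> fst x \<in> MV d1 \<longrightarrow> snd x \<in> MV d2 \<longrightarrow> ext1_dim d1 (fst x) d2 (snd x) = ext1_dim d1 (fst (m1, m2)) d2 (snd (m1, m2)) \<longrightarrow>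
        (\<exists>D\<in>derivs scale d1 (fst x) d2 (snd x). \<forall>q\<in>X \<times> {..<d1} \<times> {..<d2}. D q = \<sigma> q x)))"
      by (rule ext_chart[OF RP]) (use mD pair_entries in simp_all)
    then obtain s where s: "s \<in> RP d1 d2" "s (m1, m2) \<noteq> 0"
      "\<forall>D0\<in>derivs scale d1 m1 d2 m2. \<exists>\<sigma>. (\<forall>q\<in>X \<times> {..<d1} \<times> {..<d2}. \<sigma> q \<in> RP d1 d2 \<and> \<sigma> q (m1, m2) = D0 q) \<and>
      (\<forall>x. s x \<noteq> 0 \<longrightarrow> fst x \<in> MV d1 \<longrightarrow> snd x \<in> MV d2 \<longrightarrow> ext1_dim d1 (fst x) d2 (snd x) = ext1_dim d1 m1 d2 m2 \<longrightarrow>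
        (\<exists>D\<in>derivs scale d1 (fst x) d2 (snd x). \<forall>q\<in>X \<times> {..<d1} \<times> {..<d2}. D q = \<sigma> q x))"
      unfolding fst_conv snd_conv by (elim bexE conjE)
    from bspec[OF s(3) D0] obtain \<sigma> where \<sigma>: "\<forall>q\<in>X \<times> {..<d1} \<times> {..<d2}. \<sigma> q \<in> RP d1 d2 \<and> \<sigma> q (m1, m2) = D0 q"
      "\<forall>x. s x \<noteq> 0 \<longrightarrow> fst x \<in> MV d1 \<longrightarrow> snd x \<in> MV d2 \<longrightarrow> ext1_dim d1 (fst x) d2 (snd x) = ext1_dim d1 m1 d2 m2 \<longrightarrow>
        (\<exists>D\<in>derivs scale d1 (fst x) d2 (snd x). \<forall>q\<in>X \<times> {..<d1} \<times> {..<d2}. D q = \<sigma> q x)"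
      by (elim exE conjE)
    have "\<exists>F\<in>RP d1 d2. \<forall>x D. block_mod d1 d2 (fst x) D (snd x) \<in> MV (d1 + d2) \<longrightarrow>
      (\<forall>q\<in>X \<times> {..<d1} \<times> {..<d2}. D q = \<sigma> q x) \<longrightarrow> F x = f (block_mod d1 d2 (fst x) D (snd x))"
      by (rule block_mod_compose[OF RP f pair_entries(1) pair_entries(2) conjunct1[OF bspec[OF \<sigma>(1)]]])
    then obtain F where F: "F \<in> RP d1 d2" "\<forall>x D. block_mod d1 d2 (fst x) D (snd x) \<in> MV (d1 + d2) \<longrightarrow>
      (\<forall>q\<in>X \<times> {..<d1} \<times> {..<d2}. D q = \<sigma> q x) \<longrightarrow> F x = f (block_mod d1 d2 (fst x) D (snd x))"
      by (elim bexE)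
    have F': "F (n1, n2) = f (block_mod d1 d2 n1 D n2)"
      if "(n1, n2) \<in> good" "D \<in> derivs scale d1 n1 d2 n2" "\<forall>q\<in>X \<times> {..<d1} \<times> {..<d2}. D q = \<sigma> q (n1, n2)" for n1 n2 D
      using F(2)[rule_format, of "(n1, n2)" D] block_mod_mem[OF goodD(3,4)[OF that(1)] that(2)] that(3) by simp
    show ?thesis
    proof (rule bexI[OF _ RP.mult[OF s(1) F(1)]], intro conjI allI impI)
      have "F (m1, m2) = f (block_mod d1 d2 m1 D0 m2)" using \<sigma>(1) by (intro F' m D0) simp
      then show "s (m1, m2) * F (m1, m2) \<noteq> 0" using s(2) nz by simp
      fix n1 n2 assume n: "(n1, n2) \<in> good" and "s (n1, n2) * F (n1, n2) \<noteq> 0"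
      then have nz: "s (n1, n2) \<noteq> 0" "F (n1, n2) \<noteq> 0" by auto
      have "\<exists>D\<in>derivs scale d1 n1 d2 n2. \<forall>q\<in>X \<times> {..<d1} \<times> {..<d2}. D q = \<sigma> q (n1, n2)"
        using \<sigma>(2)[rule_format, of "(n1, n2)"] nz(1) goodD[OF n] mD(6) unfolding fst_conv snd_conv by simp
      then obtain D where D: "D\<in>derivs scale d1 n1 d2 n2" "\<forall>q\<in>X \<times> {..<d1} \<times> {..<d2}. D q = \<sigma> q (n1, n2)"
        by (elim bexE)
      then show "\<exists>D\<in>derivs scale d1 n1 d2 n2. f (block_mod d1 d2 n1 D n2) \<noteq> 0"
        using F'[OF n D] nz(2) by (intro bexI[OF _ D(1)]) simp
    qed
  qed
  fix f g assume f: "f \<in> RF (d1 + d2)" and g: "g \<in> RF (d1 + d2)"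
    and "\<exists>t\<in>blocks scale d1 d2 good. f t \<noteq> 0" "\<exists>t\<in>blocks scale d1 d2 good. g t \<noteq> 0"
  then obtain m1 D1 m2 n1 D2 n2 where m: "(m1, m2) \<in> good" "D1 \<in> derivs scale d1 m1 d2 m2" "f (block_mod d1 d2 m1 D1 m2) \<noteq> 0"
    and n: "(n1, n2) \<in> good" "D2 \<in> derivs scale d1 n1 d2 n2" "g (block_mod d1 d2 n1 D2 n2) \<noteq> 0"
    unfolding blocks_def by blast
  from spread[OF f m] obtain F where F: "F \<in> RP d1 d2" "F (m1, m2) \<noteq> 0" "\<forall>n1 n2. (n1, n2) \<in> good \<longrightarrow> F (n1, n2) \<noteq> 0 \<longrightarrow>
      (\<exists>D\<in>derivs scale d1 n1 d2 n2. f (block_mod d1 d2 n1 D n2) \<noteq> 0)" by (elim bexE conjE)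
  from spread[OF g n] obtain G where G: "G \<in> RP d1 d2" "G (n1, n2) \<noteq> 0" "\<forall>n1 n2. (n1, n2) \<in> good \<longrightarrow> G (n1, n2) \<noteq> 0 \<longrightarrow>
      (\<exists>D\<in>derivs scale d1 n1 d2 n2. g (block_mod d1 d2 n1 D n2) \<noteq> 0)" by (elim bexE conjE)
  from irredD[OF irred_good F(1) G(1) m(1) F(2) n(1) G(2)]
  obtain p1 p2 where p: "(p1, p2) \<in> good" "F (p1, p2) \<noteq> 0" "G (p1, p2) \<noteq> 0" by auto
  obtain E1 E2 where E: "E1 \<in> derivs scale d1 p1 d2 p2" "f (block_mod d1 d2 p1 E1 p2) \<noteq> 0"
    "E2 \<in> derivs scale d1 p1 d2 p2" "g (block_mod d1 d2 p1 E2 p2) \<noteq> 0"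
    using F(3) G(3) p by meson
  define R where "R = range (\<lambda>p t. poly p t :: 'k)"
  have fR: "fun_algebra R"
  proof
    show "(\<lambda>x. c) \<in> R" for c unfolding R_def using image_eqI[of "\<lambda>x. c" "\<lambda>p t. poly p t" "[:c:]" UNIV] by simp
    fix u v assume "u \<in> R" "v \<in> R"
    then obtain a b where ab: "u = poly a" "v = poly b" unfolding R_def by blast
    show "(\<lambda>x. u x + v x) \<in> R" "(\<lambda>x. u x * v x) \<in> R"
      unfolding ab R_def poly_add[symmetric] poly_mult[symmetric] by blast+
  qed
  \<comment> \<open>On this line in the fibre \<open>f\<close> and \<open>g\<close> become
    polynomials in the parameter, the first nonzero at 0 and the second at 1, so they have a common
    nonroot.\<close>
  define L where "L t = fscale (1 - t) E1 + fscale t E2" for t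
  have L: "L t \<in> derivs scale d1 p1 d2 p2" for t
    unfolding L_def using E fs.subspace_add[OF derivs_subspace] fs.subspace_scale[OF derivs_subspace] by blast
  have Lb: "block_mod d1 d2 p1 (L t) p2 \<in> MV (d1 + d2)" for t by (rule block_mod_mem[OF goodD(3,4)[OF p(1)] L])
  have LR: "(\<lambda>t. L t q) \<in> R" for q
  proof -
    have "(\<lambda>t. L t q) = poly [:E1 q, E2 q - E1 q:]" by (auto simp: L_def fscale_def algebra_simps)
    then show ?thesis unfolding R_def by blast
  qed
  have comp: "\<exists>P. \<forall>t. poly P t = f (block_mod d1 d2 p1 (L t) p2)" if f: "f \<in> RF (d1 + d2)" for f
  proof -
    have "\<exists>F\<in>R. \<forall>x D. block_mod d1 d2 p1 D p2 \<in> MV (d1 + d2) \<longrightarrow>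
      (\<forall>q\<in>X \<times> {..<d1} \<times> {..<d2}. D q = L x q) \<longrightarrow> F x = f (block_mod d1 d2 p1 D p2)"
      by (rule block_mod_compose[OF fR f fun_algebra.const[OF fR] fun_algebra.const[OF fR] LR])
    then obtain F where F: "F \<in> R" "\<forall>x D. block_mod d1 d2 p1 D p2 \<in> MV (d1 + d2) \<longrightarrow>
      (\<forall>q\<in>X \<times> {..<d1} \<times> {..<d2}. D q = L x q) \<longrightarrow> F x = f (block_mod d1 d2 p1 D p2)" by (elim bexE)
    from F(1) obtain P where "F = poly P" unfolding R_def by blast
    then show ?thesis using F(2) Lb by (intro exI[of _ P]) blast
  qed
  from comp[OF f] comp[OF g] obtain P Q where PQ: "\<forall>t. poly P t = f (block_mod d1 d2 p1 (L t) p2)"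
    "\<forall>t. poly Q t = g (block_mod d1 d2 p1 (L t) p2)" by (elim exE)
  have "L 0 = E1" "L 1 = E2" by (auto simp: L_def fscale_def)
  then have "poly P 0 \<noteq> 0" "poly Q 1 \<noteq> 0" using PQ E(2,4) by simp_all
  then have "P \<noteq> 0" "Q \<noteq> 0" by auto
  then have "\<exists>t. \<forall>q\<in>{P, Q}. poly q t \<noteq> 0" by (intro finite_union_nonroot inf) auto
  then obtain t where "poly P t \<noteq> 0" "poly Q t \<noteq> 0" by auto
  moreover have "block_mod d1 d2 p1 (L t) p2 \<in> blocks scale d1 d2 good" unfolding blocks_def using p(1) L by blast
  ultimately show "\<exists>t\<in>blocks scale d1 d2 good. f t \<noteq> 0 \<and> g t \<noteq> 0" using PQ by auto
qed

lemma extension_set_good: "extension_set scale d1 d2 good = gl_saturate (d1 + d2) (blocks scale d1 d2 good)"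
  by (rule extension_set_blocks[OF good_subset good_conj])

lemma extension_set_subset: "extension_set scale d1 d2 P \<subseteq> MV (d1 + d2)"
  unfolding extension_set_def by blast

lemma irred_extension_set: "irred (RF (d1 + d2)) (extension_set scale d1 d2 good)"
  unfolding extension_set_good by (rule irred_gl_saturate[OF inf blocks_subset[OF good_subset] irred_blocks])

lemma regular_blocks:
  assumes "i < d1" "j < d1" "k < d2" "l < d2"
  shows "(\<lambda>m. upper_left d1 m a $$ (i, j)) \<in> RF (d1 + d2)" "(\<lambda>m. lower_right d1 d2 m a $$ (k, l)) \<in> RF (d1 + d2)"
  using assms by (simp_all add: upper_left_def lower_right_def entry_regular)

text \<open>The block triangular modules with diagonal blocks in \<open>C1\<close> and \<open>C2\<close> form a closed set stable under the
  Borel subgroup, so that its saturation is closed.\<close>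

lemma extension_set_closed: "closedin (mod_top scale X (d1 + d2)) (extension_set scale d1 d2 (C1 \<times> C2))"
proof -
  let ?d = "d1 + d2"
  interpret RF: fun_algebra "RF ?d" by (rule fun_algebra_regular_on)
  define Y where "Y = blocks scale d1 d2 (C1 \<times> C2)"
  note sub1 = componentD(1)[OF C1] and sub2 = componentD(1)[OF C2]
  have sub: "C1 \<times> C2 \<subseteq> MV d1 \<times> MV d2" using sub1 sub2 by blast
  have Ysub: "Y \<subseteq> MV ?d" unfolding Y_def by (rule blocks_subset[OF sub])
  have blk: "upper_left d1 (block_mod d1 d2 m1 D m2) = m1" "lower_right d1 d2 (block_mod d1 d2 m1 D m2) = m2"
    if "m1 \<in> MV d1" "m2 \<in> MV d2" for m1 m2 D
    using mod_var_dim[OF that(1)] mod_var_dim[OF that(2)]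
    by (auto simp: upper_left_def lower_right_def block_mod_entry fun_eq_iff intro!: eq_matI)
  \<comment> \<open>In this form \<open>Y\<close> is visibly given by closed conditions: vanishing
    of entries, and diagonal blocks in closed sets.\<close>
  have Y: "m \<in> Y \<longleftrightarrow> m \<in> MV ?d \<and> (\<forall>a i j. i < d2 \<longrightarrow> j < d1 \<longrightarrow> m a $$ (d1 + i, j) = 0) \<and>
    upper_left d1 m \<in> C1 \<and> lower_right d1 d2 m \<in> C2" for m
  proof
    assume "m \<in> Y"
    then obtain m1 D m2 where m: "m = block_mod d1 d2 m1 D m2" "m1 \<in> C1" "m2 \<in> C2" unfolding Y_def blocks_def by blast
    have "m \<in> MV ?d" using \<open>m \<in> Y\<close> Ysub by blast
    then show "m \<in> MV ?d \<and> (\<forall>a i j. i < d2 \<longrightarrow> j < d1 \<longrightarrow> m a $$ (d1 + i, j) = 0) \<and>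
      upper_left d1 m \<in> C1 \<and> lower_right d1 d2 m \<in> C2"
      using m blk[of m1 m2 D] subsetD[OF sub1 m(2)] subsetD[OF sub2 m(3)] by (simp add: block_mod_entry)
  next
    assume m: "m \<in> MV ?d \<and> (\<forall>a i j. i < d2 \<longrightarrow> j < d1 \<longrightarrow> m a $$ (d1 + i, j) = 0) \<and>
      upper_left d1 m \<in> C1 \<and> lower_right d1 d2 m \<in> C2"
    have ll: "m a $$ (d1 + i, j) = 0" if "i < d2" "j < d1" for a i j using m that by blast
    have b: "upper_right d1 d2 m \<in> derivs scale d1 (upper_left d1 m) d2 (lower_right d1 d2 m)"
      "block_mod d1 d2 (upper_left d1 m) (upper_right d1 d2 m) (lower_right d1 d2 m) = m"
      by (rule block_decomposition[OF conjunct1[OF m]], rule ll, assumption+)+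
    have "block_mod d1 d2 (upper_left d1 m) (upper_right d1 d2 m) (lower_right d1 d2 m) \<in> Y"
      unfolding Y_def blocks_def using m b(1) by blast
    then show "m \<in> Y" using b(2) by simp
  qed
  have "closedin (mod_top scale X ?d) Y"
  proof (rule closedin_mod_topI[OF Ysub])
    fix m assume m: "m \<in> MV ?d" "m \<notin> Y"
    show "\<exists>\<phi>\<in>RF ?d. (\<forall>s\<in>Y. \<phi> s = 0) \<and> \<phi> m \<noteq> 0"
    proof (cases "\<forall>a i j. i < d2 \<longrightarrow> j < d1 \<longrightarrow> m a $$ (d1 + i, j) = 0")
      case False
      then obtain a i j where ij: "i < d2" "j < d1" "m a $$ (d1 + i, j) \<noteq> 0" by blast
      have "(\<lambda>m. m a $$ (d1 + i, j)) \<in> RF ?d" using ij by (intro entry_regular) auto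
      then show ?thesis using ij Y by (intro bexI[of _ "\<lambda>m. m a $$ (d1 + i, j)"]) auto
    next
      case True
      then have ll: "m a $$ (d1 + i, j) = 0" if "i < d2" "j < d1" for a i j using that by blast
      have b: "upper_left d1 m \<in> MV d1" "lower_right d1 d2 m \<in> MV d2"
        by (rule block_decomposition[OF m(1)], rule ll, assumption+)+
      have "upper_left d1 m \<notin> C1 \<or> lower_right d1 d2 m \<notin> C2" using m True Y by blast
      then show ?thesis
      proof
        assume "upper_left d1 m \<notin> C1"
        from closedin_mod_topD(2)[OF component_closed(2)[OF C1] b(1) this]
        obtain \<phi> where \<phi>: "\<phi> \<in> RF d1" "\<forall>s\<in>C1. \<phi> s = 0" "\<phi> (upper_left d1 m) \<noteq> 0" by blast
        obtain F where F: "F \<in> RF ?d" "\<And>x n. n \<in> MV d1 \<Longrightarrow> (\<And>i. i \<in> Idx d1 \<Longrightarrow>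
            mod_coords X d1 n i = mod_coords X d1 (upper_left d1 x) i) \<Longrightarrow> F x = \<phi> n"
        proof (rule RF.regular_on_compose[OF \<phi>(1), where \<zeta> = "\<lambda>x. mod_coords X d1 (upper_left d1 x)"])
          fix z assume "z \<in> Idx d1"
          then obtain a i j where z: "z = (a, i, j)" "a \<in> X" "i < d1" "j < d1" by auto
          have "(\<lambda>x. x a $$ (i, j)) \<in> RF ?d" using z by (intro entry_regular) auto
          then show "(\<lambda>x. mod_coords X d1 (upper_left d1 x) z) \<in> RF ?d"
            unfolding z(1) mod_coords_eq[OF z(2-4)] using z by (simp add: upper_left_def)
        qed blast
        have "F x = \<phi> (upper_left d1 x)" if "upper_left d1 x \<in> MV d1" for x by (rule F(2)[OF that refl])
        then show ?thesis using \<phi> b(1) Y sub1 by (intro bexI[OF _ F(1)]) auto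
      next
        assume "lower_right d1 d2 m \<notin> C2"
        from closedin_mod_topD(2)[OF component_closed(2)[OF C2] b(2) this]
        obtain \<phi> where \<phi>: "\<phi> \<in> RF d2" "\<forall>s\<in>C2. \<phi> s = 0" "\<phi> (lower_right d1 d2 m) \<noteq> 0" by blast
        obtain F where F: "F \<in> RF ?d" "\<And>x n. n \<in> MV d2 \<Longrightarrow> (\<And>i. i \<in> Idx d2 \<Longrightarrow>
            mod_coords X d2 n i = mod_coords X d2 (lower_right d1 d2 x) i) \<Longrightarrow> F x = \<phi> n"
        proof (rule RF.regular_on_compose[OF \<phi>(1), where \<zeta> = "\<lambda>x. mod_coords X d2 (lower_right d1 d2 x)"])
          fix z assume "z \<in> Idx d2"
          then obtain a i j where z: "z = (a, i, j)" "a \<in> X" "i < d2" "j < d2" by auto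
          have "(\<lambda>x. x a $$ (d1 + i, d1 + j)) \<in> RF ?d" using z by (intro entry_regular) auto
          then show "(\<lambda>x. mod_coords X d2 (lower_right d1 d2 x) z) \<in> RF ?d"
            unfolding z(1) mod_coords_eq[OF z(2-4)] using z by (simp add: lower_right_def)
        qed blast
        have "F x = \<phi> (lower_right d1 d2 x)" if "lower_right d1 d2 x \<in> MV d2" for x by (rule F(2)[OF that refl])
        then show ?thesis using \<phi> b(2) Y sub2 by (intro bexI[OF _ F(1)]) auto
      qed
    qed
  qed
  moreover have "borel_stable ?d Y"
    unfolding borel_stable_def
  proof (intro allI impI)
    fix b c :: "'k mat" and y assume bc: "mat_inverse_pair ?d b c" and b: "upper_triangular b" and y: "y \<in> Y"
    note D = mat_inverse_pairD[OF bc]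
    have c: "upper_triangular c" by (rule inverse_upper_triangular[OF bc b])
    have b0: "b $$ (i, j) = 0" and c0: "c $$ (i, j) = 0" if "j < i" "i < ?d" for i j
      using upper_triangularD[OF b that(1)] upper_triangularD[OF c that(1)] D that by auto
    note yY = y[unfolded Y]
    have y0: "y a $$ (d1 + i, j) = 0" if "i < d2" "j < d1" for a i j using yY that by blast
    have ym: "y \<in> MV ?d" using yY by blast
    have zm: "conj_mod b c y \<in> MV ?d" by (rule conj_mod_var[OF bc ym])
    \<comment> \<open>An upper triangular matrix is block triangular, so it conjugates the diagonal
      blocks by its own diagonal blocks, and the components are stable under these.\<close>
    define b1 c1 b2 c2 where "b1 = mat d1 d1 (\<lambda>ij. b $$ ij)" "c1 = mat d1 d1 (\<lambda>ij. c $$ ij)"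
      and "b2 = mat d2 d2 (\<lambda>(i, j). b $$ (d1 + i, d1 + j))" "c2 = mat d2 d2 (\<lambda>(i, j). c $$ (d1 + i, d1 + j))"
    note bd = this
    have prod1: "(u * v) $$ (i, j) = (\<Sum>l<d1. u $$ (i, l) * v $$ (l, j))"
      if "u \<in> carrier_mat ?d ?d" "v \<in> carrier_mat ?d ?d" "\<And>i j. i < d2 \<Longrightarrow> j < d1 \<Longrightarrow> v $$ (d1 + i, j) = 0" "i < ?d" "j < d1"
      for u v :: "'k mat" and i j
    proof -
      have j: "j < ?d" using that(5) by simp
      show ?thesis unfolding mat_mult_entry[OF that(1,2,4) j] sum_lessThan_add using that(3,5) by simp
    qed
    have prod2: "(u * v) $$ (d1 + i, j) = (\<Sum>l<d2. u $$ (d1 + i, d1 + l) * v $$ (d1 + l, j))"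
      if "u \<in> carrier_mat ?d ?d" "v \<in> carrier_mat ?d ?d" "\<And>i j. i < d2 \<Longrightarrow> j < d1 \<Longrightarrow> u $$ (d1 + i, j) = 0" "i < d2" "j < ?d"
      for u v :: "'k mat" and i j
    proof -
      have i: "d1 + i < ?d" using that(4) by simp
      show ?thesis unfolding mat_mult_entry[OF that(1,2) i that(5)] sum_lessThan_add using that(3,4) by simp
    qed
    have lb: "b $$ (d1 + i, j) = 0" and lc: "c $$ (d1 + i, j) = 0" if "i < d2" "j < d1" for i j
      using b0[of j "d1 + i"] c0[of j "d1 + i"] that by auto
    have yc: "y a \<in> carrier_mat ?d ?d" for a by (rule mod_varD(1)[OF ym])
    have byc: "b * y a \<in> carrier_mat ?d ?d" for a using D(1) yc[of a] by simp
    have lby: "(b * y a) $$ (d1 + i, j) = 0" if "i < d2" "j < d1" for a i j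
      using that y0 by (subst prod2[OF D(1) yc lb]) auto
    have p1: "mat_inverse_pair d1 b1 c1"
    proof -
      have "(b * c) $$ (i, j) = (b1 * c1) $$ (i, j)" "(c * b) $$ (i, j) = (c1 * b1) $$ (i, j)" if "i < d1" "j < d1" for i j
        using that prod1[OF D(1,2) lc, of i j] prod1[OF D(2,1) lb, of i j]
          mat_mult_entry[of b1 d1 d1 c1 d1 i j] mat_mult_entry[of c1 d1 d1 b1 d1 i j] by (simp_all add: bd del: index_mult_mat(1))
      then show ?thesis
        unfolding mat_inverse_pair_def D(3,4) by (auto simp: bd intro!: eq_matI simp del: index_mult_mat(1))
    qed
    have p2: "mat_inverse_pair d2 b2 c2"
    proof -
      have "(b * c) $$ (d1 + i, d1 + j) = (b2 * c2) $$ (i, j)" "(c * b) $$ (d1 + i, d1 + j) = (c2 * b2) $$ (i, j)" if "i < d2" "j < d2" for i j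
        using that prod2[OF D(1,2) lb, of i "d1 + j"] prod2[OF D(2,1) lc, of i "d1 + j"]
          mat_mult_entry[of b2 d2 d2 c2 d2 i j] mat_mult_entry[of c2 d2 d2 b2 d2 i j] by (simp_all add: bd del: index_mult_mat(1))
      then show ?thesis
        unfolding mat_inverse_pair_def D(3,4) by (auto simp: bd intro!: eq_matI simp del: index_mult_mat(1))
    qed
    have ul: "upper_left d1 (conj_mod b c y) = conj_mod b1 c1 (upper_left d1 y)"
    proof (rule ext, rule eq_matI)
      fix a i j assume "i < dim_row (conj_mod b1 c1 (upper_left d1 y) a)" "j < dim_col (conj_mod b1 c1 (upper_left d1 y) a)"
      then have ij: "i < d1" "j < d1" by (simp_all add: conj_mod_def bd)
      have cc: "b1 \<in> carrier_mat d1 d1" "c1 \<in> carrier_mat d1 d1" "upper_left d1 y a \<in> carrier_mat d1 d1"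
        by (simp_all add: bd upper_left_def)
      have cb: "b1 * upper_left d1 y a \<in> carrier_mat d1 d1" by (rule mult_carrier_mat[OF cc(1,3)])
      show "upper_left d1 (conj_mod b c y) a $$ (i, j) = conj_mod b1 c1 (upper_left d1 y) a $$ (i, j)"
        using ij prod1[OF byc D(2) lc, of i j] prod1[OF D(1) yc y0, of i]
        by (simp add: conj_mod_def upper_left_def[of d1 "\<lambda>a. b * y a * c"] mat_mult_entry[OF cb cc(2)] mat_mult_entry[OF cc(1) cc(3)]
            del: index_mult_mat(1)) (simp add: bd upper_left_def)
    qed (simp_all add: conj_mod_def bd upper_left_def)
    have lr: "lower_right d1 d2 (conj_mod b c y) = conj_mod b2 c2 (lower_right d1 d2 y)"
    proof (rule ext, rule eq_matI)
      fix a i j assume "i < dim_row (conj_mod b2 c2 (lower_right d1 d2 y) a)" "j < dim_col (conj_mod b2 c2 (lower_right d1 d2 y) a)"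
      then have ij: "i < d2" "j < d2" by (simp_all add: conj_mod_def bd)
      have cc: "b2 \<in> carrier_mat d2 d2" "c2 \<in> carrier_mat d2 d2" "lower_right d1 d2 y a \<in> carrier_mat d2 d2"
        by (simp_all add: bd lower_right_def)
      have cb: "b2 * lower_right d1 d2 y a \<in> carrier_mat d2 d2" by (rule mult_carrier_mat[OF cc(1,3)])
      show "lower_right d1 d2 (conj_mod b c y) a $$ (i, j) = conj_mod b2 c2 (lower_right d1 d2 y) a $$ (i, j)"
        using ij prod2[OF byc D(2) lby, of i "d1 + j"] prod2[OF D(1) yc lb, of i]
        by (simp add: conj_mod_def lower_right_def[of d1 d2 "\<lambda>a. b * y a * c"] mat_mult_entry[OF cb cc(2)] mat_mult_entry[OF cc(1) cc(3)]
            del: index_mult_mat(1)) (simp add: bd lower_right_def)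
    qed (simp_all add: conj_mod_def bd lower_right_def)
    have "(b * y a * c) $$ (d1 + i, j) = 0" if "i < d2" "j < d1" for a i j
      using that lc by (subst prod2[OF byc D(2) lby]) auto
    then show "conj_mod b c y \<in> Y"
      unfolding Y ul lr using zm component_conj[OF inf C1 _ p1] component_conj[OF inf C2 _ p2] yY
      by (simp add: conj_mod_def)
  qed
  ultimately have "closedin (mod_top scale X ?d) (gl_saturate ?d Y)" by (rule gl_saturate_closed)
  moreover have "extension_set scale d1 d2 (C1 \<times> C2) = gl_saturate ?d Y"
    unfolding Y_def using component_conj[OF inf C1] component_conj[OF inf C2] by (intro extension_set_blocks[OF sub]) auto
  ultimately show ?thesis by simp
qed

end

section \<open>Newton iteration as a vanishing theorem for polynomial functions\<close>

section \<open>Newton iteration\<close>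

lemma fun_algebra_polyfun: "fun_algebra (polyfun I)"
  by unfold_locales (auto intro: polyfun.intros)

lemma polyfun_pair:
  fixes q :: "('i + 'j \<Rightarrow> 'k::field) \<Rightarrow> 'k"
  assumes "q \<in> polyfun (I <+> J)" "\<And>j. j \<in> J \<Longrightarrow> u j \<in> polyfun I"
  shows "(\<lambda>x. q (case_sum x (\<lambda>j. u j x))) \<in> polyfun I"
proof (rule fun_algebra.polyfun_compose[OF fun_algebra_polyfun assms(1)])
  fix i assume "i \<in> I <+> J"
  then show "(\<lambda>x. case_sum x (\<lambda>j. u j x) i) \<in> polyfun I"
    using assms(2) by (auto intro: polyfun.coord)
qed

lemma power_fun_apply: "(q ^ n) x = q x ^ n" for q :: "'x \<Rightarrow> 'k::comm_ring_1"
  by (induction n) simp_all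

text \<open>Let \<open>\<Phi>\<close> be a contraction in \<open>u\<close> near \<open>(x0, 0)\<close>. If \<open>f\<close> vanishes at all points \<open>x\<close> of the closure of \<open>V\<close>
  which lift to a fixed point \<open>(x, u)\<close> of \<open>\<Phi>\<close> with \<open>s (x, u) \<noteq> 0\<close>, then \<open>f\<close> vanishes on \<open>V\<close> near \<open>x0\<close>: a power
  of \<open>f * s\<close> is by the Nullstellensatz a combination of the \<open>u j - \<Phi> j (x, u)\<close>, and evaluated at the Newton
  iterates these become arbitrarily small.\<close>

theorem newton_vanishing:
  fixes \<Phi> :: "'j \<Rightarrow> ('i + 'j \<Rightarrow> 'k::alg_closed_field) \<Rightarrow> 'k" and V :: "('i \<Rightarrow> 'k) set" and x0 :: "'i \<Rightarrow> 'k"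
  defines "Y \<equiv> (\<lambda>i (x :: 'i \<Rightarrow> 'k). x i - x0 i)"
  assumes I: "finite I" and J: "finite J" and f: "f \<in> polyfun I" and s: "s \<in> polyfun (I <+> J)"
    and \<Phi>: "\<And>j. j \<in> J \<Longrightarrow> \<Phi> j \<in> polyfun (I <+> J)" and \<Phi>0: "\<And>j. j \<in> J \<Longrightarrow> \<Phi> j (case_sum x0 (\<lambda>_. 0)) = 0"
    and contr: "\<And>N u u' j. (\<And>l. l \<in> J \<Longrightarrow> ideal_power (polyfun I) (Y ` I) 1 (u l)) \<Longrightarrow>
      (\<And>l. l \<in> J \<Longrightarrow> ideal_power (polyfun I) (Y ` I) 1 (u' l)) \<Longrightarrow>
      (\<And>l. l \<in> J \<Longrightarrow> ideal_power (polyfun I) (Y ` I) N (u l - u' l)) \<Longrightarrow> j \<in> J \<Longrightarrow>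
      ideal_power (polyfun I) (Y ` I) (Suc N)
        (\<lambda>x. \<Phi> j (case_sum x (\<lambda>l. u l x)) - \<Phi> j (case_sum x (\<lambda>l. u' l x)))"
    and s0: "s (case_sum x0 (\<lambda>_. 0)) \<noteq> 0"
    and van: "\<And>x u. (\<forall>q\<in>polyfun I. (\<forall>y\<in>V. q y = 0) \<longrightarrow> q x = 0) \<Longrightarrow> (\<And>j. j \<in> J \<Longrightarrow> \<Phi> j (case_sum x u) = u j) \<Longrightarrow>
      s (case_sum x u) \<noteq> 0 \<Longrightarrow> f x = 0"
  shows "\<exists>t\<in>polyfun I. t x0 \<noteq> 0 \<and> (\<forall>x\<in>V. t x * f x = 0)"
proof -
  let ?A = "polyfun I :: (('i \<Rightarrow> 'k) \<Rightarrow> 'k) set" and ?B = "polyfun (I <+> J) :: (('i + 'j \<Rightarrow> 'k) \<Rightarrow> 'k) set"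
  interpret A: fun_algebra ?A by (rule fun_algebra_polyfun)
  interpret B: fun_algebra ?B by (rule fun_algebra_polyfun)
  have sA: "is_subring ?A" and sB: "is_subring ?B" by (rule is_subring_polyfun)+
  have fB: "(\<lambda>z. f (z \<circ> Inl)) \<in> ?B"
  proof (rule B.polyfun_compose[OF f])
    show "(\<lambda>z. (z \<circ> Inl) i) \<in> ?B" if "i \<in> I" for i using that by (auto intro: polyfun.coord)
  qed
  \<comment> \<open>Over points of \<open>V\<close> the members are combinations of the fixed point
    equations. Every polynomial in \<open>x\<close> vanishing on \<open>V\<close> is included, with
    zero coefficients, so the zeros of \<open>\<J>\<close> are the fixed points over the closure of
    \<open>V\<close>.\<close>
  define \<J> where "\<J> = {q\<in>?B. \<exists>a. (\<forall>j\<in>J. a j \<in> ?B) \<and>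
    (\<forall>x\<in>V. \<forall>u. q (case_sum x u) = (\<Sum>j\<in>J. a j (case_sum x u) * (u j - \<Phi> j (case_sum x u))))}"
  have ideal: "is_ideal ?B \<J>"
    unfolding is_ideal_def
  proof (intro conjI ballI)
    show "\<J> \<subseteq> ?B" unfolding \<J>_def by blast
    show "0 \<in> \<J>" unfolding \<J>_def using is_subringD(1)[OF sB]
      by (intro CollectI conjI exI[of _ "\<lambda>j z. 0"]) (auto intro: B.const)
    fix p q assume p: "p \<in> \<J>" and q: "q \<in> \<J>"
    from p obtain a where a: "\<forall>j\<in>J. a j \<in> ?B"
      "\<forall>x\<in>V. \<forall>u. p (case_sum x u) = (\<Sum>j\<in>J. a j (case_sum x u) * (u j - \<Phi> j (case_sum x u)))" unfolding \<J>_def by blast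
    from q obtain b where b: "\<forall>j\<in>J. b j \<in> ?B"
      "\<forall>x\<in>V. \<forall>u. q (case_sum x u) = (\<Sum>j\<in>J. b j (case_sum x u) * (u j - \<Phi> j (case_sum x u)))" unfolding \<J>_def by blast
    have "p + q \<in> ?B" using p q is_subringD(3)[OF sB] unfolding \<J>_def by blast
    then show "p + q \<in> \<J>" unfolding \<J>_def using a b
      by (intro CollectI conjI exI[of _ "\<lambda>j z. a j z + b j z"]) (auto intro: B.add simp: distrib_right sum.distrib)
  next
    fix p q assume p: "p \<in> ?B" and q: "q \<in> \<J>"
    from q obtain b where b: "\<forall>j\<in>J. b j \<in> ?B"
      "\<forall>x\<in>V. \<forall>u. q (case_sum x u) = (\<Sum>j\<in>J. b j (case_sum x u) * (u j - \<Phi> j (case_sum x u)))" unfolding \<J>_def by blast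
    have "p * q \<in> ?B" using p q is_subringD(4)[OF sB] unfolding \<J>_def by blast
    then show "p * q \<in> \<J>" unfolding \<J>_def using b p
      by (intro CollectI conjI exI[of _ "\<lambda>j z. p z * b j z"]) (auto intro: B.mult simp: sum_distrib_left mult.assoc)
  qed
  define q where "q z = f (z \<circ> Inl) * s z" for z
  have qB: "q \<in> ?B" unfolding q_def by (rule B.mult[OF fB s])
  have "\<exists>n. q ^ n \<in> \<J>"
  proof (rule nullstellensatz[OF _ ideal qB])
    show "finite (I <+> J)" using I J by simp
    fix z assume z: "\<forall>g\<in>\<J>. g z = 0"
    define x u where "x = z \<circ> Inl" and "u = z \<circ> Inr"
    have zxu: "z = case_sum x u" unfolding x_def u_def by (auto simp: fun_eq_iff split: sum.split)
    have 1: "\<forall>p\<in>?A. (\<forall>y\<in>V. p y = 0) \<longrightarrow> p x = 0"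
    proof (intro ballI impI)
      fix p assume p: "p \<in> ?A" "\<forall>y\<in>V. p y = 0"
      have "(\<lambda>z. p (z \<circ> Inl)) \<in> ?B"
      proof (rule B.polyfun_compose[OF p(1)])
        show "(\<lambda>z. (z \<circ> Inl) i) \<in> ?B" if "i \<in> I" for i using that by (auto intro: polyfun.coord)
      qed
      moreover have "case_sum y w \<circ> Inl = y" for y :: "'i \<Rightarrow> 'k" and w :: "'j \<Rightarrow> 'k" by (simp add: fun_eq_iff)
      ultimately have "(\<lambda>z. p (z \<circ> Inl)) \<in> \<J>" unfolding \<J>_def using p(2)
        by (intro CollectI conjI exI[of _ "\<lambda>j z. 0"]) (auto intro: B.const)
      from bspec[OF z this] show "p x = 0" unfolding x_def .
    qed
    have 2: "\<Phi> j (case_sum x u) = u j" if j: "j \<in> J" for j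
    proof -
      have "(\<lambda>z. z (Inr j) - \<Phi> j z) \<in> \<J>"
        unfolding \<J>_def mem_Collect_eq
      proof (intro conjI exI[of _ "\<lambda>l z. if l = j then 1 else 0"] ballI allI)
        show "(\<lambda>z. z (Inr j) - \<Phi> j z) \<in> ?B" using j by (intro B.diff \<Phi> polyfun.coord) auto
        show "(\<lambda>z. if l = j then 1 else 0) \<in> ?B" for l by (rule B.const)
        fix x :: "'i \<Rightarrow> 'k" and u :: "'j \<Rightarrow> 'k"
        have "(\<Sum>l\<in>J. (if l = j then 1 else 0) * (u l - \<Phi> l (case_sum x u))) = (\<Sum>l\<in>J. if l = j then u j - \<Phi> j (case_sum x u) else 0)"
          by (intro sum.cong) auto
        then show "case_sum x u (Inr j) - \<Phi> j (case_sum x u) = (\<Sum>l\<in>J. (if l = j then 1 else 0) * (u l - \<Phi> l (case_sum x u)))"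
          using J j by simp
      qed
      from bspec[OF z this] show ?thesis unfolding zxu by simp
    qed
    show "q z = 0"
    proof (cases "s z = 0")
      case False
      have "f x = 0" by (rule van[OF 1 2]) (use False zxu in simp_all)
      then show ?thesis unfolding q_def x_def by simp
    qed (simp add: q_def)
  qed
  then obtain M where "q ^ M \<in> \<J>" by blast
  then obtain a where a: "\<forall>j\<in>J. a j \<in> ?B"
    "\<forall>x\<in>V. \<forall>u. (q ^ M) (case_sum x u) = (\<Sum>j\<in>J. a j (case_sum x u) * (u j - \<Phi> j (case_sum x u)))" unfolding \<J>_def by blast
  \<comment> \<open>The iterates start at zero and vanish at \<open>x0\<close>; by the contraction
    property consecutive ones agree to higher and higher order there.\<close>
  define it where "it = rec_nat (\<lambda>j (x :: 'i \<Rightarrow> 'k). 0) (\<lambda>_ u j x. if j \<in> J then \<Phi> j (case_sum x (\<lambda>l. u l x)) else 0)"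
  have it0: "it 0 j = (\<lambda>x. 0)" and itS: "it (Suc N) j = (\<lambda>x. if j \<in> J then \<Phi> j (case_sum x (\<lambda>l. it N l x)) else 0)" for N j
    unfolding it_def by (simp_all add: fun_eq_iff)
  have itA: "it N j \<in> ?A \<and> it N j x0 = 0" for N j
  proof (induction N arbitrary: j)
    case 0
    then show ?case unfolding it0 by (simp add: A.const)
  next
    case (Suc N)
    show ?case
    proof (cases "j \<in> J")
      case True
      have "(\<lambda>x. \<Phi> j (case_sum x (\<lambda>l. it N l x))) \<in> ?A" by (rule polyfun_pair[OF \<Phi>[OF True]]) (use Suc in blast)
      moreover have "\<Phi> j (case_sum x0 (\<lambda>l. it N l x0)) = 0" using Suc \<Phi>0[OF True] by simp
      ultimately show ?thesis unfolding itS using True by simp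
    qed (simp add: itS A.const)
  qed
  have YA: "Y ` I \<subseteq> ?A" unfolding Y_def by (auto intro!: A.diff A.const polyfun.coord)
  have it1: "ideal_power ?A (Y ` I) 1 (it N j)" for N j
    unfolding Y_def using itA by (intro vanishing_imp_ideal_power) blast+
  have step: "ideal_power ?A (Y ` I) (Suc N) (it N j - it (Suc N) j)" if "j \<in> J" for N j
    using that
  proof (induction N arbitrary: j)
    case 0
    have d: "it 0 j - it (Suc 0) j \<in> ?A" "(it 0 j - it (Suc 0) j) x0 = 0"
      using itA is_subringD(6)[OF sA] by simp_all
    have "ideal_power ?A (Y ` I) 1 (it 0 j - it (Suc 0) j)"
      unfolding Y_def by (rule vanishing_imp_ideal_power) (fact d)+
    then show ?case by (simp only: One_nat_def)
  next
    case (Suc N)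
    have eq: "it (Suc N) j - it (Suc (Suc N)) j = (\<lambda>x. \<Phi> j (case_sum x (\<lambda>l. it N l x)) - \<Phi> j (case_sum x (\<lambda>l. it (Suc N) l x)))"
      unfolding itS[of N j] itS[of "Suc N" j] using Suc.prems by (auto simp: fun_eq_iff)
    show ?case unfolding eq
      by (rule contr[where u = "it N" and u' = "it (Suc N)", OF _ _ _ Suc.prems]) (rule it1, rule it1, rule Suc.IH)
  qed
  define K where "K = {g\<in>?A. \<forall>x\<in>V. g x = 0}"
  have K: "is_ideal ?A K"
    unfolding is_ideal_def
  proof (intro conjI ballI)
    show "K \<subseteq> ?A" "0 \<in> K" unfolding K_def using is_subringD(1)[OF sA] by auto
    show "a + b \<in> K" if "a \<in> K" "b \<in> K" for a b
      using that is_subringD(3)[OF sA, of a b] unfolding K_def by simp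
    show "a * b \<in> K" if "a \<in> ?A" "b \<in> K" for a b
      using that is_subringD(4)[OF sA, of a b] unfolding K_def by simp
  qed
  have fM: "f ^ M \<in> ?A" by (rule is_subring_power[OF sA f])
  have "\<exists>t\<in>?A. t x0 \<noteq> 0 \<and> t * f ^ M \<in> K"
  proof (rule krull_intersection[OF I K fM])
    fix N
    define sN where "sN = (\<lambda>x. s (case_sum x (\<lambda>l. it N l x)) ^ M)"
    have sN: "sN \<in> ?A" unfolding sN_def by (rule A.power, rule polyfun_pair[OF s]) (use itA in blast)
    have sN0: "sN x0 \<noteq> 0" unfolding sN_def using s0 itA by simp
    \<comment> \<open>Substituting the iterate number \<open>N\<close> turns each
      \<open>u j - \<Phi> j\<close> into the difference of consecutive iterates, which lies in power
      \<open>N + 1\<close> of the maximal ideal of \<open>x0\<close>.\<close>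
    define g where "g = (\<Sum>j\<in>J. (\<lambda>x. a j (case_sum x (\<lambda>l. it N l x))) * (it N j - it (Suc N) j))"
    have aA: "(\<lambda>x. a j (case_sum x (\<lambda>l. it N l x))) \<in> ?A" if "j \<in> J" for j
      by (rule polyfun_pair[OF bspec[OF a(1) that]]) (use itA in blast)
    have gA': "ideal_power ?A (Y ` I) (Suc N) g"
      unfolding g_def by (intro ideal_power_sum ideal_power_smult[OF sA] aA step)
    then have g: "ideal_power ?A (Y ` I) N g" using ideal_power_Suc_imp[OF sA YA gA'] by simp
    have gA: "g \<in> ?A" by (rule ideal_power_mem[OF sA YA g])
    have "(sN * f ^ M - g) x = 0" if x: "x \<in> V" for x
    proof -
      have "(q ^ M) (case_sum x (\<lambda>l. it N l x)) = sN x * (f ^ M) x"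
        unfolding power_fun_apply q_def sN_def by (simp add: power_mult_distrib comp_def mult.commute)
      moreover have "(q ^ M) (case_sum x (\<lambda>l. it N l x)) = g x"
        unfolding a(2)[rule_format, OF x] g_def sum_fun_apply by (intro sum.cong refl) (simp add: itS)
      ultimately show ?thesis by simp
    qed
    moreover have "sN * f ^ M - g \<in> ?A" by (rule is_subringD(6)[OF sA is_subringD(4)[OF sA sN fM] gA])
    ultimately have "sN * f ^ M - g \<in> K" unfolding K_def by blast
    then show "\<exists>s\<in>?A. s x0 \<noteq> 0 \<and> (\<exists>g. ideal_power ?A ((\<lambda>i x. x i - x0 i) ` I) N g \<and> s * f ^ M - g \<in> K)"
      by (intro bexI[OF _ sN] conjI sN0 exI[of _ g]) (use g in \<open>simp_all only: Y_def\<close>)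
  qed
  then obtain t where t: "t \<in> ?A" "t x0 \<noteq> 0" "t * f ^ M \<in> K" by blast
  have "t x * f x = 0" if "x \<in> V" for x
  proof -
    have "t x * f x ^ M = 0" using t(3) that unfolding K_def by (auto simp: power_fun_apply)
    then show ?thesis by auto
  qed
  with t(1,2) show ?thesis by blast
qed

section \<open>Effect of lower unitriangular conjugation; modules from coordinate vectors\<close>

section \<open>Conjugation by lower unitriangular block matrices\<close>

definition low_unip :: "nat \<Rightarrow> nat \<Rightarrow> (nat \<times> nat \<Rightarrow> 'k::field) \<Rightarrow> 'k mat" where
  "low_unip d1 d2 u = mat (d1 + d2) (d1 + d2) (\<lambda>(i, j). if i = j then 1 else if d1 \<le> i \<and> j < d1 then u (i - d1, j) else 0)"

lemma low_unip_carrier: "low_unip d1 d2 u \<in> carrier_mat (d1 + d2) (d1 + d2)"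
  by (simp add: low_unip_def)

lemma sum_single: "finite S \<Longrightarrow> i \<in> S \<Longrightarrow> (\<Sum>l\<in>S. (if i = l then 1 else 0) * f l) = f i" for f :: "'i \<Rightarrow> 'k::field"
  by (subst sum.cong[OF refl, of _ _ "\<lambda>l. if i = l then f l else 0"]) auto

lemma sum_single': "finite S \<Longrightarrow> i \<in> S \<Longrightarrow> (\<Sum>l\<in>S. f l * (if l = i then 1 else 0)) = f i" for f :: "'i \<Rightarrow> 'k::field"
  by (subst sum.cong[OF refl, of _ _ "\<lambda>l. if i = l then f l else 0"]) auto

lemma low_unip_mult:
  assumes A: "A \<in> carrier_mat (d1 + d2) n" and k: "k < n"
  shows "i < d1 \<Longrightarrow> (low_unip d1 d2 u * A) $$ (i, k) = A $$ (i, k)"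
    and "i < d2 \<Longrightarrow> (low_unip d1 d2 u * A) $$ (d1 + i, k) = (\<Sum>l<d1. u (i, l) * A $$ (l, k)) + A $$ (d1 + i, k)"
proof -
  note e = mat_mult_entry[OF low_unip_carrier A _ k, unfolded sum_lessThan_add]
  assume i: "i < d1"
  have "(\<Sum>l<d1. low_unip d1 d2 u $$ (i, l) * A $$ (l, k)) = (\<Sum>l<d1. (if i = l then 1 else 0) * A $$ (l, k))"
    using i by (intro sum.cong) (auto simp: low_unip_def)
  moreover have "(\<Sum>l<d2. low_unip d1 d2 u $$ (i, d1 + l) * A $$ (d1 + l, k)) = 0"
    using i by (intro sum.neutral) (auto simp: low_unip_def)
  ultimately show "(low_unip d1 d2 u * A) $$ (i, k) = A $$ (i, k)" using e[of i] i by (simp add: sum_single del: index_mult_mat(1))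
next
  note e = mat_mult_entry[OF low_unip_carrier A _ k, unfolded sum_lessThan_add]
  assume i: "i < d2"
  have "(\<Sum>l<d1. low_unip d1 d2 u $$ (d1 + i, l) * A $$ (l, k)) = (\<Sum>l<d1. u (i, l) * A $$ (l, k))"
    using i by (intro sum.cong) (auto simp: low_unip_def)
  moreover have "(\<Sum>l<d2. low_unip d1 d2 u $$ (d1 + i, d1 + l) * A $$ (d1 + l, k)) = (\<Sum>l<d2. (if i = l then 1 else 0) * A $$ (d1 + l, k))"
    using i by (intro sum.cong) (auto simp: low_unip_def)
  ultimately show "(low_unip d1 d2 u * A) $$ (d1 + i, k) = (\<Sum>l<d1. u (i, l) * A $$ (l, k)) + A $$ (d1 + i, k)"
    using e[of "d1 + i"] i by (simp add: sum_single del: index_mult_mat(1))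
qed

lemma mult_low_unip:
  assumes A: "A \<in> carrier_mat n (d1 + d2)" and k: "k < n"
  shows "j < d1 \<Longrightarrow> (A * low_unip d1 d2 u) $$ (k, j) = A $$ (k, j) + (\<Sum>l<d2. A $$ (k, d1 + l) * u (l, j))"
    and "j < d2 \<Longrightarrow> (A * low_unip d1 d2 u) $$ (k, d1 + j) = A $$ (k, d1 + j)"
proof -
  note e = mat_mult_entry[OF A low_unip_carrier k, unfolded sum_lessThan_add]
  assume j: "j < d1"
  have "(\<Sum>l<d1. A $$ (k, l) * low_unip d1 d2 u $$ (l, j)) = (\<Sum>l<d1. A $$ (k, l) * (if l = j then 1 else 0))"
    using j by (intro sum.cong) (auto simp: low_unip_def)
  moreover have "(\<Sum>l<d2. A $$ (k, d1 + l) * low_unip d1 d2 u $$ (d1 + l, j)) = (\<Sum>l<d2. A $$ (k, d1 + l) * u (l, j))"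
    using j by (intro sum.cong) (auto simp: low_unip_def)
  ultimately show "(A * low_unip d1 d2 u) $$ (k, j) = A $$ (k, j) + (\<Sum>l<d2. A $$ (k, d1 + l) * u (l, j))"
    using e[of j] j by (simp add: sum_single' del: index_mult_mat(1))
next
  note e = mat_mult_entry[OF A low_unip_carrier k, unfolded sum_lessThan_add]
  assume j: "j < d2"
  have "(\<Sum>l<d1. A $$ (k, l) * low_unip d1 d2 u $$ (l, d1 + j)) = 0"
    using j by (intro sum.neutral) (auto simp: low_unip_def)
  moreover have "(\<Sum>l<d2. A $$ (k, d1 + l) * low_unip d1 d2 u $$ (d1 + l, d1 + j)) = (\<Sum>l<d2. A $$ (k, d1 + l) * (if l = j then 1 else 0))"
    using j by (intro sum.cong) (auto simp: low_unip_def)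
  ultimately show "(A * low_unip d1 d2 u) $$ (k, d1 + j) = A $$ (k, d1 + j)"
    using e[of "d1 + j"] j by (simp add: sum_single' del: index_mult_mat(1))
qed

lemma low_unip_inverse: "low_unip d1 d2 u * low_unip d1 d2 (\<lambda>q. - u q) = 1\<^sub>m (d1 + d2)"
proof (rule eq_matI)
  fix i j assume "i < dim_row (1\<^sub>m (d1 + d2) :: 'a mat)" "j < dim_col (1\<^sub>m (d1 + d2) :: 'a mat)"
  then have ij: "i < d1 + d2" "j < d1 + d2" by simp_all
  show "(low_unip d1 d2 u * low_unip d1 d2 (\<lambda>q. - u q)) $$ (i, j) = 1\<^sub>m (d1 + d2) $$ (i, j)"
  proof (rule less_add_cases[OF ij(1)])
    assume i: "i < d1"
    then show ?thesis unfolding low_unip_mult(1)[OF low_unip_carrier ij(2) i] using ij by (simp add: low_unip_def)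
  next
    fix i' assume i: "i' < d2" "i = d1 + i'"
    show ?thesis
    proof (rule less_add_cases[OF ij(2)])
      assume j: "j < d1"
      have "(\<Sum>l<d1. u (i', l) * low_unip d1 d2 (\<lambda>q. - u q) $$ (l, j)) = (\<Sum>l<d1. u (i', l) * (if l = j then 1 else 0))"
        using j by (intro sum.cong) (auto simp: low_unip_def)
      then show ?thesis unfolding i(2) low_unip_mult(2)[OF low_unip_carrier ij(2) i(1)]
        using i j by (simp add: sum_single') (simp add: low_unip_def)
    next
      fix j' assume j: "j' < d2" "j = d1 + j'"
      have "(\<Sum>l<d1. u (i', l) * low_unip d1 d2 (\<lambda>q. - u q) $$ (l, j)) = 0"
        using j by (intro sum.neutral) (auto simp: low_unip_def)
      then show ?thesis unfolding i(2) low_unip_mult(2)[OF low_unip_carrier ij(2) i(1)]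
        using i j by (simp add: low_unip_def)
    qed
  qed
qed (simp_all add: low_unip_def)

lemma low_unip_pair: "mat_inverse_pair (d1 + d2) (low_unip d1 d2 u) (low_unip d1 d2 (\<lambda>q. - u q))"
  using low_unip_inverse[of d1 d2 u] low_unip_inverse[of d1 d2 "\<lambda>q. - u q"]
  unfolding mat_inverse_pair_def by (simp add: low_unip_carrier)

text \<open>In the last formula the two terms linear in \<open>u\<close> form an inner derivation
  for the diagonal blocks, and the quadratic term passes through the upper right block. Making this
  entry zero is the equation that Newton iteration solves for \<open>u\<close>.\<close>

lemma conj_low_unip:
  fixes u :: "nat \<times> nat \<Rightarrow> 'k::field"
  assumes m: "m \<in> mod_var scale (d1 + d2)"
  defines "m' \<equiv> conj_mod (low_unip d1 d2 u) (low_unip d1 d2 (\<lambda>q. - u q)) m"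
  shows "i < d1 \<Longrightarrow> j < d1 \<Longrightarrow> m' a $$ (i, j) = m a $$ (i, j) - (\<Sum>l<d2. m a $$ (i, d1 + l) * u (l, j))"
    and "i < d2 \<Longrightarrow> j < d2 \<Longrightarrow> m' a $$ (d1 + i, d1 + j) = (\<Sum>l<d1. u (i, l) * m a $$ (l, d1 + j)) + m a $$ (d1 + i, d1 + j)"
    and "i < d2 \<Longrightarrow> j < d1 \<Longrightarrow> m' a $$ (d1 + i, j) = m a $$ (d1 + i, j) + (\<Sum>l<d1. u (i, l) * m a $$ (l, j)) -
      (\<Sum>l<d2. m a $$ (d1 + i, d1 + l) * u (l, j)) - (\<Sum>l<d2. \<Sum>k<d1. u (i, k) * m a $$ (k, d1 + l) * u (l, j))"
proof -
  have c: "m a \<in> carrier_mat (d1 + d2) (d1 + d2)" by (rule mod_varD(1)[OF m])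
  have uc: "low_unip d1 d2 u * m a \<in> carrier_mat (d1 + d2) (d1 + d2)" by (rule mult_carrier_mat[OF low_unip_carrier c])
  have m'a: "m' a = low_unip d1 d2 u * m a * low_unip d1 d2 (\<lambda>q. - u q)" unfolding m'_def conj_mod_def ..
  show "m' a $$ (i, j) = m a $$ (i, j) - (\<Sum>l<d2. m a $$ (i, d1 + l) * u (l, j))" if "i < d1" "j < d1"
    unfolding m'a using that
    by (simp add: mult_low_unip(1)[OF uc] low_unip_mult(1)[OF c] sum_negf del: index_mult_mat(1))
  show "m' a $$ (d1 + i, d1 + j) = (\<Sum>l<d1. u (i, l) * m a $$ (l, d1 + j)) + m a $$ (d1 + i, d1 + j)" if "i < d2" "j < d2"
    unfolding m'a using that
    by (simp add: mult_low_unip(2)[OF uc] low_unip_mult(2)[OF c] del: index_mult_mat(1))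
  show "m' a $$ (d1 + i, j) = m a $$ (d1 + i, j) + (\<Sum>l<d1. u (i, l) * m a $$ (l, j)) -
      (\<Sum>l<d2. m a $$ (d1 + i, d1 + l) * u (l, j)) - (\<Sum>l<d2. \<Sum>k<d1. u (i, k) * m a $$ (k, d1 + l) * u (l, j))" if "i < d2" "j < d1"
    unfolding m'a using that
    by (simp add: mult_low_unip(1)[OF uc] low_unip_mult(2)[OF c] sum_negf sum_subtractf distrib_right sum.distrib sum_distrib_right del: index_mult_mat(1))
qed

context fg_algebra
begin

lemma entry_polynomials:
  obtains E where "\<And>a i j. i < d \<Longrightarrow> j < d \<Longrightarrow> E (a, i, j) \<in> polyfun (Idx d)"
    "\<And>a i j m. i < d \<Longrightarrow> j < d \<Longrightarrow> m \<in> MV d \<Longrightarrow> E (a, i, j) (mod_coords X d m) = m a $$ (i, j)"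
proof -
  have "\<forall>q. \<exists>E. fst (snd q) < d \<and> snd (snd q) < d \<longrightarrow> E \<in> polyfun (Idx d) \<and>
      (\<forall>m\<in>MV d. m (fst q) $$ (fst (snd q), snd (snd q)) = E (mod_coords X d m))"
    using entry_regular unfolding regular_on_def by blast
  from choice[OF this] obtain E where "\<forall>q. fst (snd q) < d \<and> snd (snd q) < d \<longrightarrow> E q \<in> polyfun (Idx d) \<and>
      (\<forall>m\<in>MV d. m (fst q) $$ (fst (snd q), snd (snd q)) = E q (mod_coords X d m))" by (rule exE)
  then show thesis by (intro that[of E]) force+
qed

text \<open>The image of the coordinate map is closed: the identities that make a matrix family a
  module are polynomial identities on the image, so they persist at any \<open>x\<close> satisfying
  all equations of the image, and the entry polynomials evaluated at \<open>x\<close> define a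
  module.\<close>

lemma coordinate_lift:
  assumes x: "\<And>q. q \<in> polyfun (Idx d) \<Longrightarrow> (\<And>m. m \<in> MV d \<Longrightarrow> q (mod_coords X d m) = 0) \<Longrightarrow> q x = 0"
  shows "\<exists>m\<in>MV d. \<forall>i\<in>Idx d. mod_coords X d m i = x i"
proof -
  interpret A: fun_algebra "polyfun (Idx d)" by (rule fun_algebra_polyfun)
  obtain E where E: "\<And>a i j. i < d \<Longrightarrow> j < d \<Longrightarrow> E (a, i, j) \<in> polyfun (Idx d)"
    "\<And>a i j m. i < d \<Longrightarrow> j < d \<Longrightarrow> m \<in> MV d \<Longrightarrow> E (a, i, j) (mod_coords X d m) = m a $$ (i, j)"
    by (rule entry_polynomials[of d]) blast
  have rel: "p x = q x" if "p \<in> polyfun (Idx d)" "q \<in> polyfun (Idx d)"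
    "\<And>m. m \<in> MV d \<Longrightarrow> p (mod_coords X d m) = q (mod_coords X d m)" for p q
    using x[OF A.diff[OF that(1,2)]] that(3) by simp
  define m where "m a = mat d d (\<lambda>(i, j). E (a, i, j) x)" for a
  have me: "m a $$ (i, j) = E (a, i, j) x" if "i < d" "j < d" for a i j using that by (simp add: m_def)
  have "m \<in> MV d"
  proof (rule mod_varI_entries)
    show "m a \<in> carrier_mat d d" for a by (simp add: m_def)
    fix i j assume ij: "i < d" "j < d"
    show "m (a + b) $$ (i, j) = m a $$ (i, j) + m b $$ (i, j)" for a b
      unfolding me[OF ij] by (rule rel[OF E(1)[OF ij] A.add[OF E(1)[OF ij] E(1)[OF ij]]])
        (simp add: E(2)[OF ij] mod_var_entry[OF _ ij])
    show "m (scale c a) $$ (i, j) = c * m a $$ (i, j)" for c a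
      unfolding me[OF ij] by (rule rel[OF E(1)[OF ij] A.mult[OF A.const E(1)[OF ij]]])
        (simp add: E(2)[OF ij] mod_var_entry[OF _ ij])
    show "m (a * b) $$ (i, j) = (\<Sum>l<d. m a $$ (i, l) * m b $$ (l, j))" for a b
    proof -
      have "E (a * b, i, j) x = (\<Sum>l<d. E (a, i, l) x * E (b, l, j) x)"
      proof (rule rel[OF E(1)[OF ij]])
        show "(\<lambda>x. \<Sum>l<d. E (a, i, l) x * E (b, l, j) x) \<in> polyfun (Idx d)" using ij by (intro A.sum A.mult E(1)) auto
        show "E (a * b, i, j) (mod_coords X d m) = (\<Sum>l<d. E (a, i, l) (mod_coords X d m) * E (b, l, j) (mod_coords X d m))"
          if "m \<in> MV d" for m
          unfolding E(2)[OF ij that] mod_var_entry[OF that ij] using ij by (intro sum.cong) (auto simp: E(2)[OF _ _ that])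
      qed
      then show ?thesis using ij by (simp add: me)
    qed
    show "m 1 $$ (i, j) = (if i = j then 1 else 0)"
      unfolding me[OF ij] by (rule rel[OF E(1)[OF ij] A.const]) (simp add: E(2)[OF ij] mod_var_entry[OF _ ij])
  qed
  moreover have "mod_coords X d m z = x z" if z: "z \<in> Idx d" for z
  proof -
    obtain a i j where z': "z = (a, i, j)" "a \<in> X" "i < d" "j < d" using z by auto
    have "E z x = x z"
      unfolding z'(1) by (rule rel[OF E(1)[OF z'(3,4)] polyfun.coord]) (use z' in \<open>simp_all add: E(2)[OF z'(3,4)] mod_coords_eq[OF z'(2-4)]\<close>)
    then show ?thesis unfolding z'(1) mod_coords_eq[OF z'(2-4)] me[OF z'(3,4)] .
  qed
  ultimately show ?thesis by blast
qed

end

section \<open>E(S) is dense in every irreducible set that contains it\<close>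

section \<open>Maximality\<close>

lemma polyfun_Inl: "f \<in> polyfun I \<Longrightarrow> (\<lambda>z. f (z \<circ> Inl)) \<in> polyfun (I <+> J)"
  by (rule fun_algebra.polyfun_compose[OF fun_algebra_polyfun]) (auto intro: polyfun.coord)

context ext_vanishing
begin

text \<open>Good pairs are open only relative to \<open>C1 \<times> C2\<close>. Intersecting with
  nonempty open parts of the whole varieties that lie in the components gives a neighbourhood among
  all pairs of modules; this matters because the diagonal blocks of a module near \<open>m0\<close>
  are not known beforehand to lie in the components.\<close>

lemma good_open_neighbourhood:
  obtains m1 m2 s where "(m1, m2) \<in> good" "s \<in> RP d1 d2" "s (m1, m2) \<noteq> 0"
    "\<forall>n1\<in>MV d1. \<forall>n2\<in>MV d2. s (n1, n2) \<noteq> 0 \<longrightarrow> (n1, n2) \<in> good"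
proof -
  interpret RP: fun_algebra "RP d1 d2" by (rule fun_algebra_regular_on)
  obtain h1 c1 where h1: "h1 \<in> RF d1" "c1 \<in> C1" "h1 c1 \<noteq> 0" "\<And>m. m \<in> MV d1 \<Longrightarrow> h1 m \<noteq> 0 \<Longrightarrow> m \<in> C1"
    by (rule component_open_part[OF C1]) blast
  obtain h2 c2 where h2: "h2 \<in> RF d2" "c2 \<in> C2" "h2 c2 \<noteq> 0" "\<And>m. m \<in> MV d2 \<Longrightarrow> h2 m \<noteq> 0 \<Longrightarrow> m \<in> C2"
    by (rule component_open_part[OF C2]) blast
  obtain p0 where p0: "p0 \<in> good" using irred_nonempty[OF irred_good] by blast
  from good_open[OF p0] obtain w where w: "w \<in> RP d1 d2" "w p0 \<noteq> 0" "\<forall>p\<in>C1 \<times> C2. w p \<noteq> 0 \<longrightarrow> p \<in> good"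
    by (elim bexE conjE)
  have p0C: "p0 \<in> C1 \<times> C2" using p0 unfolding good_def by auto
  have h: "(\<lambda>p. h1 (fst p) * h2 (snd p)) \<in> RP d1 d2"
    by (intro RP.mult pair_regular(1)[OF h1(1)] pair_regular(2)[OF h2(1)])
  have cc: "(c1, c2) \<in> C1 \<times> C2" using h1(2) h2(2) by blast
  have "h1 (fst (c1, c2)) * h2 (snd (c1, c2)) \<noteq> 0" using h1(3) h2(3) by simp
  from irredD[OF irred_pairs h w(1) cc this p0C w(2)]
  obtain p where p: "p \<in> C1 \<times> C2" "h1 (fst p) * h2 (snd p) \<noteq> 0" "w p \<noteq> 0" by blast
  obtain m1 m2 where m: "p = (m1, m2)" by (cases p)
  show thesis
  proof (rule that[of m1 m2 "\<lambda>p. (h1 (fst p) * h2 (snd p)) * w p"])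
    show "(m1, m2) \<in> good" using w(3) p(1,3) unfolding m by blast
    show "(\<lambda>p. (h1 (fst p) * h2 (snd p)) * w p) \<in> RP d1 d2" by (rule RP.mult[OF h w(1)])
    show "h1 (fst (m1, m2)) * h2 (snd (m1, m2)) * w (m1, m2) \<noteq> 0" using p(2,3) unfolding m by simp
    show "\<forall>n1\<in>MV d1. \<forall>n2\<in>MV d2. h1 (fst (n1, n2)) * h2 (snd (n1, n2)) * w (n1, n2) \<noteq> 0 \<longrightarrow> (n1, n2) \<in> good"
      using h1(4) h2(4) w(3) by simp
  qed
qed

text \<open>The vanishing of Ext in the form in which the Newton argument uses it.\<close>

lemma derivs_eq_inner:
  assumes "(m1, m2) \<in> good"
  shows "derivs scale d2 m2 d1 m1 = inner_derivs d2 m2 d1 m1"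
proof -
  note g = goodD[OF assms]
  obtain F where F: "finite F" "derivs scale d2 m2 d1 m1 \<subseteq> fs.span F" by (rule derivs_fd)
  have "fs.dim (inner_derivs d2 m2 d1 m1) = fs.dim (derivs scale d2 m2 d1 m1)"
    using ext1_dim_derivs[OF g(4,3)] g(5) by simp
  from fs.fd_dim_eq[OF inner_derivs_subspace inner_derivs_subset[OF g(4,3)] F(2,1) this] show ?thesis by simp
qed

text \<open>Conjugation of a module \<open>m\<close> near \<open>m0 = m1 \<oplus> m2\<close> with a lower unitriangular block matrix with block \<open>u\<close>
  changes its lower left block, a derivation, to first order by the inner derivation given by \<open>u\<close>. Since
  \<open>Ext(M2, M1) = 0\<close>, all derivations at \<open>m0\<close> are inner, and Newton iteration finds \<open>u\<close> such that the lower left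
  block becomes zero, so that \<open>m\<close> is an extension.\<close>

theorem vanishing_extends:
  assumes T: "T \<subseteq> MV (d1 + d2)" "irred (RF (d1 + d2)) T" and ET: "extension_set scale d1 d2 good \<subseteq> T"
    and f: "f \<in> RF (d1 + d2)" and f0: "\<And>m. m \<in> extension_set scale d1 d2 good \<Longrightarrow> f m = 0" and mT: "m \<in> T"
  shows "f m = 0"
proof -
  let ?d = "d1 + d2"
  obtain m1 m2 s where g: "(m1, m2) \<in> good" and s: "s \<in> RP d1 d2" "s (m1, m2) \<noteq> 0"
    and sg: "\<forall>n1\<in>MV d1. \<forall>n2\<in>MV d2. s (n1, n2) \<noteq> 0 \<longrightarrow> (n1, n2) \<in> good" by (rule good_open_neighbourhood)
  have mv: "m1 \<in> MV d1" "m2 \<in> MV d2" using goodD[OF g] by blast+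
  have dims: "dim_row (m1 a) = d1" "dim_col (m1 a) = d1" "dim_row (m2 a) = d2" "dim_col (m2 a) = d2" for a
    using mod_var_dim[OF mv(1), of a] mod_var_dim[OF mv(2), of a] by simp_all
  define m0 where "m0 = block_mod d1 d2 m1 0 m2"
  have z0D: "0 \<in> derivs scale d1 m1 d2 m2" by (rule fs.subspace_0[OF derivs_subspace])
  have m0: "m0 \<in> MV ?d" unfolding m0_def by (rule block_mod_mem[OF mv z0D])
  have "m0 \<in> blocks scale d1 d2 good" unfolding m0_def blocks_def using g z0D by blast
  then have m0T: "m0 \<in> T"
    using ET gl_saturate_subset(2)[OF blocks_subset[OF good_subset]] unfolding extension_set_good by blast
  define I J J2 where "I = Idx ?d" and "J = {..<d2} \<times> {..<d1}" and "J2 = X \<times> {..<d2} \<times> {..<d1}"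
  note IJ = I_def J_def J2_def
  have fin: "finite I" "finite J" "finite J2" unfolding IJ using finite_X by simp_all
  define A :: "(('a \<times> nat \<times> nat \<Rightarrow> 'k) \<Rightarrow> 'k) set" where "A = polyfun I"
  define B :: "((('a \<times> nat \<times> nat) + (nat \<times> nat) \<Rightarrow> 'k) \<Rightarrow> 'k) set" where "B = polyfun (I <+> J)"
  have fA: "fun_algebra A" and fB: "fun_algebra B" unfolding A_def B_def by (rule fun_algebra_polyfun)+
  interpret A: fun_algebra A by (rule fA)
  interpret B: fun_algebra B by (rule fB)
  have sA: "is_subring A" unfolding A_def by (rule is_subring_polyfun)
  define x0 where "x0 = mod_coords X ?d m0"
  \<comment> \<open>Points \<open>z\<close> combine the coordinates of a module with the entries of
    a conjugating block \<open>u\<close>; \<open>z0\<close> stands for \<open>m0\<close> with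
    \<open>u = 0\<close>.\<close>
  define z0 where "z0 = case_sum x0 (\<lambda>_ :: nat \<times> nat. 0)"
  obtain E where E: "\<And>a i j. i < ?d \<Longrightarrow> j < ?d \<Longrightarrow> E (a, i, j) \<in> A"
    "\<And>a i j m. i < ?d \<Longrightarrow> j < ?d \<Longrightarrow> m \<in> MV ?d \<Longrightarrow> E (a, i, j) (mod_coords X ?d m) = m a $$ (i, j)"
    unfolding A_def I_def by (rule entry_polynomials[of ?d]) blast
  have Ex0: "i < d1 \<Longrightarrow> j < d1 \<Longrightarrow> E (a, i, j) x0 = m1 a $$ (i, j)" "i < d1 \<Longrightarrow> k < d2 \<Longrightarrow> E (a, i, d1 + k) x0 = 0"
    "k < d2 \<Longrightarrow> j < d1 \<Longrightarrow> E (a, d1 + k, j) x0 = 0" "k < d2 \<Longrightarrow> l < d2 \<Longrightarrow> E (a, d1 + k, d1 + l) x0 = m2 a $$ (k, l)" for a i j k l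
    unfolding x0_def using E(2)[OF _ _ m0] by (simp_all add: m0_def block_mod_entry)
  have EB: "(\<lambda>z. E (a, i, j) (z \<circ> Inl)) \<in> B" if "i < ?d" "j < ?d" for a i j
    using E(1)[OF that] unfolding A_def B_def by (rule polyfun_Inl)
  have UB: "(\<lambda>z. z (Inr (i, j))) \<in> B" if "i < d2" "j < d1" for i j
    unfolding B_def using that by (intro polyfun.coord) (auto simp: IJ)

  have csI: "case_sum x w \<circ> Inl = x" for x :: "'a \<times> nat \<times> nat \<Rightarrow> 'k" and w :: "nat \<times> nat \<Rightarrow> 'k"
    by (simp add: fun_eq_iff)
  \<comment> \<open>The linear part at \<open>m0\<close> of the change of the lower left block under
    conjugation by \<open>u\<close>, read off on generators. A linear right inverse \<open>h\<close>
    on its image takes the place of the inverse derivative.\<close>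
  define Dr where "Dr = restrict_gens d2 d1 \<circ> inner_deriv d2 m2 d1 m1"
  have linDr: "Vector_Spaces.linear fscale fscale Dr"
    unfolding Dr_def by (rule Vector_Spaces.linear_compose[OF linear_inner_deriv linear_restrict_gens])
  obtain h where h: "h ` UNIV \<subseteq> supp_in J" "Vector_Spaces.linear fscale fscale h" "\<forall>v\<in>Dr ` supp_in J. Dr (h v) = v"
    using fsfs.linear_exists_right_inverse_on[OF linDr supp_in_subspace[of J]] by (elim exE conjE)
  interpret Dr: Vector_Spaces.linear fscale fscale Dr by (rule linDr)
  interpret h: Vector_Spaces.linear fscale fscale h by (rule h(2))
  have h_sum: "h v j = (\<Sum>q\<in>J2. h (unit_fun q) j * v q)" if "v \<in> supp_in J2" for v j
  proof -
    have "h v = (\<Sum>q\<in>J2. fscale (v q) (h (unit_fun q)))"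
      by (subst supp_in_sum[OF fin(3) that]) (simp add: h.sum h.scale)
    then show ?thesis by (simp add: sum_fun_apply fscale_def mult.commute)
  qed
  have Dh_sum: "Dr (h v) r = (\<Sum>q\<in>J2. Dr (h (unit_fun q)) r * v q)" if "v \<in> supp_in J2" for v r
  proof -
    have "h v = (\<Sum>q\<in>J2. fscale (v q) (h (unit_fun q)))"
      by (subst supp_in_sum[OF fin(3) that]) (simp add: h.sum h.scale)
    then have "Dr (h v) = (\<Sum>q\<in>J2. fscale (v q) (Dr (h (unit_fun q))))" by (simp add: Dr.sum Dr.scale)
    then show ?thesis by (simp add: sum_fun_apply fscale_def mult.commute)
  qed
  \<comment> \<open>The lower left block after conjugation minus its linear part
    \<open>Dr u\<close>: every remaining term in \<open>u\<close> carries a coefficient that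
    vanishes at \<open>m0\<close>.\<close>
  define W where "W = (\<lambda>(a, i, j) z. E (a, d1 + i, j) (z \<circ> Inl) +
    (\<Sum>l<d1. z (Inr (i, l)) * (E (a, l, j) (z \<circ> Inl) - m1 a $$ (l, j))) -
    (\<Sum>l<d2. (E (a, d1 + i, d1 + l) (z \<circ> Inl) - m2 a $$ (i, l)) * z (Inr (l, j))) -
    (\<Sum>l<d2. \<Sum>k<d1. z (Inr (i, k)) * E (a, k, d1 + l) (z \<circ> Inl) * z (Inr (l, j))))"
  \<comment> \<open>Fixed points solve \<open>u = - h W\<close>, the Newton equation with the
    derivative frozen at \<open>m0\<close>.\<close>
  define \<Phi> where "\<Phi> j z = - (\<Sum>q\<in>J2. h (unit_fun q) j * W q z)" for j z
  have WB: "W q \<in> B" if qJ: "q \<in> J2" for q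
  proof -
    obtain a i j where q: "q = (a, i, j)" "i < d2" "j < d1" using qJ unfolding IJ by auto
    show ?thesis unfolding q(1) W_def prod.case using q(2,3)
      by (intro B.add B.diff B.sum B.mult B.const EB UB) auto
  qed
  have \<Phi>B: "\<Phi> j \<in> B" for j unfolding \<Phi>_def using WB by (intro B.uminus B.sum B.mult B.const) blast

  \<comment> \<open>\<open>t z\<close> and \<open>p z\<close> are the diagonal blocks after
    conjugation by \<open>u\<close>, written as polynomials in \<open>z\<close>, so that they make
    sense even where \<open>z\<close> does not come from a module.\<close>
  define t where "t z a = mat d2 d2 (\<lambda>(i, j). (\<Sum>l<d1. z (Inr (i, l)) * E (a, l, d1 + j) (z \<circ> Inl)) + E (a, d1 + i, d1 + j) (z \<circ> Inl))"
    for z :: "('a \<times> nat \<times> nat) + (nat \<times> nat) \<Rightarrow> 'k" and a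
  define p where "p z a = mat d1 d1 (\<lambda>(i, j). E (a, i, j) (z \<circ> Inl) - (\<Sum>l<d2. E (a, i, d1 + l) (z \<circ> Inl) * z (Inr (l, j))))"
    for z :: "('a \<times> nat \<times> nat) + (nat \<times> nat) \<Rightarrow> 'k" and a
  have tB: "(\<lambda>z. t z a $$ (i, j)) \<in> B" if "i < d2" "j < d2" for a i j
  proof -
    have "(\<lambda>z. (\<Sum>l<d1. z (Inr (i, l)) * E (a, l, d1 + j) (z \<circ> Inl)) + E (a, d1 + i, d1 + j) (z \<circ> Inl)) \<in> B"
      using that by (intro B.add B.sum B.mult EB UB) auto
    then show ?thesis using that by (simp add: t_def)
  qed
  have pB: "(\<lambda>z. p z a $$ (i, j)) \<in> B" if "i < d1" "j < d1" for a i j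
  proof -
    have "(\<lambda>z. E (a, i, j) (z \<circ> Inl) - (\<Sum>l<d2. E (a, i, d1 + l) (z \<circ> Inl) * z (Inr (l, j)))) \<in> B"
      using that by (intro B.diff B.sum B.mult EB UB) auto
    then show ?thesis using that by (simp add: p_def)
  qed
  have zI0: "z0 \<circ> Inl = x0" "z0 (Inr q) = 0" for q unfolding z0_def by (auto simp: fun_eq_iff)
  have tz0: "t z0 = m2" and pz0: "p z0 = m1"
    by (rule ext, rule eq_matI; simp add: t_def p_def zI0 Ex0 dims)+

  have "\<exists>\<Lambda>. (\<forall>l\<in>\<Lambda>. \<forall>q\<in>X \<times> {..<d2} \<times> {..<d1}. l q \<in> B) \<and> (\<forall>x.
    restrict_gens d2 d1 ` derivs scale d2 (t x) d1 (p x) = lin_kernel \<Lambda> (X \<times> {..<d2} \<times> {..<d1}) x)"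
    by (rule derivs_lin_kernel[OF fB]) (use tB pB in simp_all)
  then obtain \<Lambda> where \<Lambda>: "\<forall>l\<in>\<Lambda>. \<forall>q\<in>J2. l q \<in> B"
    "\<forall>z. restrict_gens d2 d1 ` derivs scale d2 (t z) d1 (p z) = lin_kernel \<Lambda> J2 z" unfolding IJ by (elim exE conjE)
  \<comment> \<open>At a fixed point the lower left block \<open>v\<close> satisfies
    \<open>Dr (h v) = 0\<close>. Together with the equations of derivations this leaves only zero at
    \<open>z0\<close>, where all derivations are inner, and by elimination only zero near
    \<open>z0\<close>.\<close>
  define \<Lambda>' where "\<Lambda>' = \<Lambda> \<union> range (\<lambda>r q z. Dr (h (unit_fun q)) r)"
  have \<Lambda>'B: "l q \<in> B" if l: "l \<in> \<Lambda>'" and q: "q \<in> J2" for l q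
  proof (cases "l \<in> \<Lambda>")
    case True
    then show ?thesis using \<Lambda>(1) q by blast
  next
    case False
    then obtain r where "l = (\<lambda>q z. Dr (h (unit_fun q)) r)" using l unfolding \<Lambda>'_def by blast
    then show ?thesis using B.const by simp
  qed
  have lk: "v \<in> lin_kernel \<Lambda>' J2 z \<longleftrightarrow> v \<in> restrict_gens d2 d1 ` derivs scale d2 (t z) d1 (p z) \<and> Dr (h v) = 0" for v z
  proof -
    have sup: "v \<in> supp_in J2" if "v \<in> restrict_gens d2 d1 ` derivs scale d2 (t z) d1 (p z)"
      using that restrict_gens_supp unfolding J2_def by blast
    have "v \<in> lin_kernel \<Lambda>' J2 z \<longleftrightarrow> v \<in> lin_kernel \<Lambda> J2 z \<and> (\<forall>r. (\<Sum>q\<in>J2. Dr (h (unit_fun q)) r * v q) = 0)"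
      unfolding lin_kernel_def \<Lambda>'_def by (simp add: ball_Un)
    also have "\<dots> \<longleftrightarrow> v \<in> restrict_gens d2 d1 ` derivs scale d2 (t z) d1 (p z) \<and> (\<forall>r. (\<Sum>q\<in>J2. Dr (h (unit_fun q)) r * v q) = 0)"
      unfolding \<Lambda>(2)[rule_format] ..
    also have "\<dots> \<longleftrightarrow> v \<in> restrict_gens d2 d1 ` derivs scale d2 (t z) d1 (p z) \<and> Dr (h v) = 0"
    proof (rule conj_cong[OF refl])
      assume "v \<in> restrict_gens d2 d1 ` derivs scale d2 (t z) d1 (p z)"
      note e = Dh_sum[OF sup[OF this], symmetric]
      show "(\<forall>r. (\<Sum>q\<in>J2. Dr (h (unit_fun q)) r * v q) = 0) \<longleftrightarrow> Dr (h v) = 0"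
        unfolding e by (simp only: fun_eq_iff zero_fun_apply)
    qed
    finally show ?thesis .
  qed
  have ker0: "v = 0" if v: "v \<in> lin_kernel \<Lambda>' J2 z0" for v
  proof -
    have v1: "v \<in> restrict_gens d2 d1 ` inner_derivs d2 m2 d1 m1" and v2: "Dr (h v) = 0"
      using v unfolding lk tz0 pz0 derivs_eq_inner[OF g] by blast+
    have "v \<in> Dr ` supp_in J" using v1 unfolding inner_derivs_def image_comp Dr_def J_def .
    from bspec[OF h(3) this] show ?thesis using v2 by simp
  qed
  obtain Bs s1 C where ch: "Bs \<subseteq> J2" "s1 \<in> B" "s1 z0 \<noteq> 0" "\<forall>j\<in>J2. \<forall>b\<in>Bs. C j b \<in> B"
    "\<forall>x v. s1 x \<noteq> 0 \<longrightarrow> v \<in> lin_kernel \<Lambda>' J2 x \<longrightarrow> (\<forall>j\<in>J2. s1 x * v j = (\<Sum>b\<in>Bs. C j b x * v b))"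
    "\<forall>w. \<exists>v\<in>lin_kernel \<Lambda>' J2 z0. \<forall>b\<in>Bs. v b = w b"
    using \<Lambda>'B by (rule B.lin_kernel_chart[OF fin(3), where \<Lambda> = \<Lambda>'])
  have Bs: "Bs = {}"
  proof -
    obtain v where v: "v\<in>lin_kernel \<Lambda>' J2 z0" "\<forall>b\<in>Bs. v b = 1" using spec[OF ch(6), of "\<lambda>_. 1"] by (rule bexE)
    show ?thesis using v(2) ker0[OF v(1)] by auto
  qed
  have ker: "v = 0" if s1: "s1 z \<noteq> 0" and v: "v \<in> lin_kernel \<Lambda>' J2 z" for v z
  proof
    fix q
    show "v q = 0 q"
    proof (cases "q \<in> J2")
      case True
      then show ?thesis using ch(5)[rule_format, OF s1 v] s1 unfolding Bs by simp
    next
      case False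
      then have "v q = 0" using v unfolding lin_kernel_def by blast
      then show ?thesis by simp
    qed
  qed
  \<comment> \<open>\<open>S\<close> is the condition \<open>s\<close> imposed on the diagonal
    blocks after conjugation, as a polynomial in \<open>z\<close>.\<close>
  have "\<exists>S\<in>B. \<forall>z. p z \<in> MV d1 \<longrightarrow> t z \<in> MV d2 \<longrightarrow> S z = s (p z, t z)"
  proof -
    define \<zeta> where "\<zeta> z = pair_coords d1 d2 (p z, t z)" for z
    obtain S where S: "S \<in> B" "\<And>z m. m \<in> MV d1 \<times> MV d2 \<Longrightarrow>
        (\<And>i. i \<in> Idx d1 <+> Idx d2 \<Longrightarrow> pair_coords d1 d2 m i = \<zeta> z i) \<Longrightarrow> S z = s m"
    proof (rule B.regular_on_compose[OF s(1), where \<zeta> = \<zeta>])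
      fix i assume "i \<in> Idx d1 <+> Idx d2"
      then consider a k l where "i = Inl (a, k, l)" "a \<in> X" "k < d1" "l < d1"
        | a k l where "i = Inr (a, k, l)" "a \<in> X" "k < d2" "l < d2" by auto
      then show "(\<lambda>z. \<zeta> z i) \<in> B"
      proof cases
        case 1
        then show ?thesis using pB by (simp add: \<zeta>_def pair_coords_def mod_coords_eq)
      next
        case 2
        then show ?thesis using tB by (simp add: \<zeta>_def pair_coords_def mod_coords_eq)
      qed
    qed blast
    show ?thesis by (intro bexI[OF _ S(1)] allI impI S(2)) (simp_all add: \<zeta>_def)
  qed
  then obtain S where S: "S \<in> B" "\<And>z. p z \<in> MV d1 \<Longrightarrow> t z \<in> MV d2 \<Longrightarrow> S z = s (p z, t z)" by blast
  obtain F where F: "F \<in> A" "\<forall>m\<in>MV ?d. f m = F (mod_coords X ?d m)"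
    using f unfolding regular_on_def A_def I_def by blast

  have "\<exists>w\<in>polyfun I. w x0 \<noteq> 0 \<and> (\<forall>x\<in>mod_coords X ?d ` T. w x * F x = 0)"
  proof (rule newton_vanishing[where s = "\<lambda>z. s1 z * S z" and \<Phi> = \<Phi> and J = J])
    show "finite I" "finite J" by (rule fin)+
    show "F \<in> polyfun I" using F(1) unfolding A_def .
    show "(\<lambda>z. s1 z * S z) \<in> polyfun (I <+> J)" using B.mult[OF ch(2) S(1)] unfolding B_def .
    show "\<Phi> j \<in> polyfun (I <+> J)" for j using \<Phi>B unfolding B_def .
    have "W q z0 = 0" if qJ: "q \<in> J2" for q
    proof -
      obtain a i j where q: "q = (a, i, j)" "i < d2" "j < d1" using qJ unfolding IJ by auto
      show ?thesis unfolding q(1) W_def using q(2,3) by (simp add: Ex0 zI0)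
    qed
    then show "\<Phi> j (case_sum x0 (\<lambda>_. 0)) = 0" for j unfolding z0_def[symmetric] \<Phi>_def by simp
    have "S z0 = s (m1, m2)" using S(2)[of z0] mv unfolding tz0 pz0 by simp
    then show "s1 (case_sum x0 (\<lambda>_. 0)) * S (case_sum x0 (\<lambda>_. 0)) \<noteq> 0" using ch(3) s(2) unfolding z0_def[symmetric] by simp
  next
    fix N j and u u' :: "nat \<times> nat \<Rightarrow> ('a \<times> nat \<times> nat \<Rightarrow> 'k) \<Rightarrow> 'k"
    define Y where "Y = (\<lambda>i (x :: 'a \<times> nat \<times> nat \<Rightarrow> 'k). x i - x0 i) ` I"
    have YA: "Y \<subseteq> A" unfolding Y_def A_def using A.diff[OF _ A.const] by (auto simp: A_def intro: polyfun.coord)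
    assume "\<And>l. l \<in> J \<Longrightarrow> ideal_power (polyfun I) ((\<lambda>i x. x i - x0 i) ` I) 1 (u l)"
      "\<And>l. l \<in> J \<Longrightarrow> ideal_power (polyfun I) ((\<lambda>i x. x i - x0 i) ` I) 1 (u' l)"
      "\<And>l. l \<in> J \<Longrightarrow> ideal_power (polyfun I) ((\<lambda>i x. x i - x0 i) ` I) N (u l - u' l)" and j: "j \<in> J"
    then have u: "ideal_power A Y 1 (u l)" "ideal_power A Y 1 (u' l)" "ideal_power A Y N (u l - u' l)" if "l \<in> J" for l
      using that unfolding A_def Y_def by blast+
    have van: "ideal_power A Y 1 (\<lambda>x. E (a, i, k) x - c)" if "i < ?d" "k < ?d" "E (a, i, k) x0 = c" for a i k c
    proof -
      have e: "(\<lambda>x. E (a, i, k) x - c) \<in> polyfun I" "(\<lambda>x. E (a, i, k) x - c) x0 = 0"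
        using A.diff[OF E(1)[OF that(1,2)] A.const[of c]] that(3) unfolding A_def by simp_all
      show ?thesis unfolding Y_def A_def by (rule vanishing_imp_ideal_power) (fact e)+
    qed
    define \<Delta> where "\<Delta> q = (\<lambda>x. W q (case_sum x (\<lambda>l. u l x)) - W q (case_sum x (\<lambda>l. u' l x)))" for q
    have \<Delta>: "ideal_power A Y (Suc N) (\<Delta> q)" if qJ: "q \<in> J2" for q
    proof -
      obtain a i k where q: "q = (a, i, k)" "i < d2" "k < d1" using qJ unfolding IJ by auto
      have iJ: "(i, l) \<in> J" if "l < d1" for l using that q unfolding J_def by simp
      have kJ: "(l, k) \<in> J" if "l < d2" for l using that q unfolding J_def by simp
      note mul = ideal_power_mult[OF sA YA, of N _ 1, simplified]
      \<comment> \<open>The change of \<open>W\<close> is written with one difference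
        \<open>u - u'\<close> in each product, times a factor that vanishes at \<open>x0\<close>;
        each such product gains one power of the maximal ideal.\<close>
      define P1 where "P1 = (\<Sum>l<d1. (u (i, l) - u' (i, l)) * (\<lambda>x. E (a, l, k) x - m1 a $$ (l, k)))"
      define P2 where "P2 = (\<Sum>l<d2. (u (l, k) - u' (l, k)) * (\<lambda>x. E (a, d1 + i, d1 + l) x - m2 a $$ (i, l)))"
      define P3 where "P3 = (\<Sum>l<d2. \<Sum>r<d1. (u (i, r) - u' (i, r)) * (E (a, r, d1 + l) * u (l, k)) +
        (u (l, k) - u' (l, k)) * (E (a, r, d1 + l) * u' (i, r)))"
      have "ideal_power A Y (Suc N) P1" unfolding P1_def
        by (rule ideal_power_sum, rule mul, rule u(3), rule iJ) (use q in \<open>auto intro!: van Ex0 simp flip: One_nat_def\<close>)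
      moreover have "ideal_power A Y (Suc N) P2" unfolding P2_def
        by (rule ideal_power_sum, rule mul, rule u(3), rule kJ) (use q in \<open>auto intro!: van Ex0 simp flip: One_nat_def\<close>)
      moreover have "ideal_power A Y (Suc N) P3" unfolding P3_def
      proof (rule ideal_power_sum, rule ideal_power_sum, rule ideal_power.add)
        fix l r assume "l \<in> {..<d2}" "r \<in> {..<d1}"
        then have lr: "l < d2" "r < d1" by auto
        have e: "E (a, r, d1 + l) \<in> A" using lr by (intro E(1)) auto
        show "ideal_power A Y (Suc N) ((u (i, r) - u' (i, r)) * (E (a, r, d1 + l) * u (l, k)))"
          by (rule mul[OF u(3)[OF iJ[OF lr(2)]]]) (use ideal_power_smult[OF sA e u(1)[OF kJ[OF lr(1)]]] in simp)
        show "ideal_power A Y (Suc N) ((u (l, k) - u' (l, k)) * (E (a, r, d1 + l) * u' (i, r)))"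
          by (rule mul[OF u(3)[OF kJ[OF lr(1)]]]) (use ideal_power_smult[OF sA e u(2)[OF iJ[OF lr(2)]]] in simp)
      qed
      ultimately have "ideal_power A Y (Suc N) (P1 - P2 - P3)" by (intro ideal_power_diff[OF sA])
      moreover have "\<Delta> q = P1 - P2 - P3"
      proof
        fix x
        have "P3 x = (\<Sum>l<d2. \<Sum>r<d1. u (i, r) x * E (a, r, d1 + l) x * u (l, k) x - u' (i, r) x * E (a, r, d1 + l) x * u' (l, k) x)"
          unfolding P3_def sum_fun_apply by (intro sum.cong refl) (simp add: algebra_simps)
        moreover have "P1 x = (\<Sum>l<d1. u (i, l) x * (E (a, l, k) x - m1 a $$ (l, k)) - u' (i, l) x * (E (a, l, k) x - m1 a $$ (l, k)))"
          unfolding P1_def sum_fun_apply by (intro sum.cong refl) (simp add: algebra_simps)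
        moreover have "P2 x = (\<Sum>l<d2. (E (a, d1 + i, d1 + l) x - m2 a $$ (i, l)) * u (l, k) x - (E (a, d1 + i, d1 + l) x - m2 a $$ (i, l)) * u' (l, k) x)"
          unfolding P2_def sum_fun_apply by (intro sum.cong refl) (simp add: algebra_simps)
        ultimately show "\<Delta> q x = (P1 - P2 - P3) x"
          unfolding \<Delta>_def q(1) W_def by (simp add: sum_subtractf csI)
      qed
      ultimately show ?thesis by simp
    qed
    have "ideal_power A Y (Suc N) (\<Sum>q\<in>J2. (\<lambda>x. - h (unit_fun q) j) * \<Delta> q)"
      by (intro ideal_power_sum ideal_power_smult[OF sA A.const] \<Delta>)
    moreover have "(\<Sum>q\<in>J2. (\<lambda>x. - h (unit_fun q) j) * \<Delta> q) = (\<lambda>x. \<Phi> j (case_sum x (\<lambda>l. u l x)) - \<Phi> j (case_sum x (\<lambda>l. u' l x)))"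
    proof
      fix x
      have "(\<Sum>q\<in>J2. (\<lambda>x. - h (unit_fun q) j) * \<Delta> q) x = (\<Sum>q\<in>J2. h (unit_fun q) j * W q (case_sum x (\<lambda>l. u' l x)) - h (unit_fun q) j * W q (case_sum x (\<lambda>l. u l x)))"
        unfolding sum_fun_apply \<Delta>_def by (intro sum.cong refl) (simp add: algebra_simps)
      then show "(\<Sum>q\<in>J2. (\<lambda>x. - h (unit_fun q) j) * \<Delta> q) x = \<Phi> j (case_sum x (\<lambda>l. u l x)) - \<Phi> j (case_sum x (\<lambda>l. u' l x))"
        unfolding \<Phi>_def by (simp add: sum_subtractf)
    qed
    ultimately show "ideal_power (polyfun I) ((\<lambda>i x. x i - x0 i) ` I) (Suc N)
        (\<lambda>x. \<Phi> j (case_sum x (\<lambda>l. u l x)) - \<Phi> j (case_sum x (\<lambda>l. u' l x)))" unfolding A_def Y_def by simp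
  next
    fix x :: "'a \<times> nat \<times> nat \<Rightarrow> 'k" and u :: "nat \<times> nat \<Rightarrow> 'k"
    assume cl: "\<forall>q\<in>polyfun I. (\<forall>y\<in>mod_coords X ?d ` T. q y = 0) \<longrightarrow> q x = 0"
      and fp: "\<And>j. j \<in> J \<Longrightarrow> \<Phi> j (case_sum x u) = u j" and nz: "s1 (case_sum x u) * S (case_sum x u) \<noteq> 0"
    define z where "z = case_sum x u"
    have zI: "z \<circ> Inl = x" "z (Inr q) = u q" for q unfolding z_def by (auto simp: fun_eq_iff)
    \<comment> \<open>Since \<open>x\<close> satisfies all equations of \<open>T\<close>, it
      consists of the coordinates of a module.\<close>
    have "\<exists>m\<in>MV ?d. \<forall>i\<in>Idx ?d. mod_coords X ?d m i = x i"
    proof (rule coordinate_lift)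
      fix q assume q: "q \<in> polyfun (Idx ?d)" "\<And>m. m \<in> MV ?d \<Longrightarrow> q (mod_coords X ?d m) = 0"
      have "\<forall>y\<in>mod_coords X ?d ` T. q y = 0" using q(2) T(1) by blast
      then show "q x = 0" using cl q(1) unfolding I_def by blast
    qed
    then obtain m where m: "m \<in> MV ?d" "\<forall>i\<in>I. mod_coords X ?d m i = x i" unfolding I_def by blast
    have polyx: "q x = q (mod_coords X ?d m)" if "q \<in> A" for q
      using polyfun_eqI[OF that[unfolded A_def], of x "mod_coords X ?d m"] m(2) by simp
    have Em: "E (a, i, j) x = m a $$ (i, j)" if "i < ?d" "j < ?d" for a i j
      using polyx[OF E(1)[OF that]] E(2)[OF that m(1)] by simp
    define m' where "m' = conj_mod (low_unip d1 d2 u) (low_unip d1 d2 (\<lambda>q. - u q)) m"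
    note cj = conj_low_unip[OF m(1), where u = u, folded m'_def]
    have m': "m' \<in> MV ?d" unfolding m'_def by (rule conj_mod_var[OF low_unip_pair m(1)])
    have tz: "t z = lower_right d1 d2 m'" and pz: "p z = upper_left d1 m'"
      by (rule ext, rule eq_matI; simp add: t_def p_def lower_right_def upper_left_def zI Em cj)+
    define Wv where "Wv q = (if q \<in> J2 then W q z else 0)" for q
    define w where "w q = (if q \<in> J then u q else 0)" for q
    have Wv: "Wv \<in> supp_in J2" and w: "w \<in> supp_in J" by (simp_all add: supp_in_def Wv_def w_def)
    have "w = - h Wv"
    proof
      fix q
      show "w q = (- h Wv) q"
      proof (cases "q \<in> J")
        case True
        have "(\<Sum>r\<in>J2. h (unit_fun r) q * W r z) = (\<Sum>r\<in>J2. h (unit_fun r) q * Wv r)"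
          by (intro sum.cong) (auto simp: Wv_def)
        then show ?thesis using fp[OF True] True h_sum[OF Wv, of q] unfolding z_def[symmetric] \<Phi>_def by (simp add: w_def)
      next
        case False
        have "h Wv \<in> supp_in J" using h(1) by blast
        then have "h Wv q = 0" using False unfolding supp_in_def by blast
        then show ?thesis using False unfolding w_def by simp
      qed
    qed
    then have Drw: "Dr w = - Dr (h Wv)" by (simp only: Dr.neg)
    define v where "v = restrict_gens d2 d1 (lower_left d1 d2 m')"
    have veq: "v = Wv + Dr w"
    proof
      fix q
      show "v q = (Wv + Dr w) q"
      proof (cases "q \<in> J2")
        case True
        then obtain a i j where q: "q = (a, i, j)" "a \<in> X" "i < d2" "j < d1" unfolding IJ by auto
        have "Dr w q = (\<Sum>l<d1. u (i, l) * m1 a $$ (l, j)) - (\<Sum>l<d2. m2 a $$ (i, l) * u (l, j))"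
          unfolding q(1) Dr_def using q(2-) by (simp add: restrict_gens_def inner_deriv_def w_def J_def)
        moreover have "Wv q = m a $$ (d1 + i, j) + (\<Sum>l<d1. u (i, l) * (m a $$ (l, j) - m1 a $$ (l, j))) -
            (\<Sum>l<d2. (m a $$ (d1 + i, d1 + l) - m2 a $$ (i, l)) * u (l, j)) -
            (\<Sum>l<d2. \<Sum>k<d1. u (i, k) * m a $$ (k, d1 + l) * u (l, j))"
          using True unfolding Wv_def q(1) W_def using q(3,4) by (simp add: zI Em)
        moreover have "v q = m' a $$ (d1 + i, j)"
          unfolding v_def q(1) using q(2-) by (simp add: restrict_gens_def lower_left_def)
        ultimately show ?thesis using cj(3)[OF q(3,4), of a]
          by (simp add: right_diff_distrib left_diff_distrib sum_subtractf)
      next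
        case False
        then show ?thesis by (simp add: v_def Wv_def Dr_def restrict_gens_def J2_def)
      qed
    qed
    \<comment> \<open>The fixed point equation gives \<open>Dr w = - Dr (h Wv)\<close>, and
      \<open>Dr\<close> after \<open>h\<close> is the identity on the image of \<open>Dr\<close>, so
      the two terms cancel.\<close>
    have "Dr (h v) = Dr (h Wv) + Dr (h (Dr w))" unfolding veq h.add Dr.add ..
    moreover have "Dr (h (Dr w)) = Dr w" using h(3) w by blast
    ultimately have "Dr (h v) = 0" unfolding Drw by simp
    moreover have ll: "lower_left d1 d2 m' \<in> derivs scale d2 (t z) d1 (p z)" unfolding tz pz by (rule quasi_block[OF m'])
    ultimately have "v \<in> lin_kernel \<Lambda>' J2 z" unfolding lk v_def by blast
    moreover have nz': "s1 z \<noteq> 0" "S z \<noteq> 0" using nz unfolding z_def by auto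
    ultimately have v0: "v = 0" using ker by blast
    have "lower_left d1 d2 m' = 0"
    proof (rule derivs_zero_on_gens[OF ll])
      fix y i j assume y: "y \<in> X"
      show "lower_left d1 d2 m' (y, i, j) = 0"
      proof (cases "i < d2 \<and> j < d1")
        case True
        then show ?thesis using fun_cong[OF v0, of "(y, i, j)"] y unfolding v_def by (simp add: restrict_gens_def)
      qed (auto simp: lower_left_def)
    qed
    then have m'0: "m' a $$ (d1 + i, j) = 0" if "i < d2" "j < d1" for a i j
    proof -
      have "lower_left d1 d2 m' (a, i, j) = 0" using \<open>lower_left d1 d2 m' = 0\<close> by simp
      then show ?thesis using that by (simp add: lower_left_def)
    qed
    have b: "upper_left d1 m' \<in> MV d1" "lower_right d1 d2 m' \<in> MV d2"
      "upper_right d1 d2 m' \<in> derivs scale d1 (upper_left d1 m') d2 (lower_right d1 d2 m')"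
      "block_mod d1 d2 (upper_left d1 m') (upper_right d1 d2 m') (lower_right d1 d2 m') = m'"
      by (rule block_decomposition[OF m'], rule m'0, assumption+)+
    \<comment> \<open>The conjugate \<open>m'\<close> is now block triangular, and its diagonal
      blocks are a good pair by the choice of \<open>s\<close>; so \<open>m\<close> belongs to E(S),
      where \<open>f\<close> vanishes.\<close>
    have "s (upper_left d1 m', lower_right d1 d2 m') \<noteq> 0" using S(2)[of z] nz'(2) b(1,2) unfolding tz pz by simp
    then have "(upper_left d1 m', lower_right d1 d2 m') \<in> good" using sg b(1,2) by blast
    then have "block_mod d1 d2 (upper_left d1 m') (upper_right d1 d2 m') (lower_right d1 d2 m') \<in> blocks scale d1 d2 good"
      unfolding blocks_def using b(3) by blast
    then have "m' \<in> blocks scale d1 d2 good" unfolding b(4) .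
    moreover have "m = conj_mod (low_unip d1 d2 (\<lambda>q. - u q)) (low_unip d1 d2 u) m'"
      unfolding m'_def conj_inverse[OF low_unip_pair m(1)] ..
    ultimately have "m \<in> extension_set scale d1 d2 good"
      unfolding extension_set_good gl_saturate_def using mat_inverse_pair_sym[OF low_unip_pair] by blast
    then have "f m = 0" by (rule f0)
    then show "F x = 0" using polyx[OF F(1)] F(2) m(1) by simp
  qed
  then obtain w where w: "w \<in> polyfun I" "w x0 \<noteq> 0" "\<forall>x\<in>mod_coords X ?d ` T. w x * F x = 0" by blast
  have wR: "(\<lambda>m. w (mod_coords X ?d m)) \<in> RF ?d" unfolding regular_on_def using w(1) unfolding I_def by blast
  show ?thesis
  proof (rule ccontr)
    assume "f m \<noteq> 0"
    \<comment> \<open>\<open>f\<close> vanishes on the part of \<open>T\<close> where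
      \<open>w\<close> is nonzero, and this part contains \<open>m0\<close>; irreducibility of
      \<open>T\<close> excludes another point with \<open>f\<close> nonzero.\<close>
    then have "\<exists>n\<in>T. w (mod_coords X ?d n) \<noteq> 0 \<and> f n \<noteq> 0"
      using w(2) unfolding x0_def by (intro irredD[OF T(2) wR f m0T _ mT])
    then obtain n where n: "n \<in> T" "w (mod_coords X ?d n) \<noteq> 0" "f n \<noteq> 0" by blast
    have "n \<in> MV ?d" using n(1) T(1) by blast
    then have "F (mod_coords X ?d n) \<noteq> 0" using F(2) n(3) by simp
    moreover have "w (mod_coords X ?d n) * F (mod_coords X ?d n) = 0" using w(3) n(1) by blast
    ultimately show False using n(2) by simp
  qed
qed

text \<open>By \<open>vanishing_extends\<close> an irreducible set containing E(S) satisfies all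
  equations of E(S), so it cannot be larger than the closure.\<close>

theorem component_extension_set:
  "component (d1 + d2) (zariski_closure (d1 + d2) (extension_set scale d1 d2 good))"
  unfolding irreducible_component_def irreducible_in_iff
proof (intro conjI allI impI)
  let ?E = "extension_set scale d1 d2 good"
  have sub: "zariski_closure (d1 + d2) ?E \<subseteq> MV (d1 + d2)" unfolding zariski_closure_def by blast
  then show "zariski_closure (d1 + d2) ?E \<subseteq> MV (d1 + d2)" .
  show "irred (RF (d1 + d2)) (zariski_closure (d1 + d2) ?E)"
    by (rule irred_zariski_closure[OF extension_set_subset irred_extension_set])
  fix T assume T: "T \<subseteq> MV (d1 + d2) \<and> irred (RF (d1 + d2)) T" and le: "zariski_closure (d1 + d2) ?E \<subseteq> T"
  have ET: "?E \<subseteq> T" using zariski_closure_subset[OF extension_set_subset] le by blast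
  have "T \<subseteq> zariski_closure (d1 + d2) ?E"
  proof
    fix m assume m: "m \<in> T"
    have "f m = 0" if "f \<in> RF (d1 + d2)" "\<forall>n\<in>?E. f n = 0" for f
      by (rule vanishing_extends[OF conjunct1[OF T] conjunct2[OF T] ET that(1) _ m]) (use that(2) in blast)
    then show "m \<in> zariski_closure (d1 + d2) ?E" unfolding zariski_closure_def using T m by blast
  qed
  then show "T = zariski_closure (d1 + d2) ?E" using le by blast
qed

lemma zariski_closure_extension_set:
  "zariski_closure (d1 + d2) (extension_set scale d1 d2 good) \<subseteq> extension_set scale d1 d2 (C1 \<times> C2)"
proof (rule zariski_closure_minimal[OF extension_set_closed])
  have "good \<subseteq> C1 \<times> C2" unfolding good_def by blast
  then show "extension_set scale d1 d2 good \<subseteq> extension_set scale d1 d2 (C1 \<times> C2)"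
    unfolding extension_set_def by blast
qed

end

theorem corollary1p4:
  fixes scale :: "'k::alg_closed_field \<Rightarrow> 'a::ring_1 \<Rightarrow> 'a"
    and X :: "'a set" and d1 d2 :: nat
    and C1 C2 :: "('a \<Rightarrow> 'k mat) set"
    and S :: "(('a \<Rightarrow> 'k mat) \<times> ('a \<Rightarrow> 'k mat)) set"
  assumes "assoc_algebra scale"
    and "finite X" and "generated_subalgebra scale X = UNIV"
    and "d1 \<ge> 1" and "d2 \<ge> 1"
    and "irreducible_component (mod_top scale X d1) C1"
    and "irreducible_component (mod_top scale X d2) C2"
    and "ext1_min scale d2 C2 d1 C1 = 0"
    and "S = {(m1, m2) \<in> C1 \<times> C2.
           ext1_dim d2 m2 d1 m1 = 0 \<and>
           ext1_dim d1 m1 d2 m2 = ext1_min scale d1 C1 d2 C2}"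
  shows "\<exists>Z. irreducible_component (mod_top scale X (d1 + d2)) Z \<and>
           Z \<subseteq> extension_set scale d1 d2 (C1 \<times> C2) \<and>
           Z = mod_top scale X (d1 + d2) closure_of extension_set scale d1 d2 S"
proof -
  interpret assoc_algebra scale by (rule assms(1))
  interpret ext_vanishing scale X d1 d2 C1 C2
    by unfold_locales (fact assms)+
  have "S = good" unfolding assms(9) good_def ..
  then show ?thesis
    using component_extension_set zariski_closure_extension_set closure_of_mod_top[OF extension_set_subset] by simp
qed

end
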